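(* Let $G$ be a compact Hausdorff group, $X$ an operator space which is also a Banach space, and $\nu\in M(G,X)$. (i) Let $1\leq p<\infty$. If $f\in L^p(G)$ and $g\in L^1(\nu)$, then $f*^\nu g\in P_p(G,X)$. Further, $\|f*^\nu g\|_{P_p(G,X)}\leq\|f\|_p\|g\|_\nu$. (ii) If $\nu\in M_{p_1}(G,X)$, $g\in L^{p_2}(G)$ and $f\in L^{p_3}(G)$ where $0<\frac1{p_1}+\frac1{p_2}<1$ and $\frac1{p_1}+\frac1{p_2}+\frac1{p_3}>1$, then $f*^\nu g\in P_r(G,X)$ where $\frac1{p_1}+\frac1{p_2}+\frac1{p_3}=1+\frac1r$. Further, $\|f*^\nu g\|_{P_r(G,X)}\leq\|\nu\|_{p_1,m_G}\|g\|_{p_2}\|f\|_{p_3}$.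
   Context: $m_G$ is the normalized Haar measure on $G$, $\mathfrak{B}(G)$ the Borel $\sigma$-algebra, and $L^p(G)$ ($1\le p\le\infty$) the Lebesgue space of $m_G$ with norm $\|\cdot\|_p$; $p'$ is the conjugate exponent of $p$. An operator space is a complex vector space $X$ with a norm $\|\cdot\|_n$ on each matrix space $M_n(X)$ such that $\|x\oplus y\|_{m+n}=\max\{\|x\|_m,\|y\|_n\}$ and $\|\alpha x\beta\|_n\le\|\alpha\|\|x\|_m\|\beta\|$ for $x\in M_m(X)$, $y\in M_n(X)$ and scalar matrices $\alpha\in M_{n,m}$, $\beta\in M_{m,n}$. $M(G,X)$ is the space of $\sigma$-additive $X$-valued vector measures on $\mathfrak{B}(G)$. $X'$ is the dual of $X$ with closed unit ball $B_{X'}$; $\langle\nu,x'\rangle(A)=\langle\nu(A),x'\rangle$, with total variation $|\langle\nu,x'\rangle|$. $L^1(\nu)$ is the space of functions $g:G\to\mathbb{C}$ with $g\in L^1(|\langle\nu,x'\rangle|)$ for all $x'\in X'$ and such that for each $A\in\mathfrak{B}(G)$ there is a unique vector $\int_Ag\,d\nu\in X$ with $\langle\int_Ag\,d\nu,x'\rangle=\int_Ag\,d\langle\nu,x'\rangle$ for all $x'\in X'$; its norm is $\|g\|_\nu=\sup_{x'\in B_{X'}}\int_G|g|\,d|\langle\nu,x'\rangle|$. The vector-valued convolution, with respect to $\nu$, of two measurable functions $f$ and $g$ is defined by $f*^\nu g(t)=\int_Gf(ts^{-1})g(s)\,d\nu(s)$, provided that the mapping $s\mapsto f(ts^{-1})g(s)$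 belongs to $L^1(\nu)$ for $m_G$-almost every $t\in G$. For $1\le p<\infty$ the $p$-semivariation of $\nu$ with respect to $m_G$ is $\|\nu\|_{p,m_G}=\sup\|\sum_{A\in\rho}\alpha_A\nu(A)\|_X$, the supremum being over finite partitions $\rho$ of $G$ into Borel sets and scalars $\alpha_A$ with $\sum_{A\in\rho}\alpha_A\chi_A$ in the closed unit ball of $L^{p'}(G)$; and $\|\nu\|_{\infty,m_G}=\sup_{m_G(A)>0}\|\nu(A)\|/m_G(A)$. $M_p(G,X)$ ($1\le p\le\infty$) is the space of $X$-valued vector measures with finite $p$-semivariation. $P_p(G,X)$ is the closure in $M_p(G,X)$ of the space of $X$-valued simple functions on $G$, a function $\phi$ being identified with the measure having density $\phi$ with respect to $m_G$; its norm is the $p$-semivariation of that measure, which for simple $\phi$ equals $\sup_{x'\in B_{X'}}\|\langle\phi,x'\rangle\|_p$.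
   Formalization: f*^ν g need not exist pointwise (X=L^q, ν(A)=χ_A, g=1, f in L^1 but not L^q). It is taken as the measure whose pairing with each x' has as density the convolution with respect to <ν,x'>; it has density f*^ν g whenever f(ts^{-1})g(s) is in L^1(ν) for a.e. t. *)

theory Defs
  imports
    "HOL-Analysis.Analysis"
    "HOL-Probability.Essential_Supremum"
    "Jordan_Normal_Form.Matrix"
begin

section \<open>Complex Banach spaces and operator spaces\<close>

class complex_normed_vector = real_normed_vector +
  fixes scaleC :: "complex \<Rightarrow> 'a \<Rightarrow> 'a"  (infixr \<open>*\<^sub>C\<close> 75)
  assumes scaleC_add_right: "c *\<^sub>C (x + y) = c *\<^sub>C x + c *\<^sub>C y"
    and scaleC_add_left: "(c + d) *\<^sub>C x = c *\<^sub>C x + d *\<^sub>C x"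
    and scaleC_scaleC: "c *\<^sub>C d *\<^sub>C x = (c * d) *\<^sub>C x"
    and scaleC_of_real: "complex_of_real r *\<^sub>C x = r *\<^sub>R x"
    and norm_scaleC: "norm (c *\<^sub>C x) = cmod c * norm x"

class complex_banach = complex_normed_vector + banach

text \<open>Operator norm of a rectangular scalar matrix, for the Euclidean norms.\<close>

definition vec_l2norm :: "complex vec \<Rightarrow> real" where
  "vec_l2norm v = sqrt (\<Sum>i<dim_vec v. (cmod (vec_index v i))\<^sup>2)"

definition mat_opnorm :: "complex mat \<Rightarrow> real" where
  "mat_opnorm A = (SUP v\<in>{v \<in> carrier_vec (dim_col A). vec_l2norm v \<le> 1}. vec_l2norm (mult_mat_vec A v))"

definition bimodule_mult ::
  "complex mat \<Rightarrow> 'x::complex_normed_vector mat \<Rightarrow> complex mat \<Rightarrow> 'x mat" where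
  "bimodule_mult a x b = mat (dim_row a) (dim_col b)
     (\<lambda>(i, j). \<Sum>k<dim_row x. \<Sum>l<dim_col x. (a $$ (i, k) * b $$ (l, j)) *\<^sub>C (x $$ (k, l)))"

definition direct_sum_mat :: "'x::zero mat \<Rightarrow> 'x mat \<Rightarrow> 'x mat" where
  "direct_sum_mat x y = four_block_mat x (0\<^sub>m (dim_row x) (dim_col y)) (0\<^sub>m (dim_row y) (dim_col x)) y"

text \<open>An operator space structure on the normed space \<open>'x\<close>. The norm on the \<open>n \<times> n\<close> matrices is
  the restriction of \<open>mnorm\<close> to \<open>carrier_mat n n\<close>; the norm of \<open>'x\<close> is the norm at level one.\<close>

definition operator_space :: "('x::complex_normed_vector mat \<Rightarrow> real) \<Rightarrow> bool" where
  "operator_space mnorm \<longleftrightarrow>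
     (\<forall>n\<ge>1. \<forall>x\<in>carrier_mat n n. 0 \<le> mnorm x \<and> (mnorm x = 0 \<longleftrightarrow> x = 0\<^sub>m n n)) \<and>
     (\<forall>n\<ge>1. \<forall>x\<in>carrier_mat n n. \<forall>y\<in>carrier_mat n n. mnorm (x + y) \<le> mnorm x + mnorm y) \<and>
     (\<forall>n\<ge>1. \<forall>x\<in>carrier_mat n n. \<forall>c. mnorm (map_mat (scaleC c) x) = cmod c * mnorm x) \<and>
     (\<forall>x. mnorm (mat 1 1 (\<lambda>_. x)) = norm x) \<and>
     (\<forall>m\<ge>1. \<forall>n\<ge>1. \<forall>x\<in>carrier_mat m m. \<forall>y\<in>carrier_mat n n.
        mnorm (direct_sum_mat x y) = max (mnorm x) (mnorm y)) \<and>
     (\<forall>m\<ge>1. \<forall>n\<ge>1. \<forall>a\<in>carrier_mat n m. \<forall>x\<in>carrier_mat m m. \<forall>b\<in>carrier_mat m n.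
        mnorm (bimodule_mult a x b) \<le> mat_opnorm a * mnorm x * mat_opnorm b)"

definition cdual :: "('x::complex_normed_vector \<Rightarrow> complex) set" where
  "cdual = {\<phi>. bounded_linear \<phi> \<and> (\<forall>c x. \<phi> (c *\<^sub>C x) = c * \<phi> x)}"

definition cdual_ball :: "('x::complex_normed_vector \<Rightarrow> complex) set" where
  "cdual_ball = {\<phi>\<in>cdual. onorm \<phi> \<le> 1}"

section \<open>Haar measure and Lebesgue spaces\<close>

text \<open>The group is written additively, following the class \<open>topological_group_add\<close>, which is not
  commutative; the product \<open>t s\<^sup>-\<^sup>1\<close> is thus written \<open>t - s\<close>.\<close>

definition normalized_haar :: "'g::topological_group_add measure \<Rightarrow> bool" where
  "normalized_haar m \<longleftrightarrow>
     sets m = sets borel \<and>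
     emeasure m UNIV = 1 \<and>
     (\<forall>a. \<forall>A\<in>sets borel. emeasure m ((\<lambda>x. a + x) ` A) = emeasure m A) \<and>
     (\<forall>A\<in>sets borel. emeasure m A = (INF U\<in>{U. open U \<and> A \<subseteq> U}. emeasure m U)) \<and>
     (\<forall>A\<in>sets borel. emeasure m A = (SUP K\<in>{K. compact K \<and> K \<subseteq> A}. emeasure m K))"

text \<open>Exponents are elements of \<open>[1, \<infinity>]\<close> in \<open>ennreal\<close>, where \<open>1 / \<infinity> = 0\<close> and \<open>1 / 0 = \<infinity>\<close>.\<close>

definition conj_exponent :: "ennreal \<Rightarrow> ennreal" where
  "conj_exponent p = 1 / (1 - 1 / p)"

definition Lp_norm :: "'g measure \<Rightarrow> ennreal \<Rightarrow> ('g \<Rightarrow> complex) \<Rightarrow> ennreal" where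
  "Lp_norm m p f =
     (if p = \<infinity> then esssup m (\<lambda>t. ennreal (cmod (f t)))
      else let I = (\<integral>\<^sup>+ t. ennreal (cmod (f t) powr enn2real p) \<partial>m)
           in if I = \<infinity> then \<infinity> else ennreal (enn2real I powr (1 / enn2real p)))"

definition Lp_space :: "'g measure \<Rightarrow> ennreal \<Rightarrow> ('g \<Rightarrow> complex) set" where
  "Lp_space m p = {f \<in> borel_measurable m. Lp_norm m p f < \<infinity>}"

section \<open>Vector measures\<close>

text \<open>Set functions are total; only their values on Borel sets are relevant.\<close>

definition vector_measure :: "('g::topological_space set \<Rightarrow> 'x::real_normed_vector) \<Rightarrow> bool" where
  "vector_measure \<nu> \<longleftrightarrow>
     (\<forall>A :: nat \<Rightarrow> 'g set. range A \<subseteq> sets borel \<longrightarrow> disjoint_family A \<longrightarrow>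
        (\<lambda>i. \<nu> (A i)) sums \<nu> (\<Union>i. A i))"

definition total_variation :: "('g::topological_space set \<Rightarrow> complex) \<Rightarrow> 'g measure" where
  "total_variation \<kappa> = measure_of UNIV (sets borel)
     (\<lambda>A. SUP \<rho>\<in>{\<rho>. finite \<rho> \<and> \<rho> \<subseteq> sets borel \<and> partition_on A \<rho>}. \<Sum>B\<in>\<rho>. ennreal (cmod (\<kappa> B)))"

text \<open>The positive part of the Jordan decomposition of a finite signed measure. Its value at \<open>A\<close> is
  the supremum of the nonnegative numbers among the values on Borel subsets of \<open>A\<close>.\<close>

definition positive_part :: "('g::topological_space set \<Rightarrow> real) \<Rightarrow> 'g measure" where
  "positive_part \<sigma> = measure_of UNIV (sets borel)
     (\<lambda>A. SUP B\<in>{B \<in> sets borel. B \<subseteq> A}. ennreal (\<sigma> B))"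

definition signed_integral :: "('g::topological_space set \<Rightarrow> real) \<Rightarrow> ('g \<Rightarrow> complex) \<Rightarrow> complex" where
  "signed_integral \<sigma> h = (LINT s|positive_part \<sigma>. h s) - (LINT s|positive_part (\<lambda>A. - \<sigma> A). h s)"

definition complex_integral :: "('g::topological_space set \<Rightarrow> complex) \<Rightarrow> ('g \<Rightarrow> complex) \<Rightarrow> complex" where
  "complex_integral \<kappa> h =
     signed_integral (\<lambda>A. Re (\<kappa> A)) h + \<i> * signed_integral (\<lambda>A. Im (\<kappa> A)) h"

definition pairing :: "('g set \<Rightarrow> 'x) \<Rightarrow> ('x \<Rightarrow> complex) \<Rightarrow> 'g set \<Rightarrow> complex" where
  "pairing \<nu> \<phi> = (\<lambda>A. \<phi> (\<nu> A))"

definition is_vector_integral ::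
  "('g::topological_space set \<Rightarrow> 'x::complex_normed_vector) \<Rightarrow> 'g set \<Rightarrow> ('g \<Rightarrow> complex) \<Rightarrow> 'x \<Rightarrow> bool" where
  "is_vector_integral \<nu> A g v \<longleftrightarrow>
     (\<forall>\<phi>\<in>cdual. \<phi> v = complex_integral (pairing \<nu> \<phi>) (\<lambda>s. indicator A s * g s))"

definition vector_integral ::
  "('g::topological_space set \<Rightarrow> 'x::complex_normed_vector) \<Rightarrow> 'g set \<Rightarrow> ('g \<Rightarrow> complex) \<Rightarrow> 'x" where
  "vector_integral \<nu> A g = (THE v. is_vector_integral \<nu> A g v)"

definition L1_vector :: "('g::topological_space set \<Rightarrow> 'x::complex_normed_vector) \<Rightarrow> ('g \<Rightarrow> complex) set" where
  "L1_vector \<nu> = {g \<in> borel_measurable borel.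
     (\<forall>\<phi>\<in>cdual. integrable (total_variation (pairing \<nu> \<phi>)) g) \<and>
     (\<forall>A\<in>sets borel. \<exists>!v. is_vector_integral \<nu> A g v)}"

definition L1_vector_norm ::
  "('g::topological_space set \<Rightarrow> 'x::complex_normed_vector) \<Rightarrow> ('g \<Rightarrow> complex) \<Rightarrow> ennreal" where
  "L1_vector_norm \<nu> g =
     (SUP \<phi>\<in>cdual_ball. \<integral>\<^sup>+ s. ennreal (cmod (g s)) \<partial>total_variation (pairing \<nu> \<phi>))"

definition semivariation ::
  "'g::topological_space measure \<Rightarrow> ennreal \<Rightarrow> ('g set \<Rightarrow> 'x::complex_normed_vector) \<Rightarrow> ennreal" where
  "semivariation m p \<nu> =
     (if p = \<infinity> then SUP A\<in>{A \<in> sets borel. measure m A > 0}. ennreal (norm (\<nu> A) / measure m A)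
      else SUP (\<rho>, \<alpha>)\<in>{(\<rho>, \<alpha>). finite \<rho> \<and> \<rho> \<subseteq> sets borel \<and> partition_on UNIV \<rho> \<and>
                 Lp_norm m (conj_exponent p) (\<lambda>t. \<Sum>A\<in>\<rho>. \<alpha> A * indicator A t) \<le> 1}.
             ennreal (norm (\<Sum>A\<in>\<rho>. \<alpha> A *\<^sub>C \<nu> A)))"

definition M_space ::
  "'g::topological_space measure \<Rightarrow> ennreal \<Rightarrow> ('g set \<Rightarrow> 'x::complex_normed_vector) set" where
  "M_space m p = {\<nu>. vector_measure \<nu> \<and> semivariation m p \<nu> < \<infinity>}"

text \<open>The measure \<open>A \<mapsto> \<integral>\<^sub>A \<phi> dm\<close> for a simple function \<open>\<phi>\<close>, written as a finite sum because the
  Bochner integral of the library needs a second countable codomain.\<close>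

definition simple_density ::
  "'g measure \<Rightarrow> ('g \<Rightarrow> 'x::real_vector) \<Rightarrow> 'g set \<Rightarrow> 'x" where
  "simple_density m \<phi> A = (\<Sum>x\<in>range \<phi>. measure m (A \<inter> \<phi> -` {x}) *\<^sub>R x)"

definition P_space ::
  "'g::topological_space measure \<Rightarrow> ennreal \<Rightarrow> ('g set \<Rightarrow> 'x::complex_normed_vector) set" where
  "P_space m p = {\<mu> \<in> M_space m p. \<forall>\<epsilon>>0. \<exists>\<phi>. simple_function m \<phi> \<and>
     semivariation m p (\<lambda>A. \<mu> A - simple_density m \<phi> A) < \<epsilon>}"

text \<open>\<open>\<mu>\<close> is the measure with density \<open>F\<close> with respect to \<open>m\<close>. The integral is the weak (Pettis)
  one, and the completion of \<open>m\<close> allows \<open>F\<close> to be arbitrary on a null set.\<close>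

definition has_density ::
  "'g::topological_space measure \<Rightarrow> ('g \<Rightarrow> 'x::complex_normed_vector) \<Rightarrow> ('g set \<Rightarrow> 'x) \<Rightarrow> bool" where
  "has_density m F \<mu> \<longleftrightarrow>
     (\<forall>\<phi>\<in>cdual. integrable (completion m) (\<lambda>t. \<phi> (F t)) \<and>
        (\<forall>A\<in>sets borel. \<phi> (\<mu> A) = (LINT t|completion m. indicator A t * \<phi> (F t))))"

section \<open>Convolution with respect to a vector measure\<close>

definition vconv_defined ::
  "'g::topological_group_add measure \<Rightarrow> ('g set \<Rightarrow> 'x::complex_normed_vector)
     \<Rightarrow> ('g \<Rightarrow> complex) \<Rightarrow> ('g \<Rightarrow> complex) \<Rightarrow> bool" where
  "vconv_defined m \<nu> f g \<longleftrightarrow> (AE t in m. (\<lambda>s. f (t - s) * g s) \<in> L1_vector \<nu>)"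

definition vconv ::
  "('g::topological_group_add set \<Rightarrow> 'x::complex_normed_vector)
     \<Rightarrow> ('g \<Rightarrow> complex) \<Rightarrow> ('g \<Rightarrow> complex) \<Rightarrow> 'g \<Rightarrow> 'x" where
  "vconv \<nu> f g t = vector_integral \<nu> UNIV (\<lambda>s. f (t - s) * g s)"

text \<open>The function \<open>vconv \<nu> f g\<close> need not exist pointwise: on the circle group, with
  \<open>X = L\<^sup>q\<close>, \<open>\<nu> A = \<chi>\<^sub>A\<close>, \<open>g = 1\<close> and \<open>f\<close> integrable but not in \<open>L\<^sup>q\<close>, the function
  \<open>s \<mapsto> f (t - s)\<close> belongs to \<open>L\<^sup>1(\<nu>)\<close> for no \<open>t\<close>. As an element of a space of measures the
  convolution is the \<open>\<mu>\<close> for which every scalar measure \<open>\<phi> \<circ> \<mu>\<close> has as its density the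
  convolution of \<open>f\<close> and \<open>g\<close> with respect to the scalar measure \<open>\<phi> \<circ> \<nu>\<close>. This determines \<open>\<mu>\<close>
  on Borel sets, and it is the measure with density \<open>vconv \<nu> f g\<close> whenever \<open>vconv_defined\<close> holds.\<close>

definition is_vconv_measure ::
  "'g::topological_group_add measure \<Rightarrow> ('g set \<Rightarrow> 'x::complex_normed_vector)
     \<Rightarrow> ('g \<Rightarrow> complex) \<Rightarrow> ('g \<Rightarrow> complex) \<Rightarrow> ('g set \<Rightarrow> 'x) \<Rightarrow> bool" where
  "is_vconv_measure m \<nu> f g \<mu> \<longleftrightarrow>
     (\<forall>\<phi>\<in>cdual.
        (AE t in m. integrable (total_variation (pairing \<nu> \<phi>)) (\<lambda>s. f (t - s) * g s)) \<and>
        integrable (completion m) (\<lambda>t. complex_integral (pairing \<nu> \<phi>) (\<lambda>s. f (t - s) * g s)) \<and>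
        (\<forall>A\<in>sets borel. \<phi> (\<mu> A) =
           (LINT t|completion m. indicator A t * complex_integral (pairing \<nu> \<phi>) (\<lambda>s. f (t - s) * g s))))"

end

theory Submission
  imports Defs "HOL-Probability.Probability_Measure"
begin

text \<open>The convolution is the measure \<open>\<mu> A = \<integral> g(s) (\<integral> \<chi>\<^sub>A(t) f(t - s) dm(t)) d\<nu>(s)\<close>. By Fubini's theorem each
  \<open>\<langle>\<mu>, \<phi>\<rangle>\<close> has the scalar convolution with respect to \<open>\<langle>\<nu>, \<phi>\<rangle>\<close> as its density. Since \<open>\<nu>\<close> need not be
  regular, this uses that Haar measure is completion regular: \<open>f\<close> agrees almost everywhere with a
  Baire function \<open>f\<^sub>0\<close>, for which \<open>(t, s) \<mapsto> f\<^sub>0(t - s)\<close> is measurable for the product of the Borel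
  algebras.

  The norm estimates are tested on functionals: in (i) by Hoelder's inequality, in (ii) by
  Young's inequality, since finite \<open>p\<^sub>1\<close>-semivariation gives each \<open>|\<langle>\<nu>, \<phi>\<rangle>|\<close> a density whose
  \<open>p\<^sub>1\<close>-norm is at most \<open>\<parallel>\<phi>\<parallel>\<close> times the semivariation. By these estimates it suffices for the
  membership in \<open>P\<^sub>p\<close> to consider continuous \<open>f\<close>, and \<open>t \<mapsto> f(t - s)\<close> is then a limit of simple
  functions of \<open>t\<close>, uniformly in \<open>s\<close>.\<close>

section \<open>Norming functionals and uniform boundedness\<close>

text \<open>The space \<open>X\<close> is only seen through functionals, so the hidden issue is
  uniformity in the functional. Membership in \<open>L1_vector\<close> gives finite integrals of the
  modulus of \<open>g\<close> for each functional separately. Uniform boundedness improves this to a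
  constant times \<open>onorm \<phi>\<close>, and this is what turns weak limits into norm limits:
  integrals of bounded multiples of \<open>g\<close> exist in \<open>X\<close>, and the convolution
  is countably additive in norm. Parts (i) and (ii) differ only in how they verify one estimate,
  \<open>young_bound\<close>, on an absolute double integral; the norm bound and the approximation
  by simple functions both follow from it. To verify it, each function is written as its norm times
  a power of a nonnegative function of integral at most one, the power being the reciprocal
  exponent. Hoelder's and Young's inequalities then become pointwise inequalities whose weights sum
  to one, and an infinite exponent is merely the power zero.\<close>

definition sublinear :: "('x::real_vector \<Rightarrow> real) \<Rightarrow> bool" where
  "sublinear q \<longleftrightarrow> (\<forall>x y. q (x + y) \<le> q x + q y) \<and> (\<forall>t x. t \<ge> 0 \<longrightarrow> q (t *\<^sub>R x) = t * q x)"

lemma sublinear_add: "sublinear q \<Longrightarrow> q (x + y) \<le> q x + q y"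
  and sublinear_scaleR: "sublinear q \<Longrightarrow> t \<ge> 0 \<Longrightarrow> q (t *\<^sub>R x) = t * q x"
  by (auto simp: sublinear_def)

lemma sublinear_0: "sublinear q \<Longrightarrow> q 0 = 0"
  using sublinear_scaleR[of q 0 0] by simp

lemma sublinear_ge_minus: "sublinear q \<Longrightarrow> - q (- x) \<le> q x"
  using sublinear_add[of q x "- x"] sublinear_0[of q] by simp

text \<open>The auxiliary functional of the proof of Hahn-Banach by minimal sublinear functionals:
  it lies below \<open>q\<close>, and at \<open>- y\<close> it is at most \<open>- q y\<close>, as a
  linear functional that agrees with \<open>q\<close> at \<open>y\<close> would be.\<close>

definition sublinear_shift :: "('x::real_vector \<Rightarrow> real) \<Rightarrow> 'x \<Rightarrow> 'x \<Rightarrow> real" where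
  "sublinear_shift q y z = (INF t\<in>{0..}. q (z + t *\<^sub>R y) - t * q y)"

context
  fixes q :: "'x::real_vector \<Rightarrow> real"
  assumes q: "sublinear q"
begin

lemma sublinear_shift_bdd: "t \<ge> 0 \<Longrightarrow> - q (- z) \<le> q (z + t *\<^sub>R y) - t * q y"
  using sublinear_add[OF q, of "z + t *\<^sub>R y" "- z"] sublinear_scaleR[OF q, of t y]
  by (simp add: algebra_simps)

lemma sublinear_shift_le: "t \<ge> 0 \<Longrightarrow> sublinear_shift q y z \<le> q (z + t *\<^sub>R y) - t * q y"
  unfolding sublinear_shift_def
  by (rule cINF_lower) (auto intro!: bdd_belowI2 sublinear_shift_bdd)

lemma sublinear_shift_greatest:
  "(\<And>t. t \<ge> 0 \<Longrightarrow> c \<le> q (z + t *\<^sub>R y) - t * q y) \<Longrightarrow> c \<le> sublinear_shift q y z"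
  unfolding sublinear_shift_def by (rule cINF_greatest) auto

text \<open>Parameters \<open>t\<close> for \<open>a\<close> and \<open>s\<close> for
  \<open>b\<close> combine to the parameter \<open>t + s\<close> for \<open>a + b\<close>, and
  scaling by \<open>r > 0\<close> replaces \<open>t\<close> by \<open>r * t\<close>.\<close>

lemma sublinear_sublinear_shift: "sublinear (sublinear_shift q y)"
  unfolding sublinear_def
proof (intro conjI allI impI)
  fix a b :: 'x
  have *: "sublinear_shift q y (a + b) \<le> (q (a + t *\<^sub>R y) - t * q y) + (q (b + s *\<^sub>R y) - s * q y)"
    if "t \<ge> 0" "s \<ge> 0" for s t
    using sublinear_shift_le[of "t + s" y "a + b"] that
      sublinear_add[OF q, of "a + t *\<^sub>R y" "b + s *\<^sub>R y"] by (simp add: algebra_simps)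
  have "sublinear_shift q y (a + b) - sublinear_shift q y a \<le> sublinear_shift q y b"
  proof (rule sublinear_shift_greatest)
    fix s :: real assume s: "s \<ge> 0"
    have "sublinear_shift q y (a + b) - (q (b + s *\<^sub>R y) - s * q y) \<le> sublinear_shift q y a"
      by (rule sublinear_shift_greatest) (use *[OF _ s] in \<open>simp add: algebra_simps\<close>)
    then show "sublinear_shift q y (a + b) - sublinear_shift q y a \<le> q (b + s *\<^sub>R y) - s * q y"
      by simp
  qed
  then show "sublinear_shift q y (a + b) \<le> sublinear_shift q y a + sublinear_shift q y b"
    by simp
next
  fix r :: real and x :: 'x assume r: "r \<ge> 0"
  have le: "sublinear_shift q y (r *\<^sub>R x) \<le> r * sublinear_shift q y x" if r: "r > 0" for r x
  proof -
    have "sublinear_shift q y (r *\<^sub>R x) / r \<le> sublinear_shift q y x"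
    proof (rule sublinear_shift_greatest)
      fix t :: real assume t: "t \<ge> 0"
      have "sublinear_shift q y (r *\<^sub>R x) \<le> q (r *\<^sub>R x + (r * t) *\<^sub>R y) - (r * t) * q y"
        using r t by (intro sublinear_shift_le) auto
      also have "r *\<^sub>R x + (r * t) *\<^sub>R y = r *\<^sub>R (x + t *\<^sub>R y)" by (simp add: algebra_simps)
      also have "q \<dots> = r * q (x + t *\<^sub>R y)" using r by (intro sublinear_scaleR[OF q]) auto
      finally show "sublinear_shift q y (r *\<^sub>R x) / r \<le> q (x + t *\<^sub>R y) - t * q y"
        using r by (simp add: field_simps)
    qed
    then show ?thesis using r by (simp add: field_simps)
  qed
  show "sublinear_shift q y (r *\<^sub>R x) = r * sublinear_shift q y x"
  proof (cases "r = 0")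
    case True
    have "sublinear_shift q y 0 = 0"
    proof (rule antisym)
      show "sublinear_shift q y 0 \<le> 0"
        using sublinear_shift_le[of 0 y 0] sublinear_0[OF q] by simp
      show "0 \<le> sublinear_shift q y 0"
        by (rule sublinear_shift_greatest) (use sublinear_scaleR[OF q] in simp)
    qed
    then show ?thesis using True by simp
  next
    case False
    with r have "r > 0" by simp
    then show ?thesis
      using le[of r x] le[of "1 / r" "r *\<^sub>R x"] by (simp add: field_simps)
  qed
qed

lemma sublinear_shift_le_self: "sublinear_shift q y z \<le> q z"
  using sublinear_shift_le[of 0 y z] by simp

end

text \<open>By minimality the shift of \<open>q\<close> along \<open>y\<close> is \<open>q\<close>
  itself, and the parameter 1 in its infimum gives the superadditivity that sublinearity
  lacks.\<close>

lemma minimal_sublinear_additive: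
  assumes q: "sublinear q" and min: "\<And>q'. sublinear q' \<Longrightarrow> (\<And>x. q' x \<le> q x) \<Longrightarrow> q' = q"
  shows "q (x + y) = q x + q y"
proof -
  have "sublinear_shift q y = q"
    by (intro min sublinear_sublinear_shift q sublinear_shift_le_self)
  then have "q x \<le> q (x + y) - q y"
    using sublinear_shift_le[OF q, of 1 y x] by simp
  with sublinear_add[OF q, of x y] show ?thesis by simp
qed

text \<open>Zorn's lemma: the pointwise infimum of a chain is again sublinear. It is finite because
  every sublinear \<open>q\<close> below \<open>p\<close> satisfies
  \<open>- p (- x) \<le> q x\<close>.\<close>

lemma exists_minimal_sublinear:
  fixes p :: "'x::real_vector \<Rightarrow> real"
  assumes p: "sublinear p"
  obtains q where "sublinear q" "\<And>x. q x \<le> p x"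
    "\<And>q'. sublinear q' \<Longrightarrow> (\<And>x. q' x \<le> q x) \<Longrightarrow> q' = q"
proof -
  define S where "S = {q. sublinear q \<and> (\<forall>x. q x \<le> p x)}"
  \<comment> \<open>The order is reversed, so that a maximal element in the sense of Zorn is a
    minimal functional.\<close>
  define P :: "('x \<Rightarrow> real) \<Rightarrow> ('x \<Rightarrow> real) \<Rightarrow> bool" where "P = (\<lambda>q q'. \<forall>x. q' x \<le> q x)"
  have "\<exists>m\<in>S. \<forall>a\<in>S. P m a \<longrightarrow> a = m"
  proof (rule predicate_Zorn)
    show "partial_order_on S (relation_of P S)"
      by (rule partial_order_on_relation_ofI) (auto simp: P_def intro: order_trans, force intro: antisym)
  next
    fix C assume C: "C \<in> Chains (relation_of P S)"
    then have CS: "C \<subseteq> S" and chain: "\<And>a b. a \<in> C \<Longrightarrow> b \<in> C \<Longrightarrow> P a b \<or> P b a"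
      by (auto simp: Chains_def relation_of_def)
    show "\<exists>u\<in>S. \<forall>a\<in>C. P a u"
    proof (cases "C = {}")
      case True
      then show ?thesis using p by (auto simp: S_def)
    next
      case False
      define u where "u x = (INF q\<in>C. q x)" for x
      have lb: "- p (- x) \<le> q x" if "q \<in> C" for q x
      proof -
        have "sublinear q" "q (- x) \<le> p (- x)" using that CS by (auto simp: S_def)
        with sublinear_ge_minus[of q x] show ?thesis by simp
      qed
      have u_le: "u x \<le> q x" if "q \<in> C" for q x
        unfolding u_def by (rule cINF_lower[OF _ that]) (auto intro!: bdd_belowI2 lb)
      have u_gr: "c \<le> u x" if "\<And>q. q \<in> C \<Longrightarrow> c \<le> q x" for c x
        unfolding u_def by (rule cINF_greatest[OF False that])
      have sub: "sublinear q" if "q \<in> C" for q using that CS by (auto simp: S_def)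
      have "sublinear u"
        unfolding sublinear_def
      proof (intro conjI allI impI)
        fix x y
        have *: "u (x + y) \<le> q x + q' y" if "q \<in> C" "q' \<in> C" for q q'
          using chain[OF that]
        proof
          assume "P q q'"
          then show ?thesis using u_le[OF that(2), of "x + y"] sublinear_add[OF sub[OF that(2)], of x y]
            by (auto simp: P_def dest: spec[of _ x])
        next
          assume "P q' q"
          then show ?thesis using u_le[OF that(1), of "x + y"] sublinear_add[OF sub[OF that(1)], of x y]
            by (auto simp: P_def dest: spec[of _ y])
        qed
        have "u (x + y) - u x \<le> u y"
        proof (rule u_gr)
          fix q' assume "q' \<in> C"
          then have "u (x + y) - q' y \<le> u x"
            by (intro u_gr) (use * in \<open>force simp: algebra_simps\<close>)
          then show "u (x + y) - u x \<le> q' y" by simp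
        qed
        then show "u (x + y) \<le> u x + u y" by simp
      next
        fix t :: real and x assume t: "t \<ge> 0"
        have "u (t *\<^sub>R x) = (INF q\<in>C. t * q x)"
          unfolding u_def by (intro INF_cong refl sublinear_scaleR sub t)
        also have "\<dots> = t * u x"
        proof (cases "t = 0")
          case True
          then show ?thesis using False by simp
        next
          case F: False
          with t have t: "t > 0" by simp
          show ?thesis
          proof (rule antisym)
            have "(INF q\<in>C. t * q x) / t \<le> u x"
            proof (rule u_gr)
              fix q assume "q \<in> C"
              then have "(INF q\<in>C. t * q x) \<le> t * q x"
                using t by (intro cINF_lower bdd_belowI2[where m = "t * (- p (- x))"] mult_left_mono lb) auto
              then show "(INF q\<in>C. t * q x) / t \<le> q x" using t by (simp add: field_simps)
            qed
            then show "(INF q\<in>C. t * q x) \<le> t * u x" using t by (simp add: field_simps)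
            show "t * u x \<le> (INF q\<in>C. t * q x)"
              using t by (intro cINF_greatest[OF False] mult_left_mono u_le) auto
          qed
        qed
        finally show "u (t *\<^sub>R x) = t * u x" .
      qed
      moreover have "u x \<le> p x" for x
      proof -
        obtain q where "q \<in> C" using False by auto
        then show ?thesis using u_le[of q x] CS by (force simp: S_def intro: order_trans)
      qed
      ultimately have "u \<in> S" by (auto simp: S_def)
      then show ?thesis using u_le by (auto simp: P_def)
    qed
  qed
  then obtain q where q: "q \<in> S" "\<And>a. a \<in> S \<Longrightarrow> P q a \<Longrightarrow> a = q" by auto
  show ?thesis
  proof
    show "sublinear q" "\<And>x. q x \<le> p x" using q(1) by (auto simp: S_def)
    show "q' = q" if "sublinear q'" "\<And>x. q' x \<le> q x" for q'
      using q(1) that by (intro q(2)) (auto simp: S_def P_def intro: order_trans)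
  qed
qed

text \<open>The minimal functional is sought below the shift of the norm along \<open>x\<close>
  rather than below the norm. This forces a value of at most \<open>- norm x\<close> at
  \<open>- x\<close>, which linearity turns into \<open>norm x\<close> at \<open>x\<close>.\<close>

lemma exists_real_norming_functional:
  fixes x :: "'x::real_normed_vector"
  obtains u :: "'x \<Rightarrow> real" where "linear u" "\<And>y. u y \<le> norm y" "u x = norm x"
proof -
  have n: "sublinear (norm :: 'x \<Rightarrow> real)"
    by (simp add: sublinear_def norm_triangle_ineq)
  define p where "p = sublinear_shift norm x"
  have p: "sublinear p" "\<And>y. p y \<le> norm y" "p (- x) \<le> - norm x"
    unfolding p_def using sublinear_sublinear_shift[OF n] sublinear_shift_le_self[OF n]
      sublinear_shift_le[OF n, of 1 x "- x"] by auto
  obtain q where q: "sublinear q" "\<And>y. q y \<le> p y"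
    and min: "\<And>q'. sublinear q' \<Longrightarrow> (\<And>x. q' x \<le> q x) \<Longrightarrow> q' = q"
    using exists_minimal_sublinear[OF p(1)] by metis
  have add: "q (a + b) = q a + q b" for a b
    by (rule minimal_sublinear_additive[OF q(1) min])
  have minus: "q (- a) = - q a" for a
    using add[of a "- a"] sublinear_0[OF q(1)] by simp
  have "q (r *\<^sub>R a) = r * q a" for r a
  proof (cases "r \<ge> 0")
    case False
    then have "q ((- r) *\<^sub>R a) = (- r) * q a" by (intro sublinear_scaleR[OF q(1)]) auto
    then show ?thesis using minus[of "r *\<^sub>R a"] by simp
  qed (rule sublinear_scaleR[OF q(1)])
  then have "linear q" by (intro linearI add) auto
  moreover have le: "q y \<le> norm y" for y using q(2)[of y] p(2)[of y] by simp
  moreover have "q x = norm x"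
    using q(2)[of "- x"] p(3) minus[of x] le[of x] by simp
  ultimately show ?thesis using that by blast
qed

lemma cdual_linear: "\<phi> \<in> cdual \<Longrightarrow> \<phi> (c *\<^sub>C x) = c * \<phi> x"
  and cdual_bounded_linear: "\<phi> \<in> cdual \<Longrightarrow> bounded_linear \<phi>"
  by (auto simp: cdual_def)

lemma cdual_ball_le: "\<phi> \<in> cdual_ball \<Longrightarrow> cmod (\<phi> x) \<le> norm x"
  using onorm[of \<phi> x] mult_right_mono[of "onorm \<phi>" 1 "norm x"]
  by (force simp: cdual_ball_def cdual_def)

lemma cdual_ballI:
  assumes "\<And>x y. \<phi> (x + y) = \<phi> x + \<phi> y" "\<And>c x. \<phi> (c *\<^sub>C x) = c * \<phi> x" "\<And>x. cmod (\<phi> x) \<le> norm x"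
  shows "\<phi> \<in> cdual_ball"
proof -
  have "bounded_linear \<phi>"
    using assms(1) assms(2)[of "complex_of_real _"] assms(3)
    by (intro bounded_linear_intro[where K = 1]) (auto simp: scaleC_of_real scaleR_conv_of_real)
  moreover have "onorm \<phi> \<le> 1"
    by (rule onorm_bound) (use assms(3) in auto)
  ultimately show ?thesis using assms(2) by (auto simp: cdual_ball_def cdual_def)
qed

lemma cdual_ball_cdual: "\<phi> \<in> cdual_ball \<Longrightarrow> \<phi> \<in> cdual"
  by (simp add: cdual_ball_def)

text \<open>The complex functional is recovered from its real part \<open>u\<close> as \<open>u x - \<i> u (\<i> x)\<close>.\<close>

lemma exists_norming_functional:
  fixes x :: "'x::complex_normed_vector"
  obtains \<phi> where "\<phi> \<in> cdual_ball" "\<phi> x = of_real (norm x)"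
proof -
  obtain u where u: "linear u" "\<And>y. u y \<le> norm y" "u x = norm x"
    using exists_real_norming_functional[of x] by metis
  define \<phi> where "\<phi> y = Complex (u y) (- u (\<i> *\<^sub>C y))" for y
  have add: "\<phi> (y + z) = \<phi> y + \<phi> z" for y z
    by (simp add: \<phi>_def scaleC_add_right linear_add[OF u(1)] complex_eq_iff)
  have scR: "\<phi> (r *\<^sub>R y) = of_real r * \<phi> y" for r y
  proof -
    have "\<i> *\<^sub>C (r *\<^sub>R y) = r *\<^sub>R (\<i> *\<^sub>C y)"
      by (simp add: scaleC_of_real[symmetric] scaleC_scaleC mult.commute)
    then show ?thesis by (simp add: \<phi>_def linear_cmul[OF u(1)] complex_eq_iff)
  qed
  have ii: "\<i> *\<^sub>C \<i> *\<^sub>C y = - y" for y :: 'x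
    using scaleC_of_real[of "-1" y] by (simp add: scaleC_scaleC)
  have scI: "\<phi> (\<i> *\<^sub>C y) = \<i> * \<phi> y" for y
    by (simp add: \<phi>_def ii linear_neg[OF u(1)] complex_eq_iff)
  have sc: "\<phi> (c *\<^sub>C y) = c * \<phi> y" for c y
  proof -
    have "c *\<^sub>C y = Re c *\<^sub>R y + Im c *\<^sub>R (\<i> *\<^sub>C y)"
    proof -
      have "c *\<^sub>C y = (complex_of_real (Re c) + complex_of_real (Im c) * \<i>) *\<^sub>C y"
        by (metis complex_eq mult.commute)
      then show ?thesis by (simp only: scaleC_add_left scaleC_scaleC[symmetric] scaleC_of_real)
    qed
    then show ?thesis
      by (simp add: add scR scI complex_eq_iff)
  qed
  have le: "cmod (\<phi> y) \<le> norm y" for y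
  proof (cases "\<phi> y = 0")
    case False
    \<comment> \<open>Multiplying \<open>y\<close> by the conjugate phase of its value makes the
      value real, so the bound on \<open>u\<close> controls the modulus.\<close>
    define w where "w = cnj (\<phi> y) / of_real (cmod (\<phi> y))"
    have w: "cmod w = 1" using False by (simp add: w_def norm_divide)
    have "\<phi> (w *\<^sub>C y) = of_real (cmod (\<phi> y))"
      using False complex_norm_square[of "\<phi> y"]
      by (simp add: sc w_def mult.commute power2_eq_square nonzero_divide_eq_eq)
    then have "cmod (\<phi> y) = u (w *\<^sub>C y)" by (simp add: \<phi>_def complex_eq_iff)
    also have "\<dots> \<le> norm (w *\<^sub>C y)" by (rule u(2))
    finally show ?thesis by (simp add: norm_scaleC w)
  qed simp
  have ball: "\<phi> \<in> cdual_ball" by (intro cdual_ballI add sc le)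
  \<comment> \<open>The real part already exhausts the modulus, so the imaginary part
    vanishes.\<close>
  have "Re (\<phi> x) = norm x" by (simp add: \<phi>_def u(3))
  moreover have "(cmod (\<phi> x))\<^sup>2 \<le> (norm x)\<^sup>2" using le[of x] by (intro power_mono) auto
  ultimately have "\<phi> x = of_real (norm x)" by (simp add: cmod_power2 complex_eq_iff)
  with ball show ?thesis using that by blast
qed

lemma norm_le_cdual_ball:
  fixes x :: "'x::complex_normed_vector"
  assumes "\<And>\<phi>. \<phi> \<in> cdual_ball \<Longrightarrow> cmod (\<phi> x) \<le> B"
  shows "norm x \<le> B"
  using exists_norming_functional[of x] assms by (metis abs_norm_cancel norm_of_real)

lemma cdual_separates:
  fixes x y :: "'x::complex_normed_vector"
  assumes "\<And>\<phi>. \<phi> \<in> cdual \<Longrightarrow> \<phi> x = \<phi> y"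
  shows "x = y"
proof -
  have "norm (x - y) \<le> 0"
  proof (rule norm_le_cdual_ball)
    fix \<phi> :: "'x \<Rightarrow> complex" assume "\<phi> \<in> cdual_ball"
    then have "\<phi> (x - y) = \<phi> x - \<phi> y" "\<phi> x = \<phi> y"
      using linear_diff[OF bounded_linear.linear[OF cdual_bounded_linear]] assms
      by (auto dest: cdual_ball_cdual)
    then show "cmod (\<phi> (x - y)) \<le> 0" by simp
  qed
  then show ?thesis by simp
qed


text \<open>Gliding hump: the functional \<open>\<Sum>\<^sub>k \<plusminus>3\<^sup>-\<^sup>k \<phi>\<^sub>k\<close>, where \<open>\<phi>\<^sub>k\<close> norms \<open>v\<^sub>k\<close> and the signs are chosen
  successively so that the \<open>n\<close>-th partial sum is at least \<open>3\<^sup>-\<^sup>n \<parallel>v\<^sub>n\<parallel>\<close> on \<open>v\<^sub>n\<close>.\<close>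

lemma weakly_bounded_imp_bounded:
  fixes S :: "'x::complex_normed_vector set"
  assumes S: "\<And>\<phi>. \<phi> \<in> cdual \<Longrightarrow> \<exists>B. \<forall>x\<in>S. cmod (\<phi> x) \<le> B"
  obtains B where "\<And>x. x \<in> S \<Longrightarrow> norm x \<le> B"
proof (rule ccontr)
  assume "\<not> thesis"
  then have "\<forall>B. \<exists>x\<in>S. norm x > B" using that by (meson not_le)
  \<comment> \<open>The factor \<open>3 ^ n\<close> compensates the weight of the n-th functional
    and the factor 2 the half that the tail can consume; what is left is \<open>n\<close>.\<close>
  then have "\<forall>n. \<exists>x. x \<in> S \<and> norm x > 2 * real n * 3 ^ n" by (auto simp: Bex_def)
  then obtain v where v: "\<And>n. v n \<in> S" "\<And>n. norm (v n) > 2 * real n * 3 ^ n" by metis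
  have "\<forall>n. \<exists>\<phi>\<in>cdual_ball. \<phi> (v n) = of_real (norm (v n))"
    using exists_norming_functional by metis
  then obtain \<phi> where \<phi>: "\<And>n. \<phi> n \<in> cdual_ball" "\<And>n. \<phi> n (v n) = of_real (norm (v n))" by metis
  \<comment> \<open>With ratio 1/3 the weights after the n-th add up to half of the n-th weight, so
    the tail cannot cancel the hump.\<close>
  define c :: "nat \<Rightarrow> complex" where "c n = of_real ((1/3) ^ n)" for n
  have c: "cmod (c n) = (1/3) ^ n" for n by (simp add: c_def norm_power norm_divide)
  define P where "P = rec_nat (\<lambda>x. 0) (\<lambda>n p. if cmod (p (v n) + c n * \<phi> n (v n)) \<ge> (1/3) ^ n * norm (v n)
     then (\<lambda>x. p x + c n * \<phi> n x) else (\<lambda>x. p x - c n * \<phi> n x))"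
  have P0: "P 0 = (\<lambda>x. 0)" by (simp add: P_def)
  have PS: "P (Suc n) = (if cmod (P n (v n) + c n * \<phi> n (v n)) \<ge> (1/3) ^ n * norm (v n)
     then (\<lambda>x. P n x + c n * \<phi> n x) else (\<lambda>x. P n x - c n * \<phi> n x))" for n
    by (simp add: P_def)
  define d where "d n x = P (Suc n) x - P n x" for n x
  have lin: "\<phi> n (x + y) = \<phi> n x + \<phi> n y" "\<phi> n (a *\<^sub>C x) = a * \<phi> n x" for n x y a
    using linear_add[OF bounded_linear.linear[OF cdual_bounded_linear[OF cdual_ball_cdual[OF \<phi>(1)]]]]
      cdual_linear[OF cdual_ball_cdual[OF \<phi>(1)]] by auto
  have d_lin: "d n (x + y) = d n x + d n y" "d n (a *\<^sub>C x) = a * d n x" for n x y a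
    by (simp_all add: d_def PS lin algebra_simps)
  have d_le: "cmod (d n x) \<le> (1/3) ^ n * norm x" for n x
    using cdual_ball_le[OF \<phi>(1), of n x] by (simp add: d_def PS norm_mult c mult_left_mono)
  have P_sum: "P n x = (\<Sum>k<n. d k x)" for n x
    unfolding d_def by (subst sum_lessThan_telescope) (simp add: P0)
  have sg: "summable (\<lambda>k. (1/3) ^ k * norm x)" for x :: 'x
    by (intro summable_mult2 summable_geometric) auto
  have sd: "summable (\<lambda>k. d k x)" for x
    by (rule summable_comparison_test'[OF sg d_le])
  define \<psi> where "\<psi> x = suminf (\<lambda>k. d k x)" for x
  have "\<psi> \<in> cdual"
  proof -
    have *: "cmod (\<psi> x) \<le> (3/2) * norm x" for x
    proof -
      have "cmod (\<psi> x) \<le> (\<Sum>k. (1/3) ^ k * norm x)"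
        unfolding \<psi>_def by (rule norm_suminf_le[OF d_le sg])
      also have "\<dots> = (3/2) * norm x"
        by (subst suminf_mult2[symmetric]) (auto intro!: summable_geometric simp: suminf_geometric)
      finally show ?thesis .
    qed
    have add: "\<psi> (x + y) = \<psi> x + \<psi> y" for x y
      unfolding \<psi>_def by (simp add: d_lin suminf_add sd)
    have sc: "\<psi> (a *\<^sub>C x) = a * \<psi> x" for a x
      unfolding \<psi>_def by (simp add: d_lin suminf_mult sd)
    have "bounded_linear \<psi>"
      using * add sc[of "complex_of_real _"]
      by (intro bounded_linear_intro[where K = "3/2"])
        (auto simp: scaleC_of_real scaleR_conv_of_real mult.commute)
    then show ?thesis using sc by (auto simp: cdual_def)
  qed
  then obtain B where B: "\<And>x. x \<in> S \<Longrightarrow> cmod (\<psi> x) \<le> B" using S by blast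
  have big: "cmod (P (Suc n) (v n)) \<ge> (1/3) ^ n * norm (v n)" for n
  proof (cases "cmod (P n (v n) + c n * \<phi> n (v n)) \<ge> (1/3) ^ n * norm (v n)")
    case False
    let ?a = "P n (v n)" and ?b = "c n * \<phi> n (v n)"
    have "cmod ?b = (1/3) ^ n * norm (v n)" by (simp add: norm_mult c \<phi>(2))
    \<comment> \<open>\<open>?a + ?b\<close> and \<open>?a - ?b\<close> differ by
      \<open>2 * ?b\<close>, so one of the two signs yields a modulus of at least that of
      \<open>?b\<close>.\<close>
    moreover have "2 * cmod ?b \<le> cmod (?a + ?b) + cmod (?a - ?b)"
      using norm_triangle_ineq4[of "?a + ?b" "?a - ?b"] by (simp add: norm_mult algebra_simps flip: mult_2 mult_2_right)
    ultimately show ?thesis using False by (simp add: PS)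
  qed (simp add: PS)
  have "real n \<le> B" for n
  proof -
    have "\<psi> (v n) = (\<Sum>k. d (k + Suc n) (v n)) + P (Suc n) (v n)"
      unfolding \<psi>_def P_sum by (rule suminf_split_initial_segment[OF sd])
    then have "cmod (P (Suc n) (v n)) \<le> cmod (\<psi> (v n)) + cmod (\<Sum>k. d (k + Suc n) (v n))"
      by (metis add_diff_cancel_left' norm_triangle_ineq4)
    also have "cmod (\<Sum>k. d (k + Suc n) (v n)) \<le> (\<Sum>k. (1/3) ^ k * ((1/3) ^ Suc n * norm (v n)))"
    proof (rule norm_suminf_le)
      show "cmod (d (k + Suc n) (v n)) \<le> (1/3) ^ k * ((1/3) ^ Suc n * norm (v n))" for k
        using d_le[of "k + Suc n" "v n"] by (simp add: power_add mult_ac)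
    qed (intro summable_mult2 summable_geometric, auto)
    also have "\<dots> = (1/2) * ((1/3) ^ n * norm (v n))"
      by (subst suminf_mult2[symmetric]) (auto intro!: summable_geometric simp: suminf_geometric)
    finally have "(1/2) * ((1/3) ^ n * norm (v n)) \<le> cmod (\<psi> (v n))"
      using big[of n] by linarith
    moreover have "(1/2) * ((1/3) ^ n * norm (v n)) \<ge> real n"
      using v(2)[of n] by (simp add: power_one_over field_simps)
    ultimately show ?thesis using B[OF v(1), of n] by linarith
  qed
  then show False using reals_Archimedean2[of B] by (meson not_le)
qed

section \<open>Scalar measures\<close>

text \<open>The terms may have either sign: \<open>ennreal\<close> cuts negative ones to zero, which
  only enlarges the partial sums.\<close>

lemma ennreal_le_suminf_of_sums:
  fixes F :: "nat \<Rightarrow> ennreal" and a :: "nat \<Rightarrow> real"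
  assumes "a sums s" "\<And>i. ennreal (a i) \<le> F i"
  shows "ennreal s \<le> (\<Sum>i. F i)"
proof (rule LIMSEQ_le_const2)
  show "(\<lambda>n. ennreal (\<Sum>i<n. a i)) \<longlonglongrightarrow> ennreal s"
    using assms(1) by (intro tendsto_ennrealI) (simp add: sums_def)
  have "ennreal (\<Sum>i<n. a i) \<le> (\<Sum>i. F i)" for n
  proof -
    have "ennreal (\<Sum>i<n. a i) \<le> ennreal (\<Sum>i<n. max 0 (a i))"
      by (intro ennreal_leI sum_mono) auto
    also have "\<dots> = (\<Sum>i<n. ennreal (max 0 (a i)))" by (rule sum_ennreal[symmetric]) auto
    also have "\<dots> = (\<Sum>i<n. ennreal (a i))" by (intro sum.cong) (auto simp: max_def ennreal_neg)
    also have "\<dots> \<le> (\<Sum>i<n. F i)" by (intro sum_mono assms)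
    also have "\<dots> \<le> (\<Sum>i. F i)" by (intro sum_le_suminf) auto
    finally show ?thesis .
  qed
  then show "\<exists>N. \<forall>n\<ge>N. ennreal (\<Sum>i<n. a i) \<le> (\<Sum>i. F i)" by auto
qed

section \<open>Countably additive vector measures and their boundedness\<close>

context
  fixes \<nu> :: "'g::topological_space set \<Rightarrow> 'x::real_normed_vector"
  assumes vm: "vector_measure \<nu>"
begin

lemma vector_measure_sums:
  "range A \<subseteq> sets borel \<Longrightarrow> disjoint_family A \<Longrightarrow> (\<lambda>i. \<nu> (A i)) sums \<nu> (\<Union>i. A i)"
  using vm by (auto simp: vector_measure_def)

lemma vector_measure_sums_Int:
  assumes "B \<in> sets borel" "range A \<subseteq> sets borel" "disjoint_family A" "B \<subseteq> (\<Union>i. A i)"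
  shows "(\<lambda>i. \<nu> (B \<inter> A i)) sums \<nu> B"
proof -
  have "(\<lambda>i. \<nu> (B \<inter> A i)) sums \<nu> (\<Union>i. B \<inter> A i)"
    using assms by (intro vector_measure_sums) (auto simp: disjoint_family_on_def)
  moreover have "(\<Union>i. B \<inter> A i) = B" using assms(4) by auto
  ultimately show ?thesis by simp
qed

lemma vector_measure_empty: "\<nu> {} = 0"
proof -
  have "(\<lambda>i::nat. \<nu> {}) sums \<nu> {}"
    using vector_measure_sums[of "\<lambda>_. {}"] by (simp add: disjoint_family_on_def)
  then show ?thesis by (simp add: summable_const_iff sums_iff)
qed

lemma vector_measure_Un:
  assumes "A \<in> sets borel" "B \<in> sets borel" "A \<inter> B = {}"
  shows "\<nu> (A \<union> B) = \<nu> A + \<nu> B"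
proof -
  define F where "F i = (if i = 0 then A else if i = (1::nat) then B else {})" for i
  have "(\<lambda>i. \<nu> (F i)) sums \<nu> (\<Union>i. F i)"
    using assms by (intro vector_measure_sums) (auto simp: F_def disjoint_family_on_def)
  moreover have "(\<Union>i. F i) = A \<union> B" by (auto simp: F_def split: if_splits)
  moreover have "(\<lambda>i. \<nu> (F i)) sums (\<Sum>i\<in>{0,1}. \<nu> (F i))"
    by (intro sums_finite) (auto simp: F_def vector_measure_empty)
  ultimately show ?thesis by (auto simp: F_def dest: sums_unique2)
qed

lemma vector_measure_Diff:
  assumes "A \<in> sets borel" "B \<in> sets borel" "B \<subseteq> A"
  shows "\<nu> (A - B) = \<nu> A - \<nu> B"
  using vector_measure_Un[of B "A - B"] assms by (simp add: Un_absorb1)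

lemma vector_measure_Union:
  assumes "finite \<rho>" "\<rho> \<subseteq> sets borel" "disjoint \<rho>"
  shows "\<nu> (\<Union>\<rho>) = (\<Sum>B\<in>\<rho>. \<nu> B)"
  using assms
proof (induction \<rho> rule: finite_induct)
  case (insert B \<rho>)
  have "\<nu> (B \<union> \<Union>\<rho>) = \<nu> B + \<nu> (\<Union>\<rho>)"
    using insert by (intro vector_measure_Un) (auto simp: disjoint_def)
  then show ?case using insert by (simp add: disjoint_def)
qed (simp add: vector_measure_empty)

text \<open>If \<open>\<nu>\<close> is unbounded on the subsets of \<open>E\<close>, then \<open>E\<close> splits into two parts both of which have
  measure at least one, and \<open>\<nu>\<close> is unbounded on the subsets of one of them.\<close>

lemma vector_measure_bounded:
  obtains M where "M \<ge> 0" "\<And>B. B \<in> sets borel \<Longrightarrow> norm (\<nu> B) \<le> M"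
proof (rule ccontr)
  assume not: "\<not> thesis"
  define bad where "bad E \<longleftrightarrow> E \<in> sets borel \<and> (\<forall>M. \<exists>B\<in>sets borel. B \<subseteq> E \<and> norm (\<nu> B) > M)" for E
  have "\<exists>B\<in>sets borel. norm (\<nu> B) > M" for M
  proof (rule ccontr)
    assume "\<not> ?thesis"
    then have "\<And>B. B \<in> sets borel \<Longrightarrow> norm (\<nu> B) \<le> max 0 M" by (auto simp: not_less le_max_iff_disj)
    then show False using that not by (meson max.cobounded1)
  qed
  then have UN: "bad UNIV" by (auto simp: bad_def)
  have step: "\<exists>E'. bad E' \<and> E' \<subseteq> E \<and> norm (\<nu> (E - E')) \<ge> 1" if E: "bad E" for E
  proof -
    \<comment> \<open>The margin \<open>1 + norm (\<nu> E)\<close> ensures that \<open>E - B\<close>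
      has measure of norm at least one as well as \<open>B\<close>, so either of them may be
      kept.\<close>
    obtain B where B: "B \<in> sets borel" "B \<subseteq> E" "norm (\<nu> B) > 1 + norm (\<nu> E)"
      using E by (auto simp: bad_def)
    have Eb: "E \<in> sets borel" using E by (simp add: bad_def)
    have "bad B \<or> bad (E - B)"
    proof (rule ccontr)
      assume "\<not> ?thesis"
      then have nb: "\<not> bad B" "\<not> bad (E - B)" by auto
      obtain M1 where M1: "\<And>C. C \<in> sets borel \<Longrightarrow> C \<subseteq> B \<Longrightarrow> norm (\<nu> C) \<le> M1"
        using nb(1) B(1) unfolding bad_def by (meson not_less)
      have "E - B \<in> sets borel" using B(1) Eb by auto
      then obtain M2 where M2: "\<And>C. C \<in> sets borel \<Longrightarrow> C \<subseteq> E - B \<Longrightarrow> norm (\<nu> C) \<le> M2"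
        using nb(2) unfolding bad_def by (meson not_less)
      obtain C where C: "C \<in> sets borel" "C \<subseteq> E" "norm (\<nu> C) > M1 + M2"
        using E by (auto simp: bad_def)
      have "\<nu> ((C \<inter> B) \<union> (C - B)) = \<nu> (C \<inter> B) + \<nu> (C - B)"
        using B C by (intro vector_measure_Un) auto
      then have "\<nu> C = \<nu> (C \<inter> B) + \<nu> (C - B)" by (simp add: Int_Diff_Un)
      moreover have "norm (\<nu> (C \<inter> B)) \<le> M1" "norm (\<nu> (C - B)) \<le> M2"
        using B C by (auto intro!: M1 M2)
      ultimately have "norm (\<nu> C) \<le> M1 + M2"
        by (simp add: norm_triangle_mono)
      then show False using C(3) by simp
    qed
    then show ?thesis
    proof
      assume "bad B"
      moreover have "norm (\<nu> (E - B)) \<ge> 1"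
      proof -
        have "norm (\<nu> (E - B)) = norm (\<nu> B - \<nu> E)"
          by (subst vector_measure_Diff[OF Eb B(1,2)]) (rule norm_minus_commute)
        then show ?thesis using B(3) norm_triangle_ineq2[of "\<nu> B" "\<nu> E"] by simp
      qed
      ultimately show ?thesis using B by auto
    next
      assume "bad (E - B)"
      moreover have "E - (E - B) = B" using B by auto
      moreover have "norm (\<nu> B) \<ge> 1" using B(3) norm_ge_zero[of "\<nu> E"] by linarith
      ultimately show ?thesis by (intro exI[of _ "E - B"]) auto
    qed
  qed
  have "\<exists>E. \<forall>n::nat. bad (E n) \<and> E (Suc n) \<subseteq> E n \<and> norm (\<nu> (E n - E (Suc n))) \<ge> 1"
    by (rule dependent_nat_choice) (use UN step in auto)
  then obtain E where E: "\<And>n::nat. bad (E n)" "\<And>n. E (Suc n) \<subseteq> E n" "\<And>n. norm (\<nu> (E n - E (Suc n))) \<ge> 1"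
    by auto
  have dec: "E n \<subseteq> E k" if "k \<le> n" for k n
    using lift_Suc_antimono_le[of E, OF E(2) that] .
  \<comment> \<open>The discarded pieces are disjoint and their measures have norm at least one,
    which contradicts the convergence of the series of these measures.\<close>
  define D where "D n = E n - E (Suc n)" for n
  have "disjoint_family D"
    unfolding disjoint_family_on_def
  proof (intro ballI impI)
    fix i j :: nat assume "i \<noteq> j"
    then consider "Suc i \<le> j" | "Suc j \<le> i" by linarith
    then show "D i \<inter> D j = {}" by cases (use dec in \<open>auto simp: D_def\<close>)
  qed
  moreover have "D i \<in> sets borel" for i using E(1) by (auto simp: D_def bad_def)
  ultimately have "(\<lambda>i. \<nu> (D i)) sums \<nu> (\<Union>i. D i)"
    by (intro vector_measure_sums) auto
  then have "(\<lambda>i. \<nu> (D i)) \<longlonglongrightarrow> 0" by (intro summable_LIMSEQ_zero sums_summable)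
  from tendstoD[OF this, of 1] obtain i where "norm (\<nu> (D i)) < 1"
    by (auto simp: eventually_sequentially)
  then show False using E(3)[of i] by (simp add: D_def)
qed

lemma vector_measure_bounded_linear_image:
  "bounded_linear T \<Longrightarrow> vector_measure (\<lambda>A. T (\<nu> A))"
  using vector_measure_sums bounded_linear.sums[of T] unfolding vector_measure_def by blast

end

text \<open>Positive part and total variation are suprema over pieces of a set. For such set
  functions, superadditivity on two disjoint sets and countable subadditivity are the two accessible
  halves of countable additivity.\<close>

lemma emeasure_measure_of_superadditive:
  fixes P :: "'g::topological_space set \<Rightarrow> ennreal"
  assumes empty: "P {} = 0"
    and super: "\<And>A B. A \<in> sets borel \<Longrightarrow> B \<in> sets borel \<Longrightarrow> A \<inter> B = {} \<Longrightarrow> P A + P B \<le> P (A \<union> B)"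
    and sub: "\<And>A :: nat \<Rightarrow> _. range A \<subseteq> sets borel \<Longrightarrow> disjoint_family A \<Longrightarrow> P (\<Union>i. A i) \<le> (\<Sum>i. P (A i))"
    and X: "X \<in> sets borel"
  shows "emeasure (measure_of UNIV (sets borel) P) X = P X"
proof (rule emeasure_measure_of_sigma)
  show "sigma_algebra UNIV (sets borel)" using sets.sigma_algebra_axioms[of borel] by simp
  show "positive (sets borel) P" by (simp add: positive_def empty)
  show "countably_additive (sets borel) P"
    unfolding countably_additive_def
  proof (intro allI impI antisym)
    fix A :: "nat \<Rightarrow> 'g set" assume A: "range A \<subseteq> sets borel" "disjoint_family A"
    then show "P (\<Union>i. A i) \<le> (\<Sum>i. P (A i))" by (rule sub)
    have mono: "P B \<le> P C" if "B \<subseteq> C" "B \<in> sets borel" "C \<in> sets borel" for B C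
      using super[of B "C - B"] that by (auto simp: Un_absorb1 intro: order_trans[of _ "P B + P (C - B)"])
    have "(\<Sum>i<n. P (A i)) \<le> P (\<Union>i<n. A i)" for n
    proof (induction n)
      case (Suc n)
      have "(\<Sum>i<Suc n. P (A i)) \<le> P (\<Union>i<n. A i) + P (A n)" using Suc by (simp add: add_right_mono)
      also have "\<dots> \<le> P ((\<Union>i<n. A i) \<union> A n)"
      proof (rule super)
        show "(\<Union>i<n. A i) \<inter> A n = {}"
          using A(2) by (auto simp: disjoint_family_on_def) (metis IntI emptyE less_irrefl)
      qed (use A in auto)
      also have "(\<Union>i<n. A i) \<union> A n = (\<Union>i<Suc n. A i)" by (auto simp: lessThan_Suc)
      finally show ?case .
    qed (simp add: empty)
    also have "P (\<Union>i<n. A i) \<le> P (\<Union>i. A i)" for n using A by (intro mono) auto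
    finally show "(\<Sum>i. P (A i)) \<le> P (\<Union>i. A i)" by (intro suminf_le_const) auto
  qed
qed (rule X)

lemma sigma_sets_borel: "sigma_sets UNIV (sets borel) = sets borel"
  using sets.sigma_sets_eq[of borel] by (simp only: space_borel)

lemma sets_total_variation [simp, measurable_cong]: "sets (total_variation \<kappa>) = sets borel"
  unfolding total_variation_def by (subst sets_measure_of) (auto simp only: sigma_sets_borel subset_Pow_Union Pow_UNIV subset_UNIV)

lemma space_total_variation [simp]: "space (total_variation \<kappa>) = UNIV"
  unfolding total_variation_def by (rule space_measure_of) simp

lemma sets_positive_part [simp, measurable_cong]: "sets (positive_part \<kappa>) = sets borel"
  unfolding positive_part_def by (subst sets_measure_of) (auto simp only: sigma_sets_borel subset_Pow_Union Pow_UNIV subset_UNIV)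

lemma space_positive_part [simp]: "space (positive_part \<kappa>) = UNIV"
  unfolding positive_part_def by (rule space_measure_of) simp

lemma emeasure_positive_part:
  fixes \<sigma> :: "'g::topological_space set \<Rightarrow> real"
  assumes vm: "vector_measure \<sigma>" and X: "X \<in> sets borel"
  shows "emeasure (positive_part \<sigma>) X = (SUP B\<in>{B \<in> sets borel. B \<subseteq> X}. ennreal (\<sigma> B))"
  unfolding positive_part_def
proof (rule emeasure_measure_of_superadditive[OF _ _ _ X])
  let ?P = "\<lambda>A. SUP B\<in>{B \<in> sets borel. B \<subseteq> A}. ennreal (\<sigma> B)"
  have "{B \<in> sets borel. B \<subseteq> {}} = {{} :: 'g set}" by auto
  then show "?P {} = 0" by (simp add: vector_measure_empty[OF vm])
  fix A B :: "'g set" assume AB: "A \<in> sets borel" "B \<in> sets borel" "A \<inter> B = {}"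
  have ne: "{B \<in> sets borel. B \<subseteq> A} \<noteq> {}" for A :: "'g set" by auto
  have "ennreal (\<sigma> C) + ennreal (\<sigma> D) \<le> ?P (A \<union> B)"
    if "C \<in> sets borel" "C \<subseteq> A" "D \<in> sets borel" "D \<subseteq> B" for C D
  proof -
    have up: "ennreal (\<sigma> E) \<le> ?P (A \<union> B)" if "E \<in> sets borel" "E \<subseteq> A \<union> B" for E
      using that by (intro SUP_upper) auto
    have "C \<inter> D = {}" using that AB by auto
    then have CD: "\<sigma> (C \<union> D) = \<sigma> C + \<sigma> D" using that by (intro vector_measure_Un[OF vm]) auto
    have sub: "C \<union> D \<subseteq> A \<union> B" "C \<subseteq> A \<union> B" "D \<subseteq> A \<union> B" using that by auto
    \<comment> \<open>A piece of nonpositive measure counts as zero under \<open>ennreal\<close>, so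
      the other piece alone suffices.\<close>
    consider "\<sigma> C \<ge> 0" "\<sigma> D \<ge> 0" | "\<sigma> C \<le> 0" | "\<sigma> D \<le> 0" by linarith
    then show ?thesis
    proof cases
      case 1
      then show ?thesis using up[of "C \<union> D"] that sub CD by simp
    next
      case 2
      then show ?thesis using up[of D] that sub by (simp add: ennreal_neg)
    next
      case 3
      then show ?thesis using up[of C] that sub by (simp add: ennreal_neg)
    qed
  qed
  then have "ennreal (\<sigma> C) + ?P B \<le> ?P (A \<union> B)" if "C \<in> sets borel" "C \<subseteq> A" for C
    using that ne by (subst ennreal_SUP_add_right) (auto intro!: SUP_least)
  then show "?P A + ?P B \<le> ?P (A \<union> B)"
    using ne by (subst ennreal_SUP_add_left[symmetric]) (auto intro!: SUP_least)
next
  let ?P = "\<lambda>A. SUP B\<in>{B \<in> sets borel. B \<subseteq> A}. ennreal (\<sigma> B)"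
  fix A :: "nat \<Rightarrow> 'g set" assume A: "range A \<subseteq> sets borel" "disjoint_family A"
  show "?P (\<Union>i. A i) \<le> (\<Sum>i. ?P (A i))"
  proof (rule SUP_least)
    fix B assume B: "B \<in> {B \<in> sets borel. B \<subseteq> (\<Union>i. A i)}"
    then have "(\<lambda>i. \<sigma> (B \<inter> A i)) sums \<sigma> B"
      using A by (intro vector_measure_sums_Int[OF vm]) auto
    moreover have "A i \<in> sets borel" for i using A(1) by auto
    ultimately show "ennreal (\<sigma> B) \<le> (\<Sum>i. ?P (A i))"
      using B by (intro ennreal_le_suminf_of_sums[where a = "\<lambda>i. \<sigma> (B \<inter> A i)"] SUP_upper) auto
  qed
qed

text \<open>Partitions of disjoint sets are joined for superadditivity. For subadditivity, a
  partition of the union is cut by each \<open>A i\<close>, and countable additivity of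
  \<open>\<kappa>\<close> bounds the modulus on each member by the sum over its cuts.\<close>

lemma emeasure_total_variation:
  fixes \<kappa> :: "'g::topological_space set \<Rightarrow> complex"
  assumes vm: "vector_measure \<kappa>" and X: "X \<in> sets borel"
  shows "emeasure (total_variation \<kappa>) X =
    (SUP \<rho>\<in>{\<rho>. finite \<rho> \<and> \<rho> \<subseteq> sets borel \<and> partition_on X \<rho>}. \<Sum>B\<in>\<rho>. ennreal (cmod (\<kappa> B)))"
  unfolding total_variation_def
proof (rule emeasure_measure_of_superadditive[OF _ _ _ X])
  let ?S = "\<lambda>A. {\<rho>. finite \<rho> \<and> \<rho> \<subseteq> sets borel \<and> partition_on A \<rho>} :: 'g set set set"
  let ?s = "\<lambda>\<rho>. \<Sum>B\<in>\<rho>. ennreal (cmod (\<kappa> B))"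
  let ?P = "\<lambda>A. SUP \<rho>\<in>?S A. ?s \<rho>"
  have "?S {} = {{}}" by (auto simp: partition_on_def)
  then show "?P {} = 0" by simp
  fix A B :: "'g set" assume AB: "A \<in> sets borel" "B \<in> sets borel" "A \<inter> B = {}"
  have ne: "?S A \<noteq> {}" if "A \<in> sets borel" for A
  proof -
    \<comment> \<open>Members of a partition are nonempty; for empty \<open>A\<close> this
      expression is the empty partition.\<close>
    have "{A} - {{}} \<in> ?S A" using that by (auto simp: partition_on_def disjoint_def)
    then show ?thesis by blast
  qed
  have "?s \<rho> + ?s \<rho>' \<le> ?P (A \<union> B)" if \<rho>: "\<rho> \<in> ?S A" and \<rho>': "\<rho>' \<in> ?S B" for \<rho> \<rho>'
  proof -
    have disj: "\<rho> \<inter> \<rho>' = {}"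
    proof (rule ccontr)
      assume "\<rho> \<inter> \<rho>' \<noteq> {}"
      then obtain C where "C \<in> \<rho>" "C \<in> \<rho>'" by auto
      then have "C \<noteq> {}" "C \<subseteq> A" "C \<subseteq> B" using \<rho> \<rho>' by (auto simp: partition_on_def)
      then show False using AB(3) by auto
    qed
    then have "?s \<rho> + ?s \<rho>' = ?s (\<rho> \<union> \<rho>')"
      using \<rho> \<rho>' by (intro sum.union_disjoint[symmetric]) auto
    also have "\<dots> \<le> ?P (A \<union> B)"
    proof (intro SUP_upper CollectI conjI)
      have "disjnt p q" if p: "p \<in> \<rho>" and q: "q \<in> \<rho>'" for p q
      proof -
        have "p \<subseteq> A" "q \<subseteq> B" using \<rho> \<rho>' p q by (auto simp: partition_on_def)
        then show ?thesis using AB(3) by (auto simp: disjnt_def)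
      qed
      moreover have "disjnt q p" if "p \<in> \<rho>" "q \<in> \<rho>'" for p q
        using calculation[OF that] by (rule disjnt_sym)
      ultimately show "partition_on (A \<union> B) (\<rho> \<union> \<rho>')"
        using \<rho> \<rho>' by (intro partition_onI) (auto simp: partition_on_def pairwise_def)
    qed (use \<rho> \<rho>' in auto)
    finally show ?thesis .
  qed
  then have "?s \<rho> + ?P B \<le> ?P (A \<union> B)" if "\<rho> \<in> ?S A" for \<rho>
    using that ne[OF AB(2)] by (subst ennreal_SUP_add_right) (auto intro!: SUP_least)
  then show "?P A + ?P B \<le> ?P (A \<union> B)"
    using ne[OF AB(1)] by (subst ennreal_SUP_add_left[symmetric]) (auto intro!: SUP_least)
next
  let ?S = "\<lambda>A. {\<rho>. finite \<rho> \<and> \<rho> \<subseteq> sets borel \<and> partition_on A \<rho>} :: 'g set set set"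
  let ?s = "\<lambda>\<rho>. \<Sum>B\<in>\<rho>. ennreal (cmod (\<kappa> B))"
  let ?P = "\<lambda>A. SUP \<rho>\<in>?S A. ?s \<rho>"
  fix A :: "nat \<Rightarrow> 'g set" assume A: "range A \<subseteq> sets borel" "disjoint_family A"
  show "?P (\<Union>i. A i) \<le> (\<Sum>i. ?P (A i))"
  proof (rule SUP_least)
    fix \<rho> assume \<rho>: "\<rho> \<in> ?S (\<Union>i. A i)"
    have le: "ennreal (cmod (\<kappa> B)) \<le> (\<Sum>i. ennreal (cmod (\<kappa> (B \<inter> A i))))" if B: "B \<in> \<rho>" for B
    proof -
      have "B \<subseteq> (\<Union>i. A i)" using B \<rho> by (auto simp: partition_on_def)
      then have sums: "(\<lambda>i. \<kappa> (B \<inter> A i)) sums \<kappa> B"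
        using A B \<rho> by (intro vector_measure_sums_Int[OF vm]) auto
      show ?thesis
      proof (rule LIMSEQ_le_const2)
        show "(\<lambda>n. ennreal (cmod (\<Sum>i<n. \<kappa> (B \<inter> A i)))) \<longlonglongrightarrow> ennreal (cmod (\<kappa> B))"
          using sums by (intro tendsto_ennrealI tendsto_norm) (simp add: sums_def)
        have "ennreal (cmod (\<Sum>i<n. \<kappa> (B \<inter> A i))) \<le> (\<Sum>i. ennreal (cmod (\<kappa> (B \<inter> A i))))" for n
        proof -
          have "ennreal (cmod (\<Sum>i<n. \<kappa> (B \<inter> A i))) \<le> ennreal (\<Sum>i<n. cmod (\<kappa> (B \<inter> A i)))"
            by (intro ennreal_leI norm_sum)
          also have "\<dots> = (\<Sum>i<n. ennreal (cmod (\<kappa> (B \<inter> A i))))" by (rule sum_ennreal[symmetric]) auto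
          also have "\<dots> \<le> (\<Sum>i. ennreal (cmod (\<kappa> (B \<inter> A i))))" by (intro sum_le_suminf) auto
          finally show ?thesis .
        qed
        then show "\<exists>N. \<forall>n\<ge>N. ennreal (cmod (\<Sum>i<n. \<kappa> (B \<inter> A i))) \<le> (\<Sum>i. ennreal (cmod (\<kappa> (B \<inter> A i))))"
          by auto
      qed
    qed
    have "?s \<rho> \<le> (\<Sum>B\<in>\<rho>. \<Sum>i. ennreal (cmod (\<kappa> (B \<inter> A i))))" by (intro sum_mono le)
    also have "\<dots> = (\<Sum>i. \<Sum>B\<in>\<rho>. ennreal (cmod (\<kappa> (B \<inter> A i))))" by (rule suminf_sum[symmetric]) auto
    also have "\<dots> \<le> (\<Sum>i. ?P (A i))"
    proof (intro suminf_le)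
      fix i
      \<comment> \<open>Empty intersections are dropped to obtain a partition. They contribute
        nothing, and the remaining intersections come from distinct members, so the sum can be
        reindexed.\<close>
      define \<rho>' where "\<rho>' = (\<lambda>B. B \<inter> A i) ` \<rho> - {{}}"
      have inter: "B = C" if "B \<in> \<rho>" "C \<in> \<rho>" "B \<inter> C \<noteq> {}" for B C
        using \<rho> that disjointD[of \<rho> B C] by (auto dest: partition_onD2)
      have p: "partition_on (A i) \<rho>'"
      proof (rule partition_onI)
        show "\<Union>\<rho>' = A i" using \<rho> unfolding \<rho>'_def partition_on_def by blast
        show "disjnt p q" if pq: "p \<in> \<rho>'" "q \<in> \<rho>'" and ne: "p \<noteq> q" for p q
        proof -
          obtain B C where BC: "B \<in> \<rho>" "C \<in> \<rho>" "p = B \<inter> A i" "q = C \<inter> A i"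
            using pq by (auto simp: \<rho>'_def)
          then have "B \<noteq> C" using ne by auto
          then have "B \<inter> C = {}" using inter[OF BC(1,2)] by blast
          then show ?thesis using BC by (auto simp: disjnt_def)
        qed
      qed (auto simp: \<rho>'_def)
      have "(\<Sum>B\<in>\<rho>. ennreal (cmod (\<kappa> (B \<inter> A i)))) = (\<Sum>B\<in>{B\<in>\<rho>. B \<inter> A i \<noteq> {}}. ennreal (cmod (\<kappa> (B \<inter> A i))))"
        using \<rho> by (intro sum.mono_neutral_right) (auto simp: vector_measure_empty[OF vm])
      also have "\<dots> = ?s \<rho>'"
      proof (rule sum.reindex_cong[symmetric])
        show "inj_on (\<lambda>B. B \<inter> A i) {B\<in>\<rho>. B \<inter> A i \<noteq> {}}"
          by (rule inj_onI) (intro inter, auto)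
      qed (auto simp: \<rho>'_def)
      also have "\<dots> \<le> ?P (A i)"
        using p \<rho> A by (intro SUP_upper) (auto simp: \<rho>'_def)
      finally show "(\<Sum>B\<in>\<rho>. ennreal (cmod (\<kappa> (B \<inter> A i)))) \<le> ?P (A i)" .
    qed auto
    finally show "?s \<rho> \<le> (\<Sum>i. ?P (A i))" .
  qed
qed

text \<open>The members of nonnegative and of negative measure are united separately; the sum is
  then a difference of two values of \<open>\<sigma>\<close>.\<close>

lemma sum_abs_le:
  fixes \<sigma> :: "'g::topological_space set \<Rightarrow> real"
  assumes vm: "vector_measure \<sigma>" and M: "\<And>B. B \<in> sets borel \<Longrightarrow> \<bar>\<sigma> B\<bar> \<le> M"
    and \<rho>: "finite \<rho>" "\<rho> \<subseteq> sets borel" "disjoint \<rho>"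
  shows "(\<Sum>B\<in>\<rho>. \<bar>\<sigma> B\<bar>) \<le> 2 * M"
proof -
  define P N where "P = {B\<in>\<rho>. 0 \<le> \<sigma> B}" and "N = {B\<in>\<rho>. \<not> 0 \<le> \<sigma> B}"
  have sub: "P \<subseteq> \<rho>" "N \<subseteq> \<rho>" by (auto simp: P_def N_def)
  have s: "\<sigma> (\<Union>Q) = (\<Sum>B\<in>Q. \<sigma> B)" "\<Union>Q \<in> sets borel" if "Q \<subseteq> \<rho>" for Q
  proof -
    show "\<sigma> (\<Union>Q) = (\<Sum>B\<in>Q. \<sigma> B)"
      using \<rho> that by (intro vector_measure_Union[OF vm]) (auto intro: finite_subset simp: disjoint_def)
    show "\<Union>Q \<in> sets borel" using \<rho> that by (intro sets.finite_Union) (auto intro: finite_subset)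
  qed
  have "(\<Sum>B\<in>\<rho>. \<bar>\<sigma> B\<bar>) = (\<Sum>B\<in>P. \<bar>\<sigma> B\<bar>) + (\<Sum>B\<in>N. \<bar>\<sigma> B\<bar>)"
    unfolding P_def N_def by (rule sum.Int_Diff[OF \<rho>(1), of _ "{B. 0 \<le> \<sigma> B}", unfolded Int_def set_diff_eq mem_Collect_eq])
  also have "(\<Sum>B\<in>P. \<bar>\<sigma> B\<bar>) = \<sigma> (\<Union>P)" unfolding s(1)[OF sub(1)] by (intro sum.cong) (auto simp: P_def)
  also have "(\<Sum>B\<in>N. \<bar>\<sigma> B\<bar>) = - \<sigma> (\<Union>N)"
    unfolding s(1)[OF sub(2)] sum_negf[symmetric] by (intro sum.cong) (auto simp: N_def)
  finally show ?thesis using M[OF s(2)[OF sub(1)]] M[OF s(2)[OF sub(2)]] by linarith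
qed

lemma sum_indicator_disjoint:
  fixes \<alpha> :: "'a set \<Rightarrow> 'b::semiring_1"
  assumes "finite \<rho>" "disjoint \<rho>" "B \<in> \<rho>" "x \<in> B"
  shows "(\<Sum>A\<in>\<rho>. \<alpha> A * indicator A x) = \<alpha> B"
proof -
  have "x \<notin> A" if "A \<in> \<rho>" "A \<noteq> B" for A
    using disjointD[OF assms(2) that(1) assms(3) that(2)] assms(4) by auto
  then have "(\<Sum>A\<in>\<rho>. \<alpha> A * indicator A x) = (\<Sum>A\<in>{B}. \<alpha> A * indicator A x)"
    using assms by (intro sum.mono_neutral_right) (auto simp: indicator_def)
  then show ?thesis using assms(4) by simp
qed

lemma indicator_Union_disjoint:
  assumes "finite \<rho>" "disjoint \<rho>"
  shows "(\<Sum>A\<in>\<rho>. indicator A x) = (indicator (\<Union>\<rho>) x :: 'b::semiring_1)"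
proof (cases "x \<in> \<Union>\<rho>")
  case True
  then obtain B where B: "B \<in> \<rho>" "x \<in> B" by auto
  then show ?thesis using sum_indicator_disjoint[OF assms B, of "\<lambda>_. 1 :: 'b"] True by simp
next
  case False
  then show ?thesis by (auto intro!: sum.neutral simp: indicator_def)
qed

lemma cmod_indicator: "cmod (indicator A x) = indicator A x"
  by (simp add: indicator_def)

text \<open>The test set is the set where \<open>f\<close> is positive.\<close>

lemma AE_nonpos_if_integrals_nonpos:
  fixes f :: "'a \<Rightarrow> real"
  assumes f: "integrable M f" and le: "\<And>A. A \<in> sets M \<Longrightarrow> (LINT x|M. indicator A x * f x) \<le> 0"
  shows "AE x in M. f x \<le> 0"
proof -
  define A where "A = {x \<in> space M. 0 < f x}"
  have A: "A \<in> sets M" using f unfolding A_def by measurable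
  have i: "integrable M (\<lambda>x. indicator A x * f x)"
    using integrable_mult_indicator[OF A f] by simp
  have nn: "0 \<le> indicator A x * f x" for x by (auto simp: A_def indicator_def)
  have "(LINT x|M. indicator A x * f x) = 0"
    using le[OF A] by (intro antisym Bochner_Integration.integral_nonneg nn)
  then have "AE x in M. indicator A x * f x = 0"
    using integral_nonneg_eq_0_iff_AE[OF i] nn by auto
  then show ?thesis using AE_space by eventually_elim (auto simp: A_def indicator_def split: if_splits)
qed

context
  fixes \<kappa> :: "'g::topological_space set \<Rightarrow> complex"
  assumes vm: "vector_measure \<kappa>"
begin

lemma cmod_le_total_variation:
  assumes A: "A \<in> sets borel"
  shows "ennreal (cmod (\<kappa> A)) \<le> emeasure (total_variation \<kappa>) A"
proof (cases "A = {}")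
  case True
  then show ?thesis by (simp add: vector_measure_empty[OF vm])
next
  case False
  have "(\<Sum>B\<in>{A}. ennreal (cmod (\<kappa> B))) \<le> emeasure (total_variation \<kappa>) A"
    unfolding emeasure_total_variation[OF vm A]
    by (rule SUP_upper) (use A False in \<open>auto simp: partition_on_def\<close>)
  then show ?thesis by simp
qed

lemma vector_measure_Re: "vector_measure (\<lambda>A. Re (\<kappa> A))"
  and vector_measure_Im: "vector_measure (\<lambda>A. Im (\<kappa> A))"
  by (intro vector_measure_bounded_linear_image[OF vm] bounded_linear_Re bounded_linear_Im)+

lemma finite_measure_total_variation: "finite_measure (total_variation \<kappa>)"
proof
  obtain M where M: "M \<ge> 0" "\<And>B. B \<in> sets borel \<Longrightarrow> cmod (\<kappa> B) \<le> M"
    by (rule vector_measure_bounded[OF vm]) (rule that)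
  have U: "UNIV \<in> sets (borel :: 'g measure)" by simp
  \<comment> \<open>The real and the imaginary part contribute \<open>2 * M\<close> each.\<close>
  have "emeasure (total_variation \<kappa>) UNIV \<le> ennreal (4 * M)"
    unfolding emeasure_total_variation[OF vm U]
  proof (rule SUP_least)
    fix \<rho> :: "'g set set" assume "\<rho> \<in> {\<rho>. finite \<rho> \<and> \<rho> \<subseteq> sets borel \<and> partition_on UNIV \<rho>}"
    then have \<rho>: "finite \<rho>" "\<rho> \<subseteq> sets borel" "disjoint \<rho>" by (auto dest: partition_onD2)
    have "(\<Sum>B\<in>\<rho>. cmod (\<kappa> B)) \<le> (\<Sum>B\<in>\<rho>. \<bar>Re (\<kappa> B)\<bar> + \<bar>Im (\<kappa> B)\<bar>)"
      by (intro sum_mono cmod_le)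
    also have "\<dots> \<le> 2 * M + 2 * M"
      unfolding sum.distrib
    proof (intro add_mono sum_abs_le vector_measure_Re vector_measure_Im \<rho>)
      show "\<bar>Re (\<kappa> B)\<bar> \<le> M" "\<bar>Im (\<kappa> B)\<bar> \<le> M" if "B \<in> sets borel" for B
        using abs_Re_le_cmod[of "\<kappa> B"] abs_Im_le_cmod[of "\<kappa> B"] M(2)[OF that] by linarith+
    qed
    finally show "(\<Sum>B\<in>\<rho>. ennreal (cmod (\<kappa> B))) \<le> ennreal (4 * M)"
      by (subst sum_ennreal) (auto intro!: ennreal_leI)
  qed
  then show "emeasure (total_variation \<kappa>) (space (total_variation \<kappa>)) \<noteq> \<infinity>"
    by (auto simp: top_unique)
qed

interpretation finite_measure "total_variation \<kappa>" by (rule finite_measure_total_variation)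

lemma emeasure_positive_part_le:
  assumes \<sigma>: "vector_measure \<sigma>" "\<And>B. \<bar>\<sigma> B\<bar> \<le> cmod (\<kappa> B)" and A: "A \<in> sets borel"
  shows "emeasure (positive_part \<sigma>) A \<le> emeasure (total_variation \<kappa>) A"
  unfolding emeasure_positive_part[OF \<sigma>(1) A]
proof (rule SUP_least)
  fix B assume B: "B \<in> {B \<in> sets borel. B \<subseteq> A}"
  have "ennreal (\<sigma> B) \<le> ennreal (cmod (\<kappa> B))" using \<sigma>(2)[of B] by (intro ennreal_leI) auto
  also have "\<dots> \<le> emeasure (total_variation \<kappa>) B" using B by (intro cmod_le_total_variation) auto
  also have "\<dots> \<le> emeasure (total_variation \<kappa>) A" using B A by (intro emeasure_mono) auto
  finally show "ennreal (\<sigma> B) \<le> emeasure (total_variation \<kappa>) A" .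
qed

text \<open>The positive part is dominated by the total variation, so its Radon-Nikodym derivative
  is at most one almost everywhere; cutting it at one makes the bound hold everywhere.\<close>

lemma positive_part_density:
  assumes \<sigma>: "vector_measure \<sigma>" "\<And>B. \<bar>\<sigma> B\<bar> \<le> cmod (\<kappa> B)"
  obtains r :: "'g \<Rightarrow> real" where "r \<in> borel_measurable borel" "\<And>x. 0 \<le> r x" "\<And>x. r x \<le> 1"
    "positive_part \<sigma> = density (total_variation \<kappa>) (\<lambda>x. ennreal (r x))"
proof -
  have fin: "finite_measure (positive_part \<sigma>)"
    using emeasure_positive_part_le[OF \<sigma>, of UNIV] emeasure_finite[of UNIV]
    by (intro finite_measureI) (auto simp: top_unique)
  have "absolutely_continuous (total_variation \<kappa>) (positive_part \<sigma>)"
    unfolding absolutely_continuous_def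
    using emeasure_positive_part_le[OF \<sigma>] by (auto simp: null_sets_def) (metis le_zero_eq)
  from Radon_Nikodym_finite_measure[OF fin _ this]
  obtain f where f: "f \<in> borel_measurable (total_variation \<kappa>)" "density (total_variation \<kappa>) f = positive_part \<sigma>"
    by auto
  have fb [measurable]: "f \<in> borel_measurable borel" using f(1) by (simp cong: measurable_cong_sets)
  have "AE x in total_variation \<kappa>. f x \<le> 1"
  proof (rule AE_I')
    show "{x. 1 < f x} \<in> null_sets (total_variation \<kappa>)"
    proof (rule ccontr)
      let ?A = "{x. 1 < f x}"
      have A: "?A \<in> sets borel" by measurable
      assume "?A \<notin> null_sets (total_variation \<kappa>)"
      then have pos: "emeasure (total_variation \<kappa>) ?A \<noteq> 0" using A by (auto simp: null_sets_def)
      have "emeasure (total_variation \<kappa>) ?A = (\<integral>\<^sup>+x. indicator ?A x \<partial>total_variation \<kappa>)" using A by simp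
      also have "\<dots> < (\<integral>\<^sup>+x. f x * indicator ?A x \<partial>total_variation \<kappa>)"
      proof (rule nn_integral_less)
        show "(\<integral>\<^sup>+x. indicator ?A x \<partial>total_variation \<kappa>) \<noteq> \<infinity>"
          using A emeasure_finite[of ?A] by simp
        show "\<not> (AE x in total_variation \<kappa>. f x * indicator ?A x \<le> indicator ?A x)"
        proof
          assume "AE x in total_variation \<kappa>. f x * indicator ?A x \<le> indicator ?A x"
          then have "AE x in total_variation \<kappa>. x \<notin> ?A"
            by eventually_elim (auto simp: indicator_def split: if_splits)
          then have "?A \<in> null_sets (total_variation \<kappa>)" using A by (subst AE_iff_null_sets) auto
          then show False using pos by (auto simp: null_sets_def)
        qed
      qed (use A f in \<open>auto simp: indicator_def split: if_splits\<close>)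
      also have "\<dots> = emeasure (positive_part \<sigma>) ?A"
        unfolding f(2)[symmetric] using A f(1) by (subst emeasure_density) auto
      finally show False using emeasure_positive_part_le[OF \<sigma> A] by simp
    qed
  qed auto
  then have ae: "AE x in total_variation \<kappa>. f x = ennreal (min 1 (enn2real (f x)))"
  proof eventually_elim
    case (elim x)
    then have "f x < \<infinity>" by (rule le_less_trans) simp
    then show ?case using elim by (cases "f x") (auto simp: min_def)
  qed
  show ?thesis
  proof (rule that[of "\<lambda>x. min 1 (enn2real (f x))"])
    show "positive_part \<sigma> = density (total_variation \<kappa>) (\<lambda>x. ennreal (min 1 (enn2real (f x))))"
      unfolding f(2)[symmetric] using ae f(1) by (intro density_cong) auto
  qed auto
qed

text \<open>The supremum of \<open>\<sigma> B\<close> over subsets \<open>B\<close> of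
  \<open>A\<close> is compared with that of the negative through complements,
  \<open>\<sigma> B = \<sigma> A - \<sigma> (A - B)\<close>. No Hahn decomposition is
  involved.\<close>

lemma jordan_decomposition:
  assumes \<sigma>: "vector_measure \<sigma>" "\<And>B. \<bar>\<sigma> B\<bar> \<le> cmod (\<kappa> B)" and A: "A \<in> sets borel"
  shows "\<sigma> A = measure (positive_part \<sigma>) A - measure (positive_part (\<lambda>A. - \<sigma> A)) A"
proof -
  have neg: "vector_measure (\<lambda>A. - \<sigma> A)"
    by (rule vector_measure_bounded_linear_image[OF \<sigma>(1)]) (intro bounded_linear_minus bounded_linear_ident)
  have upper: "s B \<le> measure (positive_part s) A" and least: "\<And>c. 0 \<le> c \<Longrightarrow>
      (\<And>B. B \<in> sets borel \<Longrightarrow> B \<subseteq> A \<Longrightarrow> s B \<le> c) \<Longrightarrow> measure (positive_part s) A \<le> c"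
    if s: "vector_measure s" "\<And>B. \<bar>s B\<bar> \<le> cmod (\<kappa> B)" and B: "B \<in> sets borel" "B \<subseteq> A" for s B
  proof -
    have fin: "emeasure (positive_part s) A < \<infinity>"
      using emeasure_positive_part_le[OF s A] emeasure_finite[of A] by (auto simp: less_top[symmetric] top_unique)
    then have eq: "emeasure (positive_part s) A = ennreal (measure (positive_part s) A)"
      by (intro emeasure_eq_ennreal_measure) auto
    have "ennreal (s B) \<le> emeasure (positive_part s) A"
      unfolding emeasure_positive_part[OF s(1) A] using B by (intro SUP_upper) auto
    then show "s B \<le> measure (positive_part s) A"
      by (simp only: eq ennreal_le_iff[OF measure_nonneg])
    fix c :: real assume c: "0 \<le> c" "\<And>B. B \<in> sets borel \<Longrightarrow> B \<subseteq> A \<Longrightarrow> s B \<le> c"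
    have "emeasure (positive_part s) A \<le> ennreal c"
      unfolding emeasure_positive_part[OF s(1) A] by (rule SUP_least) (auto intro!: ennreal_leI c)
    then show "measure (positive_part s) A \<le> c"
      by (simp only: eq ennreal_le_iff[OF c(1)])
  qed
  have \<sigma>': "\<And>B. \<bar>- \<sigma> B\<bar> \<le> cmod (\<kappa> B)" using \<sigma>(2) by simp
  have diff: "\<sigma> B = \<sigma> A - \<sigma> (A - B)" if "B \<in> sets borel" "B \<subseteq> A" for B
    using vector_measure_Diff[OF \<sigma>(1) A that] by simp
  have e: "{} \<in> sets (borel :: 'g measure)" "{} \<subseteq> A" by auto
  let ?p = "measure (positive_part \<sigma>) A" and ?n = "measure (positive_part (\<lambda>A. - \<sigma> A)) A"
  have "?p \<le> \<sigma> A + ?n"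
  proof (rule least[OF \<sigma> e])
    have *: "\<sigma> B \<le> \<sigma> A + ?n" if "B \<in> sets borel" "B \<subseteq> A" for B
      using diff[OF that] upper[OF neg \<sigma>', of "A - B"] A that by auto
    then show "\<sigma> B \<le> \<sigma> A + ?n" if "B \<in> sets borel" "B \<subseteq> A" for B using that .
    show "0 \<le> \<sigma> A + ?n" using *[OF e] by (simp add: vector_measure_empty[OF \<sigma>(1)])
  qed
  moreover have "?n \<le> - \<sigma> A + ?p"
  proof (rule least[OF neg \<sigma>' e])
    have *: "- \<sigma> B \<le> - \<sigma> A + ?p" if "B \<in> sets borel" "B \<subseteq> A" for B
      using diff[OF that] upper[OF \<sigma>, of "A - B"] A that by auto
    then show "- \<sigma> B \<le> - \<sigma> A + ?p" if "B \<in> sets borel" "B \<subseteq> A" for B using that .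
    show "0 \<le> - \<sigma> A + ?p" using *[OF e] by (simp add: vector_measure_empty[OF \<sigma>(1)])
  qed
  ultimately show ?thesis by simp
qed

text \<open>The density has modulus at most one because its averages do, and at least one because the
  total variation is dominated by the integral of the modulus.\<close>

lemma polar_decomposition:
  obtains u where "u \<in> borel_measurable borel" "\<And>x. cmod (u x) = 1"
    "\<And>h. integrable (total_variation \<kappa>) h \<Longrightarrow> complex_integral \<kappa> h = (LINT s|total_variation \<kappa>. u s * h s)"
    "\<And>A. A \<in> sets borel \<Longrightarrow> \<kappa> A = (LINT s|total_variation \<kappa>. indicator A s * u s)"
proof -
  let ?\<tau> = "total_variation \<kappa>"
  have neg: "vector_measure (\<lambda>A. - s A)" if "vector_measure (s :: 'g set \<Rightarrow> real)" for s
    by (rule vector_measure_bounded_linear_image[OF that]) (intro bounded_linear_minus bounded_linear_ident)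
  have le: "\<bar>Re (\<kappa> B)\<bar> \<le> cmod (\<kappa> B)" "\<bar>- Re (\<kappa> B)\<bar> \<le> cmod (\<kappa> B)"
    "\<bar>Im (\<kappa> B)\<bar> \<le> cmod (\<kappa> B)" "\<bar>- Im (\<kappa> B)\<bar> \<le> cmod (\<kappa> B)" for B
    using abs_Re_le_cmod[of "\<kappa> B"] abs_Im_le_cmod[of "\<kappa> B"] by auto
  obtain r1 where r1 [measurable]: "r1 \<in> borel_measurable borel" and r1': "\<And>x. 0 \<le> r1 x" "\<And>x. r1 x \<le> 1"
    and d1: "positive_part (\<lambda>A. Re (\<kappa> A)) = density ?\<tau> (\<lambda>x. ennreal (r1 x))"
    by (rule positive_part_density[OF vector_measure_Re le(1)]) (rule that)
  obtain r2 where r2 [measurable]: "r2 \<in> borel_measurable borel" and r2': "\<And>x. 0 \<le> r2 x" "\<And>x. r2 x \<le> 1"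
    and d2: "positive_part (\<lambda>A. - Re (\<kappa> A)) = density ?\<tau> (\<lambda>x. ennreal (r2 x))"
    by (rule positive_part_density[OF neg[OF vector_measure_Re] le(2)]) (rule that)
  obtain r3 where r3 [measurable]: "r3 \<in> borel_measurable borel" and r3': "\<And>x. 0 \<le> r3 x" "\<And>x. r3 x \<le> 1"
    and d3: "positive_part (\<lambda>A. Im (\<kappa> A)) = density ?\<tau> (\<lambda>x. ennreal (r3 x))"
    by (rule positive_part_density[OF vector_measure_Im le(3)]) (rule that)
  obtain r4 where r4 [measurable]: "r4 \<in> borel_measurable borel" and r4': "\<And>x. 0 \<le> r4 x" "\<And>x. r4 x \<le> 1"
    and d4: "positive_part (\<lambda>A. - Im (\<kappa> A)) = density ?\<tau> (\<lambda>x. ennreal (r4 x))"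
    by (rule positive_part_density[OF neg[OF vector_measure_Im] le(4)]) (rule that)
  define k where "k x = Complex (r1 x - r2 x) (r3 x - r4 x)" for x
  have k [measurable]: "k \<in> borel_measurable borel"
    unfolding k_def by (simp add: borel_measurable_complex_iff)
  have rint: "integrable ?\<tau> (\<lambda>x. r x *\<^sub>R h x)"
    if "r \<in> borel_measurable borel" "\<And>x. 0 \<le> r x" "\<And>x. r x \<le> (1::real)" "integrable ?\<tau> h"
    for r and h :: "'g \<Rightarrow> 'b::{banach, second_countable_topology}"
    using that
    by (intro Bochner_Integration.integrable_bound[OF that(4)]) (auto intro!: AE_I2 mult_left_le_one_le)
  have int: "complex_integral \<kappa> h = (LINT s|?\<tau>. k s * h s)" if h: "integrable ?\<tau> h" for h
  proof -
    have hm: "h \<in> borel_measurable ?\<tau>" using h by simp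
    have kh: "k s * h s = (r1 s *\<^sub>R h s - r2 s *\<^sub>R h s) + \<i> * (r3 s *\<^sub>R h s - r4 s *\<^sub>R h s)" for s
      by (simp add: k_def complex_eq_iff algebra_simps)
    note ri = rint[OF r1 r1' h] rint[OF r2 r2' h] rint[OF r3 r3' h] rint[OF r4 r4' h]
    have "complex_integral \<kappa> h = ((LINT s|?\<tau>. r1 s *\<^sub>R h s) - (LINT s|?\<tau>. r2 s *\<^sub>R h s))
        + \<i> * ((LINT s|?\<tau>. r3 s *\<^sub>R h s) - (LINT s|?\<tau>. r4 s *\<^sub>R h s))"
      unfolding complex_integral_def signed_integral_def d1 d2 d3 d4
      using hm r1' r2' r3' r4' by (subst (1 2 3 4) integral_density) auto
    also have "\<dots> = (LINT s|?\<tau>. k s * h s)"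
      unfolding kh using ri by simp
    finally show ?thesis .
  qed
  have ind: "integrable ?\<tau> (\<lambda>s. indicator A s :: real)" if "A \<in> sets borel" for A :: "'g set"
    using that emeasure_finite[of A] by (intro integrable_real_indicator) (auto simp: less_top[symmetric])
  have meas: "measure (density ?\<tau> (\<lambda>x. ennreal (r x))) A = (LINT s|?\<tau>. indicator A s * r s)"
    if "A \<in> sets borel" "r \<in> borel_measurable borel" "\<And>x. 0 \<le> r x" "\<And>x. r x \<le> 1" for A r
  proof -
    have "measure (density ?\<tau> (\<lambda>x. ennreal (r x))) A = (LINT s|density ?\<tau> (\<lambda>x. ennreal (r x)). indicator A s)"
      using that(1) by simp
    also have "\<dots> = (LINT s|?\<tau>. r s *\<^sub>R indicator A s)"
      using that by (intro integral_density) auto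
    finally show ?thesis by (simp add: mult.commute)
  qed
  have \<kappa>k: "\<kappa> A = (LINT s|?\<tau>. indicator A s * k s)" and ik: "integrable ?\<tau> (\<lambda>s. indicator A s * k s)"
    if A: "A \<in> sets borel" for A
  proof -
    have iA: "integrable ?\<tau> (\<lambda>s. indicator A s :: real)" by (rule ind[OF A])
    have ri: "integrable ?\<tau> (\<lambda>s. indicator A s * r s)"
      if "r \<in> borel_measurable borel" "\<And>x. 0 \<le> r x" "\<And>x. r x \<le> (1::real)" for r
      using rint[OF that iA] by (simp add: mult.commute)
    note R = ri[OF r1 r1'] ri[OF r2 r2'] ri[OF r3 r3'] ri[OF r4 r4']
    have re: "Re (\<kappa> A) = (LINT s|?\<tau>. indicator A s * r1 s) - (LINT s|?\<tau>. indicator A s * r2 s)"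
      unfolding jordan_decomposition[OF vector_measure_Re le(1) A] d1 d2
      using A r1' r2' by (simp add: meas)
    have im: "Im (\<kappa> A) = (LINT s|?\<tau>. indicator A s * r3 s) - (LINT s|?\<tau>. indicator A s * r4 s)"
      unfolding jordan_decomposition[OF vector_measure_Im le(3) A] d3 d4
      using A r3' r4' by (simp add: meas)
    have eq: "indicator A s * k s = of_real (indicator A s * r1 s - indicator A s * r2 s)
        + \<i> * of_real (indicator A s * r3 s - indicator A s * r4 s)" for s
      by (simp add: k_def complex_eq_iff indicator_def)
    show "integrable ?\<tau> (\<lambda>s. indicator A s * k s)"
      unfolding eq using R by (intro Bochner_Integration.integrable_add integrable_mult_right integrable_of_real
        Bochner_Integration.integrable_diff)
    have "(LINT s|?\<tau>. indicator A s * k s) = of_real (LINT s|?\<tau>. indicator A s * r1 s - indicator A s * r2 s)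
        + \<i> * of_real (LINT s|?\<tau>. indicator A s * r3 s - indicator A s * r4 s)"
      unfolding eq using R
      by (subst Bochner_Integration.integral_add)
        (auto intro!: integrable_mult_right Bochner_Integration.integrable_diff simp del: of_real_diff)
    then show "\<kappa> A = (LINT s|?\<tau>. indicator A s * k s)"
      using R re im by (simp add: complex_eq_iff)
  qed
  have ik1: "integrable ?\<tau> k" using ik[of UNIV] by simp
  \<comment> \<open>The modulus bound is tested one direction at a time: the average of the
    component of \<open>k\<close> in the direction \<open>cis q\<close> over \<open>A\<close> is at
    most that of 1, since \<open>cmod (\<kappa> A)\<close> is at most the total variation of
    \<open>A\<close>.\<close>
  have le1: "AE x in ?\<tau>. Re (cnj (cis q) * k x) \<le> 1" for q
  proof -
    have "AE x in ?\<tau>. Re (cnj (cis q) * k x) - 1 \<le> 0"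
    proof (rule AE_nonpos_if_integrals_nonpos)
      show "integrable ?\<tau> (\<lambda>x. Re (cnj (cis q) * k x) - 1)"
        using ik1 by (intro Bochner_Integration.integrable_diff integrable_Re integrable_mult_right) auto
      fix A assume "A \<in> sets ?\<tau>"
      then have A: "A \<in> sets borel" by simp
      have "(LINT x|?\<tau>. indicator A x * (Re (cnj (cis q) * k x) - 1)) =
          (LINT x|?\<tau>. Re (cnj (cis q) * (indicator A x * k x)) - indicator A x)"
        by (intro Bochner_Integration.integral_cong) (auto simp: indicator_def)
      also have "\<dots> = Re (cnj (cis q) * \<kappa> A) - measure ?\<tau> A"
      proof -
        have iz: "integrable ?\<tau> (\<lambda>x. cnj (cis q) * (indicator A x * k x))"
          by (intro integrable_mult_right ik A)
        have "(LINT x|?\<tau>. Re (cnj (cis q) * (indicator A x * k x))) = Re (cnj (cis q) * \<kappa> A)"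
          unfolding integral_Re[OF iz] integral_mult_right_zero \<kappa>k[OF A] ..
        then show ?thesis
          unfolding Bochner_Integration.integral_diff[OF integrable_Re[OF iz] ind[OF A]] using A by simp
      qed
      also have "\<dots> \<le> 0"
      proof -
        have "Re (cnj (cis q) * \<kappa> A) \<le> cmod (\<kappa> A)"
          using complex_Re_le_cmod[of "cnj (cis q) * \<kappa> A"] by (simp only: norm_mult complex_mod_cnj norm_cis mult_1)
        also have "\<dots> \<le> measure ?\<tau> A"
          using cmod_le_total_variation[OF A] by (simp add: emeasure_eq_measure)
        finally show ?thesis by simp
      qed
      finally show "(LINT x|?\<tau>. indicator A x * (Re (cnj (cis q) * k x) - 1)) \<le> 0" .
    qed
    then show ?thesis by simp
  qed
  \<comment> \<open>Rational angles share one null set. Continuity in the angle then reaches the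
    argument of \<open>k x\<close>, where the component is the full modulus.\<close>
  have "AE x in ?\<tau>. \<forall>q\<in>\<rat>. Re (cnj (cis q) * k x) \<le> 1"
    using le1 by (subst AE_ball_countable) (auto intro: countable_rat)
  then have k_le: "AE x in ?\<tau>. cmod (k x) \<le> 1"
  proof eventually_elim
    case (elim x)
    have "closed {q. Re (cnj (cis q) * k x) \<le> 1}"
      by (intro closed_Collect_le continuous_intros)
    then have "closure \<rat> \<subseteq> {q. Re (cnj (cis q) * k x) \<le> 1}"
      using elim by (intro closure_minimal) auto
    then have "Re (cnj (cis (Arg (k x))) * k x) \<le> 1" by (auto simp: Rats_closure_real)
    moreover have "cnj (cis (Arg (k x))) * k x = of_real (cmod (k x))"
    proof -
      have "k x = rcis (cmod (k x)) (Arg (k x))" by (simp add: rcis_cmod_Arg)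
      then have "cnj (cis (Arg (k x))) * k x = cnj (cis (Arg (k x))) * cis (Arg (k x)) * of_real (cmod (k x))"
        by (simp add: rcis_def mult_ac)
      then show ?thesis by (simp add: cis_cnj cis_mult)
    qed
    ultimately show ?case by simp
  qed
  have k_ge: "AE x in ?\<tau>. 1 - cmod (k x) \<le> 0"
  proof (rule AE_nonpos_if_integrals_nonpos)
    show "integrable ?\<tau> (\<lambda>x. 1 - cmod (k x))" using ik1 by auto
    fix A assume "A \<in> sets ?\<tau>"
    then have A: "A \<in> sets borel" by simp
    have iak: "integrable ?\<tau> (\<lambda>x. indicator B x * cmod (k x))" if "B \<in> sets borel" for B
      using integrable_norm[OF ik[OF that]] by (simp add: norm_mult cmod_indicator)
    have "emeasure ?\<tau> A \<le> ennreal (LINT x|?\<tau>. indicator A x * cmod (k x))"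
      unfolding emeasure_total_variation[OF vm A]
    proof (rule SUP_least)
      fix \<rho> assume "\<rho> \<in> {\<rho>. finite \<rho> \<and> \<rho> \<subseteq> sets borel \<and> partition_on A \<rho>}"
      then have \<rho>: "finite \<rho>" "\<rho> \<subseteq> sets borel" "disjoint \<rho>" "\<Union>\<rho> = A" by (auto simp: partition_on_def)
      have "(\<Sum>B\<in>\<rho>. cmod (\<kappa> B)) \<le> (\<Sum>B\<in>\<rho>. LINT x|?\<tau>. indicator B x * cmod (k x))"
      proof (rule sum_mono)
        fix B assume "B \<in> \<rho>"
        then have B: "B \<in> sets borel" using \<rho> by auto
        have "cmod (\<kappa> B) \<le> (LINT x|?\<tau>. cmod (indicator B x * k x))"
          unfolding \<kappa>k[OF B] by (rule integral_norm_bound)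
        then show "cmod (\<kappa> B) \<le> (LINT x|?\<tau>. indicator B x * cmod (k x))"
          by (simp add: norm_mult cmod_indicator)
      qed
      also have "\<dots> = (LINT x|?\<tau>. (\<Sum>B\<in>\<rho>. indicator B x * cmod (k x)))"
        using \<rho>(2) iak by (intro Bochner_Integration.integral_sum[symmetric]) auto
      also have "\<dots> = (LINT x|?\<tau>. indicator A x * cmod (k x))"
        unfolding sum_distrib_right[symmetric] indicator_Union_disjoint[OF \<rho>(1,3)] \<rho>(4) ..
      finally show "(\<Sum>B\<in>\<rho>. ennreal (cmod (\<kappa> B))) \<le> ennreal (LINT x|?\<tau>. indicator A x * cmod (k x))"
        by (subst sum_ennreal) (auto intro!: ennreal_leI)
    qed
    then have "measure ?\<tau> A \<le> (LINT x|?\<tau>. indicator A x * cmod (k x))"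
      by (subst (asm) emeasure_eq_measure) (simp add: Bochner_Integration.integral_nonneg)
    moreover have "(LINT x|?\<tau>. indicator A x * (1 - cmod (k x))) = measure ?\<tau> A - (LINT x|?\<tau>. indicator A x * cmod (k x))"
      using ind[OF A] iak[OF A] A by (simp add: right_diff_distrib)
    ultimately show "(LINT x|?\<tau>. indicator A x * (1 - cmod (k x))) \<le> 0" by simp
  qed
  \<comment> \<open>A change on a null set makes the modulus equal to one everywhere.\<close>
  define u where "u x = (if cmod (k x) = 1 then k x else 1)" for x
  have um [measurable]: "u \<in> borel_measurable borel" unfolding u_def by measurable
  have uk: "AE x in ?\<tau>. u x = k x"
    using k_le k_ge by eventually_elim (auto simp: u_def)
  show ?thesis
  proof (rule that[OF um])
    show "cmod (u x) = 1" for x by (simp add: u_def)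
    show "complex_integral \<kappa> h = (LINT s|?\<tau>. u s * h s)" if h: "integrable ?\<tau> h" for h
      unfolding int[OF h] using uk h
      by (intro integral_cong_AE) (auto elim!: eventually_mono simp: measurable_cong_sets[OF sets_total_variation refl])
    show "\<kappa> A = (LINT s|?\<tau>. indicator A s * u s)" if A: "A \<in> sets borel" for A
      unfolding \<kappa>k[OF A] using uk A
      by (intro integral_cong_AE) (auto elim!: eventually_mono simp: measurable_cong_sets[OF sets_total_variation refl])
  qed
qed

end

section \<open>Haar measure on a compact group\<close>

lemma compact_t2_Urysohn:
  fixes A B :: "'a::t2_space set"
  assumes "compact (UNIV :: 'a set)" "closed A" "closed B" "A \<inter> B = {}"
  obtains h :: "'a \<Rightarrow> real" where "continuous_on UNIV h" "\<And>x. 0 \<le> h x" "\<And>x. h x \<le> 1"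
    "\<And>x. x \<in> A \<Longrightarrow> h x = 0" "\<And>x. x \<in> B \<Longrightarrow> h x = 1"
proof -
  have "normal_space (euclidean :: 'a topology)"
  proof (intro compact_Hausdorff_or_regular_imp_normal_space disjI1)
    show "Hausdorff_space (euclidean :: 'a topology)"
      unfolding Hausdorff_space_def by (simp add: disjnt_def) (metis hausdorff)
  qed (use assms(1) in \<open>simp add: compact_space_def\<close>)
  then obtain h where h: "continuous_map euclidean (top_of_set {0..1::real}) h" "h ` A \<subseteq> {0}" "h ` B \<subseteq> {1}"
    using Urysohn_lemma[of euclidean A B 0 1] assms by (auto simp: disjnt_def)
  then have "h x \<in> {0..1}" for x by (auto simp: continuous_map_in_subtopology)
  then show ?thesis
    using that[of h] h by (auto simp: continuous_map_in_subtopology image_subset_iff)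
qed

lemma compact_t2_separate_points:
  fixes x y :: "'a::t2_space"
  assumes "compact (UNIV :: 'a set)" "x \<noteq> y"
  shows "\<exists>h :: 'a \<Rightarrow> real. continuous_on UNIV h \<and> h x = 0 \<and> h y = 1"
  by (rule compact_t2_Urysohn[OF assms(1), of "{x}" "{y}"]) (use assms(2) in auto)

text \<open>The Borel algebra of a product may exceed the product of the Borel algebras, so
  continuity alone does not suffice. The continuous functions that are measurable for the product
  algebra form a ring that separates points, since functions of one coordinate belong to it; by
  Stone-Weierstrass \<open>c\<close> is a uniform limit of such functions.\<close>

lemma continuous_on_compact_prod_borel_measurable:
  fixes c :: "'a::t2_space \<times> 'b::t2_space \<Rightarrow> real"
  assumes cA: "compact (UNIV :: 'a set)" and cB: "compact (UNIV :: 'b set)"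
    and c: "continuous_on UNIV c"
  shows "c \<in> borel_measurable (borel \<Otimes>\<^sub>M borel)"
proof -
  define R where "R = {f :: 'a \<times> 'b \<Rightarrow> real. continuous_on UNIV f \<and> f \<in> borel_measurable (borel \<Otimes>\<^sub>M borel)}"
  interpret function_ring_on R "UNIV :: ('a \<times> 'b) set"
  proof
    show "compact (UNIV :: ('a \<times> 'b) set)" using compact_Times[OF cA cB] by simp
    fix x y :: "'a \<times> 'b" assume "x \<noteq> y"
    then consider "fst x \<noteq> fst y" | "snd x \<noteq> snd y" by (auto simp: prod_eq_iff)
    then show "\<exists>f\<in>R. f x \<noteq> f y"
    proof cases
      case 1
      then obtain h :: "'a \<Rightarrow> real" where h: "continuous_on UNIV h" "h (fst x) = 0" "h (fst y) = 1"
        using compact_t2_separate_points[OF cA] by blast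
      have "(\<lambda>z. h (fst z)) \<in> R"
        using h(1) borel_measurable_continuous_onI[OF h(1)]
        by (auto simp: R_def intro!: continuous_on_compose2[OF h(1)] continuous_intros)
      then show ?thesis using h by (intro bexI[of _ "\<lambda>z. h (fst z)"]) auto
    next
      case 2
      then obtain h :: "'b \<Rightarrow> real" where h: "continuous_on UNIV h" "h (snd x) = 0" "h (snd y) = 1"
        using compact_t2_separate_points[OF cB] by blast
      have "(\<lambda>z. h (snd z)) \<in> R"
        using h(1) borel_measurable_continuous_onI[OF h(1)]
        by (auto simp: R_def intro!: continuous_on_compose2[OF h(1)] continuous_intros)
      then show ?thesis using h by (intro bexI[of _ "\<lambda>z. h (snd z)"]) auto
    qed
  qed (auto simp: R_def intro!: continuous_intros)
  obtain F where F: "\<And>n. F n \<in> R" "uniform_limit UNIV F c sequentially"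
    using Stone_Weierstrass[OF c] by auto
  show ?thesis
  proof (rule borel_measurable_LIMSEQ_real)
    show "(\<lambda>i. F i x) \<longlonglongrightarrow> c x" for x by (rule tendsto_uniform_limitI[OF F(2)]) simp
    show "F i \<in> borel_measurable (borel \<Otimes>\<^sub>M borel)" for i using F(1) by (simp add: R_def)
  qed
qed

text \<open>Cozero sets are chosen as generators so that measurability of a map into
  \<open>baire\<close> only has to be tested on its compositions with continuous real
  functions.\<close>

definition baire :: "'a::topological_space measure" where
  "baire = sigma UNIV {{x. 0 < h x} | h :: 'a \<Rightarrow> real. continuous_on UNIV h}"

lemma space_baire [simp]: "space baire = UNIV"
  by (simp add: baire_def)

lemma cozero_in_sets_baire: "continuous_on UNIV (h :: 'a::topological_space \<Rightarrow> real) \<Longrightarrow> {x. 0 < h x} \<in> sets baire"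
  by (auto simp: baire_def)

lemma sets_baire_subset_borel: "sets baire \<subseteq> sets (borel :: 'a::topological_space measure)"
proof -
  have "{x. 0 < h x} \<in> sets borel" if "continuous_on UNIV h" for h :: "'a \<Rightarrow> real"
    using that by (intro borel_open open_Collect_less continuous_intros)
  then have "{{x. 0 < h x} | h :: 'a \<Rightarrow> real. continuous_on UNIV h} \<subseteq> sets borel" by auto
  from sets.sigma_sets_subset[OF this] show ?thesis by (simp add: baire_def)
qed

lemma measurable_id_baire [measurable]: "(\<lambda>x. x) \<in> borel \<rightarrow>\<^sub>M baire"
  using sets_baire_subset_borel by (auto simp: measurable_def)

lemma borel_measurable_baire_imp_borel:
  "f \<in> baire \<rightarrow>\<^sub>M M \<Longrightarrow> f \<in> borel \<rightarrow>\<^sub>M M"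
  using measurable_compose[OF measurable_id_baire] by simp

lemma continuous_imp_baire_measurable:
  fixes h :: "'a::topological_space \<Rightarrow> real"
  assumes "continuous_on UNIV h"
  shows "h \<in> borel_measurable baire"
proof (rule borel_measurableI_greater)
  fix a
  have "{x. 0 < h x - a} \<in> sets baire" by (intro cozero_in_sets_baire continuous_intros assms)
  then show "{x \<in> space baire. a < h x} \<in> sets baire" by simp
qed

section \<open>Haar measure: reflection and right invariance\<close>

locale compact_haar =
  fixes m :: "'g::{topological_group_add, t2_space} measure"
  assumes compact_UNIV: "compact (UNIV :: 'g set)" and haar: "normalized_haar m"
begin

lemma sets_m [measurable_cong, simp]: "sets m = sets borel"
  using haar by (simp add: normalized_haar_def)

lemma space_m [simp]: "space m = UNIV"
  using sets_eq_imp_space_eq[OF sets_m] by simp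

sublocale prob_space m
  by (rule prob_spaceI) (use haar in \<open>simp add: normalized_haar_def\<close>)

lemma measurable_m: "measurable m M = measurable borel M" "measurable M m = measurable M borel"
  by (auto intro!: measurable_cong_sets)

lemma continuous_borel_maps [measurable]:
  "(\<lambda>x. a + x) \<in> borel \<rightarrow>\<^sub>M (borel :: 'g measure)" "(\<lambda>x. x + a) \<in> borel \<rightarrow>\<^sub>M (borel :: 'g measure)"
  "(\<lambda>x. - x) \<in> borel \<rightarrow>\<^sub>M (borel :: 'g measure)" "(\<lambda>x. a - x) \<in> borel \<rightarrow>\<^sub>M (borel :: 'g measure)"
  "(\<lambda>x. x - a) \<in> borel \<rightarrow>\<^sub>M (borel :: 'g measure)"
  by (intro borel_measurable_continuous_onI continuous_intros)+

lemma distr_left: "distr m borel (\<lambda>x. a + x) = m"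
proof (rule measure_eqI)
  fix A assume "A \<in> sets (distr m borel (\<lambda>x. a + x))"
  then have A: "A \<in> sets borel" by simp
  have "(\<lambda>x. a + x) -` A = (\<lambda>x. - a + x) ` A"
    by (auto simp: image_iff intro!: bexI[of _ "a + _"] simp flip: add.assoc)
  then show "emeasure (distr m borel (\<lambda>x. a + x)) A = emeasure m A"
    using haar A by (simp add: emeasure_distr normalized_haar_def measurable_m)
qed simp

lemma nn_integral_left: "f \<in> borel_measurable borel \<Longrightarrow> (\<integral>\<^sup>+x. f (a + x) \<partial>m) = (\<integral>\<^sup>+x. f x \<partial>m)"
  using nn_integral_distr[of "\<lambda>x. a + x" m borel f] by (simp add: distr_left measurable_m)

lemma outer_regular: "A \<in> sets borel \<Longrightarrow> emeasure m A = (INF U\<in>{U. open U \<and> A \<subseteq> U}. emeasure m U)"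
  and inner_regular: "A \<in> sets borel \<Longrightarrow> emeasure m A = (SUP K\<in>{K. compact K \<and> K \<subseteq> A}. emeasure m K)"
  using haar unfolding normalized_haar_def by blast+

lemma open_outer:
  assumes "A \<in> sets borel" "emeasure m A < c"
  obtains U where "open U" "A \<subseteq> U" "emeasure m U < c"
proof -
  have "(INF U\<in>{U. open U \<and> A \<subseteq> U}. emeasure m U) < c"
    using assms outer_regular by metis
  then show ?thesis using that by (auto simp: INF_less_iff)
qed

lemma compact_inner:
  assumes "A \<in> sets borel" "c < emeasure m A"
  obtains K where "compact K" "K \<subseteq> A" "c < emeasure m K"
proof -
  have "c < (SUP K\<in>{K. compact K \<and> K \<subseteq> A}. emeasure m K)"
    using assms inner_regular by metis
  then show ?thesis using that by (auto simp: less_SUP_iff)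
qed

text \<open>Both orders of integration of \<open>h (- x + y)\<close> are evaluated by left invariance, one giving
  the integral of \<open>h\<close> and the other that of \<open>x \<mapsto> h (- x)\<close>.\<close>

lemma nn_integral_uminus_continuous:
  fixes h :: "'g \<Rightarrow> real"
  assumes h: "continuous_on UNIV h"
  shows "(\<integral>\<^sup>+x. h (- x) \<partial>m) = (\<integral>\<^sup>+x. h x \<partial>m)"
proof -
  interpret pair_sigma_finite m m ..
  have hm [measurable]: "h \<in> borel_measurable borel" by (rule borel_measurable_continuous_onI[OF h])
  have "(\<lambda>z. h (- fst z + snd z)) \<in> borel_measurable (borel \<Otimes>\<^sub>M borel)"
    by (intro continuous_on_compact_prod_borel_measurable compact_UNIV continuous_on_compose2[OF h]
      continuous_intros) auto
  then have meas: "(\<lambda>(x, y). ennreal (h (- x + y))) \<in> borel_measurable (m \<Otimes>\<^sub>M m)"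
    by (simp add: split_beta' cong: measurable_cong_sets sets_pair_measure_cong)
  have "(\<integral>\<^sup>+y. \<integral>\<^sup>+x. h (- x + y) \<partial>m \<partial>m) = (\<integral>\<^sup>+x. \<integral>\<^sup>+y. h (- x + y) \<partial>m \<partial>m)"
    by (rule Fubini'[OF meas])
  also have "\<dots> = (\<integral>\<^sup>+x. \<integral>\<^sup>+y. h y \<partial>m \<partial>m)"
    using nn_integral_left[of "\<lambda>x. ennreal (h x)"] by simp
  also have "(\<integral>\<^sup>+y. \<integral>\<^sup>+x. h (- x + y) \<partial>m \<partial>m) = (\<integral>\<^sup>+y. \<integral>\<^sup>+x. h (- x) \<partial>m \<partial>m)"
  proof (rule nn_integral_cong)
    fix y
    have "(\<integral>\<^sup>+x. h (- x + y) \<partial>m) = (\<integral>\<^sup>+x. h (- (y + x) + y) \<partial>m)"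
      using nn_integral_left[of "\<lambda>x. ennreal (h (- x + y))" y] by simp
    then show "(\<integral>\<^sup>+x. h (- x + y) \<partial>m) = (\<integral>\<^sup>+x. h (- x) \<partial>m)"
      by (simp add: minus_add add.assoc)
  qed
  finally show ?thesis by (simp add: emeasure_space_1[simplified])
qed

text \<open>A Urysohn function between a compact subset and \<open>U\<close> carries the reflection
  invariance of integrals of continuous functions to measures, as an inequality. The inequality
  applied to the reflected set is the reverse one.\<close>

lemma emeasure_uminus_open:
  assumes U: "open U"
  shows "emeasure m (uminus -` U) = emeasure m U"
proof -
  have le: "emeasure m U \<le> emeasure m (uminus -` U)" if U: "open U" for U
  proof (rule ccontr)
    assume "\<not> ?thesis"
    then obtain K where K: "compact K" "K \<subseteq> U" "emeasure m (uminus -` U) < emeasure m K"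
      using compact_inner[of U "emeasure m (uminus -` U)"] U by (auto simp: not_le)
    obtain h :: "'g \<Rightarrow> real" where h: "continuous_on UNIV h" "\<And>x. 0 \<le> h x" "\<And>x. h x \<le> 1"
      "\<And>x. x \<in> - U \<Longrightarrow> h x = 0" "\<And>x. x \<in> K \<Longrightarrow> h x = 1"
      using compact_t2_Urysohn[OF compact_UNIV, of "- U" K] U K compact_imp_closed[OF K(1)] by blast
    have "emeasure m K = (\<integral>\<^sup>+x. indicator K x \<partial>m)"
      using compact_imp_closed[OF K(1)] by (simp add: borel_closed)
    also have "\<dots> \<le> (\<integral>\<^sup>+x. h x \<partial>m)"
      by (intro nn_integral_mono) (auto simp: indicator_def h(5))
    also have "\<dots> = (\<integral>\<^sup>+x. h (- x) \<partial>m)"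
      by (rule nn_integral_uminus_continuous[OF h(1), symmetric])
    also have "\<dots> \<le> (\<integral>\<^sup>+x. indicator (uminus -` U) x \<partial>m)"
      by (intro nn_integral_mono) (use h(2,3,4) in \<open>force simp: indicator_def ennreal_le_1\<close>)
    also have "\<dots> = emeasure m (uminus -` U)"
      using U by (intro nn_integral_indicator) (auto intro!: borel_open open_vimage continuous_intros)
    finally show False using K(3) by simp
  qed
  have "open (uminus -` U)" using U by (intro open_vimage continuous_intros) auto
  from le[OF this] le[OF U] show ?thesis by (simp add: vimage_comp comp_def)
qed

text \<open>Outer regularity extends invariance from open to Borel sets as an inequality, which is
  used for both \<open>A\<close> and its reflection.\<close>

lemma distr_uminus: "distr m borel uminus = m"
proof (rule measure_eqI)
  have le: "emeasure m (uminus -` A) \<le> emeasure m A" if A: "A \<in> sets borel" for A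
  proof (rule ccontr)
    assume "\<not> ?thesis"
    then obtain U where U: "open U" "A \<subseteq> U" "emeasure m U < emeasure m (uminus -` A)"
      using open_outer[OF A] by (auto simp: not_le)
    have "emeasure m (uminus -` A) \<le> emeasure m (uminus -` U)"
      using U by (intro emeasure_mono) (auto intro!: borel_open open_vimage continuous_intros)
    then show False using U emeasure_uminus_open by simp
  qed
  fix A assume "A \<in> sets (distr m borel uminus)"
  then have A: "A \<in> sets borel" by simp
  then have "uminus -` A \<in> sets borel"
    using measurable_sets[OF continuous_borel_maps(3) A] by simp
  from le[OF this] le[OF A] A show "emeasure (distr m borel uminus) A = emeasure m A"
    by (simp add: emeasure_distr measurable_m vimage_comp comp_def)
qed simp

lemma nn_integral_uminus: "f \<in> borel_measurable borel \<Longrightarrow> (\<integral>\<^sup>+x. f (- x) \<partial>m) = (\<integral>\<^sup>+x. f x \<partial>m)"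
  using nn_integral_distr[of uminus m borel f] by (simp add: distr_uminus measurable_m)

text \<open>A right translation is a left translation conjugated by the reflection.\<close>

lemma nn_integral_right:
  assumes [measurable]: "f \<in> borel_measurable borel"
  shows "(\<integral>\<^sup>+x. f (x + a) \<partial>m) = (\<integral>\<^sup>+x. f x \<partial>m)"
proof -
  have "(\<integral>\<^sup>+x. f (x + a) \<partial>m) = (\<integral>\<^sup>+x. f (- x + a) \<partial>m)"
    using nn_integral_uminus[of "\<lambda>x. f (x + a)"] by simp
  also have "\<dots> = (\<integral>\<^sup>+x. f (- (- a + x)) \<partial>m)"
    by (simp add: minus_add)
  also have "\<dots> = (\<integral>\<^sup>+x. f (- x) \<partial>m)"
    using nn_integral_left[of "\<lambda>x. f (- x)" "- a"] by simp
  finally show ?thesis by (simp add: nn_integral_uminus)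
qed

lemma nn_integral_minus_right:
  "f \<in> borel_measurable borel \<Longrightarrow> (\<integral>\<^sup>+x. f (x - a) \<partial>m) = (\<integral>\<^sup>+x. f x \<partial>m)"
  using nn_integral_right[of f "- a"] by simp

lemma nn_integral_minus_left:
  assumes [measurable]: "f \<in> borel_measurable borel"
  shows "(\<integral>\<^sup>+x. f (a - x) \<partial>m) = (\<integral>\<^sup>+x. f x \<partial>m)"
  using nn_integral_uminus[of "\<lambda>x. f (a + x)"] nn_integral_left[of f a] by simp

lemma distr_minus_right: "distr m borel (\<lambda>x. x - a) = m"
proof (rule measure_eqI)
  fix A assume "A \<in> sets (distr m borel (\<lambda>x. x - a))"
  then have A [measurable]: "A \<in> sets borel" by simp
  have "emeasure (distr m borel (\<lambda>x. x - a)) A = (\<integral>\<^sup>+x. indicator A x \<partial>distr m borel (\<lambda>x. x - a))"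
    by simp
  also have "\<dots> = (\<integral>\<^sup>+x. indicator A (x - a) \<partial>m)"
    by (subst nn_integral_distr) (auto simp: measurable_m)
  also have "\<dots> = emeasure m A" by (subst nn_integral_minus_right) auto
  finally show "emeasure (distr m borel (\<lambda>x. x - a)) A = emeasure m A" .
qed simp

lemma AE_minus_right:
  assumes "AE x in m. P x"
  shows "AE x in m. P (x - a)"
proof -
  obtain N where N: "N \<in> null_sets m" "{x. \<not> P x} \<subseteq> N"
    using assms by (auto simp: eventually_ae_filter)
  have "AE x in distr m borel (\<lambda>x. x - a). x \<notin> N"
    using AE_not_in[OF N(1)] by (simp only: distr_minus_right)
  then have "AE x in m. x - a \<notin> N"
    using N(1) by (subst (asm) AE_distr_iff) (auto simp: measurable_m intro!: borel_measurableI)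
  then show ?thesis by eventually_elim (use N(2) in auto)
qed


text \<open>Urysohn functions of compact sets that exhaust \<open>U\<close> in measure are added
  with weights \<open>(1/2) ^ n\<close>. The sum is continuous, vanishes off \<open>U\<close>, and
  is positive wherever one of the functions is.\<close>

lemma open_inner_cozero:
  assumes U: "open U"
  obtains h :: "'g \<Rightarrow> real" where "continuous_on UNIV h" "\<And>x. 0 \<le> h x" "{x. 0 < h x} \<subseteq> U"
    "emeasure m {x. 0 < h x} = emeasure m U"
proof -
  have "\<exists>h :: 'g \<Rightarrow> real. continuous_on UNIV h \<and> (\<forall>x. 0 \<le> h x \<and> h x \<le> 1) \<and> (\<forall>x\<in>-U. h x = 0) \<and>
      emeasure m U \<le> emeasure m {x. 0 < h x} + ennreal (1 / Suc n)" for n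
  proof -
    have "\<exists>K. compact K \<and> K \<subseteq> U \<and> emeasure m U \<le> emeasure m K + ennreal (1 / Suc n)"
    proof -
      have "\<exists>K\<in>{K. compact K \<and> K \<subseteq> U}. emeasure m U < emeasure m K + ennreal (1 / Suc n)"
        by (rule SUP_approx_ennreal[OF _ _ inner_regular[OF borel_open[OF U]]]) auto
      then show ?thesis by (auto intro: less_imp_le)
    qed
    then obtain K where K: "compact K" "K \<subseteq> U" "emeasure m U \<le> emeasure m K + ennreal (1 / Suc n)" by blast
    obtain h :: "'g \<Rightarrow> real" where h: "continuous_on UNIV h" "\<And>x. 0 \<le> h x" "\<And>x. h x \<le> 1"
      "\<And>x. x \<in> - U \<Longrightarrow> h x = 0" "\<And>x. x \<in> K \<Longrightarrow> h x = 1"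
      using compact_t2_Urysohn[OF compact_UNIV, of "- U" K] U K compact_imp_closed[OF K(1)] by blast
    have "emeasure m K \<le> emeasure m {x. 0 < h x}"
      using h(5) by (intro emeasure_mono) (auto intro!: borel_open open_Collect_less continuous_intros h(1))
    then have "emeasure m U \<le> emeasure m {x. 0 < h x} + ennreal (1 / Suc n)"
      using K(3) by (meson add_right_mono order_trans)
    then show ?thesis using h by blast
  qed
  then obtain h :: "nat \<Rightarrow> 'g \<Rightarrow> real" where h: "\<And>n. continuous_on UNIV (h n)" "\<And>n x. 0 \<le> h n x"
    "\<And>n x. h n x \<le> 1" "\<And>n x. x \<notin> U \<Longrightarrow> h n x = 0"
    "\<And>n. emeasure m U \<le> emeasure m {x. 0 < h n x} + ennreal (1 / Suc n)"
    by (metis ComplI)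
  define H where "H x = (\<Sum>n. (1/2) ^ n * h n x)" for x
  have bd: "norm ((1/2) ^ n * h n x) \<le> (1/2) ^ n" for n x
    using h(2,3)[of n x] by (simp add: mult_left_le)
  have sg: "summable (\<lambda>n. (1/2::real) ^ n)" by (intro summable_geometric) auto
  have sH: "summable (\<lambda>n. (1/2) ^ n * h n x)" for x
    by (rule summable_comparison_test'[OF sg bd])
  have "uniform_limit UNIV (\<lambda>N x. \<Sum>n<N. (1/2) ^ n * h n x) H sequentially"
    unfolding H_def by (rule Weierstrass_m_test[OF bd sg])
  then have cont: "continuous_on UNIV H"
    by (rule uniform_limit_theorem[rotated]) (auto intro!: always_eventually continuous_intros h(1))
  have pos: "0 \<le> H x" for x unfolding H_def by (intro suminf_nonneg sH) (simp add: h)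
  have HU: "{x. 0 < H x} \<subseteq> U"
  proof
    fix x assume "x \<in> {x. 0 < H x}"
    then show "x \<in> U" by (rule contrapos_pp) (simp add: H_def h(4))
  qed
  have sub: "{x. 0 < h n x} \<subseteq> {x. 0 < H x}" for n
  proof
    fix x assume "x \<in> {x. 0 < h n x}"
    then have "0 < H x" unfolding H_def by (intro suminf_pos2[OF sH, of x n]) (auto simp: h)
    then show "x \<in> {x. 0 < H x}" by simp
  qed
  have bor: "{x. 0 < H x} \<in> sets m" by (auto intro!: borel_open open_Collect_less continuous_intros cont)
  have "emeasure m U \<le> emeasure m {x. 0 < H x}"
  proof (rule ennreal_le_epsilon)
    fix e :: real assume "0 < e"
    then obtain n where n: "1 / Suc n < e" using nat_approx_posE by blast
    have "emeasure m U \<le> emeasure m {x. 0 < h n x} + ennreal (1 / Suc n)" by (rule h(5))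
    also have "\<dots> \<le> emeasure m {x. 0 < H x} + ennreal e"
      by (intro add_mono emeasure_mono sub bor ennreal_leI less_imp_le[OF n])
    finally show "emeasure m U \<le> emeasure m {x. 0 < H x} + ennreal e" .
  qed
  moreover have "emeasure m {x. 0 < H x} \<le> emeasure m U"
    using U by (intro emeasure_mono HU) auto
  ultimately show ?thesis using that[OF cont pos HU] by simp
qed


end

section \<open>Completion regularity of Haar measure\<close>

context compact_haar
begin

text \<open>If \<open>V = {h > 0}\<close> fills \<open>U\<close> up to a null set, let \<open>U'\<close> be the union of the translates of \<open>U\<close> by
  the right periods of \<open>h\<close>. By invariance each point of \<open>U'\<close> has a neighbourhood that \<open>V\<close> fills up to
  a null set, so \<open>U' - V\<close> is null by inner regularity. It is a Baire set since it is the preimage of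
  an open set under the map sending \<open>x\<close> to the translate of \<open>h\<close> by \<open>x\<close>, which has a compact metric
  image.\<close>

lemma open_outer_baire:
  assumes U: "open U"
  obtains V U' where "V \<in> sets baire" "U' \<in> sets baire" "V \<subseteq> U" "U \<subseteq> U'" "emeasure m (U' - V) = 0"
proof -
  obtain h :: "'g \<Rightarrow> real" where h: "continuous_on UNIV h" "\<And>x. 0 \<le> h x" "{x. 0 < h x} \<subseteq> U"
    "emeasure m {x. 0 < h x} = emeasure m U"
    using open_inner_cozero[OF U] by metis
  define V where "V = {x. 0 < h x}"
  have Vb: "V \<in> sets baire" unfolding V_def by (rule cozero_in_sets_baire[OF h(1)])
  then have Vborel [measurable]: "V \<in> sets borel" using sets_baire_subset_borel by blast
  have UV0: "emeasure m (U - V) = 0"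
    using h(3,4) U emeasure_finite[of U] by (subst emeasure_Diff) (auto simp: V_def[symmetric])
  \<comment> \<open>Translates of \<open>h\<close> live in the metric space of bounded continuous
    functions; compactness of the group makes \<open>F\<close> continuous for the supremum
    distance.\<close>
  define F where "F x = Bcontfun (\<lambda>z. h (z + x))" for x
  have cz: "continuous_on UNIV (\<lambda>z. h (z + x))" for x
    by (intro continuous_on_compose2[OF h(1)] continuous_intros) auto
  have bc: "(\<lambda>z. h (z + x)) \<in> bcontfun" for x
    using compact_imp_bounded[OF compact_continuous_image[OF cz compact_UNIV]]
    by (auto simp: bcontfun_def cz)
  have F: "apply_bcontfun (F x) = (\<lambda>z. h (z + x))" for x
    unfolding F_def by (rule Bcontfun_inverse[OF bc])
  have Feq: "F x = F y \<longleftrightarrow> (\<forall>z. h (z + x) = h (z + y))" for x y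
    by (auto simp: F bcontfun_eqI apply_bcontfun_inject[symmetric] fun_eq_iff)
  have Fcont: "continuous_on UNIV F"
    unfolding continuous_on_def
  proof
    fix x0 :: 'g
    show "(F \<longlongrightarrow> F x0) (at x0 within UNIV)"
    proof (rule tendstoI)
      fix e :: real assume e: "0 < e"
      have c: "continuous_on (UNIV \<times> UNIV) (\<lambda>p. h (snd p + fst p))"
        by (intro continuous_on_compose2[OF h(1)] continuous_intros) auto
      obtain X0 where X0: "x0 \<in> X0" "open X0" "\<forall>x\<in>X0. \<forall>t. dist (h (t + x)) (h (t + x0)) \<le> e / 2"
      proof (rule continuous_on_prod_compactE[OF c compact_UNIV, of x0 "e/2"])
        fix X0 assume "x0 \<in> X0" "open X0"
          "\<forall>x\<in>X0 \<inter> UNIV. \<forall>t\<in>UNIV. dist (h (snd (x, t) + fst (x, t))) (h (snd (x0, t) + fst (x0, t))) \<le> e / 2"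
        then show thesis by (intro that[of X0]) auto
      qed (use e in auto)
      have "dist (F x) (F x0) < e" if "x \<in> X0" for x
      proof -
        have "dist (F x) (F x0) \<le> e / 2" by (rule dist_bound) (use X0(3) that in \<open>auto simp: F\<close>)
        then show ?thesis using e by simp
      qed
      then show "\<forall>\<^sub>F x in at x0 within UNIV. dist (F x) (F x0) < e"
        using X0(1,2) by (auto simp: eventually_at_topological)
    qed
  qed
  define P where "P = {\<eta>. \<forall>z. h (z + \<eta>) = h z}"
  define U' where "U' = (\<Union>\<eta>\<in>P. (\<lambda>x. x - \<eta>) -` U)"
  have Pneg: "- \<eta> \<in> P" if "\<eta> \<in> P" for \<eta>
  proof -
    have "\<forall>z. h (z + \<eta>) = h z" using that by (simp add: P_def)
    then have "h (z - \<eta> + \<eta>) = h (z - \<eta>)" for z by (rule spec)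
    then show ?thesis by (simp add: P_def)
  qed
  have op: "open ((\<lambda>x. x - \<eta>) -` U)" for \<eta> using U by (intro open_vimage continuous_intros) auto
  then have opU': "open U'" unfolding U'_def by auto
  have "0 \<in> P" by (simp add: P_def)
  then have UU': "U \<subseteq> U'" unfolding U'_def by (intro subset_trans[OF _ UN_upper[of 0]]) auto
  \<comment> \<open>\<open>U'\<close> is a union of fibres of \<open>F\<close>: if
    \<open>F x = F y\<close>, then \<open>- y + x\<close> is a right period of \<open>h\<close>, and
    composing it with \<open>\<eta>\<close> gives a period \<open>\<zeta>\<close> with
    \<open>x - \<zeta> = y - \<eta>\<close>.\<close>
  have sat: "x \<in> U'" if xy: "F x = F y" and y: "y \<in> U'" for x y
  proof -
    obtain \<eta> where \<eta>: "\<eta> \<in> P" "y - \<eta> \<in> U" using y by (auto simp: U'_def)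
    define \<zeta> where "\<zeta> = \<eta> + (- y + x)"
    have "h (z + \<zeta>) = h z" for z
    proof -
      have "h (z + \<zeta>) = h ((z + \<eta> - y) + x)" by (simp only: \<zeta>_def diff_conv_add_uminus add.assoc)
      also have "\<dots> = h ((z + \<eta> - y) + y)" using xy by (simp only: Feq)
      also have "\<dots> = h z" using \<eta>(1) by (simp add: P_def)
      finally show ?thesis .
    qed
    then have "\<zeta> \<in> P" by (simp add: P_def)
    moreover have "x - \<zeta> = y - \<eta>"
      by (simp only: \<zeta>_def diff_conv_add_uminus minus_add add.assoc minus_minus add_minus_cancel)
    ultimately show ?thesis using \<eta>(2) by (auto simp: U'_def intro!: bexI[of _ \<zeta>])
  qed
  have U'b: "U' \<in> sets baire"
  proof (cases "U' = UNIV")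
    case True
    then show ?thesis using sets.top[of "baire :: 'g measure"] by simp
  next
    case False
    \<comment> \<open>The image of the complement is closed, so the distance to it is positive
      exactly at images of points of \<open>U'\<close>, by saturation. Composed with
      \<open>F\<close> this distance is continuous, which exhibits \<open>U'\<close> as a cozero
      set.\<close>
    have "compact (- U')" using opU' compact_UNIV by (metis closed_Compl compact_Int_closed double_compl inf_top_left)
    then have cl: "closed (F ` (- U'))"
      by (intro compact_imp_closed compact_continuous_image continuous_on_subset[OF Fcont]) auto
    have ne: "F ` (- U') \<noteq> {}" using False by auto
    have "U' = {x. 0 < infdist (F x) (F ` (- U'))}"
    proof (intro Set.set_eqI iffI)
      fix x assume x: "x \<in> U'"
      then have "F x \<notin> F ` (- U')" using sat by (metis ComplD imageE)
      then show "x \<in> {x. 0 < infdist (F x) (F ` (- U'))}"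
        using in_closed_iff_infdist_zero[OF cl ne] infdist_nonneg[of "F x" "F ` (- U')"] by force
    next
      fix x assume "x \<in> {x. 0 < infdist (F x) (F ` (- U'))}"
      then show "x \<in> U'" by (rule contrapos_pp) auto
    qed
    also have "\<dots> \<in> sets baire"
      by (rule cozero_in_sets_baire) (intro continuous_on_infdist Fcont)
    finally show ?thesis .
  qed
  \<comment> \<open>\<open>V\<close> is invariant under the periods of \<open>h\<close>, so removing
    \<open>V\<close> commutes with the translations by them.\<close>
  have trans: "(\<lambda>x. x - \<eta>) -` U - V = (\<lambda>x. x - \<eta>) -` (U - V)" if "\<eta> \<in> P" for \<eta>
  proof -
    have "h (x - \<eta>) = h x" for x using Pneg[OF that] by (simp add: P_def)
    then show ?thesis by (auto simp: V_def)
  qed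
  have null: "emeasure m ((\<lambda>x. x - \<eta>) -` U - V) = 0" if "\<eta> \<in> P" for \<eta>
  proof -
    have "U - V \<in> sets borel" using U by auto
    then have "emeasure m ((\<lambda>x. x - \<eta>) -` (U - V)) = emeasure (distr m borel (\<lambda>x. x - \<eta>)) (U - V)"
      by (subst emeasure_distr) (auto simp: measurable_m)
    then show ?thesis by (simp add: trans[OF that] distr_minus_right UV0)
  qed
  \<comment> \<open>There may be uncountably many periods, so the null sets cannot be united
    directly. A compact subset of positive measure would be covered by finitely many of
    them.\<close>
  have "emeasure m (U' - V) = 0"
  proof (rule ccontr)
    assume "emeasure m (U' - V) \<noteq> 0"
    then have "0 < emeasure m (U' - V)" by (simp add: zero_less_iff_neq_zero)
    moreover have "U' - V \<in> sets borel" using opU' by auto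
    ultimately obtain K where K: "compact K" "K \<subseteq> U' - V" "0 < emeasure m K"
      using compact_inner by metis
    have "K \<subseteq> (\<Union>\<eta>\<in>P. (\<lambda>x. x - \<eta>) -` U)" using K(2) by (auto simp: U'_def)
    then obtain P' where P': "P' \<subseteq> P" "finite P'" "K \<subseteq> (\<Union>\<eta>\<in>P'. (\<lambda>x. x - \<eta>) -` U)"
      by (rule compactE_image[OF K(1) op])
    have "(\<lambda>x. x - \<eta>) -` U - V \<in> null_sets m" if "\<eta> \<in> P'" for \<eta>
      using that P'(1) borel_open[OF op[of \<eta>]] by (intro null_setsI null) auto
    then have N: "(\<Union>\<eta>\<in>P'. (\<lambda>x. x - \<eta>) -` U - V) \<in> null_sets m"
      by (rule null_sets_UN'[OF countable_finite[OF P'(2)]])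
    have "emeasure m K \<le> emeasure m (\<Union>\<eta>\<in>P'. (\<lambda>x. x - \<eta>) -` U - V)"
      using K(2) P'(3) null_setsD2[OF N] by (intro emeasure_mono) auto
    also have "\<dots> = 0" by (rule null_setsD1[OF N])
    finally have "emeasure m K \<le> 0" .
    then show False using K(3) by simp
  qed
  then show ?thesis using that[OF Vb U'b _ UU'] h(3) by (simp add: V_def)
qed

text \<open>Outer regularity supplies open sets, each contained in a Baire set of the same measure;
  the countable intersection of these Baire sets is the required one.\<close>

lemma borel_outer_baire:
  assumes B: "B \<in> sets borel"
  obtains B' where "B' \<in> sets baire" "B \<subseteq> B'" "emeasure m (B' - B) = 0"
proof -
  have "\<exists>U'. U' \<in> sets baire \<and> B \<subseteq> U' \<and> emeasure m U' \<le> emeasure m B + ennreal (1 / Suc n)" for n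
  proof -
    have "\<exists>U\<in>{U. open U \<and> B \<subseteq> U}. emeasure m U < emeasure m B + ennreal (1 / Suc n)"
      by (rule INF_approx_ennreal[OF _ outer_regular[OF B], unfolded Bex_def[symmetric]]) auto
    then obtain U where U: "open U" "B \<subseteq> U" "emeasure m U < emeasure m B + ennreal (1 / Suc n)"
      by auto
    obtain V U' where V: "V \<in> sets baire" "U' \<in> sets baire" "V \<subseteq> U" "U \<subseteq> U'" "emeasure m (U' - V) = 0"
      using open_outer_baire[OF U(1)] by metis
    have s: "V \<in> sets m" "U' \<in> sets m" "U \<in> sets m" using V U sets_baire_subset_borel by auto
    have "emeasure m U' \<le> emeasure m (U \<union> (U' - V))" using s V by (intro emeasure_mono) auto
    also have "\<dots> \<le> emeasure m U + emeasure m (U' - V)" using s by (intro emeasure_subadditive) auto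
    finally have "emeasure m U' \<le> emeasure m B + ennreal (1 / Suc n)" using V(5) U(3) by simp
    then show ?thesis using V U by blast
  qed
  then obtain U' where U': "\<And>n. U' n \<in> sets baire" "\<And>n. B \<subseteq> U' n"
    "\<And>n. emeasure m (U' n) \<le> emeasure m B + ennreal (1 / Suc n)" by metis
  define B' where "B' = (\<Inter>n. U' n)"
  have B'b: "B' \<in> sets baire" unfolding B'_def by (intro sets.countable_INT) (use U'(1) in auto)
  then have s: "B' \<in> sets borel" "\<And>n. U' n \<in> sets borel" using sets_baire_subset_borel U'(1) by blast+
  have "emeasure m B' \<le> emeasure m B"
  proof (rule ennreal_le_epsilon)
    fix e :: real assume "0 < e"
    then obtain n where n: "1 / Suc n < e" using nat_approx_posE by blast
    have "emeasure m B' \<le> emeasure m (U' n)" using s by (intro emeasure_mono) (auto simp: B'_def)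
    also have "\<dots> \<le> emeasure m B + ennreal (1 / Suc n)" by (rule U'(3))
    also have "\<dots> \<le> emeasure m B + ennreal e" by (intro add_left_mono ennreal_leI less_imp_le[OF n])
    finally show "emeasure m B' \<le> emeasure m B + ennreal e" .
  qed
  moreover have BB': "B \<subseteq> B'" using U'(2) by (auto simp: B'_def)
  ultimately have "emeasure m (B' - B) = 0"
    using emeasure_finite[of B] s B by (subst emeasure_Diff) (auto simp: diff_eq_0_iff_ennreal less_top[symmetric])
  then show ?thesis using that[OF B'b BB'] by simp
qed

text \<open>A Borel set \<open>B\<close> is enclosed in a Baire set \<open>B1\<close>, and the null
  difference \<open>B1 - B\<close> again in a Baire null set. Hence Borel sets belong to the
  completion of \<open>m0\<close>, the restriction of \<open>m\<close> to the Baire sets, and a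
  function measurable for a completion agrees almost everywhere with a measurable one.\<close>

lemma borel_measurable_eq_baire:
  fixes f :: "'g \<Rightarrow> real"
  assumes f: "f \<in> borel_measurable borel"
  obtains f0 N where "f0 \<in> borel_measurable baire" "N \<in> sets baire" "emeasure m N = 0"
    "\<And>x. x \<notin> N \<Longrightarrow> f x = f0 x"
proof -
  define m0 where "m0 = distr m baire (\<lambda>x. x)"
  have idm: "(\<lambda>x. x) \<in> m \<rightarrow>\<^sub>M baire" by (simp add: measurable_m)
  have em: "emeasure m0 A = emeasure m A" if "A \<in> sets baire" for A
    using that by (simp add: m0_def emeasure_distr[OF idm])
  have [simp]: "sets m0 = sets baire" "space m0 = UNIV" by (auto simp: m0_def)
  have "B \<in> sets (completion m0)" if B: "B \<in> sets borel" for B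
  proof -
    obtain B1 where B1: "B1 \<in> sets baire" "B \<subseteq> B1" "emeasure m (B1 - B) = 0"
      using borel_outer_baire[OF B] by metis
    have s: "B1 - B \<in> sets borel" using B B1 sets_baire_subset_borel by blast
    obtain N where N: "N \<in> sets baire" "B1 - B \<subseteq> N" "emeasure m (N - (B1 - B)) = 0"
      using borel_outer_baire[OF s] by metis
    have "emeasure m N \<le> emeasure m (N - (B1 - B)) + emeasure m (B1 - B)"
      using s N(1) sets_baire_subset_borel
      by (intro order_trans[OF emeasure_mono emeasure_subadditive]) auto
    then have "N \<in> null_sets m0" using N B1(3) by (intro null_setsI) (auto simp: em)
    moreover have "B = (B1 - N) \<union> (B \<inter> N)" using B1(2) N(2) by auto
    ultimately show ?thesis using B1(1) N(1)
      by (intro sets_completionI[of B "B1 - N" "B \<inter> N" N]) auto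
  qed
  then have "f \<in> borel_measurable (completion m0)"
    using f by (auto simp: measurable_def)
  then obtain f0 where f0: "f0 \<in> borel_measurable m0" "AE x in m0. f x = f0 x"
    using completion_ex_borel_measurable_real by blast
  then obtain N where N: "N \<in> null_sets m0" "{x. f x \<noteq> f0 x} \<subseteq> N"
    by (auto simp: eventually_ae_filter)
  show ?thesis
  proof (rule that[of f0 N])
    show "f0 \<in> borel_measurable baire" using f0(1) by (simp add: measurable_def)
    show "emeasure m N = 0" using N(1) em[of N] by (auto simp: null_sets_def)
  qed (use N in auto)
qed

lemma borel_measurable_complex_eq_baire:
  fixes f :: "'g \<Rightarrow> complex"
  assumes f: "f \<in> borel_measurable borel"
  obtains f0 N where "f0 \<in> borel_measurable baire" "N \<in> sets baire" "emeasure m N = 0"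
    "\<And>x. x \<notin> N \<Longrightarrow> f x = f0 x"
proof -
  obtain a N1 where a: "a \<in> borel_measurable baire" "N1 \<in> sets baire" "emeasure m N1 = 0"
    "\<And>x. x \<notin> N1 \<Longrightarrow> Re (f x) = a x"
    by (rule borel_measurable_eq_baire[OF measurable_compose[OF f borel_measurable_Re]]) (rule that)
  obtain b N2 where b: "b \<in> borel_measurable baire" "N2 \<in> sets baire" "emeasure m N2 = 0"
    "\<And>x. x \<notin> N2 \<Longrightarrow> Im (f x) = b x"
    by (rule borel_measurable_eq_baire[OF measurable_compose[OF f borel_measurable_Im]]) (rule that)
  show ?thesis
  proof (rule that[of "\<lambda>x. Complex (a x) (b x)" "N1 \<union> N2"])
    show "(\<lambda>x. Complex (a x) (b x)) \<in> borel_measurable baire"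
      using a(1) b(1) by (simp add: borel_measurable_complex_iff)
    have "emeasure m (N1 \<union> N2) \<le> emeasure m N1 + emeasure m N2"
      using a(2) b(2) sets_baire_subset_borel by (intro emeasure_subadditive) auto
    then show "emeasure m (N1 \<union> N2) = 0" using a(3) b(3) by simp
  qed (use a b in \<open>auto simp: complex_eq_iff\<close>)
qed

text \<open>It suffices to consider cozero sets, whose preimages are defined by continuous functions
  on the product.\<close>

lemma measurable_minus_baire [measurable]: "(\<lambda>z. fst z - snd z) \<in> borel \<Otimes>\<^sub>M borel \<rightarrow>\<^sub>M (baire :: 'g measure)"
  unfolding baire_def
proof (rule measurable_measure_of)
  fix A assume "A \<in> {{x. 0 < h x} | h :: 'g \<Rightarrow> real. continuous_on UNIV h}"
  then obtain h :: "'g \<Rightarrow> real" where h: "continuous_on UNIV h" "A = {x. 0 < h x}" by auto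
  have "(\<lambda>z. h (fst z - snd z)) \<in> borel_measurable (borel \<Otimes>\<^sub>M borel)"
    by (intro continuous_on_compact_prod_borel_measurable compact_UNIV continuous_on_compose2[OF h(1)]
      continuous_intros) auto
  then have "{z \<in> space (borel \<Otimes>\<^sub>M borel). 0 < h (fst z - snd z)} \<in> sets (borel \<Otimes>\<^sub>M borel)" by measurable
  then show "(\<lambda>z. fst z - snd z) -` A \<inter> space (borel \<Otimes>\<^sub>M borel) \<in> sets (borel \<Otimes>\<^sub>M borel)"
    by (simp add: h(2) vimage_def Int_def conj_commute)
qed auto

end

section \<open>Lebesgue spaces\<close>

text \<open>Exponents are later handled through their real reciprocals, for which conjugation is
  \<open>1 - x\<close> at both endpoints as well.\<close>

lemma enn2real_inverse_conj_exponent: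
  assumes "1 \<le> p"
  shows "enn2real (1 / conj_exponent p) = 1 - enn2real (1 / p)"
proof -
  have "1 / p \<le> 1"
    using assms by (cases p) (auto simp: divide_ennreal[of 1, simplified] ennreal_divide_top ennreal_le_1 divide_le_eq_1)
  moreover have "1 / (1 / x) = x" for x :: ennreal
  proof (cases x)
    case (real r)
    then show ?thesis
      by (cases "r = 0") (auto simp: divide_ennreal[of 1, simplified] ennreal_divide_top)
  qed (simp add: ennreal_divide_top)
  ultimately show ?thesis
    unfolding conj_exponent_def
    by (cases "1 / p") (auto simp: ennreal_minus[of _ 1, simplified] ennreal_le_1 top_unique)
qed

lemma enn2real_inverse_finite:
  assumes "1 \<le> p" "p < \<infinity>"
  shows "enn2real (1 / p) = 1 / enn2real p" "1 \<le> enn2real p"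
  using assms by (cases p; auto simp: divide_ennreal[of 1, simplified])+

text \<open>For \<open>p = \<infinity>\<close>, where the exponent is zero, take \<open>B = 1\<close>.\<close>

lemma (in prob_space) Lp_norm_factor:
  fixes f :: "'a \<Rightarrow> complex"
  assumes f: "f \<in> borel_measurable M" and p: "1 \<le> p" and fin: "Lp_norm M p f < \<infinity>"
  obtains B where "B \<in> borel_measurable M" "\<And>x. 0 \<le> B x" "(\<integral>\<^sup>+x. ennreal (B x) \<partial>M) \<le> 1"
    "AE x in M. cmod (f x) \<le> enn2real (Lp_norm M p f) * B x powr enn2real (1 / p)"
proof (cases "p = \<infinity>")
  case True
  show ?thesis
  proof (rule that[of "\<lambda>_. 1"])
    have "AE x in M. ennreal (cmod (f x)) \<le> Lp_norm M p f"
      using esssup_AE[of "\<lambda>x. ennreal (cmod (f x))" M] True by (simp add: Lp_norm_def)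
    then show "AE x in M. cmod (f x) \<le> enn2real (Lp_norm M p f) * 1 powr enn2real (1 / p)"
    proof eventually_elim
      case (elim x)
      then show ?case using fin by (cases "Lp_norm M p f") auto
    qed
    show "(\<integral>\<^sup>+x. ennreal 1 \<partial>M) \<le> 1" by (simp add: emeasure_space_1)
  qed auto
next
  case False
  define P where "P = enn2real p"
  have P: "enn2real (1 / p) = 1 / P" "1 \<le> P"
    using enn2real_inverse_finite[OF p] False by (auto simp: P_def less_top)
  define I where "I = (\<integral>\<^sup>+x. ennreal (cmod (f x) powr P) \<partial>M)"
  have I: "I \<noteq> \<infinity>" and N: "Lp_norm M p f = ennreal (enn2real I powr (1 / P))"
    using fin False by (auto simp: Lp_norm_def I_def P_def Let_def split: if_splits)
  define i where "i = enn2real I"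
  have i: "0 \<le> i" "I = ennreal i" using I by (auto simp: i_def less_top)
  have N': "enn2real (Lp_norm M p f) = i powr (1 / P)" by (simp add: N i_def)
  show ?thesis
  proof (cases "i = 0")
    case True
    have "AE x in M. ennreal (cmod (f x) powr P) = 0"
      using nn_integral_0_iff_AE[of "\<lambda>x. ennreal (cmod (f x) powr P)" M] f True i by (simp add: I_def)
    then have "AE x in M. cmod (f x) = 0" 
    proof eventually_elim
      case (elim x)
      then have "cmod (f x) powr P \<le> 0" by (simp add: ennreal_eq_0_iff)
      then show ?case using powr_ge_zero[of "cmod (f x)" P] by (metis antisym powr_eq_0_iff)
    qed
    then show ?thesis
      by (intro that[of "\<lambda>_. 1"]) (auto simp: emeasure_space_1 elim!: eventually_mono)
  next
    case False
    with i have ip: "0 < i" by simp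
    \<comment> \<open>The density is the power of the modulus with exponent \<open>P\<close>,
      divided by its integral \<open>i\<close>.\<close>
    show ?thesis
    proof (rule that[of "\<lambda>x. cmod (f x) powr P / i"])
      show "(\<lambda>x. cmod (f x) powr P / i) \<in> borel_measurable M" using f by measurable
      show "0 \<le> cmod (f x) powr P / i" for x using ip by simp
      have "(\<integral>\<^sup>+x. ennreal (cmod (f x) powr P / i) \<partial>M) = (\<integral>\<^sup>+x. ennreal (cmod (f x) powr P) / ennreal i \<partial>M)"
        using ip by (intro nn_integral_cong) (simp add: divide_ennreal)
      also have "\<dots> = I / ennreal i" unfolding I_def by (rule nn_integral_divide) (use f in measurable)
      also have "\<dots> = 1" using ip i(2) by (simp add: divide_ennreal)
      finally show "(\<integral>\<^sup>+x. ennreal (cmod (f x) powr P / i) \<partial>M) \<le> 1" by simp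
      have "cmod (f x) = i powr (1 / P) * (cmod (f x) powr P / i) powr (1 / P)" for x
        using ip P(2) by (simp add: powr_divide powr_powr)
      then show "AE x in M. cmod (f x) \<le> enn2real (Lp_norm M p f) * (cmod (f x) powr P / i) powr enn2real (1 / p)"
        by (simp add: N' P(1))
    qed
  qed
qed

text \<open>Integrated over factors of the form given by \<open>Lp_norm_factor\<close>, this is
  Hoelder's inequality. Zero arguments are harmless even for the exponent zero, since
  \<open>0 powr 0 = 0\<close>.\<close>

lemma powr_weighted_AM_GM:
  fixes A B :: real
  assumes "0 \<le> A" "0 \<le> B" "0 \<le> a" "0 \<le> b" "a + b = 1"
  shows "A powr a * B powr b \<le> a * A + b * B"
proof (cases "A = 0 \<or> B = 0")
  case True
  then show ?thesis using assms by auto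
next
  case False
  then show ?thesis using assms by (intro Youngs_inequality_0) auto
qed

text \<open>The pointwise inequality behind Young's inequality for convolutions, written for the product
  of \<open>A\<close>, \<open>B\<close> and \<open>C\<^sup>c D\<^sup>d\<close>. The three weights on the right are \<open>1 - (c + d)\<close>, \<open>1 - b\<close> and \<open>1 - a\<close>.\<close>

lemma powr_Young_four:
  fixes A B C D :: real
  assumes nn: "0 \<le> A" "0 \<le> B" "0 \<le> C" "0 \<le> D"
    and e: "0 \<le> a" "a \<le> 1" "0 \<le> b" "b \<le> 1" "0 \<le> c" "0 \<le> d" "0 < c + d" "c + d \<le> 1" "a + b + c + d = 2"
  shows "A powr a * B powr b * C powr c * D powr d \<le>
    (1 - (c + d)) * (A * B) + (1 - b) * (A * (c / (c + d) * C + d / (c + d) * D))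
      + (1 - a) * (B * (c / (c + d) * C + d / (c + d) * D))"
proof (cases "A = 0 \<or> B = 0 \<or> C = 0 \<or> D = 0")
  case True
  then have "A powr a * B powr b * C powr c * D powr d = 0" by auto
  then show ?thesis using assms by (auto intro!: add_nonneg_nonneg mult_nonneg_nonneg)
next
  case False
  with nn have pos: "0 < A" "0 < B" "0 < C" "0 < D" by auto
  \<comment> \<open>Merging \<open>C\<close> and \<open>D\<close> into their weighted geometric mean
    leaves three factors.\<close>
  define W where "W = C powr (c / (c + d)) * D powr (d / (c + d))"
  have Wpos: "0 < W" using pos by (simp add: W_def)
  have WCD: "W powr (c + d) = C powr c * D powr d"
    using e pos by (simp add: W_def powr_mult powr_powr)
  have Wle: "W \<le> c / (c + d) * C + d / (c + d) * D"
    unfolding W_def using e nn by (intro powr_weighted_AM_GM) (auto simp flip: add_divide_distrib)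
  define x y z where "x = 1 - (c + d)" and "y = 1 - b" and "z = 1 - a"
  have xyz: "0 \<le> x" "0 \<le> y" "0 \<le> z" "x + y + z = 1" "a = x + y" "b = x + z" "c + d = y + z"
    using e by (auto simp: x_def y_def z_def)
  \<comment> \<open>The weights solve \<open>a = x + y\<close>, \<open>b = x + z\<close>,
    \<open>c + d = y + z\<close>, so the product is a weighted geometric mean of the three pairwise
    products; convexity of \<open>exp\<close> bounds it by their arithmetic mean.\<close>
  have "A powr a * B powr b * C powr c * D powr d = (A * B) powr x * ((A * W) powr y * (B * W) powr z)"
  proof -
    have "A powr a * B powr b * C powr c * D powr d = A powr (x + y) * B powr (x + z) * W powr (y + z)"
      using WCD xyz by (simp add: mult.assoc)
    then show ?thesis using pos Wpos by (simp add: powr_add powr_mult mult_ac)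
  qed
  also have "\<dots> = exp (x * ln (A * B) + y * ln (A * W) + z * ln (B * W))"
    using pos Wpos by (simp add: powr_def exp_add)
  also have "\<dots> \<le> x * exp (ln (A * B)) + y * exp (ln (A * W)) + z * exp (ln (B * W))"
  proof -
    have cv: "convex_on UNIV (exp :: real \<Rightarrow> real)" by (rule exp_convex)
    have "exp (\<Sum>i\<in>{0,1,2::nat}. [x,y,z] ! i *\<^sub>R [ln (A * B), ln (A * W), ln (B * W)] ! i) \<le>
       (\<Sum>i\<in>{0,1,2::nat}. [x,y,z] ! i * exp ([ln (A * B), ln (A * W), ln (B * W)] ! i))"
      by (rule convex_on_sum[OF _ _ cv]) (use xyz in auto)
    then show ?thesis by (simp add: add.assoc)
  qed
  also have "\<dots> = x * (A * B) + y * (A * W) + z * (B * W)" using pos Wpos by simp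
  also have "\<dots> \<le> x * (A * B) + y * (A * (c / (c + d) * C + d / (c + d) * D)) + z * (B * (c / (c + d) * C + d / (c + d) * D))"
    using xyz nn Wle by (intro add_mono mult_left_mono) auto
  finally show ?thesis by (simp add: x_def y_def z_def)
qed

section \<open>Density of the continuous functions\<close>

context compact_haar
begin

lemma continuous_bounded:
  fixes h :: "'g \<Rightarrow> complex"
  assumes "continuous_on UNIV h"
  obtains K where "\<And>x. cmod (h x) \<le> K"
  using compact_imp_bounded[OF compact_continuous_image[OF assms compact_UNIV]]
  by (auto simp: bounded_iff)

lemma integrable_continuous:
  fixes h :: "'g \<Rightarrow> complex"
  assumes "continuous_on UNIV h"
  shows "integrable m h"
proof -
  obtain K where "\<And>x. cmod (h x) \<le> K" by (rule continuous_bounded[OF assms]) (rule that)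
  then show ?thesis
    using borel_measurable_continuous_onI[OF assms]
    by (intro integrable_const_bound[of _ K]) (auto simp: measurable_m)
qed

text \<open>For an indicator, regularity gives a compact set inside and an open set outside, and a
  Urysohn function between them differs from the indicator only on their small difference.\<close>

lemma continuous_dense_L1:
  fixes f :: "'g \<Rightarrow> complex"
  assumes f: "integrable m f"
  shows "\<forall>e>0. \<exists>h. continuous_on UNIV h \<and> (LINT x|m. cmod (f x - h x)) < e"
  using f
proof (induct rule: integrable_induct)
  case (base A c)
  show ?case
  proof (intro allI impI)
    fix e :: real assume e: "0 < e"
    \<comment> \<open>The 1 in the denominator covers \<open>c = 0\<close>.\<close>
    define d where "d = (e / 2) / (cmod c + 1)"
    have d: "0 < d" using e by (auto simp: d_def intro!: divide_pos_pos add_nonneg_pos)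
    have A: "A \<in> sets borel" using base by simp
    obtain U where U: "open U" "A \<subseteq> U" "emeasure m U < emeasure m A + ennreal d"
      using INF_approx_ennreal[OF d outer_regular[OF A]] emeasure_finite[of A] by auto
    have "\<exists>K\<in>{K. compact K \<and> K \<subseteq> A}. emeasure m A < emeasure m K + ennreal d"
      by (rule SUP_approx_ennreal[OF d _ inner_regular[OF A]]) auto
    then obtain K where K: "compact K" "K \<subseteq> A" "emeasure m A < emeasure m K + ennreal d" by auto
    obtain h :: "'g \<Rightarrow> real" where h: "continuous_on UNIV h" "\<And>x. 0 \<le> h x" "\<And>x. h x \<le> 1"
      "\<And>x. x \<in> - U \<Longrightarrow> h x = 0" "\<And>x. x \<in> K \<Longrightarrow> h x = 1"
      using compact_t2_Urysohn[OF compact_UNIV, of "- U" K] U K compact_imp_closed[OF K(1)] by blast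
    have Kb: "K \<in> sets borel" "U \<in> sets borel" using compact_imp_closed[OF K(1)] U(1) by auto
    have "measure m U < measure m A + d" "measure m A < measure m K + d"
      using U(3) K(3) d by (simp_all add: emeasure_eq_measure ennreal_less_iff flip: ennreal_plus)
    moreover have "measure m (U - K) = measure m U - measure m K"
      using Kb U K by (intro finite_measure_Diff) auto
    ultimately have UK: "measure m (U - K) < 2 * d" by simp
    have i1: "integrable m (\<lambda>x. indicator (U - K) x * cmod c)"
      using Kb by (intro integrable_mult_left integrable_real_indicator) (auto simp: less_top[symmetric])
    have le: "cmod (indicator A x *\<^sub>R c - of_real (h x) * c) \<le> indicator (U - K) x * cmod c" for x
    proof -
      have "indicator A x *\<^sub>R c - of_real (h x) * c = of_real (indicator A x - h x) * c"
        by (simp add: scaleR_conv_of_real left_diff_distrib)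
      moreover have "\<bar>indicator A x - h x\<bar> \<le> (indicator (U - K) x :: real)"
        using h(2,3,4,5)[of x] U(2) K(2) by (auto simp: indicator_def)
      ultimately show ?thesis by (simp add: norm_mult mult_right_mono del: of_real_diff)
    qed
    have hm: "(\<lambda>x. of_real (h x) * c) \<in> borel_measurable borel"
      using borel_measurable_continuous_onI[OF h(1)] by measurable
    have "(LINT x|m. cmod (indicator A x *\<^sub>R c - of_real (h x) * c)) \<le> (LINT x|m. indicator (U - K) x * cmod c)"
    proof (rule integral_mono[OF _ i1 le])
      show "integrable m (\<lambda>x. cmod (indicator A x *\<^sub>R c - of_real (h x) * c))"
        by (rule Bochner_Integration.integrable_bound[OF i1]) (use A hm le in \<open>auto simp: measurable_m intro: order_trans\<close>)
    qed
    also have "\<dots> = measure m (U - K) * cmod c" using Kb by simp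
    also have "\<dots> \<le> 2 * d * cmod c" using UK by (intro mult_right_mono) auto
    also have "\<dots> < e"
    proof -
      have "2 * (e / 2 / x) * y = e * (y / x)" for x y :: real by simp
      then have "2 * d * cmod c = e * (cmod c / (cmod c + 1))" unfolding d_def .
      also have "\<dots> < e * 1"
        using e by (intro mult_strict_left_mono) (auto simp: divide_less_eq add_nonneg_pos)
      finally show ?thesis by simp
    qed
    finally show "\<exists>h. continuous_on UNIV h \<and> (LINT x|m. cmod (indicator A x *\<^sub>R c - h x)) < e"
      by (intro exI[of _ "\<lambda>x. of_real (h x) * c"] conjI continuous_intros h(1))
  qed
next
  case (add f g)
  show ?case
  proof (intro allI impI)
    fix e :: real assume e: "0 < e"
    obtain h where h: "continuous_on UNIV h" "(LINT x|m. cmod (f x - h x)) < e / 2"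
      using add(2) e by (meson half_gt_zero)
    obtain k where k: "continuous_on UNIV k" "(LINT x|m. cmod (g x - k x)) < e / 2"
      using add(4) e by (meson half_gt_zero)
    have ih: "integrable m (\<lambda>x. cmod (f x - h x))" "integrable m (\<lambda>x. cmod (g x - k x))"
      using add integrable_continuous[OF h(1)] integrable_continuous[OF k(1)] by auto
    have "(LINT x|m. cmod (f x + g x - (h x + k x))) \<le> (LINT x|m. cmod (f x - h x) + cmod (g x - k x))"
    proof (rule integral_mono)
      show "cmod (f x + g x - (h x + k x)) \<le> cmod (f x - h x) + cmod (g x - k x)" for x
        using norm_triangle_ineq[of "f x - h x" "g x - k x"] by (simp add: algebra_simps)
    qed (use add ih integrable_continuous[OF h(1)] integrable_continuous[OF k(1)] in auto)
    also have "\<dots> < e" using h k ih by simp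
    finally show "\<exists>h. continuous_on UNIV h \<and> (LINT x|m. cmod (f x + g x - h x)) < e"
      by (intro exI[of _ "\<lambda>x. h x + k x"] conjI continuous_intros h(1) k(1))
  qed
next
  case (lim f s)
  show ?case
  proof (intro allI impI)
    fix e :: real assume e: "0 < e"
    have "(\<lambda>i. LINT x|m. cmod (f x - s i x)) \<longlonglongrightarrow> (LINT x|m. 0)"
    proof (rule integral_dominated_convergence)
      show "integrable m (\<lambda>x. 3 * cmod (f x))" using lim by simp
      show "AE x in m. (\<lambda>i. cmod (f x - s i x)) \<longlonglongrightarrow> 0"
        using lim(3) by (intro AE_I2 tendsto_eq_intros) auto
      show "AE x in m. norm (cmod (f x - s i x)) \<le> 3 * cmod (f x)" for i
      proof (intro AE_I2)
        fix x
        have "cmod (f x - s i x) \<le> cmod (f x) + cmod (s i x)" by (rule norm_triangle_ineq4)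
        then show "norm (cmod (f x - s i x)) \<le> 3 * cmod (f x)" using lim(4)[of x i] by simp
      qed
    qed (use lim in auto)
    then have "\<forall>\<^sub>F i in sequentially. (LINT x|m. cmod (f x - s i x)) < e / 2"
      using e by (intro order_tendstoD(2)[where y = 0]) auto
    then obtain i where i: "(LINT x|m. cmod (f x - s i x)) < e / 2" by (auto simp: eventually_sequentially)
    obtain h where h: "continuous_on UNIV h" "(LINT x|m. cmod (s i x - h x)) < e / 2"
      using lim(2)[of i] e by (meson half_gt_zero)
    note ih = integrable_continuous[OF h(1)]
    have "(LINT x|m. cmod (f x - h x)) \<le> (LINT x|m. cmod (f x - s i x) + cmod (s i x - h x))"
    proof (rule integral_mono)
      show "cmod (f x - h x) \<le> cmod (f x - s i x) + cmod (s i x - h x)" for x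
        using norm_triangle_ineq[of "f x - s i x" "s i x - h x"] by simp
    qed (use lim ih in auto)
    also have "\<dots> < e" using h i ih lim by simp
    finally show "\<exists>h. continuous_on UNIV h \<and> (LINT x|m. cmod (f x - h x)) < e" using h(1) by blast
  qed
qed


text \<open>The nearest-point projection onto the ball of radius \<open>K\<close> is 1-Lipschitz and
  fixes the values of \<open>f\<close>, so it enforces the bound without increasing the
  error.\<close>

lemma continuous_dense_bounded:
  fixes f :: "'g \<Rightarrow> complex"
  assumes f: "f \<in> borel_measurable borel" "\<And>x. cmod (f x) \<le> K" and K: "0 < K" and e: "0 < e"
  obtains h where "continuous_on UNIV h" "\<And>x. cmod (h x) \<le> K" "(LINT x|m. cmod (f x - h x)) < e"
proof -
  have fi: "integrable m f" using f by (intro integrable_const_bound[of _ K]) (auto simp: measurable_m)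
  obtain h where h: "continuous_on UNIV h" "(LINT x|m. cmod (f x - h x)) < e"
    using continuous_dense_L1[OF fi] e by auto
  let ?c = "closest_point (cball 0 K :: complex set)"
  have ne: "cball 0 K \<noteq> ({} :: complex set)" using K by simp
  show ?thesis
  proof (rule that[of "\<lambda>x. ?c (h x)"])
    show cont: "continuous_on UNIV (\<lambda>x. ?c (h x))"
      by (rule continuous_on_compose2[OF continuous_on_closest_point[OF _ _ ne, of UNIV] h(1)]) auto
    show "cmod (?c (h x)) \<le> K" for x
      using closest_point_in_set[of "cball 0 K :: complex set" "h x"] ne by simp
    have "(LINT x|m. cmod (f x - ?c (h x))) \<le> (LINT x|m. cmod (f x - h x))"
    proof (rule integral_mono)
      fix x
      have "f x = ?c (f x)" using f(2)[of x] by (intro closest_point_self[symmetric]) simp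
      then show "cmod (f x - ?c (h x)) \<le> cmod (f x - h x)"
        using closest_point_lipschitz[OF _ _ ne, of "f x" "h x"] by (simp add: dist_norm)
    qed (use fi integrable_continuous[OF h(1)] integrable_continuous[OF cont] in auto)
    then show "(LINT x|m. cmod (f x - ?c (h x))) < e" using h(2) by simp
  qed
qed

lemma Lp_norm_finite_eq:
  "p \<noteq> \<infinity> \<Longrightarrow> Lp_norm m p f = (let I = (\<integral>\<^sup>+ t. ennreal (cmod (f t) powr enn2real p) \<partial>m)
           in if I = \<infinity> then \<infinity> else ennreal (enn2real I powr (1 / enn2real p)))"
  by (simp add: Lp_norm_def)

text \<open>Truncate \<open>f\<close>, then approximate the bounded truncation in mean by functions
  with the same bound. Since the difference is at most \<open>2 * n\<close>, its power with exponent
  \<open>P\<close> is at most \<open>(2 * n) powr (P - 1)\<close> times the difference, so small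
  mean error becomes small error in the norm of \<open>p\<close>.\<close>

lemma continuous_dense_Lp:
  fixes f :: "'g \<Rightarrow> complex"
  assumes p: "1 \<le> p" "p < \<infinity>" and f: "f \<in> Lp_space m p" and e: "0 < e"
  obtains h where "continuous_on UNIV h" "Lp_norm m p (\<lambda>x. f x - h x) < ennreal e"
proof -
  define P where "P = enn2real p"
  have P: "1 \<le> P" using enn2real_inverse_finite[OF p] by (simp add: P_def)
  have pi: "p \<noteq> \<infinity>" using p by auto
  have fm [measurable]: "f \<in> borel_measurable borel" using f by (simp add: Lp_space_def measurable_m)
  have fin: "(\<integral>\<^sup>+ t. ennreal (cmod (f t) powr P) \<partial>m) < \<infinity>"
    using f pi by (auto simp: Lp_space_def Lp_norm_def P_def Let_def less_top split: if_splits)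
  \<comment> \<open>Chosen so that
    \<open>2 powr P * (\<eta> + \<eta>) = (e / 2) powr P\<close>.\<close>
  define \<eta> where "\<eta> = (e / 2) powr P / (2 * 2 powr P)"
  have \<eta>: "0 < \<eta>" using e by (simp add: \<eta>_def)
  define T where "T n x = (if cmod (f x) \<le> real n then f x else 0)" for n x
  have Tm [measurable]: "T n \<in> borel_measurable borel" for n unfolding T_def by measurable
  have "(\<lambda>n. \<integral>\<^sup>+ x. ennreal (cmod (f x - T n x) powr P) \<partial>m) \<longlonglongrightarrow> (\<integral>\<^sup>+ x. 0 \<partial>m)"
  proof (rule nn_integral_dominated_convergence[where w = "\<lambda>x. ennreal (cmod (f x) powr P)"])
    show "AE x in m. (\<lambda>n. ennreal (cmod (f x - T n x) powr P)) \<longlonglongrightarrow> 0"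
    proof (intro AE_I2 tendsto_eventually)
      fix x
      obtain N where N: "cmod (f x) \<le> real N" using real_arch_simple by blast
      have "ennreal (cmod (f x - T n x) powr P) = 0" if "n \<ge> N" for n
        using N that by (simp add: T_def)
      then show "\<forall>\<^sub>F n in sequentially. ennreal (cmod (f x - T n x) powr P) = 0"
        by (auto simp: eventually_sequentially)
    qed
  qed (use fin in \<open>auto simp: measurable_m T_def\<close>)
  then have "\<forall>\<^sub>F n in sequentially. (\<integral>\<^sup>+ x. ennreal (cmod (f x - T n x) powr P) \<partial>m) < ennreal \<eta>"
    using \<eta> by (intro order_tendstoD(2)[where y = 0]) auto
  then obtain n0 where n0: "\<And>n. n \<ge> n0 \<Longrightarrow> (\<integral>\<^sup>+ x. ennreal (cmod (f x - T n x) powr P) \<partial>m) < ennreal \<eta>"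
    by (auto simp: eventually_sequentially)
  \<comment> \<open>The successor makes the truncation level positive.\<close>
  define n where "n = Suc n0"
  have n: "(\<integral>\<^sup>+ x. ennreal (cmod (f x - T n x) powr P) \<partial>m) < ennreal \<eta>" by (rule n0) (simp add: n_def)
  define c where "c = (2 * real n) powr (P - 1)"
  have c: "0 < c" by (simp add: c_def n_def)
  have Tb: "cmod (T n x) \<le> real n" for x by (simp add: T_def)
  have np: "0 < real n" and ec: "0 < \<eta> / c" using \<eta> c by (auto simp: n_def)
  obtain h where h: "continuous_on UNIV h" "\<And>x. cmod (h x) \<le> real n" "(LINT x|m. cmod (T n x - h x)) < \<eta> / c"
    by (rule continuous_dense_bounded[OF Tm Tb np ec]) (rule that)
  have hm [measurable]: "h \<in> borel_measurable borel" by (rule borel_measurable_continuous_onI[OF h(1)])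
  have Th: "cmod (T n x - h x) powr P \<le> c * cmod (T n x - h x)" for x
  proof (cases "T n x = h x")
    case False
    have "cmod (T n x - h x) \<le> 2 * real n"
      using norm_triangle_ineq4[of "T n x" "h x"] h(2)[of x] by (simp add: T_def split: if_splits)
    then have "cmod (T n x - h x) powr (P - 1) \<le> c" unfolding c_def using P by (intro powr_mono2) auto
    then have "cmod (T n x - h x) powr (P - 1) * cmod (T n x - h x) \<le> c * cmod (T n x - h x)"
      by (rule mult_right_mono) simp
    moreover have "cmod (T n x - h x) powr (P - 1) * cmod (T n x - h x) = cmod (T n x - h x) powr P"
      using False by (simp add: powr_mult_base[of "cmod (T n x - h x)" "P - 1"] mult.commute)
    ultimately show ?thesis by simp
  qed simp
  have iTh: "integrable m (\<lambda>x. cmod (T n x - h x))"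
  proof -
    have "integrable m (T n)"
      by (intro integrable_const_bound[of _ "real n"]) (auto simp: measurable_m T_def)
    then show ?thesis using integrable_continuous[OF h(1)] by auto
  qed
  have "(\<integral>\<^sup>+ x. ennreal (cmod (T n x - h x) powr P) \<partial>m) \<le> (\<integral>\<^sup>+ x. ennreal (c * cmod (T n x - h x)) \<partial>m)"
    by (intro nn_integral_mono ennreal_leI Th)
  also have "\<dots> = ennreal (c * (LINT x|m. cmod (T n x - h x)))"
    using c iTh by (subst nn_integral_eq_integral) auto
  also have "\<dots> < ennreal \<eta>"
    using h(3) c \<eta> by (intro ennreal_lessI) (auto simp: field_simps)
  finally have Th': "(\<integral>\<^sup>+ x. ennreal (cmod (T n x - h x) powr P) \<partial>m) < ennreal \<eta>" .
  have split: "cmod (f x - h x) powr P \<le> 2 powr P * (cmod (f x - T n x) powr P + cmod (T n x - h x) powr P)" for x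
  proof -
    let ?a = "cmod (f x - T n x)" and ?b = "cmod (T n x - h x)"
    have "cmod (f x - h x) \<le> ?a + ?b"
      using norm_triangle_ineq[of "f x - T n x" "T n x - h x"] by simp
    also have "\<dots> \<le> 2 * max ?a ?b" by simp
    finally have "cmod (f x - h x) powr P \<le> (2 * max ?a ?b) powr P" using P by (intro powr_mono2) auto
    also have "\<dots> = 2 powr P * max ?a ?b powr P" by (simp add: powr_mult)
    also have "max ?a ?b powr P \<le> ?a powr P + ?b powr P" by (simp add: max_def)
    finally show ?thesis by simp
  qed
  have "(\<integral>\<^sup>+ x. ennreal (cmod (f x - h x) powr P) \<partial>m) \<le>
      (\<integral>\<^sup>+ x. ennreal (2 powr P) * (ennreal (cmod (f x - T n x) powr P) + ennreal (cmod (T n x - h x) powr P)) \<partial>m)"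
    by (intro nn_integral_mono) (use split in \<open>simp add: ennreal_leI flip: ennreal_mult' ennreal_plus\<close>)
  also have "\<dots> = ennreal (2 powr P) * ((\<integral>\<^sup>+ x. ennreal (cmod (f x - T n x) powr P) \<partial>m) + (\<integral>\<^sup>+ x. ennreal (cmod (T n x - h x) powr P) \<partial>m))"
    by (subst nn_integral_cmult, simp add: measurable_m, subst nn_integral_add) (auto simp: measurable_m)
  also have "\<dots> \<le> ennreal (2 powr P) * (ennreal \<eta> + ennreal \<eta>)"
    using n Th' by (intro mult_left_mono add_mono) auto
  also have "\<dots> = ennreal ((e / 2) powr P)"
    using \<eta> by (simp add: \<eta>_def flip: ennreal_mult' ennreal_plus)
  finally have I: "(\<integral>\<^sup>+ x. ennreal (cmod (f x - h x) powr P) \<partial>m) \<le> ennreal ((e / 2) powr P)" .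
  then have Ifin: "(\<integral>\<^sup>+ x. ennreal (cmod (f x - h x) powr P) \<partial>m) \<noteq> \<infinity>" by (auto simp: top_unique)
  have "enn2real (\<integral>\<^sup>+ x. ennreal (cmod (f x - h x) powr P) \<partial>m) \<le> (e / 2) powr P"
    by (rule enn2real_leI[OF _ I]) simp
  then have "enn2real (\<integral>\<^sup>+ x. ennreal (cmod (f x - h x) powr P) \<partial>m) powr (1 / P) \<le> ((e / 2) powr P) powr (1 / P)"
    using P by (intro powr_mono2) auto
  also have "\<dots> = e / 2" using P e by (simp add: powr_powr)
  also have "\<dots> < e" using e by simp
  finally have "Lp_norm m p (\<lambda>x. f x - h x) < ennreal e"
    using Ifin e by (simp add: Lp_norm_finite_eq[OF pi] Let_def ennreal_lessI flip: P_def)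
  with h(1) show ?thesis by (rule that)
qed

end

section \<open>Integration with respect to a vector measure\<close>

lemma integrable_bounded_mult:
  fixes g u :: "'g::topological_space \<Rightarrow> complex"
  assumes "integrable (total_variation \<kappa>) g" "u \<in> borel_measurable borel" "\<And>s. cmod (u s) \<le> K"
  shows "integrable (total_variation \<kappa>) (\<lambda>s. u s * g s)"
proof (rule Bochner_Integration.integrable_bound)
  show "integrable (total_variation \<kappa>) (\<lambda>s. of_real K * g s)" using assms(1) by simp
  have "u \<in> borel_measurable (total_variation \<kappa>)" using assms(2) by (simp cong: measurable_cong_sets)
  then show "(\<lambda>s. u s * g s) \<in> borel_measurable (total_variation \<kappa>)" using assms(1) by simp
  have "0 \<le> K" using assms(3) norm_ge_zero order_trans by blast
  then show "AE s in total_variation \<kappa>. cmod (u s * g s) \<le> cmod (of_real K * g s)"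
    using assms(3) by (auto simp: norm_mult intro!: mult_right_mono)
qed

lemma integrable_indicator_mult:
  fixes g :: "'g::topological_space \<Rightarrow> complex"
  assumes "integrable (total_variation \<kappa>) g" "A \<in> sets borel"
  shows "integrable (total_variation \<kappa>) (\<lambda>s. indicator A s * g s)"
  using assms by (intro integrable_bounded_mult[of _ _ _ 1]) (auto simp: indicator_def)

section \<open>The integral against a complex measure\<close>

context
  fixes \<kappa> :: "'g::topological_space set \<Rightarrow> complex"
  assumes vm: "vector_measure \<kappa>"
begin

lemma complex_integral_indicator:
  assumes A: "A \<in> sets borel"
  shows "complex_integral \<kappa> (indicator A) = \<kappa> A"
proof -
  interpret finite_measure "total_variation \<kappa>" by (rule finite_measure_total_variation[OF vm])
  obtain u where u: "\<And>h. integrable (total_variation \<kappa>) h \<Longrightarrow> complex_integral \<kappa> h = (LINT s|total_variation \<kappa>. u s * h s)"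
    "\<And>A. A \<in> sets borel \<Longrightarrow> \<kappa> A = (LINT s|total_variation \<kappa>. indicator A s * u s)"
    by (rule polar_decomposition[OF vm]) (rule that)
  have "integrable (total_variation \<kappa>) (indicator A :: _ \<Rightarrow> complex)"
    using integrable_indicator_mult[OF integrable_const[of "1 :: complex"] A] by simp
  then show ?thesis by (simp add: u(1) u(2)[OF A] mult.commute)
qed

context
  fixes h :: "'g \<Rightarrow> complex"
  assumes h: "integrable (total_variation \<kappa>) h"
begin

text \<open>The definition through Jordan parts would lose a constant here; the unimodular polar
  factor turns it into a single Lebesgue integral.\<close>

lemma cmod_complex_integral_le: "cmod (complex_integral \<kappa> h) \<le> (LINT s|total_variation \<kappa>. cmod (h s))"
proof -
  obtain u where u: "\<And>x. cmod (u x) = 1"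
    "\<And>h. integrable (total_variation \<kappa>) h \<Longrightarrow> complex_integral \<kappa> h = (LINT s|total_variation \<kappa>. u s * h s)"
    by (rule polar_decomposition[OF vm]) (rule that)
  have "cmod (LINT s|total_variation \<kappa>. u s * h s) \<le> (LINT s|total_variation \<kappa>. cmod (u s * h s))"
    by (rule integral_norm_bound)
  then show ?thesis by (simp add: u(2)[OF h] norm_mult u(1))
qed

lemma complex_integral_cmult: "complex_integral \<kappa> (\<lambda>s. c * h s) = c * complex_integral \<kappa> h"
proof -
  obtain u where u: "\<And>h. integrable (total_variation \<kappa>) h \<Longrightarrow> complex_integral \<kappa> h = (LINT s|total_variation \<kappa>. u s * h s)"
    by (rule polar_decomposition[OF vm]) (rule that)
  show ?thesis using h by (simp add: u mult.left_commute[of _ c])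
qed

end

lemma integrable_unimodular_mult:
  fixes u h :: "'g \<Rightarrow> complex"
  assumes "u \<in> borel_measurable borel" "\<And>x. cmod (u x) = 1" "integrable (total_variation \<kappa>) h"
  shows "integrable (total_variation \<kappa>) (\<lambda>s. u s * h s)"
  using assms
  by (intro Bochner_Integration.integrable_bound[OF assms(3)])
    (auto simp: norm_mult intro!: borel_measurable_times cong: measurable_cong_sets)

lemma complex_integral_add:
  assumes "integrable (total_variation \<kappa>) h" "integrable (total_variation \<kappa>) k"
  shows "complex_integral \<kappa> (\<lambda>s. h s + k s) = complex_integral \<kappa> h + complex_integral \<kappa> k"
proof -
  obtain u where um: "u \<in> borel_measurable borel" "\<And>x. cmod (u x) = 1"
    and u: "\<And>h. integrable (total_variation \<kappa>) h \<Longrightarrow> complex_integral \<kappa> h = (LINT s|total_variation \<kappa>. u s * h s)"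
    by (rule polar_decomposition[OF vm]) (rule that)
  show ?thesis
    using assms integrable_unimodular_mult[OF um assms(1)] integrable_unimodular_mult[OF um assms(2)]
    by (simp add: u distrib_left)
qed

lemma complex_integral_diff:
  assumes "integrable (total_variation \<kappa>) h" "integrable (total_variation \<kappa>) k"
  shows "complex_integral \<kappa> (\<lambda>s. h s - k s) = complex_integral \<kappa> h - complex_integral \<kappa> k"
  using complex_integral_add[OF assms(1) integrable_minus[OF assms(2)]] complex_integral_cmult[OF assms(2), of "-1"]
  by simp

lemma complex_integral_sum:
  assumes "finite I" "\<And>i. i \<in> I \<Longrightarrow> integrable (total_variation \<kappa>) (h i)"
  shows "complex_integral \<kappa> (\<lambda>s. \<Sum>i\<in>I. h i s) = (\<Sum>i\<in>I. complex_integral \<kappa> (h i))"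
  using assms
proof (induction I rule: finite_induct)
  case empty
  have "complex_integral \<kappa> (\<lambda>s. 0 * 0) = 0 * complex_integral \<kappa> (\<lambda>s. 0)"
    by (rule complex_integral_cmult) simp
  then show ?case by simp
next
  case (insert i I)
  then show ?case by (simp add: complex_integral_add)
qed

lemma complex_integral_cong_AE:
  assumes "integrable (total_variation \<kappa>) h" "k \<in> borel_measurable borel"
    "AE s in total_variation \<kappa>. h s = k s"
  shows "integrable (total_variation \<kappa>) k" "complex_integral \<kappa> h = complex_integral \<kappa> k"
proof -
  have k: "k \<in> borel_measurable (total_variation \<kappa>)" using assms(2) by (simp cong: measurable_cong_sets)
  show i: "integrable (total_variation \<kappa>) k"
    using assms integrable_cong_AE[OF borel_measurable_integrable[OF assms(1)] k assms(3)] by simp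
  obtain u where um [measurable]: "u \<in> borel_measurable borel"
    and u: "\<And>h. integrable (total_variation \<kappa>) h \<Longrightarrow> complex_integral \<kappa> h = (LINT s|total_variation \<kappa>. u s * h s)"
    by (rule polar_decomposition[OF vm]) (rule that)
  have um': "u \<in> borel_measurable (total_variation \<kappa>)" using um by (simp cong: measurable_cong_sets)
  show "complex_integral \<kappa> h = complex_integral \<kappa> k"
    unfolding u[OF assms(1)] u[OF i]
  proof (rule integral_cong_AE)
    show "AE s in total_variation \<kappa>. u s * h s = u s * k s" using assms(3) by eventually_elim simp
  qed (use um' k borel_measurable_integrable[OF assms(1)] in auto)
qed

text \<open>The modulus of a complex number is at most the sum of the positive and negative parts of its
  real and imaginary parts, each of which is integrated over a suitable set.\<close>

lemma integral_norm_le_of_complex_integral: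
  assumes h: "integrable (total_variation \<kappa>) h"
    and B: "\<And>A. A \<in> sets borel \<Longrightarrow> cmod (complex_integral \<kappa> (\<lambda>s. indicator A s * h s)) \<le> B"
  shows "(LINT s|total_variation \<kappa>. cmod (h s)) \<le> 4 * B"
proof -
  let ?\<tau> = "total_variation \<kappa>"
  obtain u where um [measurable]: "u \<in> borel_measurable borel" "\<And>x. cmod (u x) = 1"
    and u: "\<And>h. integrable ?\<tau> h \<Longrightarrow> complex_integral \<kappa> h = (LINT s|?\<tau>. u s * h s)"
    by (rule polar_decomposition[OF vm]) (rule that)
  define k where "k s = u s * h s" for s
  have k: "integrable ?\<tau> k" unfolding k_def by (rule integrable_unimodular_mult[OF um h])
  have km [measurable]: "k \<in> borel_measurable borel"
    using borel_measurable_integrable[OF k] by (simp cong: measurable_cong_sets)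
  have ik: "integrable ?\<tau> (\<lambda>s. indicator A s * k s)" if "A \<in> sets borel" for A
    using integrable_indicator_mult[OF k that] .
  have le: "cmod (LINT s|?\<tau>. indicator A s * k s) \<le> B" if A: "A \<in> sets borel" for A
  proof -
    have "integrable ?\<tau> (\<lambda>s. indicator A s * h s)"
      using integrable_indicator_mult[OF h A] .
    then show ?thesis using B[OF A] by (simp add: u k_def mult.left_commute)
  qed
  have part: "(LINT s|?\<tau>. max 0 (l (k s))) \<le> B" and ipart: "integrable ?\<tau> (\<lambda>s. max 0 (l (k s)))"
    if l: "bounded_linear l" "\<And>z. l z \<le> cmod z" for l :: "complex \<Rightarrow> real"
  proof -
    have [measurable]: "(\<lambda>s. l (k s)) \<in> borel_measurable borel"
      using km borel_measurable_continuous_onI[OF linear_continuous_on[OF l(1)]] by (rule measurable_compose)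
    \<comment> \<open>Restricting to the set where the component \<open>l\<close> is positive turns
      its positive part into \<open>l\<close> of one set integral, to which the hypothesis
      applies.\<close>
    define A where "A = {s. 0 < l (k s)}"
    have A: "A \<in> sets borel" unfolding A_def by measurable
    have eq: "max 0 (l (k s)) = l (indicator A s * k s)" for s
      by (auto simp: A_def indicator_def linear_0[OF bounded_linear.linear[OF l(1)]])
    show "integrable ?\<tau> (\<lambda>s. max 0 (l (k s)))"
      unfolding eq by (rule integrable_bounded_linear[OF l(1) ik[OF A]])
    have "(LINT s|?\<tau>. max 0 (l (k s))) = l (LINT s|?\<tau>. indicator A s * k s)"
      unfolding eq by (rule integral_bounded_linear[OF l(1) ik[OF A]])
    also have "\<dots> \<le> B" using l(2) le[OF A] by (rule order_trans)
    finally show "(LINT s|?\<tau>. max 0 (l (k s))) \<le> B" .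
  qed
  have l: "bounded_linear Re" "bounded_linear Im" "bounded_linear (\<lambda>z. - Re z)" "bounded_linear (\<lambda>z. - Im z)"
    by (auto intro!: bounded_linear_intros bounded_linear_Re bounded_linear_Im bounded_linear_minus)
  have l': "Re z \<le> cmod z" "Im z \<le> cmod z" "- Re z \<le> cmod z" "- Im z \<le> cmod z" for z
    using abs_Re_le_cmod[of z] abs_Im_le_cmod[of z] by auto
  note P = part[OF l(1) l'(1)] part[OF l(2) l'(2)] part[OF l(3) l'(3)] part[OF l(4) l'(4)]
  note I = ipart[OF l(1) l'(1)] ipart[OF l(2) l'(2)] ipart[OF l(3) l'(3)] ipart[OF l(4) l'(4)]
  have "(LINT s|?\<tau>. cmod (h s)) = (LINT s|?\<tau>. cmod (k s))" by (simp add: k_def norm_mult um(2))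
  also have "\<dots> \<le> (LINT s|?\<tau>. (max 0 (Re (k s)) + max 0 (Im (k s))) + (max 0 (- Re (k s)) + max 0 (- Im (k s))))"
  proof (rule integral_mono)
    show "cmod (k s) \<le> (max 0 (Re (k s)) + max 0 (Im (k s))) + (max 0 (- Re (k s)) + max 0 (- Im (k s)))" for s
      using cmod_le[of "k s"] by (auto simp: max_def)
  qed (use k I in auto)
  also have "\<dots> = ((LINT s|?\<tau>. max 0 (Re (k s))) + (LINT s|?\<tau>. max 0 (Im (k s))))
      + ((LINT s|?\<tau>. max 0 (- Re (k s))) + (LINT s|?\<tau>. max 0 (- Im (k s))))"
    using I by simp
  finally show ?thesis using P by linarith
qed

end

lemma vector_measure_pairing: "vector_measure \<nu> \<Longrightarrow> \<phi> \<in> cdual \<Longrightarrow> vector_measure (pairing \<nu> \<phi>)"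
  unfolding pairing_def by (rule vector_measure_bounded_linear_image[OF _ cdual_bounded_linear])

lemma cdual_le_onorm: "\<phi> \<in> cdual \<Longrightarrow> cmod (\<phi> x) \<le> onorm \<phi> * norm x"
  by (rule onorm[OF cdual_bounded_linear])

lemma cdual_onorm_nonneg: "\<phi> \<in> cdual \<Longrightarrow> 0 \<le> onorm \<phi>"
  by (rule onorm_pos_le[OF cdual_bounded_linear])

lemma cdual_diff: "\<phi> \<in> cdual \<Longrightarrow> \<phi> (x - y) = \<phi> x - \<phi> y"
  and cdual_sum: "\<phi> \<in> cdual \<Longrightarrow> \<phi> (\<Sum>i\<in>I. f i) = (\<Sum>i\<in>I. \<phi> (f i))"
  by (auto intro: linear_diff linear_sum bounded_linear.linear cdual_bounded_linear)

lemma is_vector_integral_UNIV: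
  "is_vector_integral \<nu> UNIV w v \<longleftrightarrow> (\<forall>\<phi>\<in>cdual. \<phi> v = complex_integral (pairing \<nu> \<phi>) w)"
  by (simp add: is_vector_integral_def)

lemma is_vector_integral_unique:
  "is_vector_integral \<nu> A w v \<Longrightarrow> is_vector_integral \<nu> A w v' \<Longrightarrow> v = v'"
  unfolding is_vector_integral_def by (intro cdual_separates) auto

lemma L1_vectorI:
  assumes "w \<in> borel_measurable borel"
    "\<And>\<phi>. \<phi> \<in> cdual \<Longrightarrow> integrable (total_variation (pairing \<nu> \<phi>)) w"
    "\<And>A. A \<in> sets borel \<Longrightarrow> \<exists>v. is_vector_integral \<nu> A w v"
  shows "w \<in> L1_vector \<nu>"
  unfolding L1_vector_def using assms is_vector_integral_unique by blast

lemma L1_vectorD: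
  assumes "g \<in> L1_vector \<nu>"
  shows "g \<in> borel_measurable borel" "\<phi> \<in> cdual \<Longrightarrow> integrable (total_variation (pairing \<nu> \<phi>)) g"
  using assms by (auto simp: L1_vector_def)

lemma vector_integral_L1_vector:
  "g \<in> L1_vector \<nu> \<Longrightarrow> A \<in> sets borel \<Longrightarrow> is_vector_integral \<nu> A g (vector_integral \<nu> A g)"
  unfolding vector_integral_def L1_vector_def by (blast intro: theI')

section \<open>Existence of integrals with values in a Banach space\<close>

context
  fixes \<nu> :: "'g::topological_space set \<Rightarrow> 'x::complex_banach"
  assumes vm: "vector_measure \<nu>"
begin

text \<open>The error bound is uniform on the unit ball of the dual, so by norming functionals the
  integrals \<open>V n\<close> form a Cauchy sequence in norm. Completeness supplies the vector,
  which every functional identifies as the integral of \<open>w\<close>.\<close>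

lemma is_vector_integral_limit:
  assumes w: "\<And>\<phi>. \<phi> \<in> cdual \<Longrightarrow> integrable (total_variation (pairing \<nu> \<phi>)) w"
    and wn: "\<And>\<phi> n. \<phi> \<in> cdual \<Longrightarrow> integrable (total_variation (pairing \<nu> \<phi>)) (w' n)"
    and V: "\<And>n. is_vector_integral \<nu> UNIV (w' n) (V n)"
    and e: "e \<longlonglongrightarrow> 0"
    and le: "\<And>\<phi> n. \<phi> \<in> cdual \<Longrightarrow>
      (LINT s|total_variation (pairing \<nu> \<phi>). cmod (w s - w' n s)) \<le> onorm \<phi> * e n"
  shows "\<exists>v. is_vector_integral \<nu> UNIV w v"
proof -
  have \<phi>V: "\<phi> (V n) = complex_integral (pairing \<nu> \<phi>) (w' n)" if "\<phi> \<in> cdual" for \<phi> n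
    using V that by (simp add: is_vector_integral_UNIV)
  have dist: "cmod (complex_integral (pairing \<nu> \<phi>) w - \<phi> (V n)) \<le> onorm \<phi> * e n" if \<phi>: "\<phi> \<in> cdual" for \<phi> n
  proof -
    note vp = vector_measure_pairing[OF vm \<phi>]
    have "complex_integral (pairing \<nu> \<phi>) w - \<phi> (V n) = complex_integral (pairing \<nu> \<phi>) (\<lambda>s. w s - w' n s)"
      by (simp add: \<phi>V[OF \<phi>] complex_integral_diff[OF vp w[OF \<phi>] wn[OF \<phi>]])
    also have "cmod \<dots> \<le> (LINT s|total_variation (pairing \<nu> \<phi>). cmod (w s - w' n s))"
      using w[OF \<phi>] wn[OF \<phi>] by (intro cmod_complex_integral_le[OF vp]) auto
    also have "\<dots> \<le> onorm \<phi> * e n" by (rule le[OF \<phi>])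
    finally show ?thesis .
  qed
  have "Cauchy V"
  proof (rule metric_CauchyI)
    fix \<epsilon> :: real assume "0 < \<epsilon>"
    then have "\<forall>\<^sub>F n in sequentially. \<bar>e n\<bar> < \<epsilon> / 2"
      using tendstoD[OF e, of "\<epsilon> / 2"] by simp
    then obtain N where N: "\<And>n. n \<ge> N \<Longrightarrow> \<bar>e n\<bar> < \<epsilon> / 2" by (auto simp: eventually_sequentially)
    have "norm (V i - V j) \<le> \<bar>e i\<bar> + \<bar>e j\<bar>" for i j
    proof (rule norm_le_cdual_ball)
      fix \<phi> :: "'x \<Rightarrow> complex" assume b: "\<phi> \<in> cdual_ball"
      then have \<phi>: "\<phi> \<in> cdual" and o: "onorm \<phi> \<le> 1" by (auto simp: cdual_ball_def)
      have oe: "onorm \<phi> * e n \<le> \<bar>e n\<bar>" for n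
      proof -
        have "onorm \<phi> * e n \<le> onorm \<phi> * \<bar>e n\<bar>"
          using cdual_onorm_nonneg[OF \<phi>] by (intro mult_left_mono) auto
        also have "\<dots> \<le> 1 * \<bar>e n\<bar>" using o by (intro mult_right_mono) auto
        finally show ?thesis by simp
      qed
      let ?c = "complex_integral (pairing \<nu> \<phi>) w"
      have "\<phi> (V i - V j) = (?c - \<phi> (V j)) - (?c - \<phi> (V i))" by (simp add: cdual_diff[OF \<phi>])
      then have "cmod (\<phi> (V i - V j)) \<le> cmod (?c - \<phi> (V j)) + cmod (?c - \<phi> (V i))"
        by (metis norm_triangle_ineq4)
      then show "cmod (\<phi> (V i - V j)) \<le> \<bar>e i\<bar> + \<bar>e j\<bar>"
        using dist[OF \<phi>, of i] dist[OF \<phi>, of j] oe[of i] oe[of j] by linarith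
    qed
    note VV = this
    have "dist (V i) (V j) < \<epsilon>" if "i \<ge> N" "j \<ge> N" for i j
      using VV[of i j] N[OF that(1)] N[OF that(2)] unfolding dist_norm by linarith
    then show "\<exists>M. \<forall>i\<ge>M. \<forall>j\<ge>M. dist (V i) (V j) < \<epsilon>" by blast
  qed
  then obtain v where v: "V \<longlonglongrightarrow> v" using Cauchy_convergent convergent_def by blast
  have "\<phi> v = complex_integral (pairing \<nu> \<phi>) w" if \<phi>: "\<phi> \<in> cdual" for \<phi>
  proof (rule LIMSEQ_unique)
    show "(\<lambda>n. \<phi> (V n)) \<longlonglongrightarrow> \<phi> v"
      by (rule bounded_linear.tendsto[OF cdual_bounded_linear[OF \<phi>] v])
    have "(\<lambda>n. complex_integral (pairing \<nu> \<phi>) w - \<phi> (V n)) \<longlonglongrightarrow> 0"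
    proof (rule Lim_null_comparison)
      show "\<forall>\<^sub>F n in sequentially. norm (complex_integral (pairing \<nu> \<phi>) w - \<phi> (V n)) \<le> onorm \<phi> * e n"
        using dist[OF \<phi>] by simp
      show "(\<lambda>n. onorm \<phi> * e n) \<longlonglongrightarrow> 0" using tendsto_mult_right_zero[OF e] .
    qed
    then show "(\<lambda>n. \<phi> (V n)) \<longlonglongrightarrow> complex_integral (pairing \<nu> \<phi>) w"
      using tendsto_diff[OF tendsto_const[of "complex_integral (pairing \<nu> \<phi>) w"]] by fastforce
  qed
  then show ?thesis by (auto simp: is_vector_integral_UNIV)
qed

text \<open>The vectors given by the integrals of \<open>g\<close> over Borel sets are weakly
  bounded, as each functional is bounded on them by its own integral of the modulus. Hence they are
  bounded in norm, and values over all Borel sets control the integral of the modulus up to the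
  factor 4.\<close>

lemma L1_vector_bound:
  assumes g: "g \<in> L1_vector \<nu>"
  obtains C where "C \<ge> 0" "\<And>\<phi>. \<phi> \<in> cdual \<Longrightarrow> (LINT s|total_variation (pairing \<nu> \<phi>). cmod (g s)) \<le> onorm \<phi> * C"
proof -
  let ?v = "\<lambda>A. vector_integral \<nu> A g"
  have v: "\<phi> (?v A) = complex_integral (pairing \<nu> \<phi>) (\<lambda>s. indicator A s * g s)"
    if "\<phi> \<in> cdual" "A \<in> sets borel" for \<phi> A
    using vector_integral_L1_vector[OF g that(2)] that(1) by (simp add: is_vector_integral_def)
  have i: "integrable (total_variation (pairing \<nu> \<phi>)) (\<lambda>s. indicator A s * g s)"
    if "\<phi> \<in> cdual" "A \<in> sets borel" for \<phi> A
    using that by (intro integrable_indicator_mult L1_vectorD(2)[OF g])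
  have wb: "\<exists>B. \<forall>x\<in>?v ` sets borel. cmod (\<phi> x) \<le> B" if \<phi>: "\<phi> \<in> cdual" for \<phi>
  proof -
    have "cmod (\<phi> (?v A)) \<le> (LINT s|total_variation (pairing \<nu> \<phi>). cmod (g s))" if A: "A \<in> sets borel" for A
    proof -
      have "cmod (\<phi> (?v A)) \<le> (LINT s|total_variation (pairing \<nu> \<phi>). cmod (indicator A s * g s))"
        unfolding v[OF \<phi> A] by (intro cmod_complex_integral_le vector_measure_pairing vm \<phi> i A)
      also have "\<dots> \<le> (LINT s|total_variation (pairing \<nu> \<phi>). cmod (g s))"
        by (intro integral_mono integrable_norm i \<phi> A L1_vectorD(2)[OF g]) (auto simp: norm_mult indicator_def)
      finally show ?thesis .
    qed
    then show ?thesis by auto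
  qed
  obtain B where B: "\<And>x. x \<in> ?v ` sets borel \<Longrightarrow> norm x \<le> B"
    by (rule weakly_bounded_imp_bounded[OF wb]) (assumption | rule that)+
  show ?thesis
  proof (rule that[of "4 * B"])
    have "norm (?v {}) \<le> B" by (rule B) auto
    then show "0 \<le> 4 * B" using norm_ge_zero[of "?v {}"] by linarith
    fix \<phi> :: "'x \<Rightarrow> complex" assume \<phi>: "\<phi> \<in> cdual"
    have "(LINT s|total_variation (pairing \<nu> \<phi>). cmod (g s)) \<le> 4 * (onorm \<phi> * B)"
    proof (rule integral_norm_le_of_complex_integral[OF vector_measure_pairing[OF vm \<phi>] L1_vectorD(2)[OF g \<phi>]])
      fix A :: "'g set" assume A: "A \<in> sets borel"
      have "cmod (\<phi> (?v A)) \<le> onorm \<phi> * norm (?v A)" by (rule cdual_le_onorm[OF \<phi>])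
      also have "\<dots> \<le> onorm \<phi> * B" using A B by (intro mult_left_mono cdual_onorm_nonneg[OF \<phi>]) auto
      finally show "cmod (complex_integral (pairing \<nu> \<phi>) (\<lambda>s. indicator A s * g s)) \<le> onorm \<phi> * B"
        by (simp add: v[OF \<phi> A])
    qed
    then show "(LINT s|total_variation (pairing \<nu> \<phi>). cmod (g s)) \<le> onorm \<phi> * (4 * B)" by simp
  qed
qed

lemma nn_integral_le_L1_vector_norm:
  "\<phi> \<in> cdual_ball \<Longrightarrow> (\<integral>\<^sup>+ s. ennreal (cmod (g s)) \<partial>total_variation (pairing \<nu> \<phi>)) \<le> L1_vector_norm \<nu> g"
  unfolding L1_vector_norm_def by (rule SUP_upper)

lemma L1_vector_norm_finite:
  assumes g: "g \<in> L1_vector \<nu>"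
  shows "L1_vector_norm \<nu> g < \<infinity>"
proof -
  obtain C where C: "C \<ge> 0" "\<And>\<phi>. \<phi> \<in> cdual \<Longrightarrow> (LINT s|total_variation (pairing \<nu> \<phi>). cmod (g s)) \<le> onorm \<phi> * C"
    by (rule L1_vector_bound[OF g]) (rule that)
  have "L1_vector_norm \<nu> g \<le> ennreal C"
    unfolding L1_vector_norm_def
  proof (rule SUP_least)
    fix \<phi> :: "'x \<Rightarrow> complex" assume "\<phi> \<in> cdual_ball"
    then have \<phi>: "\<phi> \<in> cdual" and o: "onorm \<phi> \<le> 1" by (auto simp: cdual_ball_def)
    have "(\<integral>\<^sup>+ s. ennreal (cmod (g s)) \<partial>total_variation (pairing \<nu> \<phi>)) =
        ennreal (LINT s|total_variation (pairing \<nu> \<phi>). cmod (g s))"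
      by (intro nn_integral_eq_integral integrable_norm L1_vectorD(2)[OF g \<phi>]) auto
    also have "\<dots> \<le> ennreal (onorm \<phi> * C)" by (intro ennreal_leI C \<phi>)
    also have "\<dots> \<le> ennreal C" using o C(1) by (intro ennreal_leI mult_left_le_one_le cdual_onorm_nonneg \<phi>)
    finally show "(\<integral>\<^sup>+ s. ennreal (cmod (g s)) \<partial>total_variation (pairing \<nu> \<phi>)) \<le> ennreal C" .
  qed
  then show ?thesis by (rule le_less_trans) simp
qed

lemma is_vector_integral_finite_range_mult:
  assumes g: "g \<in> L1_vector \<nu>" and u: "u \<in> borel_measurable borel" "finite (range u)"
  shows "\<exists>v. is_vector_integral \<nu> UNIV (\<lambda>s. u s * g s) v"
proof -
  have A: "u -` {y} \<in> sets borel" for y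
    using measurable_sets[OF u(1), of "{y}"] by simp
  have eq: "u s * g s = (\<Sum>y\<in>range u. y * (indicator (u -` {y}) s * g s))" for s
  proof -
    have "(\<Sum>y\<in>range u. y * (indicator (u -` {y}) s * g s)) = (\<Sum>y\<in>{u s}. y * (indicator (u -` {y}) s * g s))"
      using u(2) by (intro sum.mono_neutral_right) (auto simp: indicator_def)
    then show ?thesis by simp
  qed
  have "is_vector_integral \<nu> UNIV (\<lambda>s. u s * g s) (\<Sum>y\<in>range u. y *\<^sub>C vector_integral \<nu> (u -` {y}) g)"
    unfolding is_vector_integral_UNIV
  proof
    fix \<phi> :: "'x \<Rightarrow> complex" assume \<phi>: "\<phi> \<in> cdual"
    note vp = vector_measure_pairing[OF vm \<phi>]
    have i: "integrable (total_variation (pairing \<nu> \<phi>)) (\<lambda>s. indicator (u -` {y}) s * g s)" for y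
      using A by (intro integrable_indicator_mult L1_vectorD(2)[OF g \<phi>])
    have "\<phi> (\<Sum>y\<in>range u. y *\<^sub>C vector_integral \<nu> (u -` {y}) g) =
        (\<Sum>y\<in>range u. y * complex_integral (pairing \<nu> \<phi>) (\<lambda>s. indicator (u -` {y}) s * g s))"
      using vector_integral_L1_vector[OF g A] \<phi>
      by (simp add: cdual_sum cdual_linear is_vector_integral_def)
    also have "\<dots> = complex_integral (pairing \<nu> \<phi>) (\<lambda>s. u s * g s)"
      unfolding eq using i u(2)
      by (subst complex_integral_sum[OF vp]) (auto simp: complex_integral_cmult[OF vp])
    finally show "\<phi> (\<Sum>y\<in>range u. y *\<^sub>C vector_integral \<nu> (u -` {y}) g) =
        complex_integral (pairing \<nu> \<phi>) (\<lambda>s. u s * g s)" .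
  qed
  then show ?thesis by blast
qed

text \<open>\<open>u\<close> is a uniform limit of functions of finite range, and
  \<open>L1_vector_bound\<close> makes the resulting error proportional to
  \<open>onorm \<phi>\<close>, as \<open>is_vector_integral_limit\<close> requires.\<close>

lemma is_vector_integral_bounded_mult:
  assumes g: "g \<in> L1_vector \<nu>" and u: "u \<in> borel_measurable borel" "\<And>s. cmod (u s) \<le> K"
  shows "\<exists>v. is_vector_integral \<nu> UNIV (\<lambda>s. u s * g s) v"
proof -
  \<comment> \<open>Rounding down to multiples of \<open>1 / Suc n\<close>, separately in both
    coordinates; bounded values leave finitely many grid points.\<close>
  define r where "r n x = of_int \<lfloor>real (Suc n) * x\<rfloor> / real (Suc n)" for n x
  define U where "U n s = Complex (r n (Re (u s))) (r n (Im (u s)))" for n s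
  have [measurable]: "(\<lambda>x. r n x) \<in> borel_measurable borel" for n unfolding r_def by measurable
  have Um: "U n \<in> borel_measurable borel" for n
    unfolding U_def borel_measurable_complex_iff using u(1) by auto
  have rx: "\<bar>x - r n x\<bar> \<le> 1 / Suc n" for n x
  proof -
    have "\<bar>real (Suc n) * x - of_int \<lfloor>real (Suc n) * x\<rfloor>\<bar> \<le> 1" by linarith
    moreover have "x - r n x = (real (Suc n) * x - of_int \<lfloor>real (Suc n) * x\<rfloor>) / real (Suc n)"
      by (simp add: r_def field_simps)
    ultimately show ?thesis by (simp add: divide_right_mono)
  qed
  have dU: "cmod (u s - U n s) \<le> 2 / Suc n" for n s
    using cmod_le[of "u s - U n s"] rx[of "Re (u s)" n] rx[of "Im (u s)" n] by (simp add: U_def)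
  have fin: "finite (range (U n))" for n
  proof -
    define m :: int where "m = \<lceil>real (Suc n) * K\<rceil> + 1"
    have fl: "\<lfloor>real (Suc n) * x\<rfloor> \<in> {-m..m}" if "\<bar>x\<bar> \<le> K" for x
    proof -
      have "\<bar>real (Suc n) * x\<bar> \<le> real (Suc n) * K" using that by (simp add: abs_mult mult_left_mono)
      then have "real (Suc n) * x \<le> of_int m" "of_int (- m) \<le> real (Suc n) * x"
        using le_of_int_ceiling[of "real (Suc n) * K"] unfolding m_def abs_le_iff of_int_minus of_int_add of_int_1
        by linarith+
      then show ?thesis unfolding atLeastAtMost_iff le_floor_iff floor_le_iff by simp
    qed
    have "range (U n) \<subseteq> (\<lambda>(i, j). Complex (of_int i / real (Suc n)) (of_int j / real (Suc n))) ` ({-m..m} \<times> {-m..m})"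
    proof
      fix z assume "z \<in> range (U n)"
      then obtain s where s: "z = U n s" by auto
      have "\<bar>Re (u s)\<bar> \<le> K" "\<bar>Im (u s)\<bar> \<le> K"
        using abs_Re_le_cmod[of "u s"] abs_Im_le_cmod[of "u s"] u(2)[of s] by auto
      then show "z \<in> (\<lambda>(i, j). Complex (of_int i / real (Suc n)) (of_int j / real (Suc n))) ` ({-m..m} \<times> {-m..m})"
        using fl by (intro image_eqI[of _ _ "(\<lfloor>real (Suc n) * Re (u s)\<rfloor>, \<lfloor>real (Suc n) * Im (u s)\<rfloor>)"])
          (auto simp only: s U_def r_def split_conv mem_Times_iff fst_conv snd_conv)
    qed
    then show ?thesis by (rule finite_subset) auto
  qed
  obtain V where V: "\<And>n. is_vector_integral \<nu> UNIV (\<lambda>s. U n s * g s) (V n)"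
    using is_vector_integral_finite_range_mult[OF g Um fin] by metis
  obtain C where C: "C \<ge> 0" "\<And>\<phi>. \<phi> \<in> cdual \<Longrightarrow> (LINT s|total_variation (pairing \<nu> \<phi>). cmod (g s)) \<le> onorm \<phi> * C"
    by (rule L1_vector_bound[OF g]) (rule that)
  have Ub: "cmod (U n s) \<le> K + 2" for n s
  proof -
    have "cmod (U n s) \<le> cmod (u s) + cmod (u s - U n s)"
      by (metis norm_triangle_sub norm_minus_commute)
    also have "2 / real (Suc n) \<le> 2" by (simp add: field_simps)
    then have "cmod (u s) + cmod (u s - U n s) \<le> K + 2" using dU[of s n] u(2)[of s] by linarith
    finally show ?thesis .
  qed
  have iu: "integrable (total_variation (pairing \<nu> \<phi>)) (\<lambda>s. u s * g s)"
    and iU: "integrable (total_variation (pairing \<nu> \<phi>)) (\<lambda>s. U n s * g s)" if "\<phi> \<in> cdual" for \<phi> n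
    using that by (auto intro!: integrable_bounded_mult[OF L1_vectorD(2)[OF g]] u Um Ub)
  show ?thesis
  proof (rule is_vector_integral_limit[OF iu iU V])
    show "(\<lambda>n. 2 / Suc n * C) \<longlonglongrightarrow> 0"
      using tendsto_mult_left_zero[OF tendsto_mult_right_zero[OF LIMSEQ_inverse_real_of_nat, of 2], of C]
      by (simp add: divide_inverse)
    fix \<phi> :: "'x \<Rightarrow> complex" and n assume \<phi>: "\<phi> \<in> cdual"
    have "(LINT s|total_variation (pairing \<nu> \<phi>). cmod (u s * g s - U n s * g s)) \<le>
        (LINT s|total_variation (pairing \<nu> \<phi>). 2 / Suc n * cmod (g s))"
    proof (rule integral_mono)
      show "cmod (u s * g s - U n s * g s) \<le> 2 / Suc n * cmod (g s)" for s
        using mult_right_mono[OF dU norm_ge_zero[of "g s"], of s n] by (simp add: norm_mult flip: left_diff_distrib)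
    qed (use iu[OF \<phi>] iU[OF \<phi>] L1_vectorD(2)[OF g \<phi>] in auto)
    also have "\<dots> = 2 / Suc n * (LINT s|total_variation (pairing \<nu> \<phi>). cmod (g s))" by simp
    also have "\<dots> \<le> 2 / Suc n * (onorm \<phi> * C)" by (intro mult_left_mono C \<phi>) auto
    finally show "(LINT s|total_variation (pairing \<nu> \<phi>). cmod (u s * g s - U n s * g s)) \<le> onorm \<phi> * (2 / Suc n * C)"
      by (simp add: mult_ac)
  qed
qed

text \<open>Bounded Borel functions thereby become integrable, as bounded multiples of one.\<close>

lemma one_in_L1_vector: "(\<lambda>_. 1) \<in> L1_vector \<nu>"
proof (rule L1_vectorI)
  fix \<phi> :: "'x \<Rightarrow> complex" assume "\<phi> \<in> cdual"
  then interpret finite_measure "total_variation (pairing \<nu> \<phi>)"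
    by (intro finite_measure_total_variation vector_measure_pairing vm)
  show "integrable (total_variation (pairing \<nu> \<phi>)) (\<lambda>_. 1 :: complex)" by simp
next
  fix A :: "'g set" assume "A \<in> sets borel"
  then have "is_vector_integral \<nu> A (\<lambda>_. 1) (\<nu> A)"
    using complex_integral_indicator[OF vector_measure_pairing[OF vm]]
    by (simp add: is_vector_integral_def pairing_def)
  then show "\<exists>v. is_vector_integral \<nu> A (\<lambda>_. 1) v" by blast
qed simp

text \<open>A uniform integrability criterion: truncations are bounded, hence integrable, and tails
  that vanish uniformly over the dual ball let their integrals converge in norm.\<close>

lemma L1_vector_of_truncations:
  assumes g: "g \<in> borel_measurable borel"
    and int: "\<And>\<phi>. \<phi> \<in> cdual \<Longrightarrow> integrable (total_variation (pairing \<nu> \<phi>)) g"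
    and e: "e \<longlonglongrightarrow> 0"
    and le: "\<And>\<phi> n. \<phi> \<in> cdual \<Longrightarrow> (LINT s|total_variation (pairing \<nu> \<phi>).
      indicator {s. real n < cmod (g s)} s * cmod (g s)) \<le> onorm \<phi> * e n"
  shows "g \<in> L1_vector \<nu>"
proof (rule L1_vectorI[OF g int])
  fix A :: "'g set" assume A: "A \<in> sets borel"
  define T where "T n = {s. cmod (g s) \<le> real n}" for n :: nat
  have T: "T n \<in> sets borel" for n unfolding T_def using g by measurable
  define w where "w n s = indicator A s * (indicator (T n) s * g s)" for n s
  have wm: "w n \<in> borel_measurable borel" for n unfolding w_def using A T g by measurable
  have wb: "cmod (w n s) \<le> real n" for n s by (auto simp: w_def T_def indicator_def)
  obtain V where V: "\<And>n. is_vector_integral \<nu> UNIV (\<lambda>s. w n s * 1) (V n)"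
    using is_vector_integral_bounded_mult[OF one_in_L1_vector wm wb] by metis
  have iA: "integrable (total_variation (pairing \<nu> \<phi>)) (\<lambda>s. indicator A s * g s)" if "\<phi> \<in> cdual" for \<phi>
    using A by (intro integrable_indicator_mult int that)
  have iw: "integrable (total_variation (pairing \<nu> \<phi>)) (\<lambda>s. w n s * 1)" if "\<phi> \<in> cdual" for \<phi> n
    by (rule integrable_bounded_mult[OF L1_vectorD(2)[OF one_in_L1_vector that] wm wb])
  have "\<exists>v. is_vector_integral \<nu> UNIV (\<lambda>s. indicator A s * g s) v"
  proof (rule is_vector_integral_limit[OF iA iw V e])
    fix \<phi> :: "'x \<Rightarrow> complex" and n :: nat assume \<phi>: "\<phi> \<in> cdual"
    have "integrable (total_variation (pairing \<nu> \<phi>)) (\<lambda>s. indicator {s. real n < cmod (g s)} s * g s)"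
      using g by (intro integrable_indicator_mult int \<phi>) measurable
    from integrable_norm[OF this]
    have i: "integrable (total_variation (pairing \<nu> \<phi>)) (\<lambda>s. indicator {s. real n < cmod (g s)} s * cmod (g s))"
      by (simp add: norm_mult cmod_indicator)
    have "(LINT s|total_variation (pairing \<nu> \<phi>). cmod (indicator A s * g s - w n s * 1)) \<le>
        (LINT s|total_variation (pairing \<nu> \<phi>). indicator {s. real n < cmod (g s)} s * cmod (g s))"
      by (intro integral_mono i integrable_norm Bochner_Integration.integrable_diff iA iw \<phi>)
        (auto simp: w_def T_def indicator_def)
    also have "\<dots> \<le> onorm \<phi> * e n" by (rule le[OF \<phi>])
    finally show "(LINT s|total_variation (pairing \<nu> \<phi>). cmod (indicator A s * g s - w n s * 1)) \<le> onorm \<phi> * e n" .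
  qed
  then show "\<exists>v. is_vector_integral \<nu> A g v"
    by (simp add: is_vector_integral_def)
qed

end

section \<open>Convolution\<close>

lemma borel_measurable_completion_AE:
  fixes f g :: "'a \<Rightarrow> 'b::topological_space"
  assumes g: "g \<in> borel_measurable (completion M)" and ae: "AE x in M. f x = g x"
  shows "f \<in> borel_measurable (completion M)"
proof -
  obtain N where N: "N \<in> null_sets M" "{x \<in> space M. f x \<noteq> g x} \<subseteq> N"
    using ae by (auto simp: eventually_ae_filter)
  show ?thesis
  proof (rule measurableI)
    fix S :: "'b set" assume S: "S \<in> sets borel"
    have gS: "g -` S \<inter> space M \<in> sets (completion M)" using measurable_sets[OF g S] by simp
    have eq: "f -` S \<inter> space M = (g -` S \<inter> space M - N) \<union> (f -` S \<inter> space M \<inter> N)"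
      using N(2) by auto
    have "N \<in> sets (completion M)" "f -` S \<inter> space M \<inter> N \<in> sets (completion M)"
      using N(1) by (auto intro: sets_completionI_sub)
    then show "f -` S \<inter> space (completion M) \<in> sets (completion M)"
      using gS eq by (metis sets.Diff sets.Un space_completion)
  qed auto
qed

lemma integral_completion_AE:
  fixes f g :: "'a \<Rightarrow> 'b::{banach, second_countable_topology}"
  assumes g: "integrable (completion M) g" and ae: "AE x in M. f x = g x"
  shows "integrable (completion M) f" "integral\<^sup>L (completion M) f = integral\<^sup>L (completion M) g"
proof -
  have gm: "g \<in> borel_measurable (completion M)" using g by simp
  have fm: "f \<in> borel_measurable (completion M)" by (rule borel_measurable_completion_AE[OF gm ae])
  have ae': "AE x in completion M. f x = g x" by (rule AE_completion[OF ae])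
  show "integrable (completion M) f" using integrable_cong_AE[OF fm gm ae'] g by simp
  show "integral\<^sup>L (completion M) f = integral\<^sup>L (completion M) g"
    by (rule integral_cong_AE[OF fm gm ae'])
qed

lemma integrable_imp_completion:
  fixes g :: "'a \<Rightarrow> 'b::{banach, second_countable_topology}"
  assumes "integrable M g"
  shows "integrable (completion M) g" "integral\<^sup>L (completion M) g = integral\<^sup>L M g"
  using assms integrable_completion[of g M] integral_completion[of g M] by auto

section \<open>Scalar convolution and Fubini's theorem\<close>

context compact_haar
begin

lemma measurable_minus_baire_swap: "(\<lambda>z. snd z - fst z) \<in> borel \<Otimes>\<^sub>M borel \<rightarrow>\<^sub>M (baire :: 'g measure)"
  using measurable_compose[OF measurable_Pair[OF measurable_snd measurable_fst] measurable_minus_baire] by simp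

lemma integrable_translate:
  fixes k :: "'g \<Rightarrow> 'b::{banach, second_countable_topology}"
  assumes k: "integrable m k"
  shows "integrable m (\<lambda>t. k (t - s))" "(LINT t|m. k (t - s)) = (LINT t|m. k t)"
proof -
  have km: "k \<in> borel_measurable borel" using k by (simp add: measurable_m borel_measurable_integrable flip: measurable_m(1))
  have T: "(\<lambda>t. t - s) \<in> m \<rightarrow>\<^sub>M borel" by (simp add: measurable_m)
  show "integrable m (\<lambda>t. k (t - s))"
    using integrable_distr_eq[OF T km] k by (simp add: distr_minus_right)
  show "(LINT t|m. k (t - s)) = (LINT t|m. k t)"
    using integral_distr[OF T km] by (simp add: distr_minus_right)
qed

lemma borel_measurable_integrable_m: "integrable m k \<Longrightarrow> k \<in> borel_measurable borel"
  using borel_measurable_integrable[of m k] by (simp add: measurable_m)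

lemma integrable_bounded_mult_m:
  fixes a k :: "'g \<Rightarrow> complex"
  assumes "a \<in> borel_measurable borel" "\<And>t. cmod (a t) \<le> K" "integrable m k"
  shows "integrable m (\<lambda>t. a t * k t)"
proof (rule Bochner_Integration.integrable_bound)
  show "integrable m (\<lambda>t. of_real K * k t)" using assms(3) by simp
  show "(\<lambda>t. a t * k t) \<in> borel_measurable m"
    using assms(1) borel_measurable_integrable_m[OF assms(3)] by (simp add: measurable_m)
  have "0 \<le> K" using assms(2) norm_ge_zero order_trans by blast
  then show "AE t in m. cmod (a t * k t) \<le> cmod (of_real K * k t)"
    using assms(2) by (auto simp: norm_mult intro!: mult_right_mono)
qed

text \<open>The kernel is general because it will be \<open>f0 (t - s)\<close> for the convolution
  itself and a difference of two kernels for its approximation by simple functions.\<close>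

definition kernel_integral :: "('g \<Rightarrow> 'g \<Rightarrow> complex) \<Rightarrow> ('g \<Rightarrow> complex) \<Rightarrow> 'g \<Rightarrow> complex" where
  "kernel_integral D a s = (LINT t|m. a t * D t s)"

lemma kernel_integral_minus_measurable:
  assumes k: "k \<in> borel_measurable baire" and a: "a \<in> borel_measurable borel"
  shows "kernel_integral (\<lambda>t s. k (t - s)) a \<in> borel_measurable borel"
  unfolding kernel_integral_def
proof (rule borel_measurable_lebesgue_integral)
  have "(\<lambda>z. k (snd z - fst z)) \<in> borel_measurable (borel \<Otimes>\<^sub>M borel)"
    by (rule measurable_compose[OF measurable_minus_baire_swap k])
  moreover have "(\<lambda>z :: 'g \<times> 'g. a (snd z)) \<in> borel_measurable (borel \<Otimes>\<^sub>M borel)"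
    by (rule measurable_compose[OF measurable_snd a])
  ultimately have "(\<lambda>z. a (snd z) * k (snd z - fst z)) \<in> borel_measurable (borel \<Otimes>\<^sub>M borel)"
    by (intro borel_measurable_times)
  then show "(\<lambda>(s, t). a t * k (t - s)) \<in> borel_measurable (borel \<Otimes>\<^sub>M m)"
    by (simp add: split_beta' measurable_cong_sets[OF sets_pair_measure_cong[OF refl sets_m] refl])
qed

lemma cmod_kernel_integral_minus_le:
  assumes k: "integrable m k" and a: "a \<in> borel_measurable borel" "\<And>t. cmod (a t) \<le> K"
  shows "cmod (kernel_integral (\<lambda>t s. k (t - s)) a s) \<le> K * (LINT t|m. cmod (k t))"
proof -
  note kt = integrable_translate(1)[OF k, of s]
  have "cmod (kernel_integral (\<lambda>t s. k (t - s)) a s) \<le> (LINT t|m. cmod (a t * k (t - s)))"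
    unfolding kernel_integral_def by (rule integral_norm_bound)
  also have "\<dots> \<le> (LINT t|m. K * cmod (k (t - s)))"
  proof (rule integral_mono)
    show "integrable m (\<lambda>t. cmod (a t * k (t - s)))"
      by (intro integrable_norm integrable_bounded_mult_m[OF a kt])
    show "cmod (a t * k (t - s)) \<le> K * cmod (k (t - s))" for t
      using a(2)[of t] by (simp add: norm_mult mult_right_mono)
  qed (use kt in auto)
  also have "\<dots> = K * (LINT t|m. cmod (k t))"
    using integrable_translate(2)[OF integrable_norm[OF k]] by simp
  finally show ?thesis .
qed

text \<open>The Baire measurability of the kernel is needed because \<open>(t, s) \<mapsto> t - s\<close> need not be measurable
  from the product of the Borel algebras to the Borel algebra.\<close>

lemma Fubini_minus:
  fixes \<tau> :: "'g measure"
  assumes fin: "finite_measure \<tau>" and \<tau>: "sets \<tau> = sets borel"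
    and k: "k \<in> borel_measurable baire" "integrable m k"
    and a: "a \<in> borel_measurable borel" "\<And>t. cmod (a t) \<le> K"
    and w: "integrable \<tau> w"
  shows "AE t in m. integrable \<tau> (\<lambda>s. a t * k (t - s) * w s)"
    "integrable m (\<lambda>t. LINT s|\<tau>. a t * k (t - s) * w s)"
    "(LINT t|m. LINT s|\<tau>. a t * k (t - s) * w s) = (LINT s|\<tau>. kernel_integral (\<lambda>t s. k (t - s)) a s * w s)"
proof -
  interpret T: finite_measure \<tau> by fact
  interpret P: pair_sigma_finite m \<tau> ..
  have wm: "w \<in> borel_measurable borel"
    using borel_measurable_integrable[OF w] by (simp add: measurable_cong_sets[OF \<tau> refl])
  have m1: "(\<lambda>z. a (fst z) * k (fst z - snd z) * w (snd z)) \<in> borel_measurable (borel \<Otimes>\<^sub>M borel)"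
    using measurable_compose[OF measurable_minus_baire k(1)] measurable_compose[OF measurable_fst a(1)]
      measurable_compose[OF measurable_snd wm] by (intro borel_measurable_times)
  then have m2: "(\<lambda>(t, s). a t * k (t - s) * w s) \<in> borel_measurable (m \<Otimes>\<^sub>M \<tau>)"
    by (simp add: split_beta' measurable_cong_sets[OF sets_pair_measure_cong[OF sets_m \<tau>] refl])
  have in1: "integrable m (\<lambda>t. a t * k (t - s) * w s)" for s
    by (intro integrable_mult_left integrable_bounded_mult_m[OF a] integrable_translate(1) k(2))
  have i: "integrable (m \<Otimes>\<^sub>M \<tau>) (\<lambda>(t, s). a t * k (t - s) * w s)"
  proof (rule integrableI_bounded[OF m2])
    have "(\<integral>\<^sup>+ z. ennreal (norm (case z of (t, s) \<Rightarrow> a t * k (t - s) * w s)) \<partial>(m \<Otimes>\<^sub>M \<tau>)) =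
        (\<integral>\<^sup>+ s. \<integral>\<^sup>+ t. ennreal (cmod (a t * k (t - s) * w s)) \<partial>m \<partial>\<tau>)"
      using P.nn_integral_snd[of "\<lambda>(t, s). ennreal (cmod (a t * k (t - s) * w s))"] m2
      by (simp add: split_beta')
    also have "\<dots> \<le> (\<integral>\<^sup>+ s. ennreal (K * (LINT t|m. cmod (k t)) * cmod (w s)) \<partial>\<tau>)"
    proof (rule nn_integral_mono)
      fix s
      have "(\<integral>\<^sup>+ t. ennreal (cmod (a t * k (t - s) * w s)) \<partial>m) = ennreal (LINT t|m. cmod (a t * k (t - s) * w s))"
        by (intro nn_integral_eq_integral integrable_norm in1) auto
      also have "(LINT t|m. cmod (a t * k (t - s) * w s)) \<le> (LINT t|m. K * cmod (w s) * cmod (k (t - s)))"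
      proof (rule integral_mono)
        show "cmod (a t * k (t - s) * w s) \<le> K * cmod (w s) * cmod (k (t - s))" for t
          using mult_right_mono[OF a(2)[of t], of "cmod (k (t - s)) * cmod (w s)"] by (simp add: norm_mult mult_ac)
      qed (use in1 integrable_translate(1)[OF k(2)] in auto)
      also have "\<dots> = K * (LINT t|m. cmod (k t)) * cmod (w s)"
        using integrable_translate(2)[OF integrable_norm[OF k(2)]] by simp
      finally show "(\<integral>\<^sup>+ t. ennreal (cmod (a t * k (t - s) * w s)) \<partial>m) \<le> ennreal (K * (LINT t|m. cmod (k t)) * cmod (w s))"
        by (simp add: ennreal_leI)
    qed
    also have "\<dots> < \<infinity>"
    proof -
      have "0 \<le> K" using a(2) norm_ge_zero order_trans by blast
      then have "(\<integral>\<^sup>+ s. ennreal (K * (LINT t|m. cmod (k t)) * cmod (w s)) \<partial>\<tau>) =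
          ennreal (LINT s|\<tau>. K * (LINT t|m. cmod (k t)) * cmod (w s))"
        using w by (intro nn_integral_eq_integral) auto
      then show ?thesis by simp
    qed
    finally show "(\<integral>\<^sup>+ z. ennreal (norm (case z of (t, s) \<Rightarrow> a t * k (t - s) * w s)) \<partial>(m \<Otimes>\<^sub>M \<tau>)) < \<infinity>" .
  qed
  show "AE t in m. integrable \<tau> (\<lambda>s. a t * k (t - s) * w s)" by (rule P.AE_integrable_fst[OF i])
  show "integrable m (\<lambda>t. LINT s|\<tau>. a t * k (t - s) * w s)" by (rule P.integrable_fst[OF i])
  have "(LINT t|m. LINT s|\<tau>. a t * k (t - s) * w s) = (LINT s|\<tau>. LINT t|m. a t * k (t - s) * w s)"
    by (rule P.Fubini_integral[OF i, symmetric])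
  also have "\<dots> = (LINT s|\<tau>. kernel_integral (\<lambda>t s. k (t - s)) a s * w s)"
    by (simp add: kernel_integral_def)
  finally show "(LINT t|m. LINT s|\<tau>. a t * k (t - s) * w s) = (LINT s|\<tau>. kernel_integral (\<lambda>t s. k (t - s)) a s * w s)" .
qed

text \<open>For fixed \<open>s\<close> the exceptional set of \<open>t\<close> is a translate of a
  null set. Exchanging the quantifiers needs the set of pairs to be product measurable, which holds
  as \<open>N\<close> is Baire.\<close>

lemma AE_minus_notin:
  fixes \<tau> :: "'g measure"
  assumes fin: "finite_measure \<tau>" and \<tau>: "sets \<tau> = sets borel"
    and N: "N \<in> sets baire" "emeasure m N = 0"
  shows "AE t in m. AE s in \<tau>. t - s \<notin> N"
proof -
  interpret T: finite_measure \<tau> by fact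
  interpret P: pair_sigma_finite m \<tau> ..
  have "N \<in> null_sets m" using N sets_baire_subset_borel by (intro null_setsI) auto
  then have "AE t in m. t - s \<notin> N" for s by (intro AE_minus_right AE_not_in)
  moreover have "{z \<in> space (m \<Otimes>\<^sub>M \<tau>). fst z - snd z \<notin> N} \<in> sets (m \<Otimes>\<^sub>M \<tau>)"
  proof -
    have "(\<lambda>z. fst z - snd z) -` (- N) \<inter> space (borel \<Otimes>\<^sub>M borel) \<in> sets (borel \<Otimes>\<^sub>M (borel :: 'g measure))"
      using N(1) by (intro measurable_sets[OF measurable_minus_baire]) (metis Compl_eq_Diff_UNIV sets.compl_sets space_baire)
    moreover have "{z \<in> space (m \<Otimes>\<^sub>M \<tau>). fst z - snd z \<notin> N} = (\<lambda>z. fst z - snd z) -` (- N) \<inter> space (borel \<Otimes>\<^sub>M borel)"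
      using sets_eq_imp_space_eq[OF \<tau>] by (auto simp: space_pair_measure)
    ultimately show ?thesis by (simp only: sets_pair_measure_cong[OF sets_m \<tau>])
  qed
  ultimately show ?thesis using P.AE_commute[of "\<lambda>t s. t - s \<notin> N"] by simp
qed

text \<open>The variation of \<open>\<kappa>\<close> may be singular to \<open>m\<close>, yet
  \<open>f\<close> can be replaced by \<open>f0\<close> under the integral: for almost every
  \<open>t\<close> the points \<open>s\<close> with \<open>t - s\<close> in \<open>N\<close> are
  null for the variation. Fubini's theorem then applies to \<open>f0\<close>, with the polar factor
  absorbed into the integrand.\<close>

lemma scalar_convolution:
  fixes \<kappa> :: "'g set \<Rightarrow> complex"
  assumes vm: "vector_measure \<kappa>" and g: "integrable (total_variation \<kappa>) g"
    and f: "f \<in> borel_measurable borel" and N: "N \<in> sets baire" "emeasure m N = 0" "\<forall>x. x \<notin> N \<longrightarrow> f x = f0 x"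
    and f0: "f0 \<in> borel_measurable baire" "integrable m f0"
  shows "AE t in m. integrable (total_variation \<kappa>) (\<lambda>s. f (t - s) * g s)"
    "integrable (completion m) (\<lambda>t. complex_integral \<kappa> (\<lambda>s. f (t - s) * g s))"
    "\<And>A. A \<in> sets borel \<Longrightarrow> (LINT t|completion m. indicator A t * complex_integral \<kappa> (\<lambda>s. f (t - s) * g s)) =
      complex_integral \<kappa> (\<lambda>s. kernel_integral (\<lambda>t s. f0 (t - s)) (indicator A) s * g s)"
proof -
  let ?\<tau> = "total_variation \<kappa>"
  note fin = finite_measure_total_variation[OF vm]
  obtain u where um: "u \<in> borel_measurable borel" "\<And>x. cmod (u x) = 1"
    and u: "\<And>h. integrable ?\<tau> h \<Longrightarrow> complex_integral \<kappa> h = (LINT s|?\<tau>. u s * h s)"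
    by (rule polar_decomposition[OF vm]) (rule that)
  have w: "integrable ?\<tau> (\<lambda>s. u s * g s)" by (rule integrable_unimodular_mult[OF vm um g])
  note Fub = Fubini_minus[OF fin sets_total_variation f0 _ _ w]
  have one: "(\<lambda>_. 1 :: complex) \<in> borel_measurable borel" "\<And>t. cmod 1 \<le> 1" by auto
  have gm: "g \<in> borel_measurable borel" using g by (simp add: borel_measurable_integrable flip: measurable_cong_sets[OF sets_total_variation refl])
  have ae0: "AE t in m. integrable ?\<tau> (\<lambda>s. f0 (t - s) * g s)"
    using Fubini_minus(1)[OF fin sets_total_variation f0 one g] by simp
  have fcg: "(\<lambda>s. f (t - s) * g s) \<in> borel_measurable borel" for t
    using f gm by measurable
  have ae: "AE t in m. integrable ?\<tau> (\<lambda>s. f0 (t - s) * g s) \<and> integrable ?\<tau> (\<lambda>s. f (t - s) * g s) \<and>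
      complex_integral \<kappa> (\<lambda>s. f (t - s) * g s) = (LINT s|?\<tau>. 1 * f0 (t - s) * (u s * g s))"
    using ae0 AE_minus_notin[OF fin sets_total_variation N(1,2)]
  proof eventually_elim
    case (elim t)
    have eq: "AE s in ?\<tau>. f0 (t - s) * g s = f (t - s) * g s"
      using elim(2) by eventually_elim (simp add: N(3))
    have "complex_integral \<kappa> (\<lambda>s. f0 (t - s) * g s) = (LINT s|?\<tau>. 1 * f0 (t - s) * (u s * g s))"
      by (simp add: u[OF elim(1)] mult.left_commute)
    then show ?case
      using complex_integral_cong_AE[OF vm elim(1) fcg eq] elim(1) by simp
  qed
  show "AE t in m. integrable ?\<tau> (\<lambda>s. f (t - s) * g s)" using ae by eventually_elim simp
  have i: "integrable m (\<lambda>t. LINT s|?\<tau>. 1 * f0 (t - s) * (u s * g s))" by (rule Fub(2)[OF one])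
  \<comment> \<open>The convolution of \<open>f\<close> is only known to agree almost everywhere
    with the measurable one of \<open>f0\<close>, hence the completion.\<close>
  show "integrable (completion m) (\<lambda>t. complex_integral \<kappa> (\<lambda>s. f (t - s) * g s))"
    by (rule integral_completion_AE(1)[OF integrable_imp_completion(1)[OF i]]) (use ae in eventually_elim, simp)
  fix A :: "'g set" assume A: "A \<in> sets borel"
  have A': "(indicator A :: 'g \<Rightarrow> complex) \<in> borel_measurable borel" "\<And>t. cmod (indicator A t) \<le> 1"
    using A by (auto simp: indicator_def)
  have "(LINT t|completion m. indicator A t * complex_integral \<kappa> (\<lambda>s. f (t - s) * g s)) =
      (LINT t|m. LINT s|?\<tau>. indicator A t * f0 (t - s) * (u s * g s))"
  proof -
    note i = Fub(2)[OF A']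
    have "AE t in m. indicator A t * complex_integral \<kappa> (\<lambda>s. f (t - s) * g s) =
        (LINT s|?\<tau>. indicator A t * f0 (t - s) * (u s * g s))"
      using ae by eventually_elim (auto simp: indicator_def)
    from integral_completion_AE(2)[OF integrable_imp_completion(1)[OF i] this] integrable_imp_completion(2)[OF i]
    show ?thesis by simp
  qed
  also have "\<dots> = (LINT s|?\<tau>. kernel_integral (\<lambda>t s. f0 (t - s)) (indicator A) s * (u s * g s))"
    by (rule Fub(3)[OF A'])
  also have "\<dots> = complex_integral \<kappa> (\<lambda>s. kernel_integral (\<lambda>t s. f0 (t - s)) (indicator A) s * g s)"
  proof -
    have "integrable ?\<tau> (\<lambda>s. kernel_integral (\<lambda>t s. f0 (t - s)) (indicator A) s * g s)"
      by (rule integrable_bounded_mult[OF g kernel_integral_minus_measurable[OF f0(1) A'(1)]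
        cmod_kernel_integral_minus_le[OF f0(2) A']])
    then show ?thesis by (simp add: u mult.left_commute)
  qed
  finally show "(LINT t|completion m. indicator A t * complex_integral \<kappa> (\<lambda>s. f (t - s) * g s)) =
      complex_integral \<kappa> (\<lambda>s. kernel_integral (\<lambda>t s. f0 (t - s)) (indicator A) s * g s)" .
qed

text \<open>Absolute continuity of the integral, uniformly over all translates: a continuous
  \<open>h\<close> close to \<open>k\<close> in mean is bounded, and the error in mean does not
  change under translation.\<close>

lemma translate_integral_small:
  fixes k :: "'g \<Rightarrow> complex"
  assumes k: "integrable m k" and e: "0 < e"
  obtains d where "0 < d" "\<And>A s. A \<in> sets borel \<Longrightarrow> measure m A < d \<Longrightarrow>
    (LINT t|m. cmod (indicator A t * k (t - s))) \<le> e"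
proof -
  obtain h where h: "continuous_on UNIV h" "(LINT x|m. cmod (k x - h x)) < e / 2"
    using continuous_dense_L1[OF k] e by (meson half_gt_zero)
  obtain K where K: "\<And>x. cmod (h x) \<le> K" by (rule continuous_bounded[OF h(1)]) (rule that)
  have K0: "0 \<le> K" using K[of 0] norm_ge_zero[of "h 0"] by linarith
  note ih = integrable_continuous[OF h(1)]
  have ikh: "integrable m (\<lambda>x. k x - h x)" using k ih by simp
  show ?thesis
  proof (rule that[of "e / (2 * (K + 1))"])
    show "0 < e / (2 * (K + 1))" using e K0 by simp
    fix A :: "'g set" and s assume A: "A \<in> sets borel" "measure m A < e / (2 * (K + 1))"
    have iA: "integrable m (\<lambda>t. K * indicator A t :: real)"
      using A(1) by (intro integrable_mult_right integrable_real_indicator) (auto simp: less_top[symmetric])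
    have "(LINT t|m. cmod (indicator A t * k (t - s))) \<le> (LINT t|m. cmod (k (t - s) - h (t - s)) + K * indicator A t)"
    proof (rule integral_mono)
      show "integrable m (\<lambda>t. cmod (indicator A t * k (t - s)))"
        using A(1) by (intro integrable_norm integrable_bounded_mult_m[of _ 1] integrable_translate(1) k) (auto simp: indicator_def)
      show "integrable m (\<lambda>t. cmod (k (t - s) - h (t - s)) + K * indicator A t)"
        using integrable_translate(1)[OF ikh, of s] iA by auto
      show "cmod (indicator A t * k (t - s)) \<le> cmod (k (t - s) - h (t - s)) + K * indicator A t" for t
        using norm_triangle_ineq[of "k (t - s) - h (t - s)" "h (t - s)"] K[of "t - s"]
        by (auto simp: indicator_def)
    qed
    also have "\<dots> = (LINT t|m. cmod (k t - h t)) + K * measure m A"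
      using integrable_translate[OF integrable_norm[OF ikh], of s] iA A(1) by simp
    also have "\<dots> \<le> e / 2 + e / 2"
    proof (intro add_mono)
      have "K * measure m A \<le> (K + 1) * (e / (2 * (K + 1)))"
        using A(2) K0 by (intro mult_mono) auto
      also have "\<dots> = e / 2" using K0 by (simp add: field_simps)
      finally show "K * measure m A \<le> e / 2" .
    qed (use h(2) in simp)
    finally show "(LINT t|m. cmod (indicator A t * k (t - s))) \<le> e" by simp
  qed
qed

end

lemma one_le_conj_exponent: "1 \<le> conj_exponent p"
proof -
  have "1 \<le> 1 / y" if "y \<le> 1" for y :: ennreal
    using that
    by (cases y; cases "y = 0")
      (auto simp: divide_ennreal[of 1, simplified] ennreal_le_1 ennreal_ge_1 top_unique le_divide_eq_1)
  then show ?thesis unfolding conj_exponent_def by (simp add: diff_le_self_ennreal)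
qed

context prob_space
begin

lemma enn2real_inverse_le_1:
  assumes "1 \<le> (p :: ennreal)"
  shows "enn2real (1 / p) \<le> 1"
  using enn2real_inverse_conj_exponent[OF assms] enn2real_nonneg[of "1 / conj_exponent p"] by simp

text \<open>Weighted means of \<open>B x\<close> and the constant 1, which has integral one on a
  probability space.\<close>

lemma nn_integral_le_Lp_norm:
  assumes f: "f \<in> borel_measurable M" and p: "1 \<le> p"
  shows "(\<integral>\<^sup>+x. ennreal (cmod (f x)) \<partial>M) \<le> Lp_norm M p f"
proof (cases "Lp_norm M p f < \<infinity>")
  case True
  define F \<theta> where "F = enn2real (Lp_norm M p f)" and "\<theta> = enn2real (1 / p)"
  obtain B where B: "B \<in> borel_measurable M" "\<And>x. 0 \<le> B x" "(\<integral>\<^sup>+x. ennreal (B x) \<partial>M) \<le> 1"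
    "AE x in M. cmod (f x) \<le> F * B x powr \<theta>"
    using Lp_norm_factor[OF f p True] unfolding F_def \<theta>_def by metis
  have \<theta>: "0 \<le> \<theta>" "\<theta> \<le> 1" using enn2real_inverse_le_1[OF p] by (auto simp: \<theta>_def)
  have F: "0 \<le> F" by (simp add: F_def)
  have "(\<integral>\<^sup>+x. ennreal (cmod (f x)) \<partial>M) \<le> (\<integral>\<^sup>+x. ennreal F * (ennreal \<theta> * ennreal (B x) + ennreal (1 - \<theta>)) \<partial>M)"
  proof (rule nn_integral_mono_AE)
    show "AE x in M. ennreal (cmod (f x)) \<le> ennreal F * (ennreal \<theta> * ennreal (B x) + ennreal (1 - \<theta>))"
      using B(4)
    proof eventually_elim
      case (elim x)
      have "B x powr \<theta> * 1 powr (1 - \<theta>) \<le> \<theta> * B x + (1 - \<theta>) * 1"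
        using B(2) \<theta> by (intro powr_weighted_AM_GM) auto
      then have "F * B x powr \<theta> \<le> F * (\<theta> * B x + (1 - \<theta>))" using F by (intro mult_left_mono) auto
      with elim have "cmod (f x) \<le> F * (\<theta> * B x + (1 - \<theta>))" by linarith
      then show ?case
        using F \<theta> B(2)[of x] by (simp add: ennreal_leI flip: ennreal_mult ennreal_plus)
    qed
  qed
  also have "\<dots> = ennreal F * (ennreal \<theta> * (\<integral>\<^sup>+x. ennreal (B x) \<partial>M) + ennreal (1 - \<theta>))"
    using B(1) by (simp add: nn_integral_cmult nn_integral_add emeasure_space_1)
  also have "\<dots> \<le> ennreal F * (ennreal \<theta> * 1 + ennreal (1 - \<theta>))"
    using B(3) by (intro mult_left_mono add_mono) auto
  also have "\<dots> = Lp_norm M p f" using \<theta> True by (simp add: F_def flip: ennreal_plus)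
  finally show ?thesis .
next
  case False
  then show ?thesis by (simp add: less_top[symmetric])
qed

lemma Lp_space_integrable: "1 \<le> p \<Longrightarrow> f \<in> Lp_space M p \<Longrightarrow> integrable M f"
  using nn_integral_le_Lp_norm[of f p] by (auto simp: Lp_space_def integrable_iff_bounded intro: le_less_trans)

end

lemma integral_finite_range:
  fixes c :: "'a \<Rightarrow> 'b" and \<Phi> :: "'b \<Rightarrow> complex"
  assumes fm: "finite_measure M" and c: "simple_function M c" and A: "A \<in> sets M"
  shows "(LINT t|M. indicator A t * \<Phi> (c t)) = (\<Sum>y\<in>c ` space M. of_real (measure M (A \<inter> (c -` {y} \<inter> space M))) * \<Phi> y)"
proof -
  interpret finite_measure M by fact
  have fin: "finite (c ` space M)" and ms: "c -` {y} \<inter> space M \<in> sets M" for y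
    using c simple_functionD[OF c] by auto
  have "(LINT t|M. indicator A t * \<Phi> (c t)) =
      (LINT t|M. (\<Sum>y\<in>c ` space M. indicator (A \<inter> (c -` {y} \<inter> space M)) t *\<^sub>R \<Phi> y))"
  proof (rule Bochner_Integration.integral_cong[OF refl])
    fix t assume t: "t \<in> space M"
    have "(\<Sum>y\<in>c ` space M. indicator (A \<inter> (c -` {y} \<inter> space M)) t *\<^sub>R \<Phi> y) =
        (\<Sum>y\<in>{c t}. indicator (A \<inter> (c -` {y} \<inter> space M)) t *\<^sub>R \<Phi> y)"
      using fin t by (intro sum.mono_neutral_right) (auto simp: indicator_def)
    then show "indicator A t * \<Phi> (c t) = (\<Sum>y\<in>c ` space M. indicator (A \<inter> (c -` {y} \<inter> space M)) t *\<^sub>R \<Phi> y)"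
      using t by (simp add: indicator_def)
  qed
  also have "\<dots> = (\<Sum>y\<in>c ` space M. LINT t|M. indicator (A \<inter> (c -` {y} \<inter> space M)) t *\<^sub>R \<Phi> y)"
    using A ms by (intro Bochner_Integration.integral_sum integrable_scaleR_left integrable_real_indicator)
      (auto simp: less_top[symmetric])
  also have "\<dots> = (\<Sum>y\<in>c ` space M. of_real (measure M (A \<inter> (c -` {y} \<inter> space M))) * \<Phi> y)"
    using A ms by (intro sum.cong refl, subst integral_scaleR_left)
      (auto simp: scaleR_conv_of_real less_top[symmetric] intro!: integrable_real_indicator)
  finally show ?thesis .
qed

section \<open>The convolution measure and its semivariation\<close>

context compact_haar
begin

lemma kernel_integral_sum:
  assumes "\<And>i. i \<in> I \<Longrightarrow> integrable m (\<lambda>t. a i t * D t s)"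
  shows "kernel_integral D (\<lambda>t. \<Sum>i\<in>I. a i t) s = (\<Sum>i\<in>I. kernel_integral D (a i) s)"
  unfolding kernel_integral_def sum_distrib_right using assms by (intro Bochner_Integration.integral_sum) auto

lemma integrable_indicator_m: "integrable m k \<Longrightarrow> A \<in> sets borel \<Longrightarrow> integrable m (\<lambda>t. indicator A t * (k t :: complex))"
  by (rule integrable_bounded_mult_m[of _ 1]) (auto simp: indicator_def)

text \<open>\<open>c\<close> moves each point within the neighbourhoods of a finite subcover.\<close>

lemma continuous_nearest_point:
  fixes h :: "'g \<Rightarrow> complex"
  assumes h: "continuous_on UNIV h" and e: "0 < e"
  obtains c where "simple_function m c" "\<And>t s. cmod (h (t - s) - h (c t - s)) \<le> e"
proof -
  have cont: "continuous_on (UNIV \<times> UNIV) (\<lambda>z :: 'g \<times> 'g. h (fst z - snd z))"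
    by (intro continuous_on_compose2[OF h] continuous_intros) auto
  have "\<exists>U. x \<in> U \<and> open U \<and> (\<forall>t\<in>U. \<forall>s. cmod (h (t - s) - h (x - s)) \<le> e)" for x
  proof (rule continuous_on_prod_compactE[OF cont compact_UNIV, of x e])
    fix X0 assume "x \<in> X0" "open X0"
      "\<forall>t\<in>X0 \<inter> UNIV. \<forall>s\<in>UNIV. dist (h (fst (t, s) - snd (t, s))) (h (fst (x, s) - snd (x, s))) \<le> e"
    then show ?thesis by (intro exI[of _ X0]) (auto simp: dist_norm)
  qed (use e in auto)
  then obtain U where U: "\<And>x. x \<in> U x" "\<And>x. open (U x)"
    "\<And>x t s. t \<in> U x \<Longrightarrow> cmod (h (t - s) - h (x - s)) \<le> e" by metis
  obtain X where X: "finite X" "UNIV \<subseteq> (\<Union>x\<in>X. U x)"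
    using compactE_image[OF compact_UNIV, of UNIV U] U(1,2) by (metis UNIV_I UN_I subsetI)
  have "\<exists>c. simple_function m c \<and> (\<forall>t\<in>(\<Union>x\<in>X. U x). t \<in> U (c t))"
    using X(1)
  proof (induction X rule: finite_induct)
    case empty
    show ?case by (intro exI[of _ "\<lambda>_. 0"]) auto
  next
    case (insert x X)
    then obtain c where c: "simple_function m c" "\<forall>t\<in>(\<Union>x\<in>X. U x). t \<in> U (c t)" by auto
    have "simple_function m (\<lambda>t. if t \<in> U x then x else c t)"
      using U(2)[of x] by (intro simple_function_If_set c(1)) auto
    then show ?case using c(2) by (intro exI[of _ "\<lambda>t. if t \<in> U x then x else c t"]) auto
  qed
  then show ?thesis using X(2) U(3) that by (metis UNIV_I subsetD)
qed

lemma continuous_imp_baire_measurable_complex: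
  fixes h :: "'g \<Rightarrow> complex"
  assumes "continuous_on UNIV h"
  shows "h \<in> borel_measurable baire"
  unfolding borel_measurable_complex_iff
  by (intro conjI continuous_imp_baire_measurable continuous_on_Re continuous_on_Im assms)

text \<open>The interface between inequalities and measures. Since the modulus is taken under both
  integrals, the bound is insensitive to cancellation and can be tested on functionals and on
  members of the dual unit ball separately.\<close>

definition young_bound ::
  "('g set \<Rightarrow> 'x::complex_normed_vector) \<Rightarrow> ('g \<Rightarrow> complex) \<Rightarrow> ennreal \<Rightarrow> ennreal \<Rightarrow> ('g \<Rightarrow> complex) \<Rightarrow> bool" where
  "young_bound \<nu> g p R k \<longleftrightarrow> (\<forall>\<phi>\<in>cdual_ball. \<forall>\<alpha>\<in>borel_measurable borel. Lp_norm m (conj_exponent p) \<alpha> \<le> 1 \<longrightarrow>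
     (\<integral>\<^sup>+s. (\<integral>\<^sup>+t. ennreal (cmod (\<alpha> t * k (t - s))) \<partial>m) * ennreal (cmod (g s)) \<partial>total_variation (pairing \<nu> \<phi>)) \<le> R)"

definition conv_measure ::
  "('g set \<Rightarrow> 'x::complex_normed_vector) \<Rightarrow> ('g \<Rightarrow> complex) \<Rightarrow> ('g \<Rightarrow> complex) \<Rightarrow> 'g set \<Rightarrow> 'x" where
  "conv_measure \<nu> g f0 A =
    (SOME v. is_vector_integral \<nu> UNIV (\<lambda>s. kernel_integral (\<lambda>t s. f0 (t - s)) (indicator A) s * g s) v)"

context
  fixes \<nu> :: "'g set \<Rightarrow> 'x::complex_banach" and g :: "'g \<Rightarrow> complex"
  assumes vm: "vector_measure \<nu>" and g: "g \<in> L1_vector \<nu>"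
begin

text \<open>A norming functional turns a combination
  \<open>\<Sum>A\<in>\<rho>. \<alpha> A *\<^sub>C \<psi> A\<close> into the scalar integral of
  \<open>g\<close> times the kernel integrated against the simple function with values
  \<open>\<alpha> A\<close>, which lies in the dual unit ball. The general kernel lets this serve
  both for the convolution and for its distance from a simple density.\<close>

lemma semivariation_le_kernel:
  assumes p: "p \<noteq> \<infinity>"
    and D: "\<And>s. integrable m (\<lambda>t. D t s)"
    and meas: "\<And>A. A \<in> sets borel \<Longrightarrow> kernel_integral D (indicator A) \<in> borel_measurable borel"
    and bdd: "\<And>A s. A \<in> sets borel \<Longrightarrow> cmod (kernel_integral D (indicator A) s) \<le> K"
    and \<psi>: "\<And>\<phi> A. \<phi> \<in> cdual \<Longrightarrow> A \<in> sets borel \<Longrightarrow>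
      \<phi> (\<psi> A) = complex_integral (pairing \<nu> \<phi>) (\<lambda>s. kernel_integral D (indicator A) s * g s)"
    and bd: "\<And>\<phi> \<alpha>. \<phi> \<in> cdual_ball \<Longrightarrow> \<alpha> \<in> borel_measurable borel \<Longrightarrow> Lp_norm m (conj_exponent p) \<alpha> \<le> 1 \<Longrightarrow>
      (\<integral>\<^sup>+s. (\<integral>\<^sup>+t. ennreal (cmod (\<alpha> t * D t s)) \<partial>m) * ennreal (cmod (g s)) \<partial>total_variation (pairing \<nu> \<phi>)) \<le> R"
  shows "semivariation m p \<psi> \<le> R"
proof -
  have "ennreal (norm (\<Sum>A\<in>\<rho>. \<alpha> A *\<^sub>C \<psi> A)) \<le> R"
    if \<rho>: "finite \<rho>" "\<rho> \<subseteq> sets borel" and N: "Lp_norm m (conj_exponent p) (\<lambda>t. \<Sum>A\<in>\<rho>. \<alpha> A * indicator A t) \<le> 1"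
    for \<rho> :: "'g set set" and \<alpha>
  proof -
    obtain \<phi> where b: "\<phi> \<in> cdual_ball"
      and eq: "\<phi> (\<Sum>A\<in>\<rho>. \<alpha> A *\<^sub>C \<psi> A) = of_real (norm (\<Sum>A\<in>\<rho>. \<alpha> A *\<^sub>C \<psi> A))"
      by (rule exists_norming_functional) (rule that)
    note \<phi> = cdual_ball_cdual[OF b]
    note vp = vector_measure_pairing[OF vm \<phi>]
    let ?\<tau> = "total_variation (pairing \<nu> \<phi>)" and ?a = "\<lambda>t. \<Sum>A\<in>\<rho>. \<alpha> A * indicator A t"
    have am: "?a \<in> borel_measurable borel" using \<rho> by (intro borel_measurable_sum) auto
    have ab: "cmod (?a t) \<le> (\<Sum>A\<in>\<rho>. cmod (\<alpha> A))" for t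
      by (rule sum_norm_le) (auto simp: norm_mult indicator_def)
    have aD: "integrable m (\<lambda>t. ?a t * D t s)" for s by (rule integrable_bounded_mult_m[OF am ab D])
    have k: "kernel_integral D ?a s = (\<Sum>A\<in>\<rho>. \<alpha> A * kernel_integral D (indicator A) s)" for s
    proof -
      have "kernel_integral D ?a s = (\<Sum>A\<in>\<rho>. kernel_integral D (\<lambda>t. \<alpha> A * indicator A t) s)"
        using \<rho>(2) integrable_indicator_m[OF D]
        by (intro kernel_integral_sum) (auto simp: mult.assoc)
      then show ?thesis by (simp add: kernel_integral_def mult.assoc)
    qed
    have i1: "integrable ?\<tau> (\<lambda>s. kernel_integral D (indicator A) s * g s)" if "A \<in> \<rho>" for A
      using that \<rho>(2) by (intro integrable_bounded_mult[OF L1_vectorD(2)[OF g \<phi>] meas bdd]) auto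
    have ka: "kernel_integral D ?a s * g s = (\<Sum>A\<in>\<rho>. \<alpha> A * (kernel_integral D (indicator A) s * g s))" for s
      by (simp add: k sum_distrib_right mult.assoc)
    have i2: "integrable ?\<tau> (\<lambda>s. kernel_integral D ?a s * g s)"
      unfolding ka using i1 by auto
    have "\<phi> (\<Sum>A\<in>\<rho>. \<alpha> A *\<^sub>C \<psi> A) = (\<Sum>A\<in>\<rho>. \<alpha> A * complex_integral (pairing \<nu> \<phi>) (\<lambda>s. kernel_integral D (indicator A) s * g s))"
      using \<rho>(2) by (auto simp: cdual_sum[OF \<phi>] cdual_linear[OF \<phi>] \<psi>[OF \<phi>] intro!: sum.cong)
    also have "\<dots> = complex_integral (pairing \<nu> \<phi>) (\<lambda>s. kernel_integral D ?a s * g s)"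
      unfolding ka using i1 \<rho>(1) by (subst complex_integral_sum[OF vp]) (auto simp: complex_integral_cmult[OF vp])
    finally have "norm (\<Sum>A\<in>\<rho>. \<alpha> A *\<^sub>C \<psi> A) = cmod (complex_integral (pairing \<nu> \<phi>) (\<lambda>s. kernel_integral D ?a s * g s))"
      using eq by (metis abs_norm_cancel norm_of_real)
    also have "\<dots> \<le> (LINT s|?\<tau>. cmod (kernel_integral D ?a s * g s))"
      by (rule cmod_complex_integral_le[OF vp i2])
    finally have "ennreal (norm (\<Sum>A\<in>\<rho>. \<alpha> A *\<^sub>C \<psi> A)) \<le> ennreal (LINT s|?\<tau>. cmod (kernel_integral D ?a s * g s))"
      by (rule ennreal_leI)
    also have "\<dots> = (\<integral>\<^sup>+s. ennreal (cmod (kernel_integral D ?a s * g s)) \<partial>?\<tau>)"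
      by (intro nn_integral_eq_integral[symmetric] integrable_norm i2) auto
    also have "\<dots> \<le> (\<integral>\<^sup>+s. (\<integral>\<^sup>+t. ennreal (cmod (?a t * D t s)) \<partial>m) * ennreal (cmod (g s)) \<partial>?\<tau>)"
    proof (rule nn_integral_mono)
      fix s
      have "ennreal (cmod (kernel_integral D ?a s)) \<le> ennreal (LINT t|m. cmod (?a t * D t s))"
        unfolding kernel_integral_def by (intro ennreal_leI integral_norm_bound)
      also have "\<dots> = (\<integral>\<^sup>+t. ennreal (cmod (?a t * D t s)) \<partial>m)"
        by (intro nn_integral_eq_integral[symmetric] integrable_norm aD) auto
      finally show "ennreal (cmod (kernel_integral D ?a s * g s)) \<le> (\<integral>\<^sup>+t. ennreal (cmod (?a t * D t s)) \<partial>m) * ennreal (cmod (g s))"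
        by (simp add: norm_mult ennreal_mult mult_right_mono)
    qed
    also have "\<dots> \<le> R" by (rule bd[OF b am N])
    finally show ?thesis .
  qed
  then show ?thesis
    using p by (auto simp: semivariation_def intro!: SUP_least)
qed

lemma young_bound_mono: "young_bound \<nu> g p R k \<Longrightarrow> R \<le> R' \<Longrightarrow> young_bound \<nu> g p R' k"
  unfolding young_bound_def by (meson order_trans)

lemma young_bound_cong_AE:
  assumes "young_bound \<nu> g p R k" "AE x in m. k x = k' x"
  shows "young_bound \<nu> g p R k'"
proof -
  have "(\<integral>\<^sup>+t. ennreal (cmod (\<alpha> t * k (t - s))) \<partial>m) = (\<integral>\<^sup>+t. ennreal (cmod (\<alpha> t * k' (t - s))) \<partial>m)" for \<alpha> s
    using AE_minus_right[OF assms(2), of s] by (intro nn_integral_cong_AE) (auto elim: eventually_mono)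
  then show ?thesis using assms(1) by (simp add: young_bound_def)
qed

context
  fixes f0 :: "'g \<Rightarrow> complex"
  assumes f0: "f0 \<in> borel_measurable baire" "integrable m f0"
begin

lemma conv_kernel_measurable:
  "A \<in> sets borel \<Longrightarrow> kernel_integral (\<lambda>t s. f0 (t - s)) (indicator A) \<in> borel_measurable borel"
  by (intro kernel_integral_minus_measurable f0) auto

lemma conv_kernel_bounded:
  "A \<in> sets borel \<Longrightarrow> cmod (kernel_integral (\<lambda>t s. f0 (t - s)) (indicator A) s) \<le> (LINT t|m. cmod (f0 t))"
  using cmod_kernel_integral_minus_le[OF f0(2), of "indicator A" 1 s] by (auto simp: indicator_def)

lemma conv_measure:
  assumes "A \<in> sets borel" "\<phi> \<in> cdual"
  shows "\<phi> (conv_measure \<nu> g f0 A) = complex_integral (pairing \<nu> \<phi>) (\<lambda>s. kernel_integral (\<lambda>t s. f0 (t - s)) (indicator A) s * g s)"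
proof -
  have "\<exists>v. is_vector_integral \<nu> UNIV (\<lambda>s. kernel_integral (\<lambda>t s. f0 (t - s)) (indicator A) s * g s) v"
    by (rule is_vector_integral_bounded_mult[OF vm g conv_kernel_measurable conv_kernel_bounded]) (use assms in auto)
  then have "is_vector_integral \<nu> UNIV (\<lambda>s. kernel_integral (\<lambda>t s. f0 (t - s)) (indicator A) s * g s) (conv_measure \<nu> g f0 A)"
    unfolding conv_measure_def by (rule someI_ex)
  then show ?thesis using assms(2) by (simp add: is_vector_integral_UNIV)
qed

lemma integrable_conv_kernel:
  "A \<in> sets borel \<Longrightarrow> \<phi> \<in> cdual \<Longrightarrow> integrable (total_variation (pairing \<nu> \<phi>))
    (\<lambda>s. kernel_integral (\<lambda>t s. f0 (t - s)) (indicator A) s * g s)"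
  by (rule integrable_bounded_mult[OF L1_vectorD(2)[OF g] conv_kernel_measurable conv_kernel_bounded])

text \<open>The error after \<open>n\<close> sets is the value on the remainder \<open>R n\<close>,
  whose Haar measure tends to zero. Its kernel integral is then small uniformly in \<open>s\<close>,
  and the uniform bound for \<open>g\<close> makes the value small in norm.\<close>

lemma vector_measure_conv_measure: "vector_measure (conv_measure \<nu> g f0)"
  unfolding vector_measure_def
proof (intro allI impI)
  fix A :: "nat \<Rightarrow> 'g set" assume A: "range A \<subseteq> sets borel" "disjoint_family A"
  define U R where "U = (\<Union>i. A i)" and "R n = U - (\<Union>i<n. A i)" for n
  have Ab: "A i \<in> sets borel" for i using A(1) by auto
  then have Ub: "U \<in> sets borel" and Rb: "R n \<in> sets borel" for n by (auto simp: U_def R_def)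
  obtain C where C: "C \<ge> 0" "\<And>\<phi>. \<phi> \<in> cdual \<Longrightarrow> (LINT s|total_variation (pairing \<nu> \<phi>). cmod (g s)) \<le> onorm \<phi> * C"
    by (rule L1_vector_bound[OF vm g]) (rule that)
  let ?k = "kernel_integral (\<lambda>t s. f0 (t - s))"
  have ks: "?k (indicator U) s = (\<Sum>i<n. ?k (indicator (A i)) s) + ?k (indicator (R n)) s" for n s
  proof -
    note it = integrable_translate(1)[OF f0(2), of s]
    have "indicator U t = (\<Sum>i<n. indicator (A i) t) + (indicator (R n) t :: complex)" for t
    proof -
      have "(\<Sum>i<n. indicator (A i) t) = (indicator (\<Union>i<n. A i) t :: complex)"
        using A(2) by (intro indicator_UN_disjoint[symmetric]) (auto simp: disjoint_family_on_def)
      then show ?thesis by (auto simp: R_def U_def indicator_def)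
    qed
    then have "?k (indicator U) s = (LINT t|m. (\<Sum>i<n. indicator (A i) t * f0 (t - s)) + indicator (R n) t * f0 (t - s))"
      unfolding kernel_integral_def by (simp only: distrib_right sum_distrib_right)
    also have "\<dots> = (LINT t|m. (\<Sum>i<n. indicator (A i) t * f0 (t - s))) + (LINT t|m. indicator (R n) t * f0 (t - s))"
      by (intro Bochner_Integration.integral_add Bochner_Integration.integrable_sum integrable_indicator_m[OF it] Ab Rb)
    also have "(LINT t|m. (\<Sum>i<n. indicator (A i) t * f0 (t - s))) = (\<Sum>i<n. LINT t|m. indicator (A i) t * f0 (t - s))"
      by (intro Bochner_Integration.integral_sum integrable_indicator_m[OF it] Ab)
    finally show ?thesis by (simp only: kernel_integral_def)
  qed
  have le: "norm ((\<Sum>i<n. conv_measure \<nu> g f0 (A i)) - conv_measure \<nu> g f0 U) \<le> e * C"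
    if small: "\<And>s. (LINT t|m. cmod (indicator (R n) t * f0 (t - s))) \<le> e" for n e
  proof (rule norm_le_cdual_ball)
    fix \<phi> :: "'x \<Rightarrow> complex" assume "\<phi> \<in> cdual_ball"
    then have \<phi>: "\<phi> \<in> cdual" and o: "onorm \<phi> \<le> 1" by (auto simp: cdual_ball_def)
    note vp = vector_measure_pairing[OF vm \<phi>]
    let ?\<tau> = "total_variation (pairing \<nu> \<phi>)" and ?c = "complex_integral (pairing \<nu> \<phi>)"
    have sm: "cmod (?k (indicator (R n)) s) \<le> e" for s
      using small[of s] integral_norm_bound[of m "\<lambda>t. indicator (R n) t * f0 (t - s)"] unfolding kernel_integral_def
      by linarith
    then have e0: "0 \<le> e" using norm_ge_zero order_trans by blast
    have "\<phi> (conv_measure \<nu> g f0 U) = (\<Sum>i<n. ?c (\<lambda>s. ?k (indicator (A i)) s * g s)) + ?c (\<lambda>s. ?k (indicator (R n)) s * g s)"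
    proof -
      have "?c (\<lambda>s. ?k (indicator U) s * g s) = ?c (\<lambda>s. (\<Sum>i<n. ?k (indicator (A i)) s * g s) + ?k (indicator (R n)) s * g s)"
        by (simp only: ks[of _ n] distrib_right sum_distrib_right)
      also have "\<dots> = ?c (\<lambda>s. \<Sum>i<n. ?k (indicator (A i)) s * g s) + ?c (\<lambda>s. ?k (indicator (R n)) s * g s)"
        using integrable_conv_kernel[OF Ab \<phi>] integrable_conv_kernel[OF Rb \<phi>] by (intro complex_integral_add[OF vp]) auto
      also have "?c (\<lambda>s. \<Sum>i<n. ?k (indicator (A i)) s * g s) = (\<Sum>i<n. ?c (\<lambda>s. ?k (indicator (A i)) s * g s))"
        using integrable_conv_kernel[OF Ab \<phi>] by (intro complex_integral_sum[OF vp]) auto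
      finally show ?thesis by (simp add: conv_measure[OF Ub \<phi>])
    qed
    then have "\<phi> ((\<Sum>i<n. conv_measure \<nu> g f0 (A i)) - conv_measure \<nu> g f0 U) = - ?c (\<lambda>s. ?k (indicator (R n)) s * g s)"
      by (simp add: cdual_diff[OF \<phi>] cdual_sum[OF \<phi>] conv_measure[OF Ab \<phi>])
    then have "cmod (\<phi> ((\<Sum>i<n. conv_measure \<nu> g f0 (A i)) - conv_measure \<nu> g f0 U)) \<le> (LINT s|?\<tau>. cmod (?k (indicator (R n)) s * g s))"
      using cmod_complex_integral_le[OF vp integrable_conv_kernel[OF Rb \<phi>]] by simp
    also have "\<dots> \<le> (LINT s|?\<tau>. e * cmod (g s))"
      using integrable_conv_kernel[OF Rb \<phi>] L1_vectorD(2)[OF g \<phi>] sm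
      by (intro integral_mono integrable_norm) (auto simp: norm_mult intro!: mult_right_mono)
    also have "\<dots> = e * (LINT s|?\<tau>. cmod (g s))" by simp
    also have "\<dots> \<le> e * (onorm \<phi> * C)" using e0 C(2)[OF \<phi>] by (rule mult_left_mono[rotated])
    also have "\<dots> \<le> e * (1 * C)" using e0 o C(1) by (intro mult_left_mono mult_right_mono)
    finally show "cmod (\<phi> ((\<Sum>i<n. conv_measure \<nu> g f0 (A i)) - conv_measure \<nu> g f0 U)) \<le> e * C" by simp
  qed
  have R0: "(\<lambda>n. measure m (R n)) \<longlonglongrightarrow> 0"
  proof -
    have "(\<lambda>n. measure m U - (\<Sum>i<n. measure m (A i))) \<longlonglongrightarrow> measure m U - measure m U"
      using finite_measure_UNION[of A] A by (intro tendsto_diff tendsto_const) (simp add: sums_def U_def)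
    moreover have "measure m (R n) = measure m U - (\<Sum>i<n. measure m (A i))" for n
    proof -
      have "measure m (R n) = measure m U - measure m (\<Union>i<n. A i)"
        unfolding R_def using Ub Ab by (intro finite_measure_Diff) (auto simp: U_def)
      moreover have "measure m (\<Union>i<n. A i) = (\<Sum>i<n. measure m (A i))"
        using A by (intro finite_measure_finite_Union) (auto simp: disjoint_family_on_def)
      ultimately show ?thesis by simp
    qed
    ultimately show ?thesis by simp
  qed
  have "(\<lambda>n. \<Sum>i<n. conv_measure \<nu> g f0 (A i)) \<longlonglongrightarrow> conv_measure \<nu> g f0 U"
  proof (rule metric_LIMSEQ_I)
    fix e :: real assume e: "0 < e"
    define e' where "e' = e / (2 * (C + 1))"
    have e': "0 < e'" using e C(1) by (simp add: e'_def)
    obtain d where d: "0 < d" "\<And>A s. A \<in> sets borel \<Longrightarrow> measure m A < d \<Longrightarrow>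
        (LINT t|m. cmod (indicator A t * f0 (t - s))) \<le> e'"
      by (rule translate_integral_small[OF f0(2) e']) (rule that)
    obtain N where N: "\<And>n. n \<ge> N \<Longrightarrow> measure m (R n) < d"
      using order_tendstoD(2)[OF R0 d(1)] by (auto simp: eventually_sequentially)
    have "e' * C < e"
    proof -
      have "e' * C \<le> e' * (C + 1)" using e' by (intro mult_left_mono) auto
      also have "\<dots> = e / 2" using C(1) by (simp add: e'_def field_simps)
      finally show ?thesis using e by simp
    qed
    then have "dist (\<Sum>i<n. conv_measure \<nu> g f0 (A i)) (conv_measure \<nu> g f0 U) < e" if "n \<ge> N" for n
      using le[of n e'] d(2)[OF Rb N[OF that]] unfolding dist_norm by (meson le_less_trans)
    then show "\<exists>N. \<forall>n\<ge>N. dist (\<Sum>i<n. conv_measure \<nu> g f0 (A i)) (conv_measure \<nu> g f0 U) < e" by blast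
  qed
  then show "(\<lambda>i. conv_measure \<nu> g f0 (A i)) sums conv_measure \<nu> g f0 (\<Union>i. A i)" by (simp add: sums_def U_def)
qed

lemma semivariation_conv_measure:
  assumes "p \<noteq> \<infinity>" "young_bound \<nu> g p R f0"
  shows "semivariation m p (conv_measure \<nu> g f0) \<le> R"
  using assms
  by (intro semivariation_le_kernel[where D = "\<lambda>t s. f0 (t - s)" and K = "LINT t|m. cmod (f0 t)"] conv_kernel_measurable conv_kernel_bounded
      integrable_translate(1) f0 conv_measure) (auto simp: young_bound_def)

end

end

end

section \<open>Membership in the closure of the simple functions\<close>

context compact_haar
begin

lemma borel_measurable_translate_nn_integral:
  fixes k \<alpha> :: "'g \<Rightarrow> complex"
  assumes k: "k \<in> borel_measurable baire" and \<alpha>: "\<alpha> \<in> borel_measurable borel"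
  shows "(\<lambda>s. \<integral>\<^sup>+t. ennreal (cmod (\<alpha> t * k (t - s))) \<partial>m) \<in> borel_measurable borel"
proof (rule borel_measurable_nn_integral)
  have "(\<lambda>z. \<alpha> (snd z) * k (snd z - fst z)) \<in> borel_measurable (borel \<Otimes>\<^sub>M borel)"
    by (intro borel_measurable_times measurable_compose[OF measurable_minus_baire_swap k]
      measurable_compose[OF measurable_snd \<alpha>])
  then have "(\<lambda>z. ennreal (cmod (\<alpha> (snd z) * k (snd z - fst z)))) \<in> borel_measurable (borel \<Otimes>\<^sub>M borel)"
    by measurable
  then show "(\<lambda>(s, t). ennreal (cmod (\<alpha> t * k (t - s)))) \<in> borel_measurable (borel \<Otimes>\<^sub>M m)"
    by (simp add: split_beta' measurable_cong_sets[OF sets_pair_measure_cong[OF refl sets_m] refl])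
qed

lemma simple_function_compose_measurable:
  "simple_function m c \<Longrightarrow> (\<lambda>t. h (c t)) \<in> borel_measurable m"
  using measurable_compose[OF measurable_simple_function, of m c h borel] by simp

lemma cdual_simple_density:
  assumes \<phi>: "\<phi> \<in> cdual" and S: "simple_function m S" and A: "A \<in> sets borel"
  shows "\<phi> (simple_density m S A) = (LINT t|m. indicator A t * \<phi> (S t))"
proof -
  have "\<phi> (r *\<^sub>R x) = of_real r * \<phi> x" for r x
    using linear_cmul[OF bounded_linear.linear[OF cdual_bounded_linear[OF \<phi>]]] by (simp add: scaleR_conv_of_real)
  then show ?thesis
    using integral_finite_range[OF finite_measure_axioms S, of A \<phi>] A
    by (simp add: simple_density_def cdual_sum[OF \<phi>])
qed

lemma vconv_has_density:
  fixes \<nu> :: "'g set \<Rightarrow> 'x::complex_normed_vector"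
  assumes conv: "is_vconv_measure m \<nu> f g \<mu>" and d: "vconv_defined m \<nu> f g"
  shows "has_density m (vconv \<nu> f g) \<mu>"
  unfolding has_density_def
proof (intro ballI conjI)
  fix \<phi> :: "'x \<Rightarrow> complex" assume \<phi>: "\<phi> \<in> cdual"
  let ?c = "\<lambda>t. complex_integral (pairing \<nu> \<phi>) (\<lambda>s. f (t - s) * g s)"
  have ae: "AE t in m. \<phi> (vconv \<nu> f g t) = ?c t"
    using d unfolding vconv_defined_def
  proof eventually_elim
    case (elim t)
    from vector_integral_L1_vector[OF elim, of UNIV] show ?case
      using \<phi> by (simp add: vconv_def is_vector_integral_UNIV)
  qed
  have c: "integrable (completion m) ?c"
    "\<And>A. A \<in> sets borel \<Longrightarrow> \<phi> (\<mu> A) = (LINT t|completion m. indicator A t * ?c t)"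
    using conv \<phi> by (auto simp: is_vconv_measure_def)
  show "integrable (completion m) (\<lambda>t. \<phi> (vconv \<nu> f g t))"
    by (rule integral_completion_AE(1)[OF c(1) ae])
  fix A :: "'g set" assume A: "A \<in> sets borel"
  have "A \<in> sets (completion m)" using A by simp
  from integrable_mult_indicator[OF this c(1)]
  have i: "integrable (completion m) (\<lambda>t. indicator A t * ?c t)"
    by (rule Bochner_Integration.integrable_cong[THEN iffD1, rotated -1]) (auto simp: indicator_def)
  have "AE t in m. indicator A t * \<phi> (vconv \<nu> f g t) = indicator A t * ?c t"
    using ae by eventually_elim simp
  from integral_completion_AE(2)[OF i this]
  show "\<phi> (\<mu> A) = (LINT t|completion m. indicator A t * \<phi> (vconv \<nu> f g t))"
    by (simp add: c(2)[OF A])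
qed

text \<open>After \<open>f\<close> is replaced by a continuous \<open>h\<close>, the kernel
  \<open>h (t - s)\<close> is replaced by \<open>h (c t - s)\<close> with \<open>c\<close> simple.
  The latter is the convolution kernel of the simple function \<open>X (c t)\<close>, where
  \<open>X y\<close> is the vector integral of \<open>h (y - s) * g s\<close>; the two replacements
  cost \<open>e / 2\<close> each.\<close>

lemma convolution_in_P_space:
  fixes \<nu> :: "'g set \<Rightarrow> 'x::complex_banach"
  assumes vm: "vector_measure \<nu>" and g: "g \<in> L1_vector \<nu>" and p: "1 \<le> p" "p \<noteq> \<infinity>"
    and f: "f \<in> borel_measurable borel" "integrable m f"
    and R: "young_bound \<nu> g p R f" "R < \<infinity>"
    and approx: "\<And>e. 0 < e \<Longrightarrow> \<exists>h. continuous_on UNIV h \<and> young_bound \<nu> g p (ennreal e) (\<lambda>x. f x - h x)"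
  shows "\<exists>\<mu>\<in>P_space m p. is_vconv_measure m \<nu> f g \<mu> \<and>
      (vconv_defined m \<nu> f g \<longrightarrow> has_density m (vconv \<nu> f g) \<mu>) \<and> semivariation m p \<mu> \<le> R"
proof -
  obtain f0 N where f0m: "f0 \<in> borel_measurable baire" and N: "N \<in> sets baire" "emeasure m N = 0"
    "\<And>x. x \<notin> N \<Longrightarrow> f x = f0 x"
    by (rule borel_measurable_complex_eq_baire[OF f(1)]) (rule that)
  have N3: "\<forall>x. x \<notin> N \<longrightarrow> f x = f0 x" using N(3) by blast
  have "N \<in> null_sets m" using N(1,2) sets_baire_subset_borel by (intro null_setsI) auto
  then have ae: "AE x in m. f x = f0 x" using N(3) by (auto intro: AE_I'[of N])
  have "f0 \<in> borel_measurable m" using borel_measurable_baire_imp_borel[OF f0m] by (simp add: measurable_m)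
  then have "integrable m f0"
    using f(2) integrable_cong_AE[OF borel_measurable_integrable[OF f(2)] _ ae] by simp
  note f0 = f0m this
  note vg = vm g f0
  define \<mu> where "\<mu> = conv_measure \<nu> g f0"
  have conv: "is_vconv_measure m \<nu> f g \<mu>"
    unfolding is_vconv_measure_def
  proof (intro ballI conjI)
    fix \<phi> :: "'x \<Rightarrow> complex" assume \<phi>: "\<phi> \<in> cdual"
    note sc = scalar_convolution[OF vector_measure_pairing[OF vm \<phi>] L1_vectorD(2)[OF g \<phi>] f(1) N(1,2) N3 f0]
    show "AE t in m. integrable (total_variation (pairing \<nu> \<phi>)) (\<lambda>s. f (t - s) * g s)" by (rule sc(1))
    show "integrable (completion m) (\<lambda>t. complex_integral (pairing \<nu> \<phi>) (\<lambda>s. f (t - s) * g s))" by (rule sc(2))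
    show "\<phi> (\<mu> A) = (LINT t|completion m. indicator A t * complex_integral (pairing \<nu> \<phi>) (\<lambda>s. f (t - s) * g s))"
      if "A \<in> sets borel" for A
      by (simp add: sc(3)[OF that] \<mu>_def conv_measure[OF vg that \<phi>])
  qed
  have sv: "semivariation m p \<mu> \<le> R"
    unfolding \<mu>_def by (rule semivariation_conv_measure[OF vg p(2) young_bound_cong_AE[OF vm g R(1) ae]])
  have vmu: "vector_measure \<mu>" unfolding \<mu>_def by (rule vector_measure_conv_measure[OF vg])
  have "\<exists>\<psi>. simple_function m \<psi> \<and> semivariation m p (\<lambda>A. \<mu> A - simple_density m \<psi> A) < \<epsilon>"
    if \<epsilon>: "0 < \<epsilon>" for \<epsilon> :: ennreal
  proof -
    \<comment> \<open>\<open>\<epsilon>\<close> may be infinite; a smaller positive value is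
      finite.\<close>
    obtain \<epsilon>' where \<epsilon>': "0 < \<epsilon>'" "\<epsilon>' < \<epsilon>" using dense[OF \<epsilon>] by blast
    define e where "e = enn2real \<epsilon>'"
    have "\<epsilon>' < \<infinity>" using \<epsilon>'(2) by (rule order.strict_trans2) simp
    then have e: "0 < e" "ennreal e < \<epsilon>" using \<epsilon>' by (auto simp: e_def enn2real_positive_iff)
    define G where "G = enn2real (L1_vector_norm \<nu> g)"
    have G: "L1_vector_norm \<nu> g = ennreal G" "0 \<le> G"
      using L1_vector_norm_finite[OF vm g] by (auto simp: G_def)
    \<comment> \<open>A uniform kernel error \<open>e1\<close> costs at most \<open>e1 * G\<close>,
      which is then below \<open>e / 2\<close>; the added 1 covers \<open>G = 0\<close>.\<close>
    define e1 where "e1 = e / (2 * (G + 1))"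
    have e1: "0 < e1" using e G by (simp add: e1_def)
    obtain h where h: "continuous_on UNIV h" "young_bound \<nu> g p (ennreal (e / 2)) (\<lambda>x. f x - h x)"
      using approx[of "e / 2"] e by auto
    obtain c where c: "simple_function m c" "\<And>t s. cmod (h (t - s) - h (c t - s)) \<le> e1"
      by (rule continuous_nearest_point[OF h(1) e1]) (rule that)
    obtain Kh where Kh: "\<And>x. cmod (h x) \<le> Kh" by (rule continuous_bounded[OF h(1)]) (rule that)
    have hm: "h \<in> borel_measurable borel" by (rule borel_measurable_continuous_onI[OF h(1)])
    have hsm: "(\<lambda>s. h (y - s)) \<in> borel_measurable borel" for y using hm by measurable
    have "\<exists>v. is_vector_integral \<nu> UNIV (\<lambda>s. h (y - s) * g s) v" for y
      by (rule is_vector_integral_bounded_mult[OF vm g hsm Kh])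
    then obtain X where X: "\<And>y. is_vector_integral \<nu> UNIV (\<lambda>s. h (y - s) * g s) (X y)" by metis
    \<comment> \<open>The kernel that represents the difference of \<open>\<mu>\<close> and the
      simple density.\<close>
    define D where "D t s = f0 (t - s) - h (c t - s)" for t s
    have fin: "finite (range c)" using simple_functionD(1)[OF c(1)] by simp
    have ihc: "integrable m (\<lambda>t. h (c t - s))" for s
      using simple_function_compose_measurable[OF c(1), of "\<lambda>y. h (y - s)"] Kh
      by (intro integrable_const_bound[of _ Kh]) auto
    have iD: "integrable m (\<lambda>t. D t s)" for s
      unfolding D_def by (intro Bochner_Integration.integrable_diff integrable_translate(1) f0 ihc)
    define w where "w A y = complex_of_real (measure m (A \<inter> c -` {y}))" for A y
    have kh: "(LINT t|m. indicator A t * h (c t - s)) = (\<Sum>y\<in>range c. w A y * h (y - s))" if "A \<in> sets borel" for A s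
      using integral_finite_range[OF finite_measure_axioms c(1), of A "\<lambda>y. h (y - s)"] that by (simp add: w_def)
    have kD: "kernel_integral D (indicator A) s = kernel_integral (\<lambda>t s. f0 (t - s)) (indicator A) s - (\<Sum>y\<in>range c. w A y * h (y - s))"
      if A: "A \<in> sets borel" for A s
      unfolding kh[OF A, symmetric] kernel_integral_def D_def right_diff_distrib
      by (intro Bochner_Integration.integral_diff integrable_indicator_m integrable_translate(1) f0 ihc A)
    have "semivariation m p (\<lambda>A. \<mu> A - simple_density m (\<lambda>t. X (c t)) A) \<le> ennreal (e / 2) + ennreal e1 * L1_vector_norm \<nu> g"
    proof (rule semivariation_le_kernel[OF vm g p(2), where D = D])
      show "integrable m (\<lambda>t. D t s)" for s by (rule iD)
    next
      fix A :: "'g set" assume A: "A \<in> sets borel"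
      show "kernel_integral D (indicator A) \<in> borel_measurable borel"
        unfolding kD[OF A] using conv_kernel_measurable[OF vg A] hsm by measurable
      fix s
      have "cmod (LINT t|m. indicator A t * h (c t - s)) \<le> (LINT t|m. cmod (indicator A t * h (c t - s)))"
        by (rule integral_norm_bound)
      also have "\<dots> \<le> (LINT t|m. Kh)"
      proof (rule integral_mono)
        show "cmod (indicator A t * h (c t - s)) \<le> Kh" for t
          using Kh[of "c t - s"] norm_ge_zero[of "h (c t - s)"] by (auto simp: indicator_def simp del: norm_ge_zero)
      qed (use integrable_indicator_m[OF ihc A] in auto)
      also have "\<dots> = Kh" using prob_space by simp
      finally have "cmod (\<Sum>y\<in>range c. w A y * h (y - s)) \<le> Kh" by (simp add: kh[OF A])
      then show "cmod (kernel_integral D (indicator A) s) \<le> (LINT t|m. cmod (f0 t)) + Kh"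
        unfolding kD[OF A] using conv_kernel_bounded[OF vg A, of s]
        by (intro order_trans[OF norm_triangle_ineq4] add_mono)
    next
      fix \<phi> :: "'x \<Rightarrow> complex" and A :: "'g set" assume \<phi>: "\<phi> \<in> cdual" and A: "A \<in> sets borel"
      note vp = vector_measure_pairing[OF vm \<phi>]
      let ?c = "complex_integral (pairing \<nu> \<phi>)"
      have ih: "integrable (total_variation (pairing \<nu> \<phi>)) (\<lambda>s. h (y - s) * g s)" for y
        by (rule integrable_bounded_mult[OF L1_vectorD(2)[OF g \<phi>] hsm Kh])
      have "\<phi> (simple_density m (\<lambda>t. X (c t)) A) = (LINT t|m. indicator A t * \<phi> (X (c t)))"
        using simple_function_compose[OF c(1), of X] A by (intro cdual_simple_density \<phi>) (auto simp: comp_def)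
      also have "\<dots> = (\<Sum>y\<in>range c. w A y * \<phi> (X y))"
        using integral_finite_range[OF finite_measure_axioms c(1), of A "\<lambda>y. \<phi> (X y)"] A by (simp add: w_def)
      also have "\<dots> = (\<Sum>y\<in>range c. ?c (\<lambda>s. w A y * (h (y - s) * g s)))"
        using X \<phi> by (intro sum.cong refl) (simp add: complex_integral_cmult[OF vp ih] is_vector_integral_UNIV)
      also have "\<dots> = ?c (\<lambda>s. \<Sum>y\<in>range c. w A y * (h (y - s) * g s))"
        using fin ih by (intro complex_integral_sum[OF vp, symmetric]) auto
      finally have sd: "\<phi> (simple_density m (\<lambda>t. X (c t)) A) = ?c (\<lambda>s. \<Sum>y\<in>range c. w A y * (h (y - s) * g s))" .
      have eq: "kernel_integral D (indicator A) s * g s = kernel_integral (\<lambda>t s. f0 (t - s)) (indicator A) s * g s -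
          (\<Sum>y\<in>range c. w A y * (h (y - s) * g s))" for s
        by (simp add: kD[OF A] left_diff_distrib sum_distrib_right mult.assoc)
      show "\<phi> (\<mu> A - simple_density m (\<lambda>t. X (c t)) A) = ?c (\<lambda>s. kernel_integral D (indicator A) s * g s)"
        unfolding eq
        using ih by (subst complex_integral_diff[OF vp integrable_conv_kernel[OF vg A \<phi>]])
          (auto simp: cdual_diff[OF \<phi>] sd \<mu>_def conv_measure[OF vg A \<phi>])
    next
      fix \<phi> :: "'x \<Rightarrow> complex" and \<alpha> :: "'g \<Rightarrow> complex"
      assume b: "\<phi> \<in> cdual_ball" and \<alpha>: "\<alpha> \<in> borel_measurable borel" "Lp_norm m (conj_exponent p) \<alpha> \<le> 1"
      let ?\<tau> = "total_variation (pairing \<nu> \<phi>)"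
      let ?I = "\<lambda>s. \<integral>\<^sup>+t. ennreal (cmod (\<alpha> t * (f0 (t - s) - h (t - s)))) \<partial>m"
      have \<alpha>m: "\<alpha> \<in> borel_measurable m" using \<alpha>(1) by (simp add: measurable_m)
      have kb: "(\<lambda>x. f0 x - h x) \<in> borel_measurable baire"
        using f0(1) continuous_imp_baire_measurable_complex[OF h(1)] by (rule borel_measurable_diff)
      have Im: "?I \<in> borel_measurable borel" by (rule borel_measurable_translate_nn_integral[OF kb \<alpha>(1)])
      have gm: "g \<in> borel_measurable borel" by (rule L1_vectorD(1)[OF g])
      \<comment> \<open>Haar measure has total mass one, so the dual unit ball lies in the unit ball
        of the integrable functions, and a uniform kernel error passes through
        \<open>\<alpha>\<close> without loss.\<close>
      have \<alpha>1: "(\<integral>\<^sup>+t. ennreal (cmod (\<alpha> t)) \<partial>m) \<le> 1"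
        using nn_integral_le_Lp_norm[OF \<alpha>m one_le_conj_exponent[of p]] \<alpha>(2) by (rule order_trans)
      have inner: "(\<integral>\<^sup>+t. ennreal (cmod (\<alpha> t * D t s)) \<partial>m) \<le> ?I s + ennreal e1" for s
      proof -
        have "(\<integral>\<^sup>+t. ennreal (cmod (\<alpha> t * D t s)) \<partial>m) \<le>
            (\<integral>\<^sup>+t. ennreal (cmod (\<alpha> t * (f0 (t - s) - h (t - s)))) + ennreal e1 * ennreal (cmod (\<alpha> t)) \<partial>m)"
        proof (rule nn_integral_mono)
          fix t
          have "D t s = (f0 (t - s) - h (t - s)) + (h (t - s) - h (c t - s))" by (simp add: D_def)
          then have "cmod (D t s) \<le> cmod (f0 (t - s) - h (t - s)) + e1"
            using norm_triangle_ineq[of "f0 (t - s) - h (t - s)" "h (t - s) - h (c t - s)"] c(2)[of t s] by simp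
          then have "cmod (\<alpha> t) * cmod (D t s) \<le> cmod (\<alpha> t) * (cmod (f0 (t - s) - h (t - s)) + e1)"
            by (rule mult_left_mono) simp
          then show "ennreal (cmod (\<alpha> t * D t s)) \<le>
              ennreal (cmod (\<alpha> t * (f0 (t - s) - h (t - s)))) + ennreal e1 * ennreal (cmod (\<alpha> t))"
            using e1 by (simp add: norm_mult ennreal_leI distrib_left mult.commute flip: ennreal_mult ennreal_plus)
        qed
        also have "\<dots> = ?I s + ennreal e1 * (\<integral>\<^sup>+t. ennreal (cmod (\<alpha> t)) \<partial>m)"
        proof -
          have "(\<lambda>t. f0 (t - s) - h (t - s)) \<in> borel_measurable m"
            using borel_measurable_baire_imp_borel[OF kb] continuous_borel_maps(5)[of s] unfolding measurable_m
            by (rule measurable_compose[rotated])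
          then show ?thesis using \<alpha>m by (subst nn_integral_add) (auto simp: nn_integral_cmult)
        qed
        also have "\<dots> \<le> ?I s + ennreal e1 * 1" by (intro add_left_mono mult_left_mono \<alpha>1) auto
        finally show ?thesis by simp
      qed
      have "(\<integral>\<^sup>+s. (\<integral>\<^sup>+t. ennreal (cmod (\<alpha> t * D t s)) \<partial>m) * ennreal (cmod (g s)) \<partial>?\<tau>) \<le>
          (\<integral>\<^sup>+s. ?I s * ennreal (cmod (g s)) + ennreal e1 * ennreal (cmod (g s)) \<partial>?\<tau>)"
        by (intro nn_integral_mono) (simp add: mult_right_mono[OF inner] flip: distrib_right)
      also have "\<dots> = (\<integral>\<^sup>+s. ?I s * ennreal (cmod (g s)) \<partial>?\<tau>) + ennreal e1 * (\<integral>\<^sup>+s. ennreal (cmod (g s)) \<partial>?\<tau>)"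
      proof -
        have "?I \<in> borel_measurable ?\<tau>" "(\<lambda>s. ennreal (cmod (g s))) \<in> borel_measurable ?\<tau>"
          using Im gm by (simp_all cong: measurable_cong_sets)
        then show ?thesis by (subst nn_integral_add) (auto simp: nn_integral_cmult)
      qed
      also have "\<dots> \<le> ennreal (e / 2) + ennreal e1 * L1_vector_norm \<nu> g"
      proof (intro add_mono mult_left_mono nn_integral_le_L1_vector_norm[OF vm b])
        have "AE x in m. f x - h x = f0 x - h x" using ae by eventually_elim simp
        from young_bound_cong_AE[OF vm g h(2) this]
        show "(\<integral>\<^sup>+s. ?I s * ennreal (cmod (g s)) \<partial>?\<tau>) \<le> ennreal (e / 2)"
          using b \<alpha> unfolding young_bound_def by blast
      qed simp
      finally show "(\<integral>\<^sup>+s. (\<integral>\<^sup>+t. ennreal (cmod (\<alpha> t * D t s)) \<partial>m) * ennreal (cmod (g s)) \<partial>?\<tau>) \<le>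
        ennreal (e / 2) + ennreal e1 * L1_vector_norm \<nu> g" .
    qed
    also have "\<dots> \<le> ennreal e"
    proof -
      have "e1 * G \<le> e1 * (G + 1)" using e1 by (intro mult_left_mono) auto
      also have "\<dots> = e / 2" using G(2) by (simp add: e1_def field_simps)
      finally have "e / 2 + e1 * G \<le> e" by simp
      then show ?thesis using e e1 G by (simp add: ennreal_leI flip: ennreal_mult ennreal_plus)
    qed
    also have "\<dots> < \<epsilon>" by (rule e(2))
    finally show ?thesis
      using simple_function_compose[OF c(1), of X] by (auto simp: comp_def)
  qed
  then have "\<mu> \<in> P_space m p"
    using vmu sv R(2) by (auto simp: P_space_def M_space_def intro: le_less_trans)
  then show ?thesis using conv vconv_has_density[OF conv] sv by blast
qed

text \<open>Hoelder's inequality in \<open>t\<close> bounds the inner integral by the norm of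
  \<open>k\<close>, uniformly in \<open>s\<close> by translation invariance; what remains is the
  integral of the modulus of \<open>g\<close>.\<close>

lemma young_bound_Lp:
  fixes \<nu> :: "'g set \<Rightarrow> 'x::complex_banach"
  assumes vm: "vector_measure \<nu>" and g: "g \<in> L1_vector \<nu>" and p: "1 \<le> p" and k: "k \<in> Lp_space m p"
  shows "young_bound \<nu> g p (Lp_norm m p k * L1_vector_norm \<nu> g) k"
  unfolding young_bound_def
proof (intro ballI impI)
  fix \<phi> :: "'x \<Rightarrow> complex" and \<alpha> :: "'g \<Rightarrow> complex"
  assume b: "\<phi> \<in> cdual_ball" and \<alpha>: "\<alpha> \<in> borel_measurable borel" "Lp_norm m (conj_exponent p) \<alpha> \<le> 1"
  define F \<theta> where "F = enn2real (Lp_norm m p k)" and "\<theta> = enn2real (1 / p)"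
  have \<theta>: "0 \<le> \<theta>" "\<theta> \<le> 1" using enn2real_inverse_le_1[OF p] by (auto simp: \<theta>_def)
  have km: "k \<in> borel_measurable m" and kf: "Lp_norm m p k < \<infinity>" using k by (auto simp: Lp_space_def)
  have F: "0 \<le> F" "Lp_norm m p k = ennreal F" using kf by (auto simp: F_def)
  obtain B where B: "B \<in> borel_measurable m" "\<And>x. 0 \<le> B x" "(\<integral>\<^sup>+x. ennreal (B x) \<partial>m) \<le> 1"
    "AE x in m. cmod (k x) \<le> F * B x powr \<theta>"
    by (rule Lp_norm_factor[OF km p kf, folded F_def \<theta>_def]) (rule that)
  have \<alpha>m: "\<alpha> \<in> borel_measurable m" using \<alpha>(1) by (simp add: measurable_m)
  have \<alpha>f: "Lp_norm m (conj_exponent p) \<alpha> < \<infinity>" using \<alpha>(2) by (rule le_less_trans) simp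
  obtain A where A: "A \<in> borel_measurable m" "\<And>x. 0 \<le> A x" "(\<integral>\<^sup>+x. ennreal (A x) \<partial>m) \<le> 1"
    "AE x in m. cmod (\<alpha> x) \<le> enn2real (Lp_norm m (conj_exponent p) \<alpha>) * A x powr enn2real (1 / conj_exponent p)"
    by (rule Lp_norm_factor[OF \<alpha>m one_le_conj_exponent \<alpha>f]) (rule that)
  note A4 = A(4)[unfolded enn2real_inverse_conj_exponent[OF p], folded \<theta>_def]
  have n1: "enn2real (Lp_norm m (conj_exponent p) \<alpha>) \<le> 1" using \<alpha>(2) by (intro enn2real_leI) auto
  have inner: "(\<integral>\<^sup>+t. ennreal (cmod (\<alpha> t * k (t - s))) \<partial>m) \<le> ennreal F" for s
  proof -
    have Bs: "(\<lambda>t. B (t - s)) \<in> borel_measurable m"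
      using B(1) continuous_borel_maps(5)[of s] unfolding measurable_m by (rule measurable_compose[rotated])
    have "(\<integral>\<^sup>+t. ennreal (cmod (\<alpha> t * k (t - s))) \<partial>m) \<le>
        (\<integral>\<^sup>+t. ennreal F * (ennreal (1 - \<theta>) * ennreal (A t) + ennreal \<theta> * ennreal (B (t - s))) \<partial>m)"
    proof (rule nn_integral_mono_AE)
      show "AE t in m. ennreal (cmod (\<alpha> t * k (t - s))) \<le>
          ennreal F * (ennreal (1 - \<theta>) * ennreal (A t) + ennreal \<theta> * ennreal (B (t - s)))"
        using A4 AE_minus_right[OF B(4), of s]
      proof eventually_elim
        case (elim t)
        have "cmod (\<alpha> t) \<le> 1 * A t powr (1 - \<theta>)"
          using elim(1) n1 by (rule order_trans[OF _ mult_right_mono]) simp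
        then have "cmod (\<alpha> t * k (t - s)) \<le> A t powr (1 - \<theta>) * (F * B (t - s) powr \<theta>)"
          unfolding norm_mult using elim(2) F by (intro mult_mono) auto
        also have "\<dots> = F * (A t powr (1 - \<theta>) * B (t - s) powr \<theta>)" by simp
        also have "\<dots> \<le> F * ((1 - \<theta>) * A t + \<theta> * B (t - s))"
          using A(2) B(2) \<theta> F by (intro mult_left_mono powr_weighted_AM_GM) auto
        finally show ?case
          using A(2)[of t] B(2)[of "t - s"] \<theta> F by (simp add: ennreal_leI flip: ennreal_mult ennreal_plus)
      qed
    qed
    also have "\<dots> = ennreal F * (ennreal (1 - \<theta>) * (\<integral>\<^sup>+t. ennreal (A t) \<partial>m) + ennreal \<theta> * (\<integral>\<^sup>+t. ennreal (B (t - s)) \<partial>m))"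
      using A(1) Bs by (simp add: nn_integral_cmult nn_integral_add)
    also have "\<dots> \<le> ennreal F * (ennreal (1 - \<theta>) * 1 + ennreal \<theta> * 1)"
      using A(3) B(1,3) nn_integral_minus_right[of "\<lambda>x. ennreal (B x)" s]
      by (intro mult_left_mono add_mono) (auto simp: measurable_m)
    also have "\<dots> = ennreal F" using \<theta> by (simp flip: ennreal_plus)
    finally show ?thesis .
  qed
  have "(\<integral>\<^sup>+s. (\<integral>\<^sup>+t. ennreal (cmod (\<alpha> t * k (t - s))) \<partial>m) * ennreal (cmod (g s)) \<partial>total_variation (pairing \<nu> \<phi>)) \<le>
      (\<integral>\<^sup>+s. ennreal F * ennreal (cmod (g s)) \<partial>total_variation (pairing \<nu> \<phi>))"
    by (intro nn_integral_mono mult_right_mono inner) simp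
  also have "\<dots> = ennreal F * (\<integral>\<^sup>+s. ennreal (cmod (g s)) \<partial>total_variation (pairing \<nu> \<phi>))"
    using L1_vectorD(1)[OF g] by (intro nn_integral_cmult) (simp cong: measurable_cong_sets)
  also have "\<dots> \<le> Lp_norm m p k * L1_vector_norm \<nu> g"
    unfolding F(2) by (intro mult_left_mono nn_integral_le_L1_vector_norm[OF vm b]) simp
  finally show "(\<integral>\<^sup>+s. (\<integral>\<^sup>+t. ennreal (cmod (\<alpha> t * k (t - s))) \<partial>m) * ennreal (cmod (g s)) \<partial>total_variation (pairing \<nu> \<phi>))
    \<le> Lp_norm m p k * L1_vector_norm \<nu> g" .
qed

text \<open>A bound proportional to the norm of \<open>k\<close> transfers the density of continuous
  functions, available for finite \<open>q\<close>, to the approximation that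
  \<open>convolution_in_P_space\<close> asks for. The exponent \<open>q\<close> of the function may
  differ from the exponent \<open>p\<close> of the target space.\<close>

lemma convolution_of_young_bound:
  fixes \<nu> :: "'g set \<Rightarrow> 'x::complex_banach"
  assumes vm: "vector_measure \<nu>" and g: "g \<in> L1_vector \<nu>" and p: "1 \<le> p" "p \<noteq> \<infinity>"
    and q: "1 \<le> q" "q < \<infinity>" and f: "f \<in> Lp_space m q" and C: "C < \<infinity>"
    and bound: "\<And>k. k \<in> Lp_space m q \<Longrightarrow> young_bound \<nu> g p (Lp_norm m q k * C) k"
  shows "\<exists>\<mu>\<in>P_space m p. is_vconv_measure m \<nu> f g \<mu> \<and>
      (vconv_defined m \<nu> f g \<longrightarrow> has_density m (vconv \<nu> f g) \<mu>) \<and> semivariation m p \<mu> \<le> Lp_norm m q f * C"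
proof (rule convolution_in_P_space[OF vm g p])
  have fm: "f \<in> borel_measurable m" "Lp_norm m q f < \<infinity>" using f by (auto simp: Lp_space_def)
  show "f \<in> borel_measurable borel" using fm(1) by (simp add: measurable_m)
  show "integrable m f" by (rule Lp_space_integrable[OF q(1) f])
  show "young_bound \<nu> g p (Lp_norm m q f * C) f" by (rule bound[OF f])
  show "Lp_norm m q f * C < \<infinity>" using fm(2) C by (simp add: ennreal_mult_less_top)
  fix e :: real assume e: "0 < e"
  define c where "c = enn2real C"
  have c: "0 \<le> c" "C = ennreal c" using C by (auto simp: c_def)
  obtain h where h: "continuous_on UNIV h" "Lp_norm m q (\<lambda>x. f x - h x) < ennreal (e / (c + 1))"
    by (rule continuous_dense_Lp[OF q f, of "e / (c + 1)"]) (use e c that in auto)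
  have "(\<lambda>x. f x - h x) \<in> borel_measurable m"
    using fm(1) borel_measurable_continuous_onI[OF h(1)] by (intro borel_measurable_diff) (simp_all add: measurable_m)
  then have "(\<lambda>x. f x - h x) \<in> Lp_space m q"
    using h(2) by (auto simp: Lp_space_def intro: less_trans)
  from bound[OF this] have "young_bound \<nu> g p (ennreal e) (\<lambda>x. f x - h x)"
  proof (rule young_bound_mono[OF vm g])
    have "Lp_norm m q (\<lambda>x. f x - h x) * C \<le> ennreal (e / (c + 1)) * ennreal c"
      unfolding c(2) using h(2) by (intro mult_right_mono) auto
    also have "\<dots> = ennreal (e * (c / (c + 1)))" using e c by (simp flip: ennreal_mult)
    also have "\<dots> \<le> ennreal e" using e c by (intro ennreal_leI mult_left_le) (auto simp: divide_le_eq_1)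
    finally show "Lp_norm m q (\<lambda>x. f x - h x) * C \<le> ennreal e" .
  qed
  then show "\<exists>h. continuous_on UNIV h \<and> young_bound \<nu> g p (ennreal e) (\<lambda>x. f x - h x)"
    using h(1) by blast
qed

end

section \<open>Measures of finite semivariation\<close>

text \<open>The level sets of \<open>a\<close> form a partition as in the definition of the
  semivariation.\<close>

lemma semivariation_finite_range:
  fixes \<nu> :: "'g::topological_space set \<Rightarrow> 'x::complex_normed_vector"
  assumes vm: "vector_measure \<nu>" and p: "p \<noteq> \<infinity>" and \<phi>: "\<phi> \<in> cdual"
    and a: "a \<in> borel_measurable borel" "finite (range a)" and N: "Lp_norm m (conj_exponent p) a \<le> 1"
    and c: "semivariation m p \<nu> \<le> ennreal c" "0 \<le> c"
  shows "cmod (complex_integral (pairing \<nu> \<phi>) a) \<le> onorm \<phi> * c"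
proof -
  note vp = vector_measure_pairing[OF vm \<phi>]
  interpret finite_measure "total_variation (pairing \<nu> \<phi>)" by (rule finite_measure_total_variation[OF vp])
  define L where "L y = a -` {y}" for y
  define \<rho> where "\<rho> = L ` range a"
  \<comment> \<open>Coefficients are indexed by sets, so the common value on a level set is read off
    at a chosen point.\<close>
  define \<alpha> where "\<alpha> A = a (SOME x. x \<in> A)" for A
  have Lb: "L y \<in> sets borel" for y
    unfolding L_def using measurable_sets[OF a(1), of "{y}"] by simp
  have \<alpha>L: "\<alpha> (L y) = y" if "y \<in> range a" for y
  proof -
    have "\<exists>x. x \<in> L y" using that by (auto simp: L_def)
    then have "(SOME x. x \<in> L y) \<in> L y" by (rule someI_ex)
    then show ?thesis by (simp add: \<alpha>_def L_def)
  qed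
  have inj: "inj_on L (range a)" by (rule inj_on_inverseI[where g = \<alpha>]) (rule \<alpha>L)
  have part: "finite \<rho>" "\<rho> \<subseteq> sets borel" "partition_on UNIV \<rho>"
    using a(2) Lb by (auto simp: \<rho>_def partition_on_def L_def disjoint_def)
  have sum_eq: "(\<Sum>A\<in>\<rho>. F (\<alpha> A) A) = (\<Sum>y\<in>range a. F y (L y))" for F :: "complex \<Rightarrow> 'g set \<Rightarrow> 'b::comm_monoid_add"
    unfolding \<rho>_def by (subst sum.reindex[OF inj]) (simp add: \<alpha>L cong: sum.cong)
  have ia: "a t = (\<Sum>y\<in>range a. y * indicator (L y) t)" for t
  proof -
    have "(\<Sum>y\<in>range a. y * indicator (L y) t) = (\<Sum>y\<in>{a t}. y * indicator (L y) t)"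
      using a(2) by (intro sum.mono_neutral_right) (auto simp: indicator_def L_def)
    then show ?thesis by (simp add: L_def)
  qed
  have "(\<lambda>t. \<Sum>A\<in>\<rho>. \<alpha> A * indicator A t) = a"
  proof
    fix t
    have "(\<Sum>A\<in>\<rho>. \<alpha> A * indicator A t) = (\<Sum>y\<in>range a. y * indicator (L y) t)" by (rule sum_eq)
    then show "(\<Sum>A\<in>\<rho>. \<alpha> A * indicator A t) = a t" by (rule trans[OF _ ia[symmetric]])
  qed
  then have "ennreal (norm (\<Sum>A\<in>\<rho>. \<alpha> A *\<^sub>C \<nu> A)) \<le> semivariation m p \<nu>"
    using p part N unfolding semivariation_def by (auto intro!: SUP_upper2[where i = "(\<rho>, \<alpha>)"])
  then have "ennreal (norm (\<Sum>A\<in>\<rho>. \<alpha> A *\<^sub>C \<nu> A)) \<le> ennreal c" using c(1) by (rule order_trans)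
  then have le: "norm (\<Sum>y\<in>range a. y *\<^sub>C \<nu> (L y)) \<le> c"
    using c(2) by (simp add: sum_eq[of "\<lambda>y A. y *\<^sub>C \<nu> A"])
  have ind: "integrable (total_variation (pairing \<nu> \<phi>)) (indicator (L y) :: 'g \<Rightarrow> complex)" for y
    using integrable_indicator_mult[OF integrable_const[of "1 :: complex"] Lb] by simp
  have "complex_integral (pairing \<nu> \<phi>) a = complex_integral (pairing \<nu> \<phi>) (\<lambda>t. \<Sum>y\<in>range a. y * indicator (L y) t)"
    by (rule arg_cong[where f = "complex_integral (pairing \<nu> \<phi>)"]) (rule ext, rule ia)
  also have "\<dots> = (\<Sum>y\<in>range a. y * \<phi> (\<nu> (L y)))"
  proof -
    have "complex_integral (pairing \<nu> \<phi>) (\<lambda>t. y * indicator (L y) t) = y * \<phi> (\<nu> (L y))" for y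
      unfolding complex_integral_cmult[OF vp ind] complex_integral_indicator[OF vp Lb] by (simp add: pairing_def)
    then show ?thesis
      using complex_integral_sum[OF vp a(2), of "\<lambda>y t. y * indicator (L y) t"] ind by simp
  qed
  also have "\<dots> = \<phi> (\<Sum>y\<in>range a. y *\<^sub>C \<nu> (L y))"
    by (simp add: cdual_sum[OF \<phi>] cdual_linear[OF \<phi>])
  also have "cmod \<dots> \<le> onorm \<phi> * norm (\<Sum>y\<in>range a. y *\<^sub>C \<nu> (L y))" by (rule cdual_le_onorm[OF \<phi>])
  also have "\<dots> \<le> onorm \<phi> * c" by (intro mult_left_mono le cdual_onorm_nonneg[OF \<phi>])
  finally show ?thesis .
qed

text \<open>Simple unimodular approximations of the conjugate of the polar factor turn the scalar measure
  into its total variation.\<close>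

lemma integral_total_variation_le_semivariation:
  fixes \<nu> :: "'g::topological_space set \<Rightarrow> 'x::complex_normed_vector" and w :: "'g \<Rightarrow> real"
  assumes vm: "vector_measure \<nu>" and p: "p \<noteq> \<infinity>" and \<phi>: "\<phi> \<in> cdual"
    and w: "w \<in> borel_measurable borel" "finite (range w)" "\<And>t. 0 \<le> w t"
    and N: "Lp_norm m (conj_exponent p) (\<lambda>t. of_real (w t)) \<le> 1"
    and c: "semivariation m p \<nu> \<le> ennreal c" "0 \<le> c"
  shows "(LINT t|total_variation (pairing \<nu> \<phi>). w t) \<le> onorm \<phi> * c"
proof -
  note vp = vector_measure_pairing[OF vm \<phi>]
  let ?\<tau> = "total_variation (pairing \<nu> \<phi>)"
  interpret finite_measure ?\<tau> by (rule finite_measure_total_variation[OF vp])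
  obtain u where um: "u \<in> borel_measurable borel" "\<And>x. cmod (u x) = 1"
    and u: "\<And>h. integrable ?\<tau> h \<Longrightarrow> complex_integral (pairing \<nu> \<phi>) h = (LINT s|?\<tau>. u s * h s)"
    by (rule polar_decomposition[OF vp]) (rule that)
  have cum: "(\<lambda>x. cnj (u x)) \<in> borel_measurable ?\<tau>"
    using um(1) borel_measurable_continuous_onI[of cnj] by (simp add: continuous_intros cong: measurable_cong_sets)
  obtain S where S: "\<And>i. simple_function ?\<tau> (S i)" "\<And>x. (\<lambda>i. S i x) \<longlonglongrightarrow> cnj (u x)"
    using borel_measurable_implies_sequence_metric[OF cum, of 0] by (auto simp del: complex_cnj_zero)
  \<comment> \<open>Normalising makes the approximations unimodular. The default 1 at zeros keeps
    the modulus one there and does not affect the limit, which is nowhere zero.\<close>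
  define v where "v i x = (if S i x = 0 then 1 else sgn (S i x))" for i x
  have v1: "cmod (v i x) = 1" for i x by (simp add: v_def norm_sgn)
  have Sm: "S i \<in> borel_measurable borel" for i
    using borel_measurable_simple_function[OF S(1)[of i]] by (simp cong: measurable_cong_sets)
  have vm': "v i \<in> borel_measurable borel" for i
    using Sm[of i] unfolding v_def sgn_div_norm by measurable
  have vfin: "finite (range (v i))" for i
  proof -
    have "range (v i) \<subseteq> insert 1 (sgn ` range (S i))" by (auto simp: v_def)
    moreover have "finite (range (S i))" using simple_functionD(1)[OF S(1)[of i]] by simp
    ultimately show ?thesis by (meson finite_imageI finite_insert finite_subset)
  qed
  have vlim: "(\<lambda>i. v i x) \<longlonglongrightarrow> cnj (u x)" for x
  proof -
    have nz: "cnj (u x) \<noteq> 0" using um(2)[of x] by auto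
    have t: "(\<lambda>i. sgn (S i x)) \<longlonglongrightarrow> sgn (cnj (u x))" by (rule tendsto_sgn[OF S(2) nz])
    have eq: "sgn (cnj (u x)) = cnj (u x)" by (simp add: sgn_div_norm um(2))
    have ev: "\<forall>\<^sub>F i in sequentially. sgn (S i x) = v i x"
      using tendsto_imp_eventually_ne[OF S(2) nz] by eventually_elim (simp add: v_def)
    show ?thesis using Lim_transform_eventually[OF t ev] by (simp only: eq)
  qed
  obtain K where K: "\<And>t. w t \<le> K" using w(2) by (meson bdd_above.E bdd_above_finite rangeI)
  have wm: "w \<in> borel_measurable ?\<tau>" using w(1) by (simp cong: measurable_cong_sets)
  have iw: "integrable ?\<tau> w" using w(3) K by (intro integrable_const_bound[of _ K] wm) (auto simp: abs_of_nonneg)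
  have um': "u \<in> borel_measurable ?\<tau>" "v i \<in> borel_measurable ?\<tau>" for i
    using um(1) vm' by (simp_all cong: measurable_cong_sets)
  have "(\<lambda>i. LINT t|?\<tau>. u t * (of_real (w t) * v i t)) \<longlonglongrightarrow> (LINT t|?\<tau>. u t * (of_real (w t) * cnj (u t)))"
  proof (rule integral_dominated_convergence[where w = w])
    show "AE t in ?\<tau>. (\<lambda>i. u t * (of_real (w t) * v i t)) \<longlonglongrightarrow> u t * (of_real (w t) * cnj (u t))"
      by (intro AE_I2 tendsto_intros vlim)
    show "AE t in ?\<tau>. cmod (u t * (of_real (w t) * v i t)) \<le> w t" for i
      using w(3) by (intro AE_I2) (simp add: norm_mult um(2) v1)
  qed (use um' cum wm iw in auto)
  moreover have "u t * (of_real (w t) * cnj (u t)) = of_real (w t)" for t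
  proof -
    have "u t * cnj (u t) = 1" using complex_norm_square[of "u t"] um(2)[of t] by simp
    then show ?thesis by (simp add: mult.left_commute)
  qed
  ultimately have lim: "(\<lambda>i. LINT t|?\<tau>. u t * (of_real (w t) * v i t)) \<longlonglongrightarrow> of_real (LINT t|?\<tau>. w t)"
    by simp
  have "cmod (of_real (LINT t|?\<tau>. w t)) \<le> onorm \<phi> * c"
  proof (rule LIMSEQ_le_const2[OF tendsto_norm[OF lim]], intro exI allI impI)
    fix i
    have am: "(\<lambda>t. of_real (w t) * v i t) \<in> borel_measurable borel" using w(1) vm'[of i] by measurable
    have afin: "finite (range (\<lambda>t. of_real (w t) * v i t))"
    proof (rule finite_subset)
      show "range (\<lambda>t. of_real (w t) * v i t) \<subseteq> (\<lambda>(x, y). of_real x * y) ` (range w \<times> range (v i))" by auto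
    qed (use w(2) vfin in auto)
    \<comment> \<open>A unimodular factor does not change the norm, so each product is still an
      admissible test function.\<close>
    have "Lp_norm m (conj_exponent p) (\<lambda>t. of_real (w t) * v i t) = Lp_norm m (conj_exponent p) (\<lambda>t. of_real (w t))"
      by (simp add: Lp_norm_def norm_mult v1)
    then have N': "Lp_norm m (conj_exponent p) (\<lambda>t. of_real (w t) * v i t) \<le> 1" using N by simp
    have "integrable ?\<tau> (\<lambda>t. of_real (w t) * v i t)"
      using w(3) K um' wm by (intro integrable_const_bound[of _ K]) (auto simp: norm_mult v1)
    then show "cmod (LINT t|?\<tau>. u t * (of_real (w t) * v i t)) \<le> onorm \<phi> * c"
      using semivariation_finite_range[OF vm p \<phi> am afin N' c] by (simp add: u)
  qed
  then show ?thesis by simp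
qed

context compact_haar
begin

lemma Lp_norm_AE_zero:
  assumes "1 \<le> p" "AE x in m. f x = 0" "f \<in> borel_measurable m"
  shows "Lp_norm m p f = 0"
proof (cases "p = \<infinity>")
  case True
  have "esssup m (\<lambda>t. ennreal (cmod (f t))) \<le> 0"
    using assms(2,3) by (intro esssup_I) (auto elim!: eventually_mono)
  then show ?thesis using True by (simp add: Lp_norm_def)
next
  case False
  then have "0 < enn2real p" using enn2real_inverse_finite(2)[OF assms(1)] by (simp add: less_top)
  then have "(\<integral>\<^sup>+ t. ennreal (cmod (f t) powr enn2real p) \<partial>m) = (\<integral>\<^sup>+ t. 0 \<partial>m)"
    using assms(2) by (intro nn_integral_cong_AE) (auto elim!: eventually_mono)
  then show ?thesis using False by (simp add: Lp_norm_def)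
qed

text \<open>Finitely many translates of a nonempty open set cover the compact group, and all have
  the same measure.\<close>

lemma emeasure_open_pos:
  assumes U: "open U" "U \<noteq> {}"
  shows "0 < emeasure m U"
proof (rule ccontr)
  assume "\<not> ?thesis"
  then have U0: "emeasure m U = 0" by simp
  obtain a where a: "a \<in> U" using U(2) by auto
  have op: "open ((\<lambda>x. x - b) -` U)" for b using U(1) by (intro open_vimage continuous_intros) auto
  have "(UNIV :: 'g set) \<subseteq> (\<Union>b\<in>UNIV. (\<lambda>x. x - b) -` U)"
  proof
    fix x :: 'g
    have "x - (- a + x) = a" by (simp only: diff_conv_add_uminus minus_add minus_minus add_minus_cancel)
    then show "x \<in> (\<Union>b\<in>UNIV. (\<lambda>x. x - b) -` U)" using a by (intro UN_I[of "- a + x"]) auto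
  qed
  then obtain T where T: "finite T" "(UNIV :: 'g set) \<subseteq> (\<Union>b\<in>T. (\<lambda>x. x - b) -` U)"
    by (rule compactE_image[OF compact_UNIV op])
  have "(\<lambda>x. x - b) -` U \<in> null_sets m" for b
  proof -
    have "emeasure m ((\<lambda>x. x - b) -` U) = emeasure (distr m borel (\<lambda>x. x - b)) U"
      using U(1) by (subst emeasure_distr) (auto simp: measurable_m)
    then show ?thesis using op[of b] by (intro null_setsI) (auto simp: distr_minus_right U0)
  qed
  then have "(\<Union>b\<in>T. (\<lambda>x. x - b) -` U) \<in> null_sets m" by (rule null_sets_UN'[OF countable_finite[OF T(1)]])
  moreover have "(\<Union>b\<in>T. (\<lambda>x. x - b) -` U) = UNIV" using T(2) by auto
  ultimately show False using emeasure_space_1 by (auto simp: null_sets_def)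
qed

text \<open>The \<open>\<infinity>\<close>-semivariation ignores null sets. A non-empty null set exists only if points are null;
  it can then be enlarged by sets of arbitrarily small positive measure.\<close>

lemma semivariation_infinity_null:
  fixes \<nu> :: "'g set \<Rightarrow> 'x::complex_normed_vector"
  assumes vm: "vector_measure \<nu>" and c: "semivariation m \<infinity> \<nu> \<le> ennreal c" "0 \<le> c" and A: "A \<in> sets borel"
  shows "norm (\<nu> A) \<le> c * measure m A"
proof -
  have pos: "norm (\<nu> B) \<le> c * measure m B" if B: "B \<in> sets borel" "0 < measure m B" for B
  proof -
    have "ennreal (norm (\<nu> B) / measure m B) \<le> semivariation m \<infinity> \<nu>"
      unfolding semivariation_def using B by (auto intro!: SUP_upper)
    then have "ennreal (norm (\<nu> B) / measure m B) \<le> ennreal c" using c(1) by (rule order_trans)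
    then show ?thesis using c(2) B by (simp add: divide_le_eq)
  qed
  show ?thesis
  proof (cases "0 < measure m A \<or> A = {}")
    case True
    then show ?thesis using pos[OF A] vector_measure_empty[OF vm] by auto
  next
    case False
    then have A0: "measure m A = 0" and "A \<noteq> {}" using measure_nonneg[of m A] by (auto simp: not_less)
    then obtain a where a: "a \<in> A" by auto
    have s: "{a} \<in> sets borel" by simp
    have "measure m {a} \<le> measure m A" using a A by (intro finite_measure_mono) auto
    then have a0: "emeasure m {a} = 0" using A0 measure_nonneg[of m "{a}"] by (simp add: emeasure_eq_measure)
    have "norm (\<nu> A) \<le> 0 + e" if e: "0 < e" for e
    proof -
      define d where "d = (e / 2) / (c + 1)"
      have d: "0 < d" using e c(2) by (simp add: d_def)
      then have "emeasure m {a} < ennreal d" using a0 by simp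
      then obtain U where U: "open U" "{a} \<subseteq> U" "emeasure m U < ennreal d" by (rule open_outer[OF s])
      have Ub: "U \<in> sets borel" using U(1) by auto
      have mU: "0 < measure m U" "measure m U < d"
        using emeasure_open_pos[OF U(1)] U(2,3) d by (auto simp: emeasure_eq_measure ennreal_less_iff)
      have m1: "measure m (U - A) = measure m U" and m2: "measure m (U \<union> A) = measure m U"
        using A Ub A0 by (auto simp: measure_Diff_null_set measure_Un_null_set null_sets_def emeasure_eq_measure)
      have "\<nu> ((U - A) \<union> A) = \<nu> (U - A) + \<nu> A" using A Ub by (intro vector_measure_Un[OF vm]) auto
      then have "\<nu> A = \<nu> (U \<union> A) - \<nu> (U - A)" by (simp add: Un_commute)
      then have "norm (\<nu> A) \<le> norm (\<nu> (U \<union> A)) + norm (\<nu> (U - A))" by (metis norm_triangle_ineq4)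
      also have "\<dots> \<le> c * measure m U + c * measure m U"
        using pos[of "U \<union> A"] pos[of "U - A"] A Ub mU m1 m2 by (intro add_mono) auto
      also have "\<dots> \<le> (c + 1) * d + (c + 1) * d"
        using mU c(2) by (intro add_mono mult_mono) auto
      also have "(c + 1) * d = e / 2"
      proof -
        have "c + 1 \<noteq> 0" using c(2) by simp
        from nonzero_eq_divide_eq[OF this, THEN iffD1, OF d_def] show ?thesis by (simp only: mult.commute)
      qed
      finally show ?thesis by simp
    qed
    then have "norm (\<nu> A) \<le> 0" by (rule field_le_epsilon)
    then show ?thesis by (simp add: A0)
  qed
qed

end

section \<open>Densities of the total variations and their norms\<close>

context compact_haar
begin

lemma ex_density_total_variation:
  assumes vm: "vector_measure (\<kappa> :: 'g set \<Rightarrow> complex)"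
    and ac: "\<And>A. A \<in> sets borel \<Longrightarrow> emeasure m A = 0 \<Longrightarrow> emeasure (total_variation \<kappa>) A = 0"
  obtains n :: "'g \<Rightarrow> real" where "n \<in> borel_measurable borel" "\<And>x. 0 \<le> n x"
    "total_variation \<kappa> = density m (\<lambda>x. ennreal (n x))" "integrable m n"
proof -
  have fin: "finite_measure (total_variation \<kappa>)" by (rule finite_measure_total_variation[OF vm])
  have "absolutely_continuous m (total_variation \<kappa>)"
    using ac by (auto simp: absolutely_continuous_def null_sets_def)
  from Radon_Nikodym_finite_measure[OF fin _ this] obtain f
    where f: "f \<in> borel_measurable m" "density m f = total_variation \<kappa>" by auto
  have "(\<integral>\<^sup>+x. f x \<partial>m) = emeasure (density m f) UNIV"
    using f(1) by (subst emeasure_density) auto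
  also have "\<dots> \<noteq> \<infinity>"
    unfolding f(2) using finite_measure.emeasure_finite[OF fin] by auto
  finally have fI: "(\<integral>\<^sup>+x. f x \<partial>m) \<noteq> \<infinity>" .
  have ae: "AE x in m. f x \<noteq> \<infinity>" by (rule nn_integral_PInf_AE[OF f(1) fI])
  then have ae': "AE x in m. f x = ennreal (enn2real (f x))" by eventually_elim (simp add: less_top)
  show ?thesis
  proof (rule that[of "\<lambda>x. enn2real (f x)"])
    show "(\<lambda>x. enn2real (f x)) \<in> borel_measurable borel" using f(1) by (simp add: measurable_m)
    show "total_variation \<kappa> = density m (\<lambda>x. ennreal (enn2real (f x)))"
      unfolding f(2)[symmetric] using ae' f(1) by (intro density_cong) auto
    have "(\<integral>\<^sup>+x. ennreal (enn2real (f x)) \<partial>m) = (\<integral>\<^sup>+x. f x \<partial>m)"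
      using ae' by (intro nn_integral_cong_AE) (auto elim!: eventually_mono)
    then show "integrable m (\<lambda>x. enn2real (f x))"
      using fI f(1) by (intro integrableI_nonneg) (auto simp: less_top)
  qed simp
qed

text \<open>The bound by a multiple of Haar measure holds on each member of a partition and adds up
  to the same bound for the total variation, so its density is bounded by the constant.\<close>

lemma density_semivariation_infinity:
  fixes \<nu> :: "'g set \<Rightarrow> 'x::complex_normed_vector"
  assumes vm: "vector_measure \<nu>" and \<phi>: "\<phi> \<in> cdual"
    and c: "semivariation m \<infinity> \<nu> \<le> ennreal c" "0 \<le> c"
  obtains n where "n \<in> borel_measurable borel" "\<And>x. 0 \<le> n x"
    "total_variation (pairing \<nu> \<phi>) = density m (\<lambda>x. ennreal (n x))" "AE x in m. n x \<le> onorm \<phi> * c"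
proof -
  note vp = vector_measure_pairing[OF vm \<phi>]
  let ?\<tau> = "total_variation (pairing \<nu> \<phi>)" and ?o = "onorm \<phi> * c"
  have o: "0 \<le> ?o" using c(2) cdual_onorm_nonneg[OF \<phi>] by simp
  have \<tau>le: "emeasure ?\<tau> A \<le> ennreal (?o * measure m A)" if A: "A \<in> sets borel" for A
    unfolding emeasure_total_variation[OF vp A]
  proof (rule SUP_least)
    fix \<rho> assume "\<rho> \<in> {\<rho>. finite \<rho> \<and> \<rho> \<subseteq> sets borel \<and> partition_on A \<rho>}"
    then have \<rho>: "finite \<rho>" "\<rho> \<subseteq> sets borel" "disjoint \<rho>" "\<Union>\<rho> = A" by (auto simp: partition_on_def)
    have "(\<Sum>B\<in>\<rho>. cmod (pairing \<nu> \<phi> B)) \<le> (\<Sum>B\<in>\<rho>. ?o * measure m B)"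
    proof (rule sum_mono)
      fix B assume "B \<in> \<rho>"
      then have "norm (\<nu> B) \<le> c * measure m B" using \<rho>(2) by (intro semivariation_infinity_null[OF vm c]) auto
      then have "onorm \<phi> * norm (\<nu> B) \<le> onorm \<phi> * (c * measure m B)"
        by (intro mult_left_mono cdual_onorm_nonneg[OF \<phi>])
      then show "cmod (pairing \<nu> \<phi> B) \<le> ?o * measure m B"
        using cdual_le_onorm[OF \<phi>, of "\<nu> B"] by (simp add: pairing_def mult.assoc)
    qed
    also have "\<dots> = ?o * measure m A"
    proof -
      have "measure m (\<Union>B\<in>\<rho>. B) = (\<Sum>B\<in>\<rho>. measure m B)"
        using \<rho> by (intro finite_measure_finite_Union) (auto simp: disjoint_family_on_def disjoint_def)
      then show ?thesis using \<rho>(4) by (simp add: sum_distrib_left)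
    qed
    finally show "(\<Sum>B\<in>\<rho>. ennreal (cmod (pairing \<nu> \<phi> B))) \<le> ennreal (?o * measure m A)"
      by (subst sum_ennreal) (auto intro!: ennreal_leI)
  qed
  have "emeasure ?\<tau> A = 0" if "A \<in> sets borel" "emeasure m A = 0" for A
    using \<tau>le[OF that(1)] that(2) by (simp add: measure_def)
  from ex_density_total_variation[OF vp this]
  obtain n where n: "n \<in> borel_measurable borel" "\<And>x. 0 \<le> n x" "?\<tau> = density m (\<lambda>x. ennreal (n x))" "integrable m n"
    by metis
  have "AE x in m. n x - ?o \<le> 0"
  proof (rule AE_nonpos_if_integrals_nonpos)
    show "integrable m (\<lambda>x. n x - ?o)" using n(4) by simp
    fix A assume "A \<in> sets m"
    then have A: "A \<in> sets borel" by simp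
    have iA: "integrable m (\<lambda>x. indicator A x * n x)" "integrable m (\<lambda>x. indicator A x * ?o)"
      using integrable_mult_indicator[of A m n] integrable_mult_indicator[of A m "\<lambda>_. ?o"] n(4) A by auto
    have "ennreal (LINT x|m. indicator A x * n x) = (\<integral>\<^sup>+x. ennreal (n x) * indicator A x \<partial>m)"
      using n(2) by (subst nn_integral_eq_integral[OF iA(1), symmetric])
        (auto intro!: nn_integral_cong simp: indicator_def)
    also have "\<dots> = emeasure ?\<tau> A" unfolding n(3) using A n(1) by (subst emeasure_density) (auto simp: measurable_m)
    also have "\<dots> \<le> ennreal (?o * measure m A)" by (rule \<tau>le[OF A])
    finally have "(LINT x|m. indicator A x * n x) \<le> ?o * measure m A"
      using o by (subst (asm) ennreal_le_iff) auto
    then show "(LINT x|m. indicator A x * (n x - ?o)) \<le> 0"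
      using iA A by (simp add: right_diff_distrib mult.commute)
  qed
  then have "AE x in m. n x \<le> ?o" by simp
  with n(1-3) show ?thesis by (rule that)
qed

text \<open>Testing the measure on the power \<open>n\<^sub>j\<^sup>P\<^sup>-\<^sup>1\<close> of simple functions \<open>n\<^sub>j\<close> increasing to its
  density bounds the \<open>P\<close>-norm of the density.\<close>

lemma density_semivariation_finite:
  fixes \<nu> :: "'g set \<Rightarrow> 'x::complex_normed_vector"
  assumes vm: "vector_measure \<nu>" and \<phi>: "\<phi> \<in> cdual" and p: "1 \<le> p" "p \<noteq> \<infinity>" "enn2real (1 / p) < 1"
    and c: "semivariation m p \<nu> \<le> ennreal c" "0 \<le> c"
  obtains n where "n \<in> borel_measurable borel" "\<And>x. 0 \<le> n x"
    "total_variation (pairing \<nu> \<phi>) = density m (\<lambda>x. ennreal (n x))"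
    "(\<integral>\<^sup>+x. ennreal (n x powr enn2real p) \<partial>m) \<le> ennreal ((onorm \<phi> * c) powr enn2real p)"
proof -
  note vp = vector_measure_pairing[OF vm \<phi>]
  let ?\<tau> = "total_variation (pairing \<nu> \<phi>)" and ?o = "onorm \<phi> * c"
  define P Q where "P = enn2real p" and "Q = enn2real (conj_exponent p)"
  have o: "0 \<le> ?o" using c(2) cdual_onorm_nonneg[OF \<phi>] by simp
  have P: "enn2real (1 / p) = 1 / P" "1 < P"
    using enn2real_inverse_finite[of p] p by (auto simp: P_def less_top divide_less_eq_1 split: if_splits)
  have q1: "enn2real (1 / conj_exponent p) = 1 - 1 / P"
    by (simp only: enn2real_inverse_conj_exponent[OF p(1)] P(1))
  have qi: "conj_exponent p \<noteq> \<infinity>"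
  proof
    assume "conj_exponent p = \<infinity>"
    then show False using q1 P(2) by simp
  qed
  then have Q: "1 / Q = 1 - 1 / P" "1 \<le> Q"
    using enn2real_inverse_finite[of "conj_exponent p"] one_le_conj_exponent[of p] q1
    by (auto simp: Q_def less_top)
  \<comment> \<open>The relation of conjugate exponents that makes the test function with power
    \<open>P - 1\<close> lie in the dual space.\<close>
  have PQ: "(P - 1) * Q = P" using Q P(2) by (auto simp: field_simps)
  note T = integral_total_variation_le_semivariation[OF vm p(2) \<phi> _ _ _ _ c]
  interpret \<tau>: finite_measure ?\<tau> by (rule finite_measure_total_variation[OF vp])
  have null: "emeasure ?\<tau> A = 0" if A: "A \<in> sets borel" "emeasure m A = 0" for A
  proof -
    \<comment> \<open>On a null set every multiple of the indicator has norm zero and is an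
      admissible test function; since \<open>K\<close> is arbitrary, the variation of
      \<open>A\<close> must vanish.\<close>
    have "K * measure ?\<tau> A \<le> ?o" if K: "0 \<le> K" for K
    proof -
      have "AE x in m. x \<notin> A" using A by (intro AE_not_in) (auto simp: null_sets_def)
      then have "AE x in m. of_real (K * indicator A x) = (0 :: complex)" by eventually_elim simp
      then have "Lp_norm m (conj_exponent p) (\<lambda>t. of_real (K * indicator A t)) = 0"
        using A(1) by (intro Lp_norm_AE_zero one_le_conj_exponent) (auto simp: measurable_m)
      moreover have "finite (range (\<lambda>t. K * indicator A t))"
        by (rule finite_subset[of _ "{0, K}"]) (auto simp: indicator_def)
      ultimately have "(LINT t|?\<tau>. K * indicator A t) \<le> ?o"
        using A(1) K by (intro T) auto
      then show ?thesis using A(1) by simp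
    qed
    from this[of "(?o + 1) / measure ?\<tau> A"] have "measure ?\<tau> A = 0"
      using o measure_nonneg[of ?\<tau> A] by (cases "measure ?\<tau> A = 0") auto
    then show ?thesis by (simp add: \<tau>.emeasure_eq_measure)
  qed
  from ex_density_total_variation[OF vp null]
  obtain n where n: "n \<in> borel_measurable borel" "\<And>x. 0 \<le> n x" "?\<tau> = density m (\<lambda>x. ennreal (n x))" "integrable m n"
    by metis
  have nm: "n \<in> borel_measurable m" using n(1) by (simp add: measurable_m)
  obtain f where f: "\<And>i. simple_function m (f i)" "incseq f" "\<And>i x. f i x < \<infinity>" "\<And>x. (SUP i. f i x) = ennreal (n x)"
    using borel_measurable_implies_simple_function_sequence'[of "\<lambda>x. ennreal (n x)" m] nm by auto
  define s where "s j x = enn2real (f j x)" for j x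
  have fs: "f j x = ennreal (s j x)" for j x using f(3)[of j x] by (simp add: s_def)
  have s0: "0 \<le> s j x" for j x by (simp add: s_def)
  have sn: "s j x \<le> n x" for j x
  proof -
    have "ennreal (s j x) \<le> ennreal (n x)" unfolding fs[symmetric] f(4)[symmetric] by (rule SUP_upper) simp
    then show ?thesis using n(2) by (simp add: ennreal_le_iff)
  qed
  have slim: "(\<lambda>j. s j x) \<longlonglongrightarrow> n x" for x
  proof -
    have "(\<lambda>j. f j x) \<longlonglongrightarrow> (SUP j. f j x)" using f(2) by (intro LIMSEQ_SUP) (auto simp: incseq_def le_fun_def)
    then have "(\<lambda>j. enn2real (f j x)) \<longlonglongrightarrow> enn2real (ennreal (n x))" unfolding f(4) by (intro tendsto_enn2real) auto
    then show ?thesis using n(2) by (simp add: s_def)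
  qed
  have sfin: "finite (range (s j))" for j
  proof -
    have "finite (range (f j))" using simple_functionD(1)[OF f(1)[of j]] by simp
    moreover have "range (s j) = enn2real ` range (f j)" by (auto simp: s_def)
    ultimately show ?thesis by simp
  qed
  have sm: "s j \<in> borel_measurable borel" for j
    using borel_measurable_simple_function[OF f(1)[of j]] unfolding s_def by (simp add: measurable_m)
  have bound: "(\<integral>\<^sup>+x. ennreal (s j x powr P) \<partial>m) \<le> ennreal (?o powr P)" for j
  proof -
    obtain K where K: "\<And>x. s j x \<le> K" using bdd_above_finite[OF sfin[of j]] by (auto simp: bdd_above_def)
    have sPm: "(\<lambda>x. s j x powr P) \<in> borel_measurable m" using sm[of j] unfolding measurable_m by measurable
    have sPb: "s j x powr P \<le> K powr P" for x using K[of x] s0[of j x] P(2) by (intro powr_mono2) auto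
    have iP: "integrable m (\<lambda>x. s j x powr P)"
      using sPb sPm by (intro integrable_const_bound[of _ "K powr P"]) auto
    define I where "I = (LINT x|m. s j x powr P)"
    have I0: "0 \<le> I" unfolding I_def by (intro Bochner_Integration.integral_nonneg) simp
    have nnI: "(\<integral>\<^sup>+x. ennreal (s j x powr P) \<partial>m) = ennreal I"
      unfolding I_def by (rule nn_integral_eq_integral[OF iP]) simp
    show ?thesis
    proof (cases "I = 0")
      case False
      with I0 have I: "0 < I" by simp
      \<comment> \<open>The extremal function for Hoelder's inequality, normalised in the dual norm;
        paired with \<open>s j\<close> it returns the \<open>P\<close>-norm of
        \<open>s j\<close>.\<close>
      define w where "w x = s j x powr (P - 1) / I powr (1 / Q)" for x
      have w0: "0 \<le> w x" for x by (simp add: w_def)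
      have wm: "w \<in> borel_measurable borel" unfolding w_def using sm[of j] by measurable
      have wfin: "finite (range w)"
      proof -
        have "range w = (\<lambda>y. y powr (P - 1) / I powr (1 / Q)) ` range (s j)" by (auto simp: w_def)
        then show ?thesis using sfin[of j] by simp
      qed
      have wQ: "w x powr Q = s j x powr P / I" for x
        using I Q(2) by (simp add: w_def powr_divide powr_powr PQ)
      have "(\<integral>\<^sup>+x. ennreal (cmod (of_real (w x)) powr Q) \<partial>m) = (\<integral>\<^sup>+x. ennreal (s j x powr P / I) \<partial>m)"
        using w0 by (simp add: wQ)
      also have "\<dots> = ennreal (LINT x|m. s j x powr P / I)"
        using iP I by (intro nn_integral_eq_integral) auto
      also have "\<dots> = 1" using I by (simp flip: I_def)
      finally have "Lp_norm m (conj_exponent p) (\<lambda>x. of_real (w x)) = 1"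
        by (simp add: Lp_norm_finite_eq[OF qi] flip: Q_def)
      then have "(LINT t|?\<tau>. w t) \<le> ?o" by (intro T wm wfin w0) simp
      moreover have iw: "integrable ?\<tau> w"
      proof (rule \<tau>.integrable_const_bound)
        show "AE x in ?\<tau>. norm (w x) \<le> Max (range w)"
          using wfin w0 by (intro AE_I2) simp
        show "w \<in> borel_measurable ?\<tau>" using wm by (simp cong: measurable_cong_sets)
      qed
      have wmm: "w \<in> borel_measurable m" using wm by (simp add: measurable_m)
      have inw: "integrable m (\<lambda>x. n x * w x)"
        using iw integrable_density[OF wmm nm, of ] n(2) unfolding n(3) by auto
      have "(LINT t|?\<tau>. w t) = (LINT x|m. n x * w x)"
        unfolding n(3) using integral_density[OF wmm nm] n(2) by simp
      moreover have "I powr (1 / P) \<le> (LINT x|m. n x * w x)"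
      proof -
        have eq: "s j x powr P / I powr (1 / Q) = s j x * w x" for x
          using s0[of j x] by (simp add: w_def powr_mult_base)
        have "I powr (1 / P) = I / I powr (1 / Q)"
          using I by (simp add: Q(1) powr_diff)
        also have "\<dots> = (LINT x|m. s j x powr P / I powr (1 / Q))" by (simp add: I_def)
        also have "\<dots> \<le> (LINT x|m. n x * w x)"
        proof (rule integral_mono[OF _ inw])
          show "integrable m (\<lambda>x. s j x powr P / I powr (1 / Q))" using iP by simp
          show "s j x powr P / I powr (1 / Q) \<le> n x * w x" for x
            unfolding eq by (intro mult_right_mono sn w0)
        qed
        finally show ?thesis .
      qed
      ultimately have "I powr (1 / P) \<le> ?o" by linarith
      then have "(I powr (1 / P)) powr P \<le> ?o powr P" using P(2) by (intro powr_mono2) auto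
      then have "I \<le> ?o powr P" using I P(2) by (simp add: powr_powr)
      then show ?thesis by (simp add: nnI ennreal_leI)
    qed (simp add: nnI)
  qed
  \<comment> \<open>The uniform bound passes to the limit \<open>n\<close> by Fatou's lemma.\<close>
  have "(\<integral>\<^sup>+x. ennreal (n x powr P) \<partial>m) = (\<integral>\<^sup>+x. liminf (\<lambda>j. ennreal (s j x powr P)) \<partial>m)"
  proof (rule nn_integral_cong)
    fix x
    have "(\<lambda>j. ennreal (s j x powr P)) \<longlonglongrightarrow> ennreal (n x powr P)"
      using slim[of x] s0 P(2) by (intro tendsto_ennrealI tendsto_powr2) (auto intro!: tendsto_const always_eventually)
    then show "ennreal (n x powr P) = liminf (\<lambda>j. ennreal (s j x powr P))"
      by (intro lim_imp_Liminf[symmetric]) auto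
  qed
  also have "\<dots> \<le> liminf (\<lambda>j. \<integral>\<^sup>+x. ennreal (s j x powr P) \<partial>m)"
    using sm by (intro nn_integral_liminf) (simp add: measurable_m)
  also have "\<dots> \<le> ennreal (?o powr P)"
    by (rule Liminf_le) (use bound in simp_all)
  finally show ?thesis using that[OF n(1-3)] by (simp add: P_def)
qed

text \<open>The same normal form as in \<open>Lp_norm_factor\<close>, with
  \<open>onorm \<phi> * c\<close> in place of the norm: this makes the measure a fourth factor on
  equal terms with the functions in Young's inequality.\<close>

lemma density_of_semivariation:
  fixes \<nu> :: "'g set \<Rightarrow> 'x::complex_normed_vector"
  assumes vm: "vector_measure \<nu>" and \<phi>: "\<phi> \<in> cdual" and p: "1 \<le> p" "enn2real (1 / p) < 1"
    and c: "semivariation m p \<nu> \<le> ennreal c" "0 \<le> c"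
  obtains n D where "n \<in> borel_measurable borel" "\<And>x. 0 \<le> n x"
    "total_variation (pairing \<nu> \<phi>) = density m (\<lambda>x. ennreal (n x))"
    "D \<in> borel_measurable borel" "\<And>x. 0 \<le> D x" "(\<integral>\<^sup>+x. ennreal (D x) \<partial>m) \<le> 1"
    "AE x in m. n x \<le> onorm \<phi> * c * D x powr enn2real (1 / p)"
proof (cases "p = \<infinity>")
  case True
  have c': "semivariation m \<infinity> \<nu> \<le> ennreal c" using c(1) True by simp
  obtain n where n: "n \<in> borel_measurable borel" "\<And>x. 0 \<le> n x"
    "total_variation (pairing \<nu> \<phi>) = density m (\<lambda>x. ennreal (n x))" "AE x in m. n x \<le> onorm \<phi> * c"
    by (rule density_semivariation_infinity[OF vm \<phi> c' c(2)]) (rule that)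
  show ?thesis
    by (rule that[OF n(1-3), of "\<lambda>_. 1"]) (use n(4) emeasure_space_1 in auto)
next
  case False
  define b where "b = onorm \<phi> * c"
  have o: "0 \<le> b" using c(2) cdual_onorm_nonneg[OF \<phi>] by (simp add: b_def)
  define P where "P = enn2real p"
  have P: "enn2real (1 / p) = 1 / P" "1 \<le> P"
    using enn2real_inverse_finite[OF p(1)] False by (auto simp: P_def less_top)
  obtain n where n: "n \<in> borel_measurable borel" "\<And>x. 0 \<le> n x"
    "total_variation (pairing \<nu> \<phi>) = density m (\<lambda>x. ennreal (n x))"
    "(\<integral>\<^sup>+x. ennreal (n x powr P) \<partial>m) \<le> ennreal (b powr P)"
    by (rule density_semivariation_finite[OF vm \<phi> p(1) False p(2) c, folded P_def b_def]) (rule that)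
  show ?thesis
  proof (cases "b = 0")
    case True
    have "(\<integral>\<^sup>+x. ennreal (n x powr P) \<partial>m) = 0" using n(4) True by simp
    then have "AE x in m. ennreal (n x powr P) = 0"
      using n(1) by (subst (asm) nn_integral_0_iff_AE) (auto simp: measurable_m)
    then have "AE x in m. n x \<le> onorm \<phi> * c * 1 powr enn2real (1 / p)"
    proof eventually_elim
      case (elim x)
      then have "n x powr P \<le> 0" by (simp add: ennreal_eq_0_iff)
      then have "n x = 0" using powr_ge_zero[of "n x" P] by (metis antisym powr_eq_0_iff)
      then show ?case using o by (simp add: b_def)
    qed
    then show ?thesis
      by (intro that[OF n(1-3), of "\<lambda>_. 1"]) (use emeasure_space_1 in auto)
  next
    case False
    with o have op: "0 < b" by simp
    show ?thesis
    proof (rule that[OF n(1-3)])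
      show "(\<lambda>x. n x powr P / b powr P) \<in> borel_measurable borel" using n(1) by measurable
      have "(\<integral>\<^sup>+x. ennreal (n x powr P / b powr P) \<partial>m) = (\<integral>\<^sup>+x. ennreal (n x powr P) / ennreal (b powr P) \<partial>m)"
        using op by (intro nn_integral_cong) (simp add: divide_ennreal)
      also have "\<dots> = (\<integral>\<^sup>+x. ennreal (n x powr P) \<partial>m) / ennreal (b powr P)"
        using n(1) by (intro nn_integral_divide) (simp add: measurable_m)
      also have "\<dots> \<le> ennreal (b powr P) / ennreal (b powr P)" using n(4) by (intro divide_right_mono_ennreal)
      also have "\<dots> = 1" using op by (simp add: divide_ennreal)
      finally show "(\<integral>\<^sup>+x. ennreal (n x powr P / b powr P) \<partial>m) \<le> 1" .
      have "n x = b * (n x powr P / b powr P) powr (1 / P)" for x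
        using op P(2) n(2)[of x] by (simp add: powr_divide powr_powr)
      then show "AE x in m. n x \<le> onorm \<phi> * c * (n x powr P / b powr P) powr enn2real (1 / p)"
        by (simp add: P(1) flip: b_def)
    qed (use op in auto)
  qed
qed

end

section \<open>Young's inequality for vector measures\<close>

context compact_haar
begin

text \<open>Integrating over \<open>s\<close> first gives the integral of \<open>B\<close>, by
  invariance under \<open>s \<mapsto> t - s\<close>. Baire measurability of \<open>B\<close> makes
  the exchange of integrals legitimate.\<close>

lemma nn_integral_convolution_le:
  fixes A B :: "'g \<Rightarrow> real"
  assumes A: "A \<in> borel_measurable borel" "\<And>x. 0 \<le> A x" "(\<integral>\<^sup>+x. ennreal (A x) \<partial>m) \<le> 1"
    and B: "B \<in> borel_measurable baire" "\<And>x. 0 \<le> B x" "(\<integral>\<^sup>+x. ennreal (B x) \<partial>m) \<le> 1"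
  shows "(\<lambda>s. \<integral>\<^sup>+t. ennreal (A t * B (t - s)) \<partial>m) \<in> borel_measurable borel"
    "(\<integral>\<^sup>+s. \<integral>\<^sup>+t. ennreal (A t * B (t - s)) \<partial>m \<partial>m) \<le> 1"
proof -
  interpret P: pair_sigma_finite m m ..
  have Bb: "B \<in> borel_measurable borel" by (rule borel_measurable_baire_imp_borel[OF B(1)])
  have eq: "ennreal (A t * B (t - s)) = ennreal (cmod (of_real (A t) * of_real (B (t - s))))" for t s
    using A(2) B(2) by (simp add: norm_mult)
  show "(\<lambda>s. \<integral>\<^sup>+t. ennreal (A t * B (t - s)) \<partial>m) \<in> borel_measurable borel"
    unfolding eq using A(1) B(1)
    by (intro borel_measurable_translate_nn_integral[where k = "\<lambda>x. of_real (B x)" and \<alpha> = "\<lambda>x. of_real (A x)"]) auto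
  have "(\<lambda>z. A (fst z) * B (fst z - snd z)) \<in> borel_measurable (borel \<Otimes>\<^sub>M borel)"
    by (intro borel_measurable_times measurable_compose[OF measurable_fst A(1)] measurable_compose[OF measurable_minus_baire B(1)])
  then have "(\<lambda>z. ennreal (A (fst z) * B (fst z - snd z))) \<in> borel_measurable (borel \<Otimes>\<^sub>M borel)" by measurable
  then have meas: "(\<lambda>(t, s). ennreal (A t * B (t - s))) \<in> borel_measurable (m \<Otimes>\<^sub>M m)"
    by (simp add: split_beta' measurable_cong_sets[OF sets_pair_measure_cong[OF sets_m sets_m] refl])
  have "(\<integral>\<^sup>+s. \<integral>\<^sup>+t. ennreal (A t * B (t - s)) \<partial>m \<partial>m) = (\<integral>\<^sup>+t. \<integral>\<^sup>+s. ennreal (A t * B (t - s)) \<partial>m \<partial>m)"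
    by (rule P.Fubini'[OF meas])
  also have "\<dots> = (\<integral>\<^sup>+t. ennreal (A t) * (\<integral>\<^sup>+x. ennreal (B x) \<partial>m) \<partial>m)"
  proof (rule nn_integral_cong)
    fix t
    have "(\<lambda>s. ennreal (B (t - s))) \<in> borel_measurable m"
      using Bb continuous_borel_maps(4)[of t] unfolding measurable_m by measurable
    then have "(\<integral>\<^sup>+s. ennreal (A t * B (t - s)) \<partial>m) = ennreal (A t) * (\<integral>\<^sup>+s. ennreal (B (t - s)) \<partial>m)"
      using A(2) B(2) by (simp add: ennreal_mult nn_integral_cmult)
    then show "(\<integral>\<^sup>+s. ennreal (A t * B (t - s)) \<partial>m) = ennreal (A t) * (\<integral>\<^sup>+x. ennreal (B x) \<partial>m)"
      using nn_integral_minus_left[of "\<lambda>x. ennreal (B x)" t] Bb by simp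
  qed
  also have "\<dots> = (\<integral>\<^sup>+t. ennreal (A t) \<partial>m) * (\<integral>\<^sup>+x. ennreal (B x) \<partial>m)"
    using A(1) by (intro nn_integral_multc) (simp add: measurable_m)
  also have "\<dots> \<le> 1 * 1" by (intro mult_mono A B) auto
  finally show "(\<integral>\<^sup>+s. \<integral>\<^sup>+t. ennreal (A t * B (t - s)) \<partial>m \<partial>m) \<le> 1" by simp
qed

text \<open>\<open>powr_Young_four\<close> bounds the integrand by a mean of the pairwise products
  of \<open>A t\<close>, \<open>B (t - s)\<close> and \<open>W s\<close>, with weights summing to
  one. Each pairwise product has double integral at most one, by invariance and because
  \<open>W\<close> is a convex combination of \<open>C\<close> and \<open>D\<close>.\<close>

lemma four_fold_Young:
  fixes A B C D :: "'g \<Rightarrow> real"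
  assumes A: "A \<in> borel_measurable borel" "\<And>x. 0 \<le> A x" "(\<integral>\<^sup>+x. ennreal (A x) \<partial>m) \<le> 1"
    and B: "B \<in> borel_measurable baire" "\<And>x. 0 \<le> B x" "(\<integral>\<^sup>+x. ennreal (B x) \<partial>m) \<le> 1"
    and C: "C \<in> borel_measurable borel" "\<And>x. 0 \<le> C x" "(\<integral>\<^sup>+x. ennreal (C x) \<partial>m) \<le> 1"
    and D: "D \<in> borel_measurable borel" "\<And>x. 0 \<le> D x" "(\<integral>\<^sup>+x. ennreal (D x) \<partial>m) \<le> 1"
    and e: "0 \<le> a" "a \<le> 1" "0 \<le> b" "b \<le> 1" "0 \<le> c" "0 \<le> d" "0 < c + d" "c + d \<le> 1" "a + b + c + d = 2"
  shows "(\<integral>\<^sup>+s. \<integral>\<^sup>+t. ennreal (A t powr a * B (t - s) powr b * C s powr c * D s powr d) \<partial>m \<partial>m) \<le> 1"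
proof -
  define u v where "u = c / (c + d)" and "v = d / (c + d)"
  define W where "W s = u * C s + v * D s" for s
  define x y z where "x = 1 - (c + d)" and "y = 1 - b" and "z = 1 - a"
  have xyz: "0 \<le> x" "0 \<le> y" "0 \<le> z" "x + y + z = 1" using e by (auto simp: x_def y_def z_def)
  have uv: "0 \<le> u" "0 \<le> v" "u + v = 1"
    using e by (auto simp: u_def v_def simp flip: add_divide_distrib)
  have W0: "0 \<le> W s" for s unfolding W_def using uv C(2) D(2) by simp
  have Wm: "W \<in> borel_measurable borel" unfolding W_def using C(1) D(1) by measurable
  have W1: "(\<integral>\<^sup>+s. ennreal (W s) \<partial>m) \<le> 1"
  proof -
    have "(\<integral>\<^sup>+s. ennreal (W s) \<partial>m) = (\<integral>\<^sup>+s. ennreal u * ennreal (C s) + ennreal v * ennreal (D s) \<partial>m)"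
      using uv C(2) D(2) by (intro nn_integral_cong) (simp add: W_def flip: ennreal_mult ennreal_plus)
    also have "\<dots> = ennreal u * (\<integral>\<^sup>+s. ennreal (C s) \<partial>m) + ennreal v * (\<integral>\<^sup>+s. ennreal (D s) \<partial>m)"
      using C(1) D(1) by (simp add: nn_integral_add nn_integral_cmult measurable_m)
    also have "\<dots> \<le> ennreal u * 1 + ennreal v * 1"
      by (intro add_mono mult_left_mono C D) auto
    also have "\<dots> = 1" using uv by (simp flip: ennreal_plus)
    finally show ?thesis .
  qed
  let ?J = "\<lambda>s. \<integral>\<^sup>+t. ennreal (A t * B (t - s)) \<partial>m"
  note J = nn_integral_convolution_le[OF A B]
  have Bb: "B \<in> borel_measurable borel" by (rule borel_measurable_baire_imp_borel[OF B(1)])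
  have inner: "(\<integral>\<^sup>+t. ennreal (A t powr a * B (t - s) powr b * C s powr c * D s powr d) \<partial>m) \<le>
      ennreal x * ?J s + ennreal (y + z) * ennreal (W s)" for s
  proof -
    have Bs: "(\<lambda>t. B (t - s)) \<in> borel_measurable borel" using Bb by measurable
    have "(\<integral>\<^sup>+t. ennreal (A t powr a * B (t - s) powr b * C s powr c * D s powr d) \<partial>m) \<le>
        (\<integral>\<^sup>+t. ennreal x * ennreal (A t * B (t - s)) + (ennreal (y * W s) * ennreal (A t) + ennreal (z * W s) * ennreal (B (t - s))) \<partial>m)"
    proof (rule nn_integral_mono)
      fix t
      have "A t powr a * B (t - s) powr b * C s powr c * D s powr d \<le>
          x * (A t * B (t - s)) + y * (A t * W s) + z * (B (t - s) * W s)"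
        unfolding x_def y_def z_def W_def u_def v_def by (rule powr_Young_four[OF A(2) B(2) C(2) D(2) e])
      then show "ennreal (A t powr a * B (t - s) powr b * C s powr c * D s powr d) \<le>
          ennreal x * ennreal (A t * B (t - s)) + (ennreal (y * W s) * ennreal (A t) + ennreal (z * W s) * ennreal (B (t - s)))"
        using xyz A(2)[of t] B(2)[of "t - s"] W0[of s]
        by (simp add: ennreal_leI mult_ac add.assoc flip: ennreal_mult ennreal_plus)
    qed
    also have "\<dots> = ennreal x * ?J s + (ennreal (y * W s) * (\<integral>\<^sup>+t. ennreal (A t) \<partial>m) + ennreal (z * W s) * (\<integral>\<^sup>+t. ennreal (B (t - s)) \<partial>m))"
    proof -
      have "(\<lambda>t. ennreal (A t * B (t - s))) \<in> borel_measurable m" "(\<lambda>t. ennreal (A t)) \<in> borel_measurable m"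
        "(\<lambda>t. ennreal (B (t - s))) \<in> borel_measurable m"
        using A(1) Bs unfolding measurable_m by measurable
      then show ?thesis by (simp add: nn_integral_add nn_integral_cmult)
    qed
    also have "\<dots> \<le> ennreal x * ?J s + (ennreal (y * W s) * 1 + ennreal (z * W s) * 1)"
      using A(3) B(3) nn_integral_minus_right[of "\<lambda>x. ennreal (B x)" s] Bb
      by (intro add_mono mult_left_mono) auto
    also have "ennreal (y * W s) * 1 + ennreal (z * W s) * 1 = ennreal (y + z) * ennreal (W s)"
      using xyz W0[of s] by (simp add: distrib_right flip: ennreal_mult ennreal_plus)
    finally show ?thesis .
  qed
  have "(\<integral>\<^sup>+s. \<integral>\<^sup>+t. ennreal (A t powr a * B (t - s) powr b * C s powr c * D s powr d) \<partial>m \<partial>m) \<le>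
      (\<integral>\<^sup>+s. ennreal x * ?J s + ennreal (y + z) * ennreal (W s) \<partial>m)"
    by (intro nn_integral_mono inner)
  also have "\<dots> = ennreal x * (\<integral>\<^sup>+s. ?J s \<partial>m) + ennreal (y + z) * (\<integral>\<^sup>+s. ennreal (W s) \<partial>m)"
  proof -
    have "?J \<in> borel_measurable m" "(\<lambda>s. ennreal (W s)) \<in> borel_measurable m"
      using J(1) Wm by (simp_all add: measurable_m)
    then show ?thesis by (simp add: nn_integral_add nn_integral_cmult)
  qed
  also have "\<dots> \<le> ennreal x * 1 + ennreal (y + z) * 1" by (intro add_mono mult_left_mono J(2) W1) auto
  also have "\<dots> = 1" using xyz by (simp add: add.assoc flip: ennreal_plus)
  finally show ?thesis .
qed

text \<open>The variation is replaced by its density, bounded by a power of \<open>D\<close>, and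
  \<open>g\<close> by a power of \<open>C\<close>; with the given bounds on \<open>\<alpha>\<close>
  and \<open>k\<close> all four factors are powers as in \<open>four_fold_Young\<close>. Functions
  of \<open>t - s\<close> are first exchanged for Baire versions to have joint
  measurability.\<close>

lemma Young_total_variation:
  fixes \<nu> :: "'g set \<Rightarrow> 'x::complex_normed_vector" and \<alpha> k g :: "'g \<Rightarrow> complex"
  assumes vm: "vector_measure \<nu>" and \<phi>: "\<phi> \<in> cdual"
    and p1: "1 \<le> p1" "enn2real (1 / p1) < 1" and c: "semivariation m p1 \<nu> \<le> ennreal c" "0 \<le> c"
    and p2: "1 \<le> p2" and g: "g \<in> Lp_space m p2"
    and A: "A \<in> borel_measurable borel" "\<And>x. 0 \<le> A x" "(\<integral>\<^sup>+x. ennreal (A x) \<partial>m) \<le> 1"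
    and B: "B \<in> borel_measurable borel" "\<And>x. 0 \<le> B x" "(\<integral>\<^sup>+x. ennreal (B x) \<partial>m) \<le> 1"
    and \<alpha>: "\<alpha> \<in> borel_measurable borel" "AE x in m. cmod (\<alpha> x) \<le> A x powr a"
    and k: "k \<in> borel_measurable borel" "AE x in m. cmod (k x) \<le> F * B x powr b" "0 \<le> F"
    and e: "0 \<le> a" "a \<le> 1" "0 \<le> b" "b \<le> 1" "0 < enn2real (1 / p2) + enn2real (1 / p1)"
      "enn2real (1 / p2) + enn2real (1 / p1) \<le> 1" "a + b + enn2real (1 / p2) + enn2real (1 / p1) = 2"
  shows "(\<integral>\<^sup>+s. (\<integral>\<^sup>+t. ennreal (cmod (\<alpha> t * k (t - s))) \<partial>m) * ennreal (cmod (g s)) \<partial>total_variation (pairing \<nu> \<phi>))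
    \<le> ennreal (onorm \<phi> * c * F * enn2real (Lp_norm m p2 g))"
proof -
  let ?\<tau> = "total_variation (pairing \<nu> \<phi>)"
  define G where "G = enn2real (Lp_norm m p2 g)"
  define c2 d1 where "c2 = enn2real (1 / p2)" and "d1 = enn2real (1 / p1)"
  define q where "q = onorm \<phi> * c"
  have q: "0 \<le> q" using c(2) cdual_onorm_nonneg[OF \<phi>] by (simp add: q_def)
  have G0: "0 \<le> G" by (simp add: G_def)
  have gm: "g \<in> borel_measurable m" and gf: "Lp_norm m p2 g < \<infinity>" using g by (auto simp: Lp_space_def)
  obtain n D where n: "n \<in> borel_measurable borel" "\<And>x. 0 \<le> n x" "?\<tau> = density m (\<lambda>x. ennreal (n x))"
    and D: "D \<in> borel_measurable borel" "\<And>x. 0 \<le> D x" "(\<integral>\<^sup>+x. ennreal (D x) \<partial>m) \<le> 1"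
    and nD: "AE x in m. n x \<le> q * D x powr d1"
    by (rule density_of_semivariation[OF vm \<phi> p1 c, folded q_def d1_def]) (rule that)
  obtain C where C': "C \<in> borel_measurable m" and C: "\<And>x. 0 \<le> C x" "(\<integral>\<^sup>+x. ennreal (C x) \<partial>m) \<le> 1"
    and gC: "AE x in m. cmod (g x) \<le> G * C x powr c2"
    by (rule Lp_norm_factor[OF gm p2 gf, folded G_def c2_def]) (rule that)
  have Cm: "C \<in> borel_measurable borel" using C' by (simp add: measurable_m)
  obtain k0 N where k0: "k0 \<in> borel_measurable baire" and N: "N \<in> sets baire" "emeasure m N = 0"
    "\<And>x. x \<notin> N \<Longrightarrow> k x = k0 x"
    by (rule borel_measurable_complex_eq_baire[OF k(1)]) (rule that)
  obtain B0 N' where B0: "B0 \<in> borel_measurable baire" and N': "N' \<in> sets baire" "emeasure m N' = 0"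
    "\<And>x. x \<notin> N' \<Longrightarrow> B x = B0 x"
    by (rule borel_measurable_eq_baire[OF B(1)]) (rule that)
  \<comment> \<open>The Baire version may be negative on the exceptional null set.\<close>
  define B1 where "B1 x = max 0 (B0 x)" for x
  have null: "N \<in> null_sets m" "N' \<in> null_sets m"
    using N(1,2) N'(1,2) sets_baire_subset_borel by (auto intro!: null_setsI)
  have aek: "AE x in m. k x = k0 x" using AE_not_in[OF null(1)] by eventually_elim (rule N(3))
  have aeB: "AE x in m. B x = B1 x"
    using AE_not_in[OF null(2)]
  proof eventually_elim
    case (elim x)
    then show ?case using N'(3)[of x] B(2)[of x] by (simp add: B1_def)
  qed
  have B1m: "B1 \<in> borel_measurable baire" unfolding B1_def using B0 by measurable
  have B1: "\<And>x. 0 \<le> B1 x" by (simp add: B1_def)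
  have "(\<integral>\<^sup>+x. ennreal (B1 x) \<partial>m) = (\<integral>\<^sup>+x. ennreal (B x) \<partial>m)"
    using aeB by (intro nn_integral_cong_AE) (auto elim!: eventually_mono)
  then have B1i: "(\<integral>\<^sup>+x. ennreal (B1 x) \<partial>m) \<le> 1" using B(3) by simp
  have kB: "AE x in m. cmod (k0 x) \<le> F * B1 x powr b" using k(2) aek aeB by eventually_elim simp
  let ?I = "\<lambda>s. \<integral>\<^sup>+t. ennreal (cmod (\<alpha> t * k0 (t - s))) \<partial>m"
  have Im: "?I \<in> borel_measurable borel" by (rule borel_measurable_translate_nn_integral[OF k0 \<alpha>(1)])
  have Ieq: "(\<integral>\<^sup>+t. ennreal (cmod (\<alpha> t * k (t - s))) \<partial>m) = ?I s" for s
    using AE_minus_right[OF aek, of s] by (intro nn_integral_cong_AE) (auto elim: eventually_mono)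
  define K where "K = q * F * G"
  have K0: "0 \<le> K" using q G0 k(3) by (simp add: K_def)
  let ?M = "\<lambda>s t. A t powr a * B1 (t - s) powr b * C s powr c2 * D s powr d1"
  have "(\<integral>\<^sup>+s. (\<integral>\<^sup>+t. ennreal (cmod (\<alpha> t * k (t - s))) \<partial>m) * ennreal (cmod (g s)) \<partial>?\<tau>) =
      (\<integral>\<^sup>+s. ennreal (n s) * (?I s * ennreal (cmod (g s))) \<partial>m)"
    unfolding Ieq n(3)
  proof (rule nn_integral_density)
    show "(\<lambda>s. ennreal (n s)) \<in> borel_measurable m" using n(1) by (simp add: measurable_m)
    have "?I \<in> borel_measurable m" using Im by (simp add: measurable_m)
    then show "(\<lambda>s. ?I s * ennreal (cmod (g s))) \<in> borel_measurable m" using gm by measurable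
  qed
  also have "\<dots> \<le> (\<integral>\<^sup>+s. ennreal K * (\<integral>\<^sup>+t. ennreal (?M s t) \<partial>m) \<partial>m)"
  proof (rule nn_integral_mono_AE)
    show "AE s in m. ennreal (n s) * (?I s * ennreal (cmod (g s))) \<le> ennreal K * (\<integral>\<^sup>+t. ennreal (?M s t) \<partial>m)"
      using nD gC
    proof eventually_elim
      case (elim s)
      have B1s: "(\<lambda>t. B1 (t - s)) \<in> borel_measurable m"
        using borel_measurable_baire_imp_borel[OF B1m] continuous_borel_maps(5)[of s] unfolding measurable_m
        by (rule measurable_compose[rotated])
      have ks: "(\<lambda>t. k0 (t - s)) \<in> borel_measurable m"
        using borel_measurable_baire_imp_borel[OF k0] continuous_borel_maps(5)[of s] unfolding measurable_m
        by (rule measurable_compose[rotated])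
      have \<alpha>k: "(\<lambda>t. ennreal (cmod (\<alpha> t * k0 (t - s)))) \<in> borel_measurable m"
        using \<alpha>(1) ks unfolding measurable_m by measurable
      have Mm: "(\<lambda>t. ennreal (?M s t)) \<in> borel_measurable m"
        using A(1) B1s unfolding measurable_m by measurable
      have "ennreal (n s) * (?I s * ennreal (cmod (g s))) = ennreal (n s * cmod (g s)) * ?I s"
        using n(2) by (simp add: ennreal_mult mult_ac)
      also have "\<dots> = (\<integral>\<^sup>+t. ennreal (n s * cmod (g s)) * ennreal (cmod (\<alpha> t * k0 (t - s))) \<partial>m)"
        by (rule nn_integral_cmult[OF \<alpha>k, symmetric])
      also have "\<dots> \<le> (\<integral>\<^sup>+t. ennreal K * ennreal (?M s t) \<partial>m)"
      proof (rule nn_integral_mono_AE)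
        show "AE t in m. ennreal (n s * cmod (g s)) * ennreal (cmod (\<alpha> t * k0 (t - s))) \<le> ennreal K * ennreal (?M s t)"
          using \<alpha>(2) AE_minus_right[OF kB, of s]
        proof eventually_elim
          fix t assume 1: "cmod (\<alpha> t) \<le> A t powr a" and 2: "cmod (k0 (t - s)) \<le> F * B1 (t - s) powr b"
          have "(n s * cmod (g s)) * (cmod (\<alpha> t) * cmod (k0 (t - s))) \<le>
              (q * D s powr d1 * (G * C s powr c2)) * (A t powr a * (F * B1 (t - s) powr b))"
            using elim 1 2 n(2) q G0 k(3) by (intro mult_mono) auto
          also have "\<dots> = K * ?M s t" by (simp add: K_def mult_ac)
          finally show "ennreal (n s * cmod (g s)) * ennreal (cmod (\<alpha> t * k0 (t - s))) \<le> ennreal K * ennreal (?M s t)"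
            using n(2)[of s] K0 by (simp add: norm_mult ennreal_leI flip: ennreal_mult)
        qed
      qed
      also have "\<dots> = ennreal K * (\<integral>\<^sup>+t. ennreal (?M s t) \<partial>m)"
        by (rule nn_integral_cmult[OF Mm])
      finally show ?case .
    qed
  qed
  also have "\<dots> \<le> ennreal K"
  proof -
    have y: "(\<integral>\<^sup>+s. (\<integral>\<^sup>+t. ennreal (?M s t) \<partial>m) \<partial>m) \<le> 1"
      using e by (intro four_fold_Young A B1m B1 B1i Cm C D) (auto simp: c2_def d1_def)
    have "(\<integral>\<^sup>+s. ennreal K * (\<integral>\<^sup>+t. ennreal (?M s t) \<partial>m) \<partial>m) = ennreal K * (\<integral>\<^sup>+s. (\<integral>\<^sup>+t. ennreal (?M s t) \<partial>m) \<partial>m)"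
    proof (rule nn_integral_cmult)
      have "(\<lambda>s. \<integral>\<^sup>+t. ennreal (cmod (of_real (A t powr a) * of_real (B1 (t - s) powr b))) \<partial>m) \<in> borel_measurable borel"
      proof (rule borel_measurable_translate_nn_integral[where k = "\<lambda>x. of_real (B1 x powr b)" and \<alpha> = "\<lambda>x. of_real (A x powr a)"])
        show "(\<lambda>x. complex_of_real (B1 x powr b)) \<in> borel_measurable baire"
          by (rule measurable_compose[OF B1m]) simp
        show "(\<lambda>x. complex_of_real (A x powr a)) \<in> borel_measurable borel"
          by (rule measurable_compose[OF A(1)]) simp
      qed
      then have I': "(\<lambda>s. \<integral>\<^sup>+t. ennreal (A t powr a * B1 (t - s) powr b) \<partial>m) \<in> borel_measurable m"
        by (simp add: norm_mult measurable_m)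
      have CDm: "(\<lambda>s. ennreal (C s powr c2 * D s powr d1)) \<in> borel_measurable m"
        using Cm D(1) unfolding measurable_m by measurable
      have "(\<integral>\<^sup>+t. ennreal (?M s t) \<partial>m) = (\<integral>\<^sup>+t. ennreal (A t powr a * B1 (t - s) powr b) \<partial>m) * ennreal (C s powr c2 * D s powr d1)" for s
      proof -
        have B1s: "(\<lambda>t. B1 (t - s)) \<in> borel_measurable m"
          using borel_measurable_baire_imp_borel[OF B1m] continuous_borel_maps(5)[of s] unfolding measurable_m
          by (rule measurable_compose[rotated])
        have Am: "A \<in> borel_measurable m" using A(1) by (simp add: measurable_m)
        show ?thesis
          using Am B1s by (subst nn_integral_multc[symmetric]) (auto intro!: nn_integral_cong simp: mult.assoc simp flip: ennreal_mult)
      qed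
      then show "(\<lambda>s. \<integral>\<^sup>+t. ennreal (?M s t) \<partial>m) \<in> borel_measurable m" using I' CDm by simp
    qed
    also have "\<dots> \<le> ennreal K * 1" by (intro mult_left_mono y) simp
    finally show ?thesis by simp
  qed
  finally show ?thesis by (simp add: K_def q_def G_def)
qed

text \<open>Hoelder's inequality as the case of constant \<open>\<alpha>\<close> and
  \<open>k\<close> in the Young estimate: with \<open>a = 1\<close>, the free exponent
  \<open>b\<close> takes up what is missing to the sum 2.\<close>

lemma nn_integral_total_variation_le_Lp:
  fixes \<nu> :: "'g set \<Rightarrow> 'x::complex_normed_vector"
  assumes vm: "vector_measure \<nu>" and \<phi>: "\<phi> \<in> cdual"
    and p1: "1 \<le> p1" "enn2real (1 / p1) < 1" and c: "semivariation m p1 \<nu> \<le> ennreal c" "0 \<le> c"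
    and p2: "1 \<le> p2" and g: "g \<in> Lp_space m p2"
    and e: "0 < enn2real (1 / p2) + enn2real (1 / p1)" "enn2real (1 / p2) + enn2real (1 / p1) \<le> 1"
  shows "(\<integral>\<^sup>+s. ennreal (cmod (g s)) \<partial>total_variation (pairing \<nu> \<phi>)) \<le> ennreal (onorm \<phi> * (c * enn2real (Lp_norm m p2 g)))"
  using Young_total_variation[OF vm \<phi> p1 c p2 g, of "\<lambda>_. 1" "\<lambda>_. 1" "\<lambda>_. 1" 1 "\<lambda>_. 1" 1
      "1 - (enn2real (1 / p2) + enn2real (1 / p1))"] e emeasure_space_1
  by (simp add: mult.assoc)

text \<open>For the infinite exponent the tails vanish almost everywhere from some level on; for
  finite exponents dominated convergence applies.\<close>

lemma Lp_norm_truncation_tendsto_0: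
  assumes p: "1 \<le> p" and g: "g \<in> Lp_space m p"
  shows "(\<lambda>n. enn2real (Lp_norm m p (\<lambda>s. indicator {s. real n < cmod (g s)} s * g s))) \<longlonglongrightarrow> 0"
    "(\<lambda>s. indicator {s. real n < cmod (g s)} s * g s) \<in> Lp_space m p"
proof -
  have gm: "g \<in> borel_measurable m" and gf: "Lp_norm m p g < \<infinity>" using g by (auto simp: Lp_space_def)
  let ?u = "\<lambda>n s. indicator {s. real n < cmod (g s)} s * g s"
  have um: "?u n \<in> borel_measurable m" for n using gm by measurable
  have ule: "cmod (?u n s) \<le> cmod (g s)" for n s by (simp add: indicator_def)
  have "(\<lambda>n. enn2real (Lp_norm m p (?u n))) \<longlonglongrightarrow> 0 \<and> Lp_norm m p (?u n) < \<infinity>"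
  proof (cases "p = \<infinity>")
    case True
    have "AE s in m. ennreal (cmod (g s)) \<le> Lp_norm m p g"
      using esssup_AE[of "\<lambda>s. ennreal (cmod (g s))" m] True by (simp add: Lp_norm_def)
    then have ae: "AE s in m. cmod (g s) \<le> enn2real (Lp_norm m p g)"
    proof eventually_elim
      case (elim x)
      then show ?case using gf by (cases "Lp_norm m p g") auto
    qed
    obtain N where N: "enn2real (Lp_norm m p g) \<le> real N" using real_arch_simple by blast
    have "Lp_norm m p (?u n) = 0" if n: "n \<ge> N" for n
    proof (rule Lp_norm_AE_zero[OF p _ um])
      show "AE s in m. ?u n s = 0"
        using ae
      proof eventually_elim
        case (elim s)
        then show ?case using N n by (simp add: indicator_def)
      qed
    qed
    then have "\<forall>\<^sub>F n in sequentially. enn2real (Lp_norm m p (?u n)) = 0"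
      unfolding eventually_sequentially by (intro exI[of _ N]) simp
    moreover have "Lp_norm m p (?u n) \<le> Lp_norm m p g"
      using True um[of n] ule by (auto simp: Lp_norm_def intro!: esssup_mono ennreal_leI)
    ultimately show ?thesis using gf by (auto intro: tendsto_eventually le_less_trans)
  next
    case False
    define P where "P = enn2real p"
    have P: "1 \<le> P" using enn2real_inverse_finite(2)[OF p] False by (simp add: P_def less_top)
    have fin: "(\<integral>\<^sup>+ t. ennreal (cmod (g t) powr P) \<partial>m) < \<infinity>"
      using gf False by (auto simp: Lp_norm_def P_def Let_def less_top split: if_splits)
    let ?I = "\<lambda>n. \<integral>\<^sup>+ t. ennreal (cmod (?u n t) powr P) \<partial>m"
    have Ile: "?I n \<le> (\<integral>\<^sup>+ t. ennreal (cmod (g t) powr P) \<partial>m)" for n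
      using P ule by (intro nn_integral_mono ennreal_leI powr_mono2) auto
    then have Ifin: "?I n < \<infinity>" for n using fin by (rule le_less_trans)
    have "?I \<longlonglongrightarrow> (\<integral>\<^sup>+ x. 0 \<partial>m)"
    proof (rule nn_integral_dominated_convergence[where w = "\<lambda>x. ennreal (cmod (g x) powr P)"])
      show "AE x in m. (\<lambda>n. ennreal (cmod (?u n x) powr P)) \<longlonglongrightarrow> 0"
      proof (intro AE_I2 tendsto_eventually)
        fix x
        obtain N where N: "cmod (g x) \<le> real N" using real_arch_simple by blast
        have "ennreal (cmod (?u n x) powr P) = 0" if "n \<ge> N" for n
          using N that by (simp add: indicator_def)
        then show "\<forall>\<^sub>F n in sequentially. ennreal (cmod (?u n x) powr P) = 0"
          by (auto simp: eventually_sequentially)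
      qed
      show "AE x in m. ennreal (cmod (?u n x) powr P) \<le> ennreal (cmod (g x) powr P)" for n
        using P ule by (intro AE_I2 ennreal_leI powr_mono2) auto
      show "(\<lambda>x. ennreal (cmod (?u n x) powr P)) \<in> borel_measurable m" for n using um[of n] by measurable
    qed (use fin gm in auto)
    then have "(\<lambda>n. enn2real (?I n)) \<longlonglongrightarrow> enn2real 0" by (intro tendsto_enn2real) auto
    then have "(\<lambda>n. enn2real (?I n) powr (1 / P)) \<longlonglongrightarrow> 0 powr (1 / P)"
      using P by (intro tendsto_powr2) (auto intro!: tendsto_const always_eventually)
    moreover have "Lp_norm m p (?u n) = ennreal (enn2real (?I n) powr (1 / P))" for n
      using Ifin[of n] by (simp add: Lp_norm_finite_eq[OF False] Let_def flip: P_def)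
    ultimately show ?thesis by simp
  qed
  then show "(\<lambda>n. enn2real (Lp_norm m p (?u n))) \<longlonglongrightarrow> 0" "?u n \<in> Lp_space m p"
    using um[of n] by (auto simp: Lp_space_def)
qed

text \<open>Hoelder's inequality applied to the tails of \<open>g\<close> bounds them by
  \<open>onorm \<phi>\<close> times a null sequence that does not depend on \<open>\<phi>\<close>,
  so the truncation criterion applies.\<close>

lemma Lp_space_in_L1_vector:
  fixes \<nu> :: "'g set \<Rightarrow> 'x::complex_banach"
  assumes vm: "vector_measure \<nu>"
    and p1: "1 \<le> p1" "enn2real (1 / p1) < 1" and c: "semivariation m p1 \<nu> \<le> ennreal c" "0 \<le> c"
    and p2: "1 \<le> p2" and g: "g \<in> Lp_space m p2"
    and e: "0 < enn2real (1 / p2) + enn2real (1 / p1)" "enn2real (1 / p2) + enn2real (1 / p1) \<le> 1"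
  shows "g \<in> L1_vector \<nu>"
proof -
  have gm: "g \<in> borel_measurable borel" using g by (simp add: Lp_space_def measurable_m)
  note H = nn_integral_total_variation_le_Lp[OF vm _ p1 c p2 _ e]
  let ?u = "\<lambda>n s. indicator {s. real n < cmod (g s)} s * g s"
  have um: "?u n \<in> borel_measurable borel" for n using gm by measurable
  have int: "integrable (total_variation (pairing \<nu> \<phi>)) h"
    if "\<phi> \<in> cdual" "h \<in> Lp_space m p2" "h \<in> borel_measurable borel" for \<phi> :: "'x \<Rightarrow> complex" and h
    using H[OF that(1,2)] that(3)
    by (intro integrableI_bounded) (auto simp: le_less_trans cong: measurable_cong_sets)
  show ?thesis
  proof (rule L1_vector_of_truncations[OF vm gm int[OF _ g gm]])
    show "(\<lambda>n. c * enn2real (Lp_norm m p2 (?u n))) \<longlonglongrightarrow> 0"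
      using tendsto_mult_right_zero[OF Lp_norm_truncation_tendsto_0(1)[OF p2 g]] .
    fix \<phi> :: "'x \<Rightarrow> complex" and n assume \<phi>: "\<phi> \<in> cdual"
    let ?\<tau> = "total_variation (pairing \<nu> \<phi>)"
    note u = Lp_norm_truncation_tendsto_0(2)[OF p2 g, of n]
    have "ennreal (LINT s|?\<tau>. cmod (?u n s)) = (\<integral>\<^sup>+s. ennreal (cmod (?u n s)) \<partial>?\<tau>)"
      by (intro nn_integral_eq_integral[symmetric] integrable_norm int[OF \<phi> u um]) auto
    also have "\<dots> \<le> ennreal (onorm \<phi> * (c * enn2real (Lp_norm m p2 (?u n))))" by (rule H[OF \<phi> u])
    finally have "(LINT s|?\<tau>. cmod (?u n s)) \<le> onorm \<phi> * (c * enn2real (Lp_norm m p2 (?u n)))"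
      using c(2) cdual_onorm_nonneg[OF \<phi>] by (subst (asm) ennreal_le_iff) auto
    then show "(LINT s|?\<tau>. indicator {s. real n < cmod (g s)} s * cmod (g s)) \<le> onorm \<phi> * (c * enn2real (Lp_norm m p2 (?u n)))"
      by (simp add: norm_mult cmod_indicator)
  qed
qed

text \<open>The relation between the exponents says exactly that the reciprocals of the conjugate of
  \<open>r\<close>, of \<open>p3\<close>, of \<open>p2\<close> and of \<open>p1\<close> sum to 2, as
  Young's inequality for four factors demands.\<close>

lemma young_bound_semivariation:
  fixes \<nu> :: "'g set \<Rightarrow> 'x::complex_banach"
  assumes vm: "vector_measure \<nu>"
    and p1: "1 \<le> p1" "enn2real (1 / p1) < 1" and c: "semivariation m p1 \<nu> < \<infinity>"
    and p2: "1 \<le> p2" and g: "g \<in> Lp_space m p2" and p3: "1 \<le> p3" and k: "k \<in> Lp_space m p3" and r: "1 \<le> r"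
    and e: "0 < enn2real (1 / p2) + enn2real (1 / p1)" "enn2real (1 / p2) + enn2real (1 / p1) \<le> 1"
      "enn2real (1 / p1) + enn2real (1 / p2) + enn2real (1 / p3) = 1 + enn2real (1 / r)"
  shows "young_bound \<nu> g r (Lp_norm m p3 k * (semivariation m p1 \<nu> * Lp_norm m p2 g)) k"
  unfolding young_bound_def
proof (intro ballI impI)
  fix \<phi> :: "'x \<Rightarrow> complex" and \<alpha> :: "'g \<Rightarrow> complex"
  assume b: "\<phi> \<in> cdual_ball" and \<alpha>: "\<alpha> \<in> borel_measurable borel" "Lp_norm m (conj_exponent r) \<alpha> \<le> 1"
  have \<phi>: "\<phi> \<in> cdual" and o1: "onorm \<phi> \<le> 1" using b by (auto simp: cdual_ball_def)
  define c' where "c' = enn2real (semivariation m p1 \<nu>)"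
  have c': "semivariation m p1 \<nu> = ennreal c'" "0 \<le> c'" using c by (auto simp: c'_def)
  define F G where "F = enn2real (Lp_norm m p3 k)" and "G = enn2real (Lp_norm m p2 g)"
  have km: "k \<in> borel_measurable m" and kf: "Lp_norm m p3 k < \<infinity>" using k by (auto simp: Lp_space_def)
  have F: "Lp_norm m p3 k = ennreal F" "0 \<le> F" using kf by (auto simp: F_def)
  have G: "Lp_norm m p2 g = ennreal G" "0 \<le> G" using g by (auto simp: G_def Lp_space_def)
  obtain B where B: "B \<in> borel_measurable m" "\<And>x. 0 \<le> B x" "(\<integral>\<^sup>+x. ennreal (B x) \<partial>m) \<le> 1"
    "AE x in m. cmod (k x) \<le> F * B x powr enn2real (1 / p3)"
    by (rule Lp_norm_factor[OF km p3 kf, folded F_def]) (rule that)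
  have \<alpha>m: "\<alpha> \<in> borel_measurable m" using \<alpha>(1) by (simp add: measurable_m)
  have \<alpha>f: "Lp_norm m (conj_exponent r) \<alpha> < \<infinity>" using \<alpha>(2) by (rule le_less_trans) simp
  obtain A where A: "A \<in> borel_measurable m" "\<And>x. 0 \<le> A x" "(\<integral>\<^sup>+x. ennreal (A x) \<partial>m) \<le> 1"
    and \<alpha>A: "AE x in m. cmod (\<alpha> x) \<le> enn2real (Lp_norm m (conj_exponent r) \<alpha>) * A x powr enn2real (1 / conj_exponent r)"
    by (rule Lp_norm_factor[OF \<alpha>m one_le_conj_exponent \<alpha>f]) (rule that)
  have n1: "enn2real (Lp_norm m (conj_exponent r) \<alpha>) \<le> 1" using \<alpha>(2) by (intro enn2real_leI) auto
  have \<alpha>A': "AE x in m. cmod (\<alpha> x) \<le> A x powr (1 - enn2real (1 / r))"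
    using \<alpha>A unfolding enn2real_inverse_conj_exponent[OF r]
  proof eventually_elim
    case (elim x)
    also have "enn2real (Lp_norm m (conj_exponent r) \<alpha>) * A x powr (1 - enn2real (1 / r)) \<le> 1 * A x powr (1 - enn2real (1 / r))"
      using n1 by (rule mult_right_mono) simp
    finally show ?case by simp
  qed
  have bm: "A \<in> borel_measurable borel" "B \<in> borel_measurable borel" "k \<in> borel_measurable borel"
    using A(1) B(1) km by (simp_all add: measurable_m)
  have "(\<integral>\<^sup>+s. (\<integral>\<^sup>+t. ennreal (cmod (\<alpha> t * k (t - s))) \<partial>m) * ennreal (cmod (g s)) \<partial>total_variation (pairing \<nu> \<phi>))
      \<le> ennreal (onorm \<phi> * c' * F * enn2real (Lp_norm m p2 g))"
    using e enn2real_inverse_le_1[OF p3] enn2real_inverse_le_1[OF r]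
    by (intro Young_total_variation[OF vm \<phi> p1 _ c'(2) p2 g bm(1) A(2,3) bm(2) B(2,3) \<alpha>(1) \<alpha>A' bm(3) B(4) F(2)])
      (auto simp: c'(1))
  also have "\<dots> \<le> ennreal (F * (c' * G))"
  proof (rule ennreal_leI)
    have "onorm \<phi> * (c' * F * G) \<le> 1 * (c' * F * G)" using o1 c' F G by (intro mult_right_mono) auto
    then show "onorm \<phi> * c' * F * enn2real (Lp_norm m p2 g) \<le> F * (c' * G)" by (simp add: mult_ac flip: G_def)
  qed
  also have "\<dots> = Lp_norm m p3 k * (semivariation m p1 \<nu> * Lp_norm m p2 g)"
    using c' F G by (simp add: ennreal_mult)
  finally show "(\<integral>\<^sup>+s. (\<integral>\<^sup>+t. ennreal (cmod (\<alpha> t * k (t - s))) \<partial>m) * ennreal (cmod (g s)) \<partial>total_variation (pairing \<nu> \<phi>))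
    \<le> Lp_norm m p3 k * (semivariation m p1 \<nu> * Lp_norm m p2 g)" .
qed

end

section \<open>Arithmetic of the exponents and conclusion\<close>

lemma ennreal_inverse_le_1: "1 \<le> p \<Longrightarrow> 1 / p \<le> (1 :: ennreal)"
  by (cases p) (auto simp: divide_ennreal[of 1, simplified] ennreal_divide_top ennreal_le_1 divide_le_eq_1)

text \<open>The conditions are moved to real reciprocals, where linear arithmetic is available. If
  \<open>p3\<close> were infinite, the triple sum would stay below 1; if \<open>r\<close> were
  infinite, it would equal 1; and \<open>1 \<le> r\<close> follows since the first two reciprocals
  sum to less than 1 and the third is at most 1.\<close>

lemma exponent_arithmetic:
  fixes p1 p2 p3 r :: ennreal
  assumes p: "1 \<le> p1" "1 \<le> p2" "1 \<le> p3" and s: "0 < 1 / p1 + 1 / p2" "1 / p1 + 1 / p2 < 1"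
    and t: "1 < 1 / p1 + 1 / p2 + 1 / p3" and eq: "1 / p1 + 1 / p2 + 1 / p3 = 1 + 1 / r"
  shows "enn2real (1 / p1) < 1" "0 < enn2real (1 / p2) + enn2real (1 / p1)"
    "enn2real (1 / p2) + enn2real (1 / p1) \<le> 1"
    "enn2real (1 / p1) + enn2real (1 / p2) + enn2real (1 / p3) = 1 + enn2real (1 / r)"
    "p3 < \<infinity>" "1 \<le> r" "r \<noteq> \<infinity>"
proof -
  obtain x1 where x1: "1 / p1 = ennreal x1" "0 \<le> x1" "x1 \<le> 1"
    using ennreal_inverse_le_1[OF p(1)] by (cases "1 / p1") (auto simp: ennreal_le_1 top_unique)
  obtain x2 where x2: "1 / p2 = ennreal x2" "0 \<le> x2" "x2 \<le> 1"
    using ennreal_inverse_le_1[OF p(2)] by (cases "1 / p2") (auto simp: ennreal_le_1 top_unique)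
  obtain x3 where x3: "1 / p3 = ennreal x3" "0 \<le> x3" "x3 \<le> 1"
    using ennreal_inverse_le_1[OF p(3)] by (cases "1 / p3") (auto simp: ennreal_le_1 top_unique)
  have sum: "1 / p1 + 1 / p2 + 1 / p3 = ennreal (x1 + x2 + x3)" "1 / p1 + 1 / p2 = ennreal (x1 + x2)"
    using x1 x2 x3 by (simp_all flip: ennreal_plus)
  have x12: "0 < x1 + x2" "x1 + x2 < 1" and x123: "1 < x1 + x2 + x3"
  proof -
    have "0 < ennreal (x1 + x2)" "ennreal (x1 + x2) < 1" using s by (simp_all only: sum(2))
    then show "0 < x1 + x2" "x1 + x2 < 1" by (simp_all add: ennreal_less_one_iff del: ennreal_plus)
    have "1 < ennreal (x1 + x2 + x3)" using t by (simp only: sum(1))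
    then show "1 < x1 + x2 + x3" by (simp add: not_le[symmetric] ennreal_le_1 del: ennreal_plus)
  qed
  obtain y where y: "1 / r = ennreal y" "0 \<le> y"
  proof (cases "1 / r")
    case top
    then have "ennreal (x1 + x2 + x3) = \<infinity>" using eq by (simp only: sum(1)) simp
    then show ?thesis by (simp del: ennreal_plus)
  qed auto
  have "ennreal (x1 + x2 + x3) = 1 + ennreal y" using eq by (simp only: sum(1) y(1))
  also have "\<dots> = ennreal (1 + y)" using y(2) by simp
  finally have "ennreal (x1 + x2 + x3) = ennreal (1 + y)" .
  then have xy: "x1 + x2 + x3 = 1 + y" using x1 x2 x3 y by (subst (asm) ennreal_inj) auto
  show "enn2real (1 / p1) < 1" "0 < enn2real (1 / p2) + enn2real (1 / p1)"
    "enn2real (1 / p2) + enn2real (1 / p1) \<le> 1"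
    "enn2real (1 / p1) + enn2real (1 / p2) + enn2real (1 / p3) = 1 + enn2real (1 / r)"
    using x1 x2 x3 y xy x12 by auto
  show "p3 < \<infinity>"
  proof (rule ccontr)
    assume "\<not> p3 < \<infinity>"
    then have "p3 = \<infinity>" by (simp add: not_less top_unique)
    then show False using x3 x12 x123 by (simp add: ennreal_divide_top)
  qed
  show "r \<noteq> \<infinity>"
  proof
    assume "r = \<infinity>"
    then show False using y xy x123 by (simp add: ennreal_divide_top)
  qed
  then obtain z where z: "r = ennreal z" "0 \<le> z" by (cases r) auto
  have "z \<noteq> 0" using y z by auto
  then have "y = 1 / z" using y z by (simp add: divide_ennreal[of 1, simplified])
  moreover have "y < 1" using xy x12 x3 by linarith
  ultimately have "1 \<le> z" using z \<open>z \<noteq> 0\<close> by (auto simp: divide_less_eq_1)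
  then show "1 \<le> r" using z by (simp add: ennreal_ge_1)
qed

theorem theorem9p3:
  fixes m :: "'g::{topological_group_add, t2_space} measure"
    and \<nu> :: "'g set \<Rightarrow> 'x::complex_banach"
    and mnorm :: "'x mat \<Rightarrow> real"
  assumes "compact (UNIV :: 'g set)"
    and "normalized_haar m"
    and "operator_space mnorm"
    and "vector_measure \<nu>"
  shows
    "(\<forall>p f g. 1 \<le> p \<and> p < \<infinity> \<and> f \<in> Lp_space m p \<and> g \<in> L1_vector \<nu> \<longrightarrow>
        (\<exists>\<mu>\<in>P_space m p.
           is_vconv_measure m \<nu> f g \<mu> \<and>
           (vconv_defined m \<nu> f g \<longrightarrow> has_density m (vconv \<nu> f g) \<mu>) \<and>
           semivariation m p \<mu> \<le> Lp_norm m p f * L1_vector_norm \<nu> g)) \<and>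
     (\<forall>p1 p2 p3 r f g.
        1 \<le> p1 \<and> 1 \<le> p2 \<and> 1 \<le> p3 \<and>
        \<nu> \<in> M_space m p1 \<and> g \<in> Lp_space m p2 \<and> f \<in> Lp_space m p3 \<and>
        0 < 1 / p1 + 1 / p2 \<and> 1 / p1 + 1 / p2 < 1 \<and>
        1 / p1 + 1 / p2 + 1 / p3 > 1 \<and>
        1 / p1 + 1 / p2 + 1 / p3 = 1 + 1 / r \<longrightarrow>
        (\<exists>\<mu>\<in>P_space m r.
           is_vconv_measure m \<nu> f g \<mu> \<and>
           (vconv_defined m \<nu> f g \<longrightarrow> has_density m (vconv \<nu> f g) \<mu>) \<and>
           semivariation m r \<mu> \<le> semivariation m p1 \<nu> * Lp_norm m p2 g * Lp_norm m p3 f))"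
proof (intro conjI allI impI; elim conjE)
  interpret compact_haar m by unfold_locales fact+
  note vm = assms(4)
  fix p and f g :: "'g \<Rightarrow> complex"
  assume p: "1 \<le> p" "p < \<infinity>" and f: "f \<in> Lp_space m p" and g: "g \<in> L1_vector \<nu>"
  \<comment> \<open>Here the function and the target space have the same exponent, and the constant
    is the norm of \<open>g\<close> in \<open>L1_vector\<close>.\<close>
  show "\<exists>\<mu>\<in>P_space m p. is_vconv_measure m \<nu> f g \<mu> \<and>
      (vconv_defined m \<nu> f g \<longrightarrow> has_density m (vconv \<nu> f g) \<mu>) \<and>
      semivariation m p \<mu> \<le> Lp_norm m p f * L1_vector_norm \<nu> g"
    using p by (intro convolution_of_young_bound[OF vm g _ _ _ _ f] L1_vector_norm_finite[OF vm g]
      young_bound_Lp[OF vm g]) auto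
next
  interpret compact_haar m by unfold_locales fact+
  note vm = assms(4)
  fix p1 p2 p3 r and f g :: "'g \<Rightarrow> complex"
  assume p: "1 \<le> p1" "1 \<le> p2" "1 \<le> p3" and \<nu>: "\<nu> \<in> M_space m p1" and g: "g \<in> Lp_space m p2" and f: "f \<in> Lp_space m p3"
    and s: "0 < 1 / p1 + 1 / p2" "1 / p1 + 1 / p2 < 1" "1 < 1 / p1 + 1 / p2 + 1 / p3"
      "1 / p1 + 1 / p2 + 1 / p3 = 1 + 1 / r"
  note ex = exponent_arithmetic[OF p s]
  define c where "c = enn2real (semivariation m p1 \<nu>)"
  have sv: "semivariation m p1 \<nu> < \<infinity>" using \<nu> by (simp add: M_space_def)
  then have c: "semivariation m p1 \<nu> \<le> ennreal c" "0 \<le> c" by (auto simp: c_def)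
  have gL: "g \<in> L1_vector \<nu>" by (rule Lp_space_in_L1_vector[OF vm p(1) ex(1) c p(2) g ex(2,3)])
  have C: "semivariation m p1 \<nu> * Lp_norm m p2 g < \<infinity>"
    using sv g by (simp add: ennreal_mult_less_top Lp_space_def)
  \<comment> \<open>Here \<open>f\<close> has exponent \<open>p3\<close>, the target space exponent
    \<open>r\<close>, and the constant is the product of the semivariation and the norm of
    \<open>g\<close>.\<close>
  have "\<exists>\<mu>\<in>P_space m r. is_vconv_measure m \<nu> f g \<mu> \<and>
      (vconv_defined m \<nu> f g \<longrightarrow> has_density m (vconv \<nu> f g) \<mu>) \<and>
      semivariation m r \<mu> \<le> Lp_norm m p3 f * (semivariation m p1 \<nu> * Lp_norm m p2 g)"
    by (rule convolution_of_young_bound[OF vm gL ex(6,7) p(3) ex(5) f C])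
      (rule young_bound_semivariation[OF vm p(1) ex(1) sv p(2) g p(3) _ ex(6) ex(2,3,4)])
  then show "\<exists>\<mu>\<in>P_space m r. is_vconv_measure m \<nu> f g \<mu> \<and>
      (vconv_defined m \<nu> f g \<longrightarrow> has_density m (vconv \<nu> f g) \<mu>) \<and>
      semivariation m r \<mu> \<le> semivariation m p1 \<nu> * Lp_norm m p2 g * Lp_norm m p3 f"
    by (simp add: mult_ac)
qed

end
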